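(* Let $M_t$ be a scalar curvature flow with a flat side as described in the context, and let $0<T<T_c$ be such that $D_{\rho_0}\subset\Sigma_0(T)$. Then there is a constant $B>0$ such that $$\gamma(\theta,t)\ \ge\ e^{-\frac{t-t_0}{B t_0}}\,\gamma(\theta,t_0)$$ for all $0<t_0\le t\le T$ and all $\theta\in S^{n-1}$. In particular (in this sense) the free boundary moves with a finite speed for $0\le t\le T$.
   Context: Let $n\ge3$. For a hypersurface in $\mathbb{R}^{n+1}$, $\sigma_2=\frac12(H^2-|A|^2)=\sum_{i<j}\kappa_i\kappa_j$. A scalar curvature flow is a family $M_t=X(\Sigma,t)$ with $\partial X/\partial t=-\sigma_2\nu$, $\nu$ the outer unit normal, $X(\cdot,0)=X_0$. For a graph $x_{n+1}=f(x,t)$ this reads $$f_t=\frac{1}{2\sqrt{1+|\nabla f|^2}}\sum_{i,j,k,l=1}^n\Big(\delta_{ik}-\frac{f_if_k}{1+|\nabla f|^2}\Big)\Big(\delta_{jl}-\frac{f_jf_l}{1+|\nabla f|^2}\Big)(f_{ki}f_{lj}-f_{kj}f_{li}),$$ understood in the viscosity sense where $f$ is not classical. Setting. The initial hypersurface is compact and convex, $\Sigma=\Sigma_0\cup\Sigma_1$, where $\Sigma_0$ is a flat side contained in $\{x_{n+1}=0\}$, $\Sigma_1$ is strictly convex and lies above this hyperplane, and $\Gamma=\Sigma_0\cap\Sigma_1$. A part of $M_t$ containing the flat side is the graph $x_{n+1}=f(x,t)$ over $\Omega(t)=\{x\in\mathbb{R}^n:|Df(x,t)|<\infty\}$, $f\ge0$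 convex in $x$; $\Sigma_0(t)=\{f(\cdot,t)=0\}$ is the flat side and $\Gamma(t)$ its boundary (interface, free boundary). Put $g=\sqrt{2f}$; derivatives of $g$ at interface points are limits from $\{f>0\}$. At $t=0$ there is $\lambda>0$ with $|Dg(x)|\ge\lambda$ and $D^2_{\tau\tau}g(x)\ge\lambda$ for all $x\in\Gamma$ and all tangential directions $\tau$ to $\Gamma$. $T_c$ is the time when the area of the flat side shrinks to zero; $D_{\rho_0}=\{x\in\mathbb{R}^n:|x|\le\rho_0\}\subset\Sigma_0(t)$ for $0\le t\le T$, $\rho_0>0$; the domain of $f$ is contained in a ball $B_R$. In polar coordinates $(r,\theta)$ about the origin, $\Gamma(t)$ is written $r=\gamma(\theta,t)$. *)

theory Defs
  imports "HOL-Analysis.Analysis"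
begin

text \<open>
  Hypersurfaces of \<open>\<real>\<^sup>n\<^sup>+\<^sup>1\<close> are subsets of \<open>(real ^ 'n) \<times> real\<close>, whose product norm is the
  Euclidean one; the second component is the coordinate \<open>x\<^sub>n\<^sub>+\<^sub>1\<close>.
\<close>

section \<open>Curvature of graphs\<close>

text \<open>
  Below, \<open>p\<close> is the gradient and \<open>A\<close> the Hessian of a function at a point, and the normal of its
  graph is the downward one, so that convex functions have nonnegative principal curvatures.  With
  \<open>W = sqrt (1 + |p|\<^sup>2)\<close>, the matrix \<open>graph_inv_metric p\<close> is the inverse of the induced metric,
  \<open>A / W\<close> is the second fundamental form, and the eigenvalues of \<open>graph_shape p A\<close> are the
  principal curvatures.
\<close>

definition graph_inv_metric :: "real ^ 'n \<Rightarrow> real ^ 'n ^ 'n" where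
  "graph_inv_metric p = (\<chi> i k. (if i = k then 1 else 0) - p $ i * p $ k / (1 + (norm p)\<^sup>2))"

definition graph_shape :: "real ^ 'n \<Rightarrow> real ^ 'n ^ 'n \<Rightarrow> real ^ 'n ^ 'n" where
  "graph_shape p A = (1 / sqrt (1 + (norm p)\<^sup>2)) *\<^sub>R (graph_inv_metric p ** A)"

definition graph_mean_curvature :: "real ^ 'n \<Rightarrow> real ^ 'n ^ 'n \<Rightarrow> real" where
  "graph_mean_curvature p A = trace (graph_shape p A)"

text \<open>\<open>\<sigma>\<^sub>2 = (H\<^sup>2 - |A|\<^sup>2) / 2\<close>, where \<open>|A|\<^sup>2\<close> is the trace of the squared shape operator.\<close>

definition graph_sigma2 :: "real ^ 'n \<Rightarrow> real ^ 'n ^ 'n \<Rightarrow> real" where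
  "graph_sigma2 p A =
     ((graph_mean_curvature p A)\<^sup>2 - trace (graph_shape p A ** graph_shape p A)) / 2"

text \<open>The right-hand side of the evolution equation of a graph.\<close>

definition graph_speed :: "real ^ 'n \<Rightarrow> real ^ 'n ^ 'n \<Rightarrow> real" where
  "graph_speed p A = 1 / (2 * sqrt (1 + (norm p)\<^sup>2)) *
     (\<Sum>i\<in>UNIV. \<Sum>j\<in>UNIV. \<Sum>k\<in>UNIV. \<Sum>l\<in>UNIV.
        graph_inv_metric p $ i $ k * graph_inv_metric p $ j $ l *
        (A $ k $ i * A $ l $ j - A $ k $ j * A $ l $ i))"

text \<open>
  Normal speed \<open>\<sigma>\<^sub>2\<close> is vertical speed \<open>W \<sigma>\<^sub>2\<close>, so the graph equation and
  \<open>\<partial>X/\<partial>t = - \<sigma>\<^sub>2 \<nu>\<close> describe the same motion.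
\<close>

lemma graph_speed_eq_sigma2:
  "graph_speed p A = sqrt (1 + (norm p)\<^sup>2) * graph_sigma2 p A"
proof -
  define G where "G = graph_inv_metric p"
  define W where "W = sqrt (1 + (norm p)\<^sup>2)"
  have W: "W > 0" unfolding W_def by (smt (verit) real_sqrt_gt_zero zero_le_power2)
  have S: "graph_shape p A = (1 / W) *\<^sub>R (G ** A)"
    by (simp add: graph_shape_def G_def W_def)
  have H: "graph_mean_curvature p A = (1 / W) * trace (G ** A)"
    by (simp add: graph_mean_curvature_def S trace_def sum_distrib_left)
  have Q: "trace (graph_shape p A ** graph_shape p A) = (1 / W)\<^sup>2 * trace (G ** A ** (G ** A))"
    by (simp add: S trace_def matrix_matrix_mult_def sum_distrib_left power2_eq_square
        algebra_simps)
  have s1: "(\<Sum>i\<in>UNIV. \<Sum>j\<in>UNIV. \<Sum>k\<in>UNIV. \<Sum>l\<in>UNIV. G$i$k * G$j$l * (A$k$i * A$l$j))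
      = (trace (G ** A))\<^sup>2"
  proof -
    have "(\<Sum>i\<in>UNIV. \<Sum>j\<in>UNIV. \<Sum>k\<in>UNIV. \<Sum>l\<in>UNIV. G$i$k * G$j$l * (A$k$i * A$l$j))
      = (\<Sum>i\<in>UNIV. \<Sum>j\<in>UNIV. (\<Sum>k\<in>UNIV. G$i$k * A$k$i) * (\<Sum>l\<in>UNIV. G$j$l * A$l$j))"
      unfolding sum_product by (simp add: ac_simps)
    also have "\<dots> = (trace (G ** A))\<^sup>2"
      by (simp add: sum_product trace_def matrix_matrix_mult_def power2_eq_square)
    finally show ?thesis .
  qed
  have s2: "(\<Sum>i\<in>UNIV. \<Sum>j\<in>UNIV. \<Sum>k\<in>UNIV. \<Sum>l\<in>UNIV. G$i$k * G$j$l * (A$k$j * A$l$i))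
      = trace (G ** A ** (G ** A))"
  proof -
    have "(\<Sum>i\<in>UNIV. \<Sum>j\<in>UNIV. \<Sum>k\<in>UNIV. \<Sum>l\<in>UNIV. G$i$k * G$j$l * (A$k$j * A$l$i))
      = (\<Sum>i\<in>UNIV. \<Sum>j\<in>UNIV. (\<Sum>k\<in>UNIV. G$i$k * A$k$j) * (\<Sum>l\<in>UNIV. G$j$l * A$l$i))"
      unfolding sum_product by (simp add: ac_simps)
    also have "\<dots> = trace (G ** A ** (G ** A))"
      by (simp add: trace_def matrix_matrix_mult_def)
    finally show ?thesis .
  qed
  have "graph_speed p A = 1 / (2 * W) * ((trace (G ** A))\<^sup>2 - trace (G ** A ** (G ** A)))"
    unfolding graph_speed_def s1[symmetric] s2[symmetric]
    by (simp add: G_def W_def right_diff_distrib sum_subtractf)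
  also have "\<dots> = W * graph_sigma2 p A"
    using W by (simp add: graph_sigma2_def H Q field_simps power2_eq_square)
  finally show ?thesis by (simp add: W_def)
qed

section \<open>Viscosity solutions\<close>

text \<open>
  \<open>C21_on Q u ut Du D2u\<close>: on the open space-time set \<open>Q\<close> the function \<open>u\<close> is of class \<open>C\<^sup>2\<close> in
  space and \<open>C\<^sup>1\<close> in time, with the given time derivative, spatial gradient and spatial Hessian.
\<close>

definition C21_on :: "((real ^ 'n) \<times> real) set \<Rightarrow> (real ^ 'n \<Rightarrow> real \<Rightarrow> real) \<Rightarrow>
    (real ^ 'n \<Rightarrow> real \<Rightarrow> real) \<Rightarrow> (real ^ 'n \<Rightarrow> real \<Rightarrow> real ^ 'n) \<Rightarrow>
    (real ^ 'n \<Rightarrow> real \<Rightarrow> real ^ 'n ^ 'n) \<Rightarrow> bool" where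
  "C21_on Q u ut Du D2u \<longleftrightarrow> open Q \<and>
     (\<forall>(x, t)\<in>Q.
        ((\<lambda>s. u x s) has_real_derivative ut x t) (at t) \<and>
        ((\<lambda>y. u y t) has_derivative (\<lambda>h. Du x t \<bullet> h)) (at x) \<and>
        ((\<lambda>y. Du y t) has_derivative (\<lambda>h. D2u x t *v h)) (at x)) \<and>
     continuous_on Q (\<lambda>(x, t). ut x t) \<and>
     continuous_on Q (\<lambda>(x, t). Du x t) \<and>
     continuous_on Q (\<lambda>(x, t). D2u x t)"

text \<open>
  The equation is elliptic only on the closed cone \<open>H \<ge> 0\<close>, \<open>\<sigma>\<^sub>2 \<ge> 0\<close>; as usual for such equations,
  the test functions from below are restricted to this cone.  (Without the restriction not even
  classical convex solutions would be supersolutions: very concave functions touch them from below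
  and have large \<open>\<sigma>\<^sub>2\<close>.)  Functions touching a convex function from above are in the cone anyway.
\<close>

definition admissible :: "real ^ 'n \<Rightarrow> real ^ 'n ^ 'n \<Rightarrow> bool" where
  "admissible p A \<longleftrightarrow> graph_mean_curvature p A \<ge> 0 \<and> graph_sigma2 p A \<ge> 0"

definition viscosity_subsolution ::
    "((real ^ 'n) \<times> real) set \<Rightarrow> (real ^ 'n \<Rightarrow> real \<Rightarrow> real) \<Rightarrow> bool" where
  "viscosity_subsolution Q u \<longleftrightarrow>
     (\<forall>N \<phi> \<phi>t D\<phi> D2\<phi> x0 t0.
        N \<subseteq> Q \<and> C21_on N \<phi> \<phi>t D\<phi> D2\<phi> \<and> (x0, t0) \<in> N \<and>
        \<phi> x0 t0 = u x0 t0 \<and> (\<forall>(x, t)\<in>N. u x t \<le> \<phi> x t) \<longrightarrow>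
        \<phi>t x0 t0 \<le> graph_speed (D\<phi> x0 t0) (D2\<phi> x0 t0))"

definition viscosity_supersolution ::
    "((real ^ 'n) \<times> real) set \<Rightarrow> (real ^ 'n \<Rightarrow> real \<Rightarrow> real) \<Rightarrow> bool" where
  "viscosity_supersolution Q u \<longleftrightarrow>
     (\<forall>N \<phi> \<phi>t D\<phi> D2\<phi> x0 t0.
        N \<subseteq> Q \<and> C21_on N \<phi> \<phi>t D\<phi> D2\<phi> \<and> (x0, t0) \<in> N \<and>
        \<phi> x0 t0 = u x0 t0 \<and> (\<forall>(x, t)\<in>N. \<phi> x t \<le> u x t) \<and>
        admissible (D\<phi> x0 t0) (D2\<phi> x0 t0) \<longrightarrow>
        \<phi>t x0 t0 \<ge> graph_speed (D\<phi> x0 t0) (D2\<phi> x0 t0))"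

definition viscosity_solution ::
    "((real ^ 'n) \<times> real) set \<Rightarrow> (real ^ 'n \<Rightarrow> real \<Rightarrow> real) \<Rightarrow> bool" where
  "viscosity_solution Q u \<longleftrightarrow> continuous_on Q (\<lambda>(x, t). u x t) \<and>
     viscosity_subsolution Q u \<and> viscosity_supersolution Q u"

section \<open>Scalar curvature flow\<close>

definition rigid_motion :: "('a::real_inner \<Rightarrow> 'a) \<Rightarrow> bool" where
  "rigid_motion \<psi> \<longleftrightarrow> (\<exists>c L. orthogonal_transformation L \<and> \<psi> = (\<lambda>z. c + L z))"

text \<open>
  In the coordinates given by the rigid motion \<open>\<psi>\<close>, the part of \<open>M t\<close> with height between \<open>a\<close> and
  \<open>b\<close> is the graph of \<open>u\<close> over \<open>Q\<close>, and the region enclosed by \<open>M t\<close> lies above the graph.  This fixes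
  the orientation: the outer normal is the downward normal of the graph.
\<close>

definition local_graph :: "(real \<Rightarrow> ((real ^ 'n) \<times> real) set) \<Rightarrow>
    ((real ^ 'n) \<times> real \<Rightarrow> (real ^ 'n) \<times> real) \<Rightarrow> ((real ^ 'n) \<times> real) set \<Rightarrow> real \<Rightarrow> real \<Rightarrow>
    (real ^ 'n \<Rightarrow> real \<Rightarrow> real) \<Rightarrow> bool" where
  "local_graph M \<psi> Q a b u \<longleftrightarrow> rigid_motion \<psi> \<and> open Q \<and>
     continuous_on Q (\<lambda>(x, t). u x t) \<and>
     (\<forall>(x, t)\<in>Q. a < u x t \<and> u x t < b \<and>
        \<psi> (x, u x t) \<in> M t \<and>
        (\<forall>y. u x t < y \<and> y < b \<longrightarrow> \<psi> (x, y) \<in> inside (M t)) \<and>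
        (\<forall>y. a < y \<and> y < u x t \<longrightarrow> \<psi> (x, y) \<in> outside (M t)))"

text \<open>The outer unit normal, in the original coordinates, of such a graph with gradient \<open>p\<close>.\<close>

definition graph_normal :: "((real ^ 'n) \<times> real \<Rightarrow> (real ^ 'n) \<times> real) \<Rightarrow> real ^ 'n \<Rightarrow>
    (real ^ 'n) \<times> real" where
  "graph_normal \<psi> p = (1 / sqrt (1 + (norm p)\<^sup>2)) *\<^sub>R (\<psi> (p, - 1) - \<psi> (0, 0))"

definition evolving_surface :: "('a \<Rightarrow> real \<Rightarrow> 'b) \<Rightarrow> 'a set \<Rightarrow> real \<Rightarrow> 'b set" where
  "evolving_surface X S t = (\<lambda>p. X p t) ` S"

text \<open>
  A scalar curvature flow on the time interval \<open>[0, T')\<close> starting from the hypersurface \<open>S\<close>, whose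
  initial immersion is the inclusion.  For positive times the surfaces are locally Lipschitz graphs;
  wherever they are of class \<open>C\<^sup>2\<close> in space and \<open>C\<^sup>1\<close> in time, \<open>\<partial>X/\<partial>t = - \<sigma>\<^sub>2 \<nu>\<close> holds classically, and
  in all local graph representations the graph equation holds in the viscosity sense.
\<close>

definition scalar_curvature_flow ::
    "((real ^ 'n) \<times> real) set \<Rightarrow>
     ((real ^ 'n) \<times> real \<Rightarrow> real \<Rightarrow> (real ^ 'n) \<times> real) \<Rightarrow> real \<Rightarrow> bool" where
  "scalar_curvature_flow S X T' \<longleftrightarrow>
     continuous_on (S \<times> {0..<T'}) (\<lambda>(p, t). X p t) \<and>
     (\<forall>p\<in>S. X p 0 = p) \<and>
     (\<forall>t\<in>{0..<T'}. inj_on (\<lambda>p. X p t) S) \<and>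
     (\<forall>t\<in>{0<..<T'}. \<forall>z\<in>evolving_surface X S t.
        \<exists>\<psi> Q a b u x C. local_graph (evolving_surface X S) \<psi> Q a b u \<and>
          Q \<subseteq> UNIV \<times> {0<..<T'} \<and> (x, t) \<in> Q \<and> z = \<psi> (x, u x t) \<and>
          (\<forall>y y' s. (y, s) \<in> Q \<and> (y', s) \<in> Q \<longrightarrow> \<bar>u y s - u y' s\<bar> \<le> C * norm (y - y'))) \<and>
     (\<forall>\<psi> Q a b u ut Du D2u.
        local_graph (evolving_surface X S) \<psi> Q a b u \<and> Q \<subseteq> UNIV \<times> {0<..<T'} \<and>
        C21_on Q u ut Du D2u \<longrightarrow>
        (\<forall>p\<in>S. \<forall>(x, t)\<in>Q. X p t = \<psi> (x, u x t) \<longrightarrow>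
           ((\<lambda>s. X p s) has_vector_derivative
              (- graph_sigma2 (Du x t) (D2u x t)) *\<^sub>R graph_normal \<psi> (Du x t)) (at t))) \<and>
     (\<forall>\<psi> Q a b u.
        local_graph (evolving_surface X S) \<psi> Q a b u \<and> Q \<subseteq> UNIV \<times> {0<..<T'} \<longrightarrow>
        viscosity_solution Q u)"

section \<open>Hypersurfaces with a flat side\<close>

text \<open>
  The function \<open>f\<close> whose graph is the lower part of \<open>M\<close>, and its domain \<open>\<Omega> = {|Df| < \<infinity>}\<close>.  In
  \<open>graph_domain\<close> the interior of the projection is taken because \<open>lower_function M\<close> has no meaning
  (infimum of the empty set) off the projection of \<open>M\<close>.
\<close>

definition lower_function :: "((real ^ 'n) \<times> real) set \<Rightarrow> real ^ 'n \<Rightarrow> real" where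
  "lower_function M x = Inf {y. (x, y) \<in> M}"

definition graph_domain :: "((real ^ 'n) \<times> real) set \<Rightarrow> (real ^ 'n) set" where
  "graph_domain M = {x \<in> interior (fst ` M). lower_function M differentiable (at x)}"

definition flat_side :: "((real ^ 'n) \<times> real) set \<Rightarrow> (real ^ 'n) set" where
  "flat_side M = {x \<in> graph_domain M. lower_function M x = 0}"

abbreviation interface :: "((real ^ 'n) \<times> real) set \<Rightarrow> (real ^ 'n) set" where
  "interface M \<equiv> frontier (flat_side M)"

text \<open>The lower part of \<open>M\<close> is a nonnegative convex graph which contains all of \<open>M\<close> at height \<open>0\<close>.\<close>

definition graph_contains_flat_side :: "((real ^ 'n) \<times> real) set \<Rightarrow> bool" where
  "graph_contains_flat_side M \<longleftrightarrow>
     convex_on (graph_domain M) (lower_function M) \<and>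
     (\<forall>x\<in>graph_domain M. 0 \<le> lower_function M x) \<and>
     (\<forall>x. (x, 0) \<in> M \<longrightarrow> x \<in> graph_domain M)"

text \<open>
  A compact convex hypersurface \<open>S = \<Sigma>\<^sub>0 \<union> \<Sigma>\<^sub>1\<close>: \<open>\<Sigma>\<^sub>0\<close> is a flat (\<open>n\<close>-dimensional) side in the hyperplane
  \<open>x\<^sub>n\<^sub>+\<^sub>1 = 0\<close>, and the closure \<open>\<Sigma>\<^sub>1\<close> of its complement lies above the hyperplane and is strictly
  convex, i.e. contains no line segments.  \<open>\<Sigma>\<^sub>1\<close> is a closure so that it meets \<open>\<Sigma>\<^sub>0\<close> in the interface.
\<close>

definition convex_hypersurface :: "'a::euclidean_space set \<Rightarrow> bool" where
  "convex_hypersurface S \<longleftrightarrow>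
     (\<exists>K. compact K \<and> convex K \<and> interior K \<noteq> {} \<and> S = frontier K)"

definition convex_with_flat_side :: "((real ^ 'n) \<times> real) set \<Rightarrow> bool" where
  "convex_with_flat_side S \<longleftrightarrow> convex_hypersurface S \<and>
     (let \<Sigma>0 = {z \<in> S. snd z = 0}; \<Sigma>1 = closure (S - \<Sigma>0) in
        interior (fst ` \<Sigma>0) \<noteq> {} \<and>
        (\<forall>z\<in>S - \<Sigma>0. snd z > 0) \<and>
        (\<forall>z\<in>\<Sigma>1. \<forall>w\<in>\<Sigma>1. z \<noteq> w \<longrightarrow> \<not> closed_segment z w \<subseteq> \<Sigma>1))"

definition unit_tangents :: "'a::real_normed_vector set \<Rightarrow> 'a \<Rightarrow> 'a set" where
  "unit_tangents S x = {\<tau>. \<exists>y::nat \<Rightarrow> 'a. (\<forall>k. y k \<in> S - {x}) \<and> y \<longlonglongrightarrow> x \<and>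
     (\<lambda>k. (y k - x) /\<^sub>R norm (y k - x)) \<longlonglongrightarrow> \<tau>}"

text \<open>
  The condition \<open>|Dg| \<ge> l\<close>, \<open>D\<^sup>2\<^sub>\<tau>\<^sub>\<tau> g \<ge> l\<close> on the interface for \<open>g = sqrt (2 f)\<close>, where the first and
  second derivatives \<open>Dg x\<close>, \<open>D2g x\<close> at an interface point \<open>x\<close> are the limits from \<open>{f > 0}\<close>.
\<close>

definition nondegenerate_interface :: "real \<Rightarrow> ((real ^ 'n) \<times> real) set \<Rightarrow> bool" where
  "nondegenerate_interface l M \<longleftrightarrow>
     (let g = (\<lambda>x. sqrt (2 * lower_function M x));
          P = {x \<in> graph_domain M. lower_function M x > 0} in
      \<exists>(Dg :: real ^ 'n \<Rightarrow> real ^ 'n) (D2g :: real ^ 'n \<Rightarrow> real ^ 'n ^ 'n).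
        \<forall>x\<in>interface M.
          (\<forall>\<^sub>F y in at x within P.
             (g has_derivative (\<lambda>h. Dg y \<bullet> h)) (at y) \<and>
             (Dg has_derivative (\<lambda>h. D2g y *v h)) (at y)) \<and>
          (Dg \<longlongrightarrow> Dg x) (at x within P) \<and>
          (D2g \<longlongrightarrow> D2g x) (at x within P) \<and>
          norm (Dg x) \<ge> l \<and>
          (\<forall>\<tau>\<in>unit_tangents (interface M) x. \<tau> \<bullet> (D2g x *v \<tau>) \<ge> l))"

definition flat_side_vanishing_time :: "(real \<Rightarrow> ((real ^ 'n) \<times> real) set) \<Rightarrow> real \<Rightarrow> bool" where
  "flat_side_vanishing_time M Tc \<longleftrightarrow> 0 < Tc \<and>
     (\<forall>t\<in>{0..<Tc}. measure lebesgue (flat_side (M t)) > 0) \<and>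
     ((\<lambda>t. measure lebesgue (flat_side (M t))) \<longlongrightarrow> 0) (at_left Tc)"

text \<open>\<open>G\<close> is written in polar coordinates about the origin as \<open>r = \<rho> \<theta>\<close>, \<open>\<theta> \<in> S\<^sup>n\<^sup>-\<^sup>1\<close>.\<close>

definition polar_graph :: "'a::real_normed_vector set \<Rightarrow> ('a \<Rightarrow> real) \<Rightarrow> bool" where
  "polar_graph G \<rho> \<longleftrightarrow> (\<forall>\<theta>\<in>sphere 0 1. \<rho> \<theta> > 0) \<and> G = (\<lambda>\<theta>. \<rho> \<theta> *\<^sub>R \<theta>) ` sphere 0 1"

end

theory Submission
  imports Defs "HOL-Probability.Distributions"
begin

text \<open>
  Write \<open>h(\<nu>, t)\<close> for the support function of \<open>M t\<close>.  For \<open>\<mu> > 1\<close> close to \<open>1\<close>, the Minkowski combinations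
  \<open>(1 - \<eta>(s)) M (s / \<mu>) + \<eta>(s) E\<close> with \<open>\<eta>(s) = 2 (1 - 1 / \<mu>) exp (k s)\<close> and a fixed convex cap \<open>E\<close> which comes
  arbitrarily close to the hyperplane at the origin are barriers: at a first contact with \<open>M s\<close> the Hessian of
  their support function is diagonal in some frame, and the convexity of the speed \<open>\<sigma>\<^sub>2\<close> in the inverse
  second fundamental form, with the extra curvature of \<open>E\<close>, contradicts the flow equation.
  As \<open>h\<close> is not smooth, the equation for \<open>h\<close> is linearised at the contact frame into a heat inequality, which passes to mollifications of \<open>h\<close>.  Thus the
  flat side at time \<open>\<mu> t0\<close> contains the flat side at time \<open>t0\<close> shrunk by \<open>1 - A (1 - 1 / \<mu>)\<close>, and iterating
  with \<open>\<mu> \<rightarrow> 1\<close> gives \<open>\<gamma>(\<theta>, t) \<ge> (t0 / t)\<^sup>A \<gamma>(\<theta>, t0)\<close>, which is stronger than the exponential bound.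
\<close>

section \<open>Normal speed of a hypersurface in terms of a quadratic form\<close>

text \<open>The surfaces \<open>M t\<close> are not assumed convex for positive t, so the estimates
  use the support functions of their hulls and paraboloids touching the enclosed region. Let ep = 1
  - 1 / \<mu>. The rescaling s / \<mu> slows the copy of the flow by the factor 1 - ep, and
  averaging costs a second such factor. The cap repays this: its radii of curvature add 5 \<eta> P
  to the speed P of the barrier, and \<eta> >= 2 ep gives (1 - ep)^2 (1 + 5 \<eta>) >= 1. What
  remains is an error \<eta> C D, where D is the gap between the two support functions being
  combined; the growth rate k = C + 1 of \<eta> pays for it. The constant C must not depend on the
  height \<open>dl\<close> of the cap, because \<open>dl\<close> tends to 0 for fixed \<mu>. Hence
  the flattened ellipsoid in the cap: near the south pole, where D degenerates, it is so flat that
  the product of two radii of curvature is at least of order 1 / D.\<close>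

definition tangent_trace :: "'a::euclidean_space => ('a => 'a => real) => real" where
 "tangent_trace N B = (\<Sum>b\<in>Basis. B b b) - B N N / (N \<bullet> N)"

text \<open>\<open>tangent_trace N B\<close> is the trace of \<open>B\<close> on the hyperplane
  orthogonal to \<open>N\<close>, so the nested traces give |A|^2 without a basis of the tangent
  space. If a hypersurface is N . z = Q z z / 2 to second order, its second fundamental form is Q /
  |N|, and this value is |N| times sigma_2: the rate at which N . z grows on the moving
  hypersurface.\<close>

definition hyp_speed :: "'a::euclidean_space => ('a => 'a => real) => real" where
 "hyp_speed N Q = ((tangent_trace N Q)\<^sup>2 -
   tangent_trace N (%w z. tangent_trace N (%u v. Q u w * Q v z))) / (2 * norm N)"

section \<open>Bilinear forms and sums over the standard bases\<close>

lemma bilinear_simps: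
 assumes "bilinear B"
 shows "B (x + y) z = B x z + B y z" "B x (y + z) = B x y + B x z"
  "B (c *\<^sub>R x) z = c * B x z" "B x (c *\<^sub>R z) = c * B x z" "B (- x) z = - B x z" "B x (- z) = - B x z"
  "B (x - y) z = B x z - B y z" "B x (y - z) = B x y - B x z" "B 0 z = (0::real)" "B z 0 = 0"
 using assms by (auto simp: bilinear_ladd bilinear_radd bilinear_lmul bilinear_rmul bilinear_lneg
   bilinear_rneg bilinear_lsub bilinear_rsub bilinear_lzero bilinear_rzero)

lemma bilinear_sum_left:
 assumes "bilinear B" shows "B (sum f S) z = (\<Sum>i\<in>S. B (f i) z :: real)"
proof -
 interpret linear "%x. B x z" using assms by (auto simp: bilinear_def)
 show ?thesis by (rule sum)
qed

lemma bilinear_sum_right: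
 assumes "bilinear B" shows "B z (sum f S) = (\<Sum>i\<in>S. B z (f i) :: real)"
proof -
 interpret linear "%x. B z x" using assms by (auto simp: bilinear_def)
 show ?thesis by (rule sum)
qed

lemma bilinearI2:
 assumes "!!x y z. B (x + y) z = B x z + B y z" "!!x y z. B z (x + y) = B z x + B z y"
  "!!c x z. B (c *\<^sub>R x) z = c *\<^sub>R B x z" "!!c x z. B z (c *\<^sub>R x) = c *\<^sub>R B z x"
 shows "bilinear B"
 using assms by (auto simp: bilinear_def intro!: linearI)

lemma sum_Basis_cart: "(\<Sum>b\<in>(Basis :: (real^'n) set). f b) = (\<Sum>i\<in>UNIV. f (axis i 1))"
proof -
 have B: "(Basis :: (real^'n) set) = (%i. axis i 1) ` UNIV"
  by (auto simp: Basis_vec_def)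
 have i: "inj (%i. axis i 1 :: real^'n)"
  by (simp add: inj_on_def axis_eq_axis)
 show ?thesis
  unfolding B sum.reindex[OF i] by simp
qed

lemma sum_Basis_prod:
 "(\<Sum>b\<in>(Basis :: ((real^'n) \<times> real) set). f b) = (\<Sum>i\<in>UNIV. f (axis i 1, 0)) + f (0, 1)"
proof -
 have B: "(Basis :: ((real^'n) \<times> real) set) = (%u. (u, 0)) ` Basis \<union> {(0, 1)}"
  by (auto simp: Basis_prod_def)
 have i: "inj_on (%u. (u :: real^'n, 0 :: real)) Basis"
  by (simp add: inj_on_def)
 have "(\<Sum>b\<in>(%u. (u, 0)) ` (Basis :: (real^'n) set) \<union> {(0, 1 :: real)}. f b) =
   (\<Sum>b\<in>(%u. (u, 0)) ` (Basis :: (real^'n) set). f b) + (\<Sum>b\<in>{(0, 1)}. f b)"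
  by (rule sum.union_disjoint) auto
 then show ?thesis
  unfolding B sum.reindex[OF i] sum_Basis_cart by simp
qed

lemma norm2_cart: "(norm (p :: real^'n))\<^sup>2 = (\<Sum>i\<in>UNIV. (p $ i)\<^sup>2)"
 by (simp add: norm_vec_def L2_set_def sum_nonneg)

lemma cart_sum_axis: "(p :: real^'n) = (\<Sum>i\<in>UNIV. p $ i *\<^sub>R axis i 1)"
 by (simp add: vec_eq_iff axis_def if_distrib cong: if_cong)

lemma tangent_trace_scale:
 assumes "bilinear B" "m ~= 0"
 shows "tangent_trace (m *\<^sub>R N) B = tangent_trace N B"
 using assms by (simp add: tangent_trace_def bilinear_simps[OF assms(1)] field_simps)

text \<open>The vectors (axis i 1, p $ i) span the tangent space of the graph and
  \<open>graph_inv_metric p\<close> inverts their Gram matrix, so the contraction is the trace on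
  the hyperplane orthogonal to (- p, 1). Both sides are expanded in the blocks \<open>bb\<close>,
  \<open>cc\<close>, \<open>dd\<close>, \<open>y\<close> of \<open>B\<close>.\<close>

lemma graph_trace:
 fixes B :: "(real^'n) \<times> real => (real^'n) \<times> real => real" and p :: "real^'n"
 assumes B: "bilinear B" and m: "m ~= 0"
 shows "(\<Sum>i\<in>UNIV. \<Sum>j\<in>UNIV. graph_inv_metric p $ i $ j * B (axis i 1, p $ i) (axis j 1, p $ j)) =
  tangent_trace (m *\<^sub>R (- p, 1)) B"
proof -
 define E where "E i = (axis i 1 :: real^'n, 0 :: real)" for i
 define Y where "Y = (0 :: real^'n, 1 :: real)"
 define b where "b i j = B (E i) (E j)" for i j
 define c where "c i = B (E i) Y" for i
 define d where "d j = B Y (E j)" for j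
 define y where "y = B Y Y"
 define P where "P = (\<Sum>i\<in>UNIV. (p $ i)\<^sup>2)"
 define s where "s = 1 + P"
 have P0: "P >= 0" by (simp add: P_def sum_nonneg)
 have s0: "s > 0" using P0 by (simp add: s_def)
 have nP: "(norm p)\<^sup>2 = P" by (simp add: P_def norm2_cart)
 have g: "graph_inv_metric p $ i $ j = (if i = j then 1 else 0) - p $ i * p $ j / s" for i j
  by (simp add: graph_inv_metric_def nP s_def)
 have e: "(axis i 1, p $ i) = E i + p $ i *\<^sub>R Y" for i
  by (simp add: E_def Y_def)
 have Be: "B (axis i 1, p $ i) (axis j 1, p $ j) = b i j + p $ j * c i + p $ i * d j + p $ i * p $ j * y" for i j
  by (simp add: e bilinear_simps[OF B] b_def c_def d_def y_def algebra_simps)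
 define bb where "bb = (\<Sum>i\<in>UNIV. \<Sum>j\<in>UNIV. p $ i * p $ j * b i j)"
 define cc where "cc = (\<Sum>i\<in>UNIV. p $ i * c i)"
 define dd where "dd = (\<Sum>i\<in>UNIV. p $ i * d i)"
 have gx: "graph_inv_metric p $ i $ j * x = (if i = j then x else 0) - p $ i * p $ j * x / s" for i j x
  by (simp add: g left_diff_distrib)
 have 1: "(\<Sum>i\<in>UNIV. \<Sum>j\<in>UNIV. graph_inv_metric p $ i $ j * b i j) = (\<Sum>i\<in>UNIV. b i i) - bb / s"
  by (simp add: gx sum_subtractf bb_def sum_divide_distrib)
 have pp: "(\<Sum>j\<in>UNIV. graph_inv_metric p $ i $ j * p $ j) = p $ i / s" for i
 proof -
  have "(\<Sum>j\<in>UNIV. graph_inv_metric p $ i $ j * p $ j) = p $ i - p $ i * P / s"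
   by (simp add: gx sum_subtractf P_def sum_divide_distrib sum_distrib_left
     power2_eq_square mult.assoc)
  also have "... = p $ i / s" using s0 by (simp add: field_simps s_def)
  finally show ?thesis .
 qed
 have pp': "(\<Sum>i\<in>UNIV. graph_inv_metric p $ i $ j * p $ i) = p $ j / s" for j
 proof -
  have "graph_inv_metric p $ i $ j = graph_inv_metric p $ j $ i" for i by (simp add: g)
  then show ?thesis using pp[of j] by simp
 qed
 have 2: "(\<Sum>i\<in>UNIV. \<Sum>j\<in>UNIV. graph_inv_metric p $ i $ j * (p $ j * c i)) = cc / s"
 proof -
  have "(\<Sum>i\<in>UNIV. \<Sum>j\<in>UNIV. graph_inv_metric p $ i $ j * (p $ j * c i)) =
   (\<Sum>i\<in>UNIV. (\<Sum>j\<in>UNIV. graph_inv_metric p $ i $ j * p $ j) * c i)"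
   by (simp add: sum_distrib_right mult.assoc)
  then show ?thesis by (simp add: pp cc_def sum_divide_distrib)
 qed
 have 3: "(\<Sum>i\<in>UNIV. \<Sum>j\<in>UNIV. graph_inv_metric p $ i $ j * (p $ i * d j)) = dd / s"
 proof -
  have "(\<Sum>i\<in>UNIV. \<Sum>j\<in>UNIV. graph_inv_metric p $ i $ j * (p $ i * d j)) =
   (\<Sum>j\<in>UNIV. (\<Sum>i\<in>UNIV. graph_inv_metric p $ i $ j * p $ i) * d j)"
   by (subst sum.swap) (simp add: sum_distrib_right mult.assoc)
  then show ?thesis by (simp add: pp' dd_def sum_divide_distrib)
 qed
 have 4: "(\<Sum>i\<in>UNIV. \<Sum>j\<in>UNIV. graph_inv_metric p $ i $ j * (p $ i * p $ j * y)) = P / s * y"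
 proof -
  have "(\<Sum>i\<in>UNIV. \<Sum>j\<in>UNIV. graph_inv_metric p $ i $ j * (p $ i * p $ j * y)) =
   (\<Sum>i\<in>UNIV. (\<Sum>j\<in>UNIV. graph_inv_metric p $ i $ j * p $ j) * (p $ i * y))"
   by (simp add: sum_distrib_left mult_ac)
  also have "... = (\<Sum>i\<in>UNIV. (p $ i)\<^sup>2 * (y / s))"
   by (rule sum.cong) (simp_all only: pp, simp add: power2_eq_square)
  finally show ?thesis
   by (simp add: P_def sum_distrib_right sum_divide_distrib)
 qed
 have L: "(\<Sum>i\<in>UNIV. \<Sum>j\<in>UNIV. graph_inv_metric p $ i $ j * B (axis i 1, p $ i) (axis j 1, p $ j)) =
   (\<Sum>i\<in>UNIV. b i i) - bb / s + cc / s + dd / s + P / s * y"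
  unfolding Be distrib_left sum.distrib 1 2 3 4 by simp
 have N: "(- p, 1) = Y - (\<Sum>i\<in>UNIV. p $ i *\<^sub>R E i)"
 proof -
  have "(\<Sum>i\<in>UNIV. p $ i *\<^sub>R E i) = (p, 0)"
  proof -
   have "fst (\<Sum>i\<in>UNIV. p $ i *\<^sub>R E i) = p"
    by (subst (2) cart_sum_axis) (simp add: fst_sum E_def)
   moreover have "snd (\<Sum>i\<in>UNIV. p $ i *\<^sub>R E i) = 0"
    by (simp add: snd_sum E_def)
   ultimately show ?thesis by (metis prod.collapse)
  qed
  then show ?thesis by (simp add: Y_def)
 qed
 define V where "V = (\<Sum>i\<in>UNIV. p $ i *\<^sub>R E i)"
 have BV: "B V V = bb" "B V Y = cc" "B Y V = dd"
  unfolding V_def bilinear_sum_left[OF B] bilinear_sum_right[OF B] bilinear_simps[OF B]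
   bb_def cc_def dd_def b_def c_def d_def
  by (subst sum.swap) (simp_all add: sum_distrib_left mult_ac)
 have BN: "B (- p, 1) (- p, 1) = bb - cc - dd + y"
  unfolding N V_def[symmetric] bilinear_simps[OF B] BV y_def by simp
 have NN: "p \<bullet> p + 1 = s"
  by (simp add: s_def nP[symmetric] power2_norm_eq_inner)
 have "tangent_trace (m *\<^sub>R (- p, 1)) B = (\<Sum>i\<in>UNIV. b i i) + y - (bb - cc - dd + y) / s"
  unfolding tangent_trace_scale[OF B m]
  by (simp add: tangent_trace_def NN BN sum_Basis_prod b_def E_def y_def Y_def)
 also have "... = (\<Sum>i\<in>UNIV. b i i) - bb / s + cc / s + dd / s + P / s * y"
 proof -
  have "P / s = 1 - 1 / s" using s0 by (simp add: field_simps s_def)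
  then show ?thesis by (simp add: diff_divide_distrib add_divide_distrib left_diff_distrib)
 qed
 finally show ?thesis using L by simp
qed

lemma bilinear_mult_slots:
 fixes Q :: "'a::real_vector => 'a => real"
 assumes "bilinear Q"
 shows "bilinear (%u v. Q u w * Q v z :: real)"
 by (rule bilinearI2) (simp_all add: bilinear_simps[OF assms] algebra_simps)

lemma bilinear_tangent_trace_slots:
 fixes Q :: "'a::euclidean_space => 'a => real"
 assumes "bilinear Q"
 shows "bilinear (%w z. tangent_trace N (%u v. Q u w * Q v z))"
 by (rule bilinearI2)
  (simp_all add: tangent_trace_def bilinear_simps[OF assms] algebra_simps sum.distrib add_divide_distrib
   sum_distrib_left)

lemma norm_graph_vec: "norm (- p :: real^'n, 1::real) = sqrt (1 + (norm p)\<^sup>2)"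
 by (simp add: norm_Pair)

text \<open>The quadruple sum in \<open>graph_speed\<close> factors into contractions with the
  inverse metric, each a tangential trace by \<open>graph_trace\<close>. The factor \<open>m\<close>
  undoes the length of the normal in \<open>hyp_speed\<close>, because \<open>A\<close> is the
  pullback of \<open>Q\<close> without division by \<open>m\<close>.\<close>

lemma graph_speed_eq_hyp_speed:
 fixes Q :: "(real^'n) \<times> real => (real^'n) \<times> real => real" and p :: "real^'n"
 assumes B: "bilinear Q" and sym: "!!u v. Q u v = Q v u" and m: "m > 0"
  and A: "!!i j. A $ i $ j = Q (axis i 1, p $ i) (axis j 1, p $ j)"
 shows "graph_speed p A = m * hyp_speed (m *\<^sub>R (- p, 1)) Q"
  and "graph_mean_curvature p A = tangent_trace (m *\<^sub>R (- p, 1)) Q / sqrt (1 + (norm p)\<^sup>2)"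
proof -
 let ?e = "%i. (axis i 1, p $ i)"
 let ?N = "m *\<^sub>R (- p, 1::real)"
 let ?g = "%i j. graph_inv_metric p $ i $ j"
 have m0: "m ~= 0" using m by simp
 define W where "W = sqrt (1 + (norm p)\<^sup>2)"
 have T: "(\<Sum>i\<in>UNIV. \<Sum>j\<in>UNIV. ?g i j * B (?e i) (?e j)) = tangent_trace ?N B" if "bilinear B" for B
  using graph_trace[OF that m0] .
 have s1: "(\<Sum>i\<in>UNIV. \<Sum>j\<in>UNIV. \<Sum>k\<in>UNIV. \<Sum>l\<in>UNIV. ?g i k * ?g j l * (A$k$i * A$l$j)) =
   (tangent_trace ?N Q)\<^sup>2"
 proof -
  have "(\<Sum>i\<in>UNIV. \<Sum>j\<in>UNIV. \<Sum>k\<in>UNIV. \<Sum>l\<in>UNIV. ?g i k * ?g j l * (A$k$i * A$l$j)) =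
   (\<Sum>i\<in>UNIV. \<Sum>j\<in>UNIV. (\<Sum>k\<in>UNIV. ?g i k * A$k$i) * (\<Sum>l\<in>UNIV. ?g j l * A$l$j))"
   unfolding sum_product by (simp add: ac_simps)
  also have "... = (\<Sum>i\<in>UNIV. \<Sum>k\<in>UNIV. ?g i k * A$k$i)\<^sup>2"
   by (simp add: sum_product power2_eq_square)
  also have "(\<Sum>i\<in>UNIV. \<Sum>k\<in>UNIV. ?g i k * A$k$i) = tangent_trace ?N Q"
   unfolding T[OF B, symmetric] A by (simp add: sym[of "?e _" "?e _"])
  finally show ?thesis .
 qed
 have s2: "(\<Sum>i\<in>UNIV. \<Sum>j\<in>UNIV. \<Sum>k\<in>UNIV. \<Sum>l\<in>UNIV. ?g i k * ?g j l * (A$k$j * A$l$i)) =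
   tangent_trace ?N (%w z. tangent_trace ?N (%u v. Q u w * Q v z))"
 proof -
  have "(\<Sum>i\<in>UNIV. \<Sum>j\<in>UNIV. \<Sum>k\<in>UNIV. \<Sum>l\<in>UNIV. ?g i k * ?g j l * (A$k$j * A$l$i)) =
   (\<Sum>j\<in>UNIV. \<Sum>l\<in>UNIV. ?g j l * (\<Sum>i\<in>UNIV. \<Sum>k\<in>UNIV. ?g i k * (Q (?e i) (?e l) * Q (?e k) (?e j))))"
  proof -
   have "(\<Sum>i\<in>UNIV. \<Sum>j\<in>UNIV. \<Sum>k\<in>UNIV. \<Sum>l\<in>UNIV. ?g i k * ?g j l * (A$k$j * A$l$i)) =
    (\<Sum>j\<in>UNIV. \<Sum>i\<in>UNIV. \<Sum>l\<in>UNIV. \<Sum>k\<in>UNIV. ?g i k * ?g j l * (A$k$j * A$l$i))"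
    by (subst sum.swap) (rule sum.cong[OF refl], rule sum.cong[OF refl], rule sum.swap)
   also have "... = (\<Sum>j\<in>UNIV. \<Sum>l\<in>UNIV. \<Sum>i\<in>UNIV. \<Sum>k\<in>UNIV. ?g i k * ?g j l * (A$k$j * A$l$i))"
    by (rule sum.cong[OF refl], rule sum.swap)
   also have "... = (\<Sum>j\<in>UNIV. \<Sum>l\<in>UNIV. ?g j l * (\<Sum>i\<in>UNIV. \<Sum>k\<in>UNIV. ?g i k * (Q (?e i) (?e l) * Q (?e k) (?e j))))"
    by (simp add: sum_distrib_left A ac_simps sym[of "?e _" "?e _"])
   finally show ?thesis .
  qed
  also have "... = (\<Sum>j\<in>UNIV. \<Sum>l\<in>UNIV. ?g j l * tangent_trace ?N (%u v. Q u (?e l) * Q v (?e j)))"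
   by (simp only: T[OF bilinear_mult_slots[OF B], symmetric])
  also have "... = (\<Sum>j\<in>UNIV. \<Sum>l\<in>UNIV. ?g j l * tangent_trace ?N (%u v. Q u (?e j) * Q v (?e l)))"
   by (subst tangent_trace_def, subst tangent_trace_def) (simp add: ac_simps)
  also have "... = tangent_trace ?N (%w z. tangent_trace ?N (%u v. Q u w * Q v z))"
   using T[OF bilinear_tangent_trace_slots[OF B, of ?N]] by simp
  finally show ?thesis .
 qed
 have "graph_speed p A = 1 / (2 * W) * ((tangent_trace ?N Q)\<^sup>2 -
   tangent_trace ?N (%w z. tangent_trace ?N (%u v. Q u w * Q v z)))"
  unfolding graph_speed_def s1[symmetric] s2[symmetric]
  by (simp add: W_def right_diff_distrib sum_subtractf)
 moreover have "norm ?N = m * W"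
  unfolding norm_scaleR norm_graph_vec W_def using m by simp
 ultimately show "graph_speed p A = m * hyp_speed ?N Q"
  unfolding hyp_speed_def using m by simp
 have "graph_mean_curvature p A = (1 / W) * (\<Sum>i\<in>UNIV. \<Sum>k\<in>UNIV. ?g i k * A$k$i)"
  by (simp add: graph_mean_curvature_def graph_shape_def trace_def matrix_matrix_mult_def W_def
    sum_distrib_left)
 also have "(\<Sum>i\<in>UNIV. \<Sum>k\<in>UNIV. ?g i k * A$k$i) = tangent_trace ?N Q"
   unfolding T[OF B, symmetric] A by (simp add: sym[of "?e _" "?e _"])
 finally show "graph_mean_curvature p A = tangent_trace ?N Q / sqrt (1 + (norm p)\<^sup>2)"
  by (simp add: W_def)
qed

section \<open>Invariance of the normal speed under orthogonal maps\<close>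

lemma sum_Basis_orthogonal:
 fixes B :: "'a::euclidean_space => 'a => real" and L :: "'a => 'a"
 assumes B: "bilinear B" and L: "orthogonal_transformation L"
 shows "(\<Sum>b\<in>Basis. B (L b) (L b)) = (\<Sum>b\<in>Basis. B b b)"
proof -
 have bL: "bij L"
  using orthogonal_transformation_bij[OF L] .
 define L' where "L' = inv L"
 have L': "!!x. L (L' x) = x" "orthogonal_transformation L'"
  using orthogonal_transformation_inv[OF L] bL by (auto simp: L'_def bij_is_surj surj_f_inv_f)
 have i: "L b \<bullet> c = b \<bullet> L' c" for b c
  using L L'(1)[of c] unfolding orthogonal_transformation_def by metis
 have "(\<Sum>b\<in>Basis. B (L b) (L b)) =
   (\<Sum>b\<in>Basis. \<Sum>c\<in>Basis. \<Sum>d\<in>Basis. (L b \<bullet> c) * (L b \<bullet> d) * B c d)"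
 proof (rule sum.cong[OF refl])
  fix b :: 'a
  have "B (L b) (L b) = B (\<Sum>c\<in>Basis. (L b \<bullet> c) *\<^sub>R c) (\<Sum>c\<in>Basis. (L b \<bullet> c) *\<^sub>R c)"
   by (simp add: euclidean_representation)
  also have "... = (\<Sum>c\<in>Basis. \<Sum>d\<in>Basis. (L b \<bullet> c) * (L b \<bullet> d) * B c d)"
   unfolding bilinear_sum_left[OF B] bilinear_sum_right[OF B]
   by (subst sum.swap) (simp add: bilinear_simps[OF B] sum_distrib_left mult_ac)
  finally show "B (L b) (L b) = (\<Sum>c\<in>Basis. \<Sum>d\<in>Basis. (L b \<bullet> c) * (L b \<bullet> d) * B c d)" .
 qed
 also have "... = (\<Sum>c\<in>Basis. \<Sum>d\<in>Basis. \<Sum>b\<in>Basis. (L b \<bullet> c) * (L b \<bullet> d) * B c d)"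
  by (subst sum.swap) (rule sum.cong[OF refl], rule sum.swap)
 also have "... = (\<Sum>c\<in>Basis. \<Sum>d\<in>Basis. (\<Sum>b\<in>Basis. (L' c \<bullet> b) * (L' d \<bullet> b)) * B c d)"
  by (simp add: i sum_distrib_right inner_commute[of "L' _"])
 also have "... = (\<Sum>c\<in>Basis. \<Sum>d\<in>Basis. (c \<bullet> d) * B c d)"
  using L'(2) by (simp add: euclidean_inner[symmetric] orthogonal_transformation_def)
 also have "... = (\<Sum>c\<in>Basis. B c c)"
  by (rule sum.cong[OF refl]) (simp add: inner_Basis if_distribR if_distrib cong: if_cong)
 finally show ?thesis .
qed

lemma tangent_trace_orthogonal:
 fixes B :: "'a::euclidean_space => 'a => real" and L :: "'a => 'a"
 assumes B: "bilinear B" and L: "orthogonal_transformation L"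
 shows "tangent_trace N (%u v. B (L u) (L v)) = tangent_trace (L N) B"
 using L by (simp add: tangent_trace_def sum_Basis_orthogonal[OF B L] orthogonal_transformation_def)

lemma hyp_speed_orthogonal:
 fixes Q :: "'a::euclidean_space => 'a => real" and L :: "'a => 'a"
 assumes B: "bilinear Q" and L: "orthogonal_transformation L"
 shows "hyp_speed N (%u v. Q (L u) (L v)) = hyp_speed (L N) Q"
proof -
 have "tangent_trace N (%w z. tangent_trace N (%u v. Q (L u) (L w) * Q (L v) (L z))) =
  tangent_trace N (%w z. tangent_trace (L N) (%u v. Q u (L w) * Q v (L z)))"
  by (simp add: tangent_trace_orthogonal[OF bilinear_mult_slots[OF B] L])
 also have "... = tangent_trace (L N) (%w z. tangent_trace (L N) (%u v. Q u w * Q v z))"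
  by (rule tangent_trace_orthogonal[OF bilinear_tangent_trace_slots[OF B] L])
 finally show ?thesis
  using L by (simp add: hyp_speed_def tangent_trace_orthogonal[OF B L] orthogonal_transformation_norm)
qed

lemma hyp_speed_scale:
 "hyp_speed N (%u v. c * Q u v) = c\<^sup>2 * hyp_speed N Q"
proof -
 have 1: "tangent_trace N (%u v. c * B u v) = c * tangent_trace N B" for c B
  by (simp add: tangent_trace_def sum_distrib_left right_diff_distrib)
 have 2: "(%u v. c * Q u w * (c * Q v z)) = (%u v. (c * c) * (Q u w * Q v z))" for w z
  by (intro ext) simp
 have 3: "tangent_trace N (%w z. tangent_trace N (%u v. c * Q u w * (c * Q v z))) =
  c * c * tangent_trace N (%w z. tangent_trace N (%u v. Q u w * Q v z))"
  unfolding 2 1 by simp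
 show ?thesis
  unfolding hyp_speed_def 3 1 by (simp add: power2_eq_square field_simps)
qed

section \<open>Viscosity tests in the past\<close>

text \<open>The viscosity definitions ask for contact on an open space-time set, whereas contact is
  known here only in the past of t0. Adding dl / (t0 - t), which blows up at t0, forces a minimum at
  an earlier interior time; the strict lower bound on \<open>w\<close> keeps it off the parabolic
  boundary.\<close>

lemma past_minimum:
 fixes w :: "'a::euclidean_space => real => real"
 assumes cont: "continuous_on (cball x0 rho \<times> {t0 - rho..t0}) (%(x, t). w x t)"
  and w0: "w x0 t0 = 0" and pos: "rho > 0" "c > 0" "ez > 0"
  and w: "!!x t. norm (x - x0) <= rho ==> t0 - rho <= t ==> t < t0 ==> c * ((norm (x - x0))\<^sup>2 + (t0 - t)) <= w x t"
 shows "\<exists>x1 t1 dl N. dl > 0 & open N & (x1, t1) \<in> N &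
  N \<subseteq> {(x, t). norm (x - x0) < rho & t0 - rho < t & t < t0} & norm (x1 - x0) < ez &
  (\<forall>(x, t)\<in>N. w x1 t1 + dl / (t0 - t1) <= w x t + dl / (t0 - t))"
proof -
 define r where "r = min rho (ez / 2)"
 have r: "r > 0" "r <= rho" "r < ez" using pos by (auto simp: r_def min_def)
 define m where "m = min (c * r\<^sup>2) (c * r)"
 have m: "m > 0" "m <= c * r\<^sup>2" "m <= c * r" using pos r by (auto simp: m_def)
 let ?C = "cball x0 rho \<times> {t0 - rho..t0}"
 have "((%(x, t). w x t) \<longlongrightarrow> (case (x0, t0) of (x, t) => w x t)) (at (x0, t0) within ?C)"
  using cont pos by (auto simp: continuous_on_def)
 then obtain d where d: "d > 0"
  and dw: "!!x t. norm (x - x0) <= rho ==> t0 - rho <= t ==> t <= t0 ==> (x, t) ~= (x0, t0) ==>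
   dist (x, t) (x0, t0) < d ==> \<bar>w x t\<bar> < m / 2"
  unfolding tendsto_iff eventually_at using m(1) w0
  by (auto simp: dist_real_def dist_norm norm_minus_commute dest!: spec[of _ "m / 2"])
 define s where "s = min (d / 2) (r / 2)"
 have s: "s > 0" "s < d" "s < r" using d r by (auto simp: s_def)
 have ws: "\<bar>w x0 (t0 - s)\<bar> < m / 2"
  using s r pos by (intro dw) (auto simp: dist_Pair_Pair dist_real_def)
 \<comment> \<open>At (x0, t0 - s) the penalty is m / 4, so the penalised value there is below m;
   within s / 4 of t0 the penalty alone is at least m. For t = t0 - r or |x - x0| = r already
   \<open>w\<close> is at least m.\<close>
 define dl where "dl = s * m / 4"
 have dl: "dl > 0" using s m by (simp add: dl_def)
 define v where "v x t = w x t + dl / (t0 - t)" for x t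
 define Z where "Z = cball x0 r \<times> {t0 - r .. t0 - s / 4}"
 have vs: "v x0 (t0 - s) < m"
  using ws s(1) m by (simp add: v_def dl_def)
 have "compact Z" by (simp add: Z_def compact_Times)
 moreover have "(x0, t0 - s) \<in> Z" using s r by (auto simp: Z_def)
 moreover have "continuous_on Z (%z. v (fst z) (snd z))"
 proof -
  have "Z \<subseteq> ?C" using r s by (auto simp: Z_def dist_norm norm_minus_commute)
  from continuous_on_subset[OF cont this] have "continuous_on Z (%z. w (fst z) (snd z))"
   by (simp add: split_beta')
  then show ?thesis unfolding v_def using s
   by (intro continuous_intros) (auto simp: Z_def)
 qed
 ultimately obtain z1 where z1: "z1 \<in> Z" "!!z. z \<in> Z ==> v (fst z1) (snd z1) <= v (fst z) (snd z)"
  using continuous_attains_inf[of Z "%z. v (fst z) (snd z)"] by blast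
 obtain x1 t1 where e1: "z1 = (x1, t1)" by force
 have v1: "v x1 t1 < m" using z1(2)[of "(x0, t0 - s)"] \<open>(x0, t0 - s) \<in> Z\<close> vs by (simp add: e1)
 have in1: "norm (x1 - x0) <= r" "t0 - r <= t1" "t1 <= t0 - s / 4"
  using z1(1) by (auto simp: e1 Z_def dist_norm norm_minus_commute)
 have wpos: "w x t >= c * ((norm (x - x0))\<^sup>2 + (t0 - t))" if "norm (x - x0) <= r" "t0 - r <= t" "t < t0" for x t
  using w[of x t] that r by auto
 have wnn: "w x t >= 0" if "norm (x - x0) <= r" "t0 - r <= t" "t < t0" for x t
 proof -
  have "0 <= c * ((norm (x - x0))\<^sup>2 + (t0 - t))" using that pos by simp
  then show ?thesis using wpos[OF that] by linarith
 qed
 have t1: "t1 < t0" using in1 s by linarith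
 have fr: "dl / (t0 - t1) > 0" using dl t1 by simp
 define N where "N = ball x0 r \<times> {t0 - r <..< t0}"
 have "norm (x1 - x0) ~= r"
 proof
  assume "norm (x1 - x0) = r"
  then have "c * r\<^sup>2 <= w x1 t1" using wpos[of x1 t1] in1 t1 pos by (simp add: distrib_left) (smt (verit) mult_nonneg_nonneg)
  then show False using v1 fr m by (simp add: v_def)
 qed
 moreover have "t1 ~= t0 - r"
 proof
  assume "t1 = t0 - r"
  then have "c * r <= w x1 t1" using wpos[of x1 t1] in1 t1 pos
   by (simp add: distrib_left) (smt (verit) mult_nonneg_nonneg zero_le_power2)
  then show False using v1 fr m by (simp add: v_def)
 qed
 ultimately have "(x1, t1) \<in> N"
  using in1 t1 by (auto simp: N_def dist_norm norm_minus_commute)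
 moreover have "open N" by (simp add: N_def open_Times)
 moreover have "N \<subseteq> {(x, t). norm (x - x0) < rho & t0 - rho < t & t < t0}"
  using r by (auto simp: N_def dist_norm norm_minus_commute)
 moreover have "v x1 t1 <= v x t" if "(x, t) \<in> N" for x t
 proof (cases "t <= t0 - s / 4")
  case True
  then show ?thesis using z1(2)[of "(x, t)"] that by (auto simp: e1 N_def Z_def)
 next
  case False
  then have "t0 - t < s / 4" by linarith
  moreover have "t0 - t > 0" using that by (simp add: N_def)
  ultimately have "m <= dl / (t0 - t)"
   using m s mult_left_mono[of "t0 - t" "s / 4" m] by (simp add: dl_def pos_le_divide_eq mult.commute)
  moreover have "w x t >= 0" using that by (intro wnn) (auto simp: N_def dist_norm norm_minus_commute)
  ultimately show ?thesis using v1 by (simp add: v_def)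
 qed
 ultimately show ?thesis
  using dl in1(1) r(3) unfolding v_def
  by (intro exI[of _ x1] exI[of _ t1] exI[of _ dl] exI[of _ N]) auto
qed

lemma isCont_graph_speed: "isCont (%p. graph_speed p A) p"
proof -
 have "1 + (norm q)\<^sup>2 ~= 0" for q :: "real^'n"
  by (smt (verit) zero_le_power2)
 then show ?thesis
  unfolding graph_speed_def graph_inv_metric_def
  by (auto intro!: continuous_intros)
qed

lemma isCont_graph_mean_curvature: "isCont (%p. graph_mean_curvature p A) p"
proof -
 have "1 + (norm q)\<^sup>2 ~= 0" for q :: "real^'n"
  by (smt (verit) zero_le_power2)
 then show ?thesis
  unfolding graph_mean_curvature_def graph_shape_def trace_def matrix_matrix_mult_def graph_inv_metric_def
  by (auto intro!: continuous_intros)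
qed

lemma C21_on_quadratic:
 fixes p x0 :: "real^'n"
 assumes N: "open N" "!!x t. (x, t) \<in> N ==> t < t0" and sym: "!!i j. A $ i $ j = A $ j $ i"
 shows "C21_on N (%x t. p \<bullet> (x - x0) + (x - x0) \<bullet> (A *v (x - x0)) / 2 + a * (t - t0) + dl / (t0 - t) + k)
  (%x t. a + dl / (t0 - t)\<^sup>2) (%x t. p + A *v (x - x0)) (%x t. A)"
proof -
 have A: "h \<bullet> (A *v y) = (A *v h) \<bullet> y" for h y :: "real^'n"
 proof -
  have "transpose A = A" using sym by (simp add: transpose_def vec_eq_iff)
  then show ?thesis by (metis dot_lmul_matrix transpose_matrix_vector)
 qed
 have A2: "(A *v y) \<bullet> z = (A *v z) \<bullet> y" for y z
  using A[of z y] by (simp add: inner_commute)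
 have 1: "((%t. p \<bullet> (x - x0) + (x - x0) \<bullet> (A *v (x - x0)) / 2 + a * (t - t0) + dl / (t0 - t) + k)
  has_real_derivative a + dl / (t0 - t)\<^sup>2) (at t)" if "(x, t) \<in> N" for x t
  using N(2)[OF that] by (auto intro!: derivative_eq_intros simp: power2_eq_square)
 have 2: "((%y. A *v (y - x0)) has_derivative (%h. A *v h)) (at x)" for x
  by (auto intro!: derivative_eq_intros bounded_linear.has_derivative[OF matrix_vector_mul_bounded_linear])
 have 3: "((%y. p \<bullet> (y - x0) + (y - x0) \<bullet> (A *v (y - x0)) / 2 + a * (t - t0) + dl / (t0 - t) + k)
   has_derivative (%h. (p + A *v (x - x0)) \<bullet> h)) (at x)" for x t
 proof -
  have *: "(A *v h) \<bullet> (x - x0) = (A *v (x - x0)) \<bullet> h" for h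
   by (rule A2)
  have "((%y. p \<bullet> (y - x0) + (y - x0) \<bullet> (A *v (y - x0)) / 2 + a * (t - t0) + dl / (t0 - t) + k)
   has_derivative (%h. p \<bullet> h + ((x - x0) \<bullet> (A *v h) + h \<bullet> (A *v (x - x0))) / 2)) (at x)"
   by (auto intro!: derivative_eq_intros 2)
  then show ?thesis
   by (rule has_derivative_eq_rhs) (simp add: inner_add_left A * fun_eq_iff)
 qed
 have 4: "((%y. p + A *v (y - x0)) has_derivative (%h. A *v h)) (at x)" for x
  by (auto intro!: derivative_eq_intros 2)
 have "continuous_on N (%(x, t). a + dl / (t0 - t)\<^sup>2)"
 proof -
  have "t0 - snd z ~= 0" if "z \<in> N" for z using N(2)[of "fst z" "snd z"] that by auto
  then show ?thesis unfolding case_prod_beta by (intro continuous_intros) auto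
 qed
 moreover have "continuous_on N (%(x, t). p + A *v (x - x0))"
  unfolding case_prod_beta
  by (intro continuous_intros linear_continuous_on_compose[where f="%z. fst z - x0" and g="(*v) A"]) auto
 ultimately show ?thesis
  unfolding C21_on_def using N(1) 1 3 4 by (auto simp: case_prod_beta)
qed

definition quadratic_test :: "real^'n => real^'n^'n => real => real^'n => real => real" where
 "quadratic_test p A a xi tau = p \<bullet> xi + xi \<bullet> (A *v xi) / 2 + a * tau"

lemma continuous_quadratic_test:
 fixes p x0 :: "real^'n"
 shows "continuous_on S (%z. quadratic_test p A a (fst z - x0) (snd z - t0))"
 unfolding quadratic_test_def
 by (intro continuous_intros linear_continuous_on_compose[where f="%z. fst z - x0" and g="(*v) A"]) auto

text \<open>Contact moves to (x1, t1), where the gradient is p + A (x1 - x0) and the penalty adds dl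
  / (t0 - t1)^2 to the time derivative. The addition has the favourable sign, and continuity of
  \<open>graph_speed\<close> in the gradient absorbs the change of p.\<close>

lemma viscosity_subsolution_past:
 fixes u :: "real^'n => real => real"
 assumes sub: "viscosity_subsolution Q u" and Q: "open Q" "(x0, t0) \<in> Q"
  and cont: "continuous_on Q (%(x, t). u x t)" and sym: "!!i j. A $ i $ j = A $ j $ i"
  and pos: "rho > 0" "c > 0"
  and le: "!!x t. norm (x - x0) <= rho ==> t0 - rho <= t ==> t < t0 ==>
   u x t + c * ((norm (x - x0))\<^sup>2 + (t0 - t)) <= u x0 t0 + quadratic_test p A a (x - x0) (t - t0)"
 shows "a <= graph_speed p A"
proof (rule ccontr)
 assume "\<not> a <= graph_speed p A"
 then have "eventually (%q. graph_speed q A < a) (at p)"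
  using isCont_graph_speed[where A=A and p=p] by (intro order_tendstoD) (auto simp: isCont_def)
 then have "eventually (%q. graph_speed q A < a) (nhds p)"
  using \<open>\<not> a <= graph_speed p A\<close> by (simp add: eventually_nhds_conv_at)
 moreover have "((%x. p + A *v (x - x0)) \<longlongrightarrow> p + A *v (x0 - x0)) (nhds x0)"
  by (intro tendsto_intros bounded_linear.tendsto[OF matrix_vector_mul_bounded_linear]) (auto simp: filterlim_ident)
 ultimately have "eventually (%x. graph_speed (p + A *v (x - x0)) A < a) (nhds x0)"
  by (auto simp: filterlim_iff)
 then obtain ez where ez: "ez > 0" "!!x. dist x x0 < ez ==> graph_speed (p + A *v (x - x0)) A < a"
  by (auto simp: eventually_nhds_metric)
 obtain e where e: "e > 0" "cball (x0, t0) e \<subseteq> Q"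
  using Q open_contains_cball by blast
 define r where "r = min rho (e / 2)"
 have r: "r > 0" "r <= rho" "2 * r <= e" using pos e by (auto simp: r_def)
 define w where "w x t = u x0 t0 + quadratic_test p A a (x - x0) (t - t0) - u x t" for x t
 have inQ: "(x, t) \<in> Q" if "norm (x - x0) <= r" "t0 - r <= t" "t <= t0" for x t
 proof -
  have "dist (x0, t0) (x, t) <= norm (x - x0) + \<bar>t0 - t\<bar>"
   using norm_Pair_le[of "x0 - x" "t0 - t"] by (simp add: dist_norm norm_minus_commute)
  then show ?thesis using that e r by auto
 qed
 have "\<exists>x1 t1 dl N. dl > 0 & open N & (x1, t1) \<in> N &
  N \<subseteq> {(x, t). norm (x - x0) < r & t0 - r < t & t < t0} & norm (x1 - x0) < ez &
  (\<forall>(x, t)\<in>N. w x1 t1 + dl / (t0 - t1) <= w x t + dl / (t0 - t))"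
 proof (rule past_minimum[where c=c])
  have "cball x0 r \<times> {t0 - r..t0} \<subseteq> Q" using inQ by (auto simp: dist_norm norm_minus_commute)
  from continuous_on_subset[OF cont this]
  have "continuous_on (cball x0 r \<times> {t0 - r..t0}) (%z. u (fst z) (snd z))" by (simp add: split_beta')
  then show "continuous_on (cball x0 r \<times> {t0 - r..t0}) (%(x, t). w x t)"
   unfolding w_def split_beta' by (intro continuous_intros continuous_quadratic_test)
  show "c * ((norm (x - x0))\<^sup>2 + (t0 - t)) <= w x t" if "norm (x - x0) <= r" "t0 - r <= t" "t < t0" for x t
   using le[of x t] that r by (auto simp: w_def)
 qed (use pos r ez in \<open>auto simp: w_def quadratic_test_def\<close>)
 then obtain x1 t1 dl N where dl: "dl > 0" and N: "open N" "(x1, t1) \<in> N"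
  "N \<subseteq> {(x, t). norm (x - x0) < r & t0 - r < t & t < t0}" "norm (x1 - x0) < ez"
  and min: "!!x t. (x, t) \<in> N ==> w x1 t1 + dl / (t0 - t1) <= w x t + dl / (t0 - t)"
  by blast
 define k where "k = u x0 t0 - w x1 t1 - dl / (t0 - t1)"
 define \<phi> where "\<phi> x t = p \<bullet> (x - x0) + (x - x0) \<bullet> (A *v (x - x0)) / 2 + a * (t - t0) + dl / (t0 - t) + k" for x t
 have "C21_on N \<phi> (%x t. a + dl / (t0 - t)\<^sup>2) (%x t. p + A *v (x - x0)) (%x t. A)"
  unfolding \<phi>_def using N by (intro C21_on_quadratic sym) auto
 moreover have "N \<subseteq> Q" using N(3) inQ by force
 moreover have "\<phi> x1 t1 = u x1 t1" by (simp add: \<phi>_def k_def w_def quadratic_test_def)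
 moreover have "\<forall>(x, t)\<in>N. u x t <= \<phi> x t"
  using min by (force simp: \<phi>_def k_def w_def quadratic_test_def)
 ultimately have "a + dl / (t0 - t1)\<^sup>2 <= graph_speed (p + A *v (x1 - x0)) A"
  using sub N(2) unfolding viscosity_subsolution_def by blast
 moreover have "graph_speed (p + A *v (x1 - x0)) A < a" using ez(2)[of x1] N(4) by (simp add: dist_norm)
 moreover have "dl / (t0 - t1)\<^sup>2 >= 0" using dl by simp
 ultimately show False by linarith
qed

text \<open>Speed and mean curvature are assumed strictly positive at p because the supersolution
  test is made at the displaced point and demands \<open>admissible\<close> there; strict
  inequalities persist for nearby gradients.\<close>

lemma viscosity_supersolution_past:
 fixes u :: "real^'n => real => real"
 assumes super: "viscosity_supersolution Q u" and Q: "open Q" "(x0, t0) \<in> Q"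
  and cont: "continuous_on Q (%(x, t). u x t)" and sym: "!!i j. A $ i $ j = A $ j $ i"
  and pos: "rho > 0" "c > 0" and adm: "graph_speed p A > 0" "graph_mean_curvature p A > 0"
  and ge: "!!x t. norm (x - x0) <= rho ==> t0 - rho <= t ==> t < t0 ==>
   u x t >= u x0 t0 + quadratic_test p A a (x - x0) (t - t0) + c * ((norm (x - x0))\<^sup>2 + (t0 - t))"
 shows "a >= graph_speed p A"
proof (rule ccontr)
 assume "\<not> a >= graph_speed p A"
 \<comment> \<open>One open condition that preserves both the contradiction with \<open>a\<close>
   and the positivity of the speed.\<close>
 then have a: "max a 0 < graph_speed p A" using adm by simp
 have "eventually (%q. max a 0 < graph_speed q A) (at p)"
  using isCont_graph_speed[where A=A and p=p, unfolded isCont_def] a by (rule order_tendstoD(1))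
 moreover have "eventually (%q. 0 < graph_mean_curvature q A) (at p)"
  using isCont_graph_mean_curvature[where A=A and p=p, unfolded isCont_def] adm(2) by (rule order_tendstoD(1))
 ultimately have "eventually (%q. max a 0 < graph_speed q A & 0 < graph_mean_curvature q A) (at p)"
  by eventually_elim simp
 then have "eventually (%q. max a 0 < graph_speed q A & 0 < graph_mean_curvature q A) (nhds p)"
  using a adm by (simp add: eventually_nhds_conv_at)
 moreover have "((%x. p + A *v (x - x0)) \<longlongrightarrow> p + A *v (x0 - x0)) (nhds x0)"
  by (intro tendsto_intros bounded_linear.tendsto[OF matrix_vector_mul_bounded_linear]) (auto simp: filterlim_ident)
 ultimately have "eventually (%x. max a 0 < graph_speed (p + A *v (x - x0)) A & 0 < graph_mean_curvature (p + A *v (x - x0)) A) (nhds x0)"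
  by (auto simp: filterlim_iff)
 then obtain ez where ez: "ez > 0" "!!x. dist x x0 < ez ==> max a 0 < graph_speed (p + A *v (x - x0)) A"
   "!!x. dist x x0 < ez ==> 0 < graph_mean_curvature (p + A *v (x - x0)) A"
  by (auto simp: eventually_nhds_metric)
 obtain e where e: "e > 0" "cball (x0, t0) e \<subseteq> Q"
  using Q open_contains_cball by blast
 define r where "r = min rho (e / 2)"
 have r: "r > 0" "r <= rho" "2 * r <= e" using pos e by (auto simp: r_def)
 define w where "w x t = u x t - (u x0 t0 + quadratic_test p A a (x - x0) (t - t0))" for x t
 have inQ: "(x, t) \<in> Q" if "norm (x - x0) <= r" "t0 - r <= t" "t <= t0" for x t
 proof -
  have "dist (x0, t0) (x, t) <= norm (x - x0) + \<bar>t0 - t\<bar>"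
   using norm_Pair_le[of "x0 - x" "t0 - t"] by (simp add: dist_norm norm_minus_commute)
  then show ?thesis using that e r by auto
 qed
 have "\<exists>x1 t1 dl N. dl > 0 & open N & (x1, t1) \<in> N &
  N \<subseteq> {(x, t). norm (x - x0) < r & t0 - r < t & t < t0} & norm (x1 - x0) < ez &
  (\<forall>(x, t)\<in>N. w x1 t1 + dl / (t0 - t1) <= w x t + dl / (t0 - t))"
 proof (rule past_minimum[where c=c])
  have "cball x0 r \<times> {t0 - r..t0} \<subseteq> Q" using inQ by (auto simp: dist_norm norm_minus_commute)
  from continuous_on_subset[OF cont this]
  have "continuous_on (cball x0 r \<times> {t0 - r..t0}) (%z. u (fst z) (snd z))" by (simp add: split_beta')
  then show "continuous_on (cball x0 r \<times> {t0 - r..t0}) (%(x, t). w x t)"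
   unfolding w_def split_beta' by (intro continuous_intros continuous_quadratic_test)
  show "c * ((norm (x - x0))\<^sup>2 + (t0 - t)) <= w x t" if "norm (x - x0) <= r" "t0 - r <= t" "t < t0" for x t
   using ge[of x t] that r by (auto simp: w_def)
 qed (use pos r ez in \<open>auto simp: w_def quadratic_test_def\<close>)
 then obtain x1 t1 dl N where dl: "dl > 0" and N: "open N" "(x1, t1) \<in> N"
  "N \<subseteq> {(x, t). norm (x - x0) < r & t0 - r < t & t < t0}" "norm (x1 - x0) < ez"
  and min: "!!x t. (x, t) \<in> N ==> w x1 t1 + dl / (t0 - t1) <= w x t + dl / (t0 - t)"
  by blast
 define k where "k = u x0 t0 + w x1 t1 + dl / (t0 - t1)"
 define \<phi> where "\<phi> x t = p \<bullet> (x - x0) + (x - x0) \<bullet> (A *v (x - x0)) / 2 + a * (t - t0) + (- dl) / (t0 - t) + k" for x t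
 have d1: "dist x1 x0 < ez" using N(4) by (simp add: dist_norm)
 have "C21_on N \<phi> (%x t. a + (- dl) / (t0 - t)\<^sup>2) (%x t. p + A *v (x - x0)) (%x t. A)"
  unfolding \<phi>_def using N by (intro C21_on_quadratic sym) auto
 moreover have "N \<subseteq> Q" using N(3) inQ by force
 moreover have "\<phi> x1 t1 = u x1 t1" by (simp add: \<phi>_def k_def w_def quadratic_test_def)
 moreover have "\<forall>(x, t)\<in>N. \<phi> x t <= u x t"
  using min by (force simp: \<phi>_def k_def w_def quadratic_test_def)
 moreover have "admissible (p + A *v (x1 - x0)) A"
 proof -
  have "graph_sigma2 (p + A *v (x1 - x0)) A >= 0"
   using ez(2)[OF d1] graph_speed_eq_sigma2[of "p + A *v (x1 - x0)" A]
   by (simp add: zero_less_mult_iff)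
    (smt (verit) real_sqrt_ge_zero zero_le_power2)
  then show ?thesis using ez(3)[OF d1] by (simp add: admissible_def)
 qed
 ultimately have "a + (- dl) / (t0 - t1)\<^sup>2 >= graph_speed (p + A *v (x1 - x0)) A"
  using super N(2) unfolding viscosity_supersolution_def by blast
 moreover have "graph_speed (p + A *v (x1 - x0)) A > a" using ez(2)[OF d1] by simp
 moreover have "dl / (t0 - t1)\<^sup>2 >= 0" using dl by simp
 ultimately show False by simp
qed

text \<open>At height p . xi + kp, with kp quadratic in xi and linear in tau, these are up to
  constants the terms by which a paraboloid \<open>hyp_fun\<close> differs from its graph part. Each
  contains kp and one more small factor, hence is o(|xi|^2 + |tau|).\<close>

lemma graph_remainder:
 fixes q :: "(real^'n) \<times> real => (real^'n) \<times> real => real" and p :: "real^'n"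
 assumes q: "bilinear q" and eps: "eps > 0"
 shows "\<exists>r>0. \<forall>xi tau. norm xi <= r --> \<bar>tau\<bar> <= r -->
  \<bar>(k1 * q (xi, p \<bullet> xi) (xi, p \<bullet> xi) + k2 * tau) * q (xi, p \<bullet> xi) (0, 1)\<bar> +
  (k1 * q (xi, p \<bullet> xi) (xi, p \<bullet> xi) + k2 * tau)\<^sup>2 * \<bar>q (0, 1) (0, 1)\<bar> <= eps * ((norm xi)\<^sup>2 + \<bar>tau\<bar>)"
proof -
 obtain K where K: "K > 0" "!!u v. \<bar>q u v\<bar> <= norm u * norm v * K"
  using bounded_bilinear.pos_bounded[OF q[unfolded bilinear_conv_bounded_bilinear]] by auto
 define E where "E = 1 + norm p"
 have E: "E >= 1" by (simp add: E_def)
 have e: "norm (xi, p \<bullet> xi) <= E * norm xi" for xi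
 proof -
  have "norm (xi, p \<bullet> xi) <= norm xi + \<bar>p \<bullet> xi\<bar>" using norm_Pair_le[of xi "p \<bullet> xi"] by simp
  also have "... <= norm xi + norm p * norm xi" using Cauchy_Schwarz_ineq2[of p xi] by simp
  finally show ?thesis by (simp add: E_def distrib_right)
 qed
 define K1 where "K1 = \<bar>k1\<bar> * E\<^sup>2 * K + \<bar>k2\<bar> + 1"
 have K1: "K1 >= 1" using K by (simp add: K1_def)
 define X where "X = K1 * (E * K + 2 * K1 * K)"
 have X: "X > 0" using K K1 E by (simp add: X_def mult_pos_pos add_pos_pos)
 define r where "r = min 1 (eps / X)"
 have r: "r > 0" "r <= 1" "r * X <= eps"
  using X eps by (auto simp: r_def min_def field_simps)
 show ?thesis
 proof (intro exI[of _ r] conjI allI impI)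
  fix xi :: "real^'n" and tau :: real
  assume b: "norm xi <= r" "\<bar>tau\<bar> <= r"
  define kp where "kp = k1 * q (xi, p \<bullet> xi) (xi, p \<bullet> xi) + k2 * tau"
  define h where "h = (norm xi)\<^sup>2 + \<bar>tau\<bar>"
  have h0: "h >= 0" by (simp add: h_def)
  have "(norm xi)\<^sup>2 <= r * 1" unfolding power2_eq_square using b r by (intro mult_mono) auto
  then have h2: "h <= 2 * r" using b by (simp add: h_def)
  have q1: "\<bar>q (xi, p \<bullet> xi) (xi, p \<bullet> xi)\<bar> <= E\<^sup>2 * K * (norm xi)\<^sup>2"
  proof -
   have "\<bar>q (xi, p \<bullet> xi) (xi, p \<bullet> xi)\<bar> <= norm (xi, p \<bullet> xi) * norm (xi, p \<bullet> xi) * K" by (rule K(2))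
   also have "... <= (E * norm xi) * (E * norm xi) * K"
    using e[of xi] K E by (intro mult_right_mono mult_mono) auto
   finally show ?thesis by (simp add: power2_eq_square mult_ac)
  qed
  have "\<bar>kp\<bar> <= \<bar>k1\<bar> * \<bar>q (xi, p \<bullet> xi) (xi, p \<bullet> xi)\<bar> + \<bar>k2\<bar> * \<bar>tau\<bar>"
   unfolding kp_def by (metis abs_mult abs_triangle_ineq)
  also have "... <= \<bar>k1\<bar> * (E\<^sup>2 * K * (norm xi)\<^sup>2) + \<bar>k2\<bar> * \<bar>tau\<bar>"
   using q1 by (intro add_right_mono mult_left_mono) auto
  also have "... <= K1 * (norm xi)\<^sup>2 + K1 * \<bar>tau\<bar>"
  proof (rule add_mono)
   have "\<bar>k1\<bar> * E\<^sup>2 * K <= K1" by (simp add: K1_def)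
   then show "\<bar>k1\<bar> * (E\<^sup>2 * K * (norm xi)\<^sup>2) <= K1 * (norm xi)\<^sup>2"
    by (metis mult.assoc mult_right_mono zero_le_power2)
   have "\<bar>k2\<bar> <= K1" using K by (simp add: K1_def)
   then show "\<bar>k2\<bar> * \<bar>tau\<bar> <= K1 * \<bar>tau\<bar>" by (rule mult_right_mono) simp
  qed
  finally have k: "\<bar>kp\<bar> <= K1 * h" by (simp add: h_def distrib_left)
  have q2: "\<bar>q (xi, p \<bullet> xi) (0, 1)\<bar> <= E * K * r"
  proof -
   have "\<bar>q (xi, p \<bullet> xi) (0, 1)\<bar> <= norm (xi, p \<bullet> xi) * norm (0::real^'n, 1::real) * K" by (rule K(2))
   also have "... = norm (xi, p \<bullet> xi) * K" by simp
   also have "... <= (E * r) * K"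
   proof -
    have "E * norm xi <= E * r" using b E by simp
    then have "norm (xi, p \<bullet> xi) <= E * r" using e[of xi] by linarith
    then show ?thesis using K by simp
   qed
   finally show ?thesis by (simp add: mult_ac)
  qed
  have q3: "\<bar>q (0, 1) (0, 1)\<bar> <= K" using K(2)[of "(0, 1)" "(0, 1)"] by simp
  have "\<bar>kp * q (xi, p \<bullet> xi) (0, 1)\<bar> <= (K1 * h) * (E * K * r)"
   unfolding abs_mult using k q2 K1 h0 by (intro mult_mono) auto
  moreover have "kp\<^sup>2 * \<bar>q (0, 1) (0, 1)\<bar> <= (K1 * h) * (K1 * (2 * r)) * K"
  proof -
   have "kp\<^sup>2 = \<bar>kp\<bar> * \<bar>kp\<bar>" by (simp add: power2_eq_square)
   also have "... <= (K1 * h) * (K1 * h)" using k by (intro mult_mono) auto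
   also have "... <= (K1 * h) * (K1 * (2 * r))" using h2 K1 h0 by (intro mult_left_mono) auto
   finally show ?thesis using q3 K K1 h0 r by (intro mult_mono) auto
  qed
  ultimately have "\<bar>kp * q (xi, p \<bullet> xi) (0, 1)\<bar> + kp\<^sup>2 * \<bar>q (0, 1) (0, 1)\<bar> <= (r * X) * h"
   by (simp add: X_def algebra_simps)
  also have "... <= eps * h" using r h0 by (intro mult_right_mono) auto
  finally show "\<bar>(k1 * q (xi, p \<bullet> xi) (xi, p \<bullet> xi) + k2 * tau) * q (xi, p \<bullet> xi) (0, 1)\<bar> +
  (k1 * q (xi, p \<bullet> xi) (xi, p \<bullet> xi) + k2 * tau)\<^sup>2 * \<bar>q (0, 1) (0, 1)\<bar> <= eps * ((norm xi)\<^sup>2 + \<bar>tau\<bar>)"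
   by (simp add: kp_def h_def)
 qed (use r in auto)
qed

text \<open>\<open>A\<close> is the Hessian, in the coordinates of \<open>L\<close>, of the graph N
  . z = s Q z z / 2 with N = L (m (- p, 1)). The factor \<open>s\<close> near 1 makes room for the
  strict contact that the tests in the past require.\<close>

lemma graph_frame:
 fixes Q :: "(real^'n) \<times> real => (real^'n) \<times> real => real" and p :: "real^'n" and s m :: real
  and L :: "(real^'n) \<times> real => (real^'n) \<times> real"
 assumes L: "orthogonal_transformation L" and Q: "bilinear Q" and sym: "!!u v. Q u v = Q v u" and m: "m > 0"
 defines "A \<equiv> (\<chi> i j. (s / m) * Q (L (axis i 1, p $ i)) (L (axis j 1, p $ j)))"
 shows "A $ i $ j = A $ j $ i"
  and "graph_speed p A = s\<^sup>2 / m * hyp_speed (L (m *\<^sub>R (- p, 1))) Q"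
  and "graph_mean_curvature p A = (s / m) * tangent_trace (L (m *\<^sub>R (- p, 1))) Q / sqrt (1 + (norm p)\<^sup>2)"
  and "xi \<bullet> (A *v xi) = (s / m) * Q (L (xi, p \<bullet> xi)) (L (xi, p \<bullet> xi))"
proof -
 have lin: "linear L" using L by (simp add: orthogonal_transformation_def)
 interpret L: linear L by (rule lin)
 define q where "q u v = Q (L u) (L v)" for u v
 have q: "bilinear q"
  unfolding q_def by (rule bilinearI2) (simp_all add: L.add L.scaleR bilinear_simps[OF Q])
 define q' where "q' u v = (s / m) * q u v" for u v
 have q': "bilinear q'"
  unfolding q'_def by (rule bilinearI2) (simp_all add: bilinear_simps[OF q] algebra_simps)
 have A: "A $ i $ j = q' (axis i 1, p $ i) (axis j 1, p $ j)" for i j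
  by (simp add: A_def q'_def q_def)
 have sq: "q' u v = q' v u" for u v by (simp add: q'_def q_def sym)
 show "A $ i $ j = A $ j $ i" by (simp add: A sq[of "(axis i 1, p $ i)"])
 have "graph_speed p A = m * hyp_speed (m *\<^sub>R (- p, 1)) q'"
  by (rule graph_speed_eq_hyp_speed(1)[OF q' sq m A])
 also have "hyp_speed (m *\<^sub>R (- p, 1)) q' = (s / m)\<^sup>2 * hyp_speed (m *\<^sub>R (- p, 1)) q"
  unfolding q'_def by (rule hyp_speed_scale)
 also have "hyp_speed (m *\<^sub>R (- p, 1)) q = hyp_speed (L (m *\<^sub>R (- p, 1))) Q"
  unfolding q_def by (rule hyp_speed_orthogonal[OF Q L])
 finally show "graph_speed p A = s\<^sup>2 / m * hyp_speed (L (m *\<^sub>R (- p, 1))) Q"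
  using m by (simp add: power2_eq_square field_simps)
 have "graph_mean_curvature p A = tangent_trace (m *\<^sub>R (- p, 1)) q' / sqrt (1 + (norm p)\<^sup>2)"
  by (rule graph_speed_eq_hyp_speed(2)[OF q' sq m A])
 also have "tangent_trace (m *\<^sub>R (- p, 1)) q' = (s / m) * tangent_trace (m *\<^sub>R (- p, 1)) q"
  by (simp add: tangent_trace_def q'_def sum_distrib_left right_diff_distrib)
 also have "tangent_trace (m *\<^sub>R (- p, 1)) q = tangent_trace (L (m *\<^sub>R (- p, 1))) Q"
  unfolding q_def by (rule tangent_trace_orthogonal[OF Q L])
 finally show "graph_mean_curvature p A = (s / m) * tangent_trace (L (m *\<^sub>R (- p, 1))) Q / sqrt (1 + (norm p)\<^sup>2)" .
 have e: "(xi, p \<bullet> xi) = (\<Sum>i\<in>UNIV. xi $ i *\<^sub>R (axis i 1, p $ i))"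
 proof -
  have "fst (\<Sum>i\<in>UNIV. xi $ i *\<^sub>R (axis i 1 :: real^'n, p $ i)) = xi"
   by (subst (2) cart_sum_axis) (simp add: fst_sum)
  moreover have "snd (\<Sum>i\<in>UNIV. xi $ i *\<^sub>R (axis i 1 :: real^'n, p $ i)) = p \<bullet> xi"
   by (simp add: snd_sum inner_vec_def mult.commute)
  ultimately show ?thesis by (metis prod.collapse)
 qed
 have "q' (xi, p \<bullet> xi) (xi, p \<bullet> xi) = (\<Sum>i\<in>UNIV. \<Sum>j\<in>UNIV. xi $ i * (xi $ j * A $ i $ j))"
  unfolding e bilinear_sum_left[OF q'] bilinear_sum_right[OF q'] A
  by (simp only: bilinear_simps[OF q'] sum_distrib_left) (intro sum.cong refl, metis sq)
 also have "... = xi \<bullet> (A *v xi)"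
  by (simp add: inner_vec_def matrix_vector_mult_def sum_distrib_left mult_ac)
 finally show "xi \<bullet> (A *v xi) = (s / m) * Q (L (xi, p \<bullet> xi)) (L (xi, p \<bullet> xi))"
  by (simp add: q'_def q_def)
qed

text \<open>The set \<open>hyp_fun\<close> > 0 imitates the enclosed region: \<open>N\<close> is an
  inner normal and \<alpha> is |N| times the speed at which the region retreats.\<close>

definition hyp_fun :: "'a::real_inner => ('a => 'a => real) => real => 'a => real => real" where
 "hyp_fun N Q \<alpha> zt tau = N \<bullet> zt - Q zt zt / 2 - \<alpha> * tau"

text \<open>A Lipschitz chart near the contact point. The normal N = L (n1, m) is not assumed
  transversal to the base of the chart; that m > 0 is derived from the Lipschitz bound and the
  contact.\<close>

locale local_touching =
 fixes M :: "real => ((real ^ 'n) \<times> real) set" and psi QQ u x0 N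
  and Q :: "(real^'n) \<times> real => (real^'n) \<times> real => real" and aa bb t0 \<alpha> C c0 :: real
  and L :: "(real^'n) \<times> real => (real^'n) \<times> real" and n1 :: "real^'n" and m :: real
 assumes lg: "local_graph M psi QQ aa bb u" and vs: "viscosity_solution QQ u"
  and inQ: "(x0, t0) \<in> QQ"
  and lip: "!!y y' s. (y, s) \<in> QQ ==> (y', s) \<in> QQ ==> \<bar>u y s - u y' s\<bar> <= C * norm (y - y')"
  and Q: "bilinear Q" and sym: "!!u v. Q u v = Q v u" and N0: "N ~= 0"
  and c0: "c0 > 0" "!!zt. N \<bullet> zt = 0 ==> Q zt zt >= c0 * (norm zt)\<^sup>2"
  and L: "orthogonal_transformation L" "!!z z'. psi z - psi z' = L (z - z')" "N = L (n1, m)"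
begin

sublocale L: linear L using L(1) by (simp add: orthogonal_transformation_def)

lemma QQ: "open QQ" "continuous_on QQ (%(x, t). u x t)"
 and graph: "!!x t. (x, t) \<in> QQ ==> aa < u x t & u x t < bb & psi (x, u x t) \<in> M t"
  "!!x t y. (x, t) \<in> QQ ==> u x t < y ==> y < bb ==> psi (x, y) \<in> inside (M t)"
  "!!x t y. (x, t) \<in> QQ ==> y < u x t ==> aa < y ==> psi (x, y) \<in> outside (M t)"
 using lg by (auto simp: local_graph_def)

abbreviation "u0 \<equiv> u x0 t0"
abbreviation "z0 \<equiv> psi (x0, u0)"
abbreviation "F \<equiv> hyp_fun N Q \<alpha>"

definition "q v w = Q (L v) (L w)"

lemma q: "bilinear q"
 unfolding q_def by (rule bilinearI2) (simp_all add: L.add L.scaleR bilinear_simps[OF Q])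

lemma q_sym: "q v w = q w v" by (simp add: q_def sym)

lemma F_L: "F (L zt) tau = (n1, m) \<bullet> zt - q zt zt / 2 - \<alpha> * tau"
proof -
 have "L v \<bullet> L w = v \<bullet> w" for v w using L(1) unfolding orthogonal_transformation_def by blast
 then show ?thesis by (simp add: hyp_fun_def L(3) q_def)
qed

lemma psi_diff: "psi (x, y) - z0 = L (x - x0, y - u0)"
 by (simp add: L(2))

lemma dist_psi: "dist (psi (x, y)) z0 = norm (x - x0, y - u0)"
 using L(1) by (simp add: dist_norm psi_diff orthogonal_transformation_norm)

lemma bounded_q: "\<exists>K>0. \<forall>u v. \<bar>q u v\<bar> <= K * norm u * norm v"
 using bounded_bilinear.pos_bounded[OF q[unfolded bilinear_conv_bounded_bilinear]]
 by (metis mult.commute mult.left_commute real_norm_def)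

lemma near_Q: "\<exists>r>0. \<forall>x t. norm (x - x0) <= r --> \<bar>t - t0\<bar> <= r --> (x, t) \<in> QQ"
proof -
 obtain e where e: "e > 0" "cball (x0, t0) e \<subseteq> QQ"
  using QQ(1) inQ open_contains_cball by blast
 have "(x, t) \<in> QQ" if "norm (x - x0) <= e / 2" "\<bar>t - t0\<bar> <= e / 2" for x t
 proof -
  have "dist (x0, t0) (x, t) <= norm (x - x0) + \<bar>t - t0\<bar>"
   using norm_Pair_le[of "x0 - x" "t0 - t"] by (simp add: dist_norm norm_minus_commute)
  then show ?thesis using that e by auto
 qed
 then show ?thesis using e by (intro exI[of _ "e / 2"]) auto
qed

lemma cont_u: "e > 0 ==> \<exists>r>0. \<forall>x t. norm (x - x0) <= r --> \<bar>t - t0\<bar> <= r --> (x, t) \<in> QQ & \<bar>u x t - u0\<bar> < e"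
proof -
 assume e: "e > 0"
 obtain r where r: "r > 0" "!!x t. norm (x - x0) <= r ==> \<bar>t - t0\<bar> <= r ==> (x, t) \<in> QQ"
  using near_Q by blast
 obtain d where d: "d > 0" "!!z. z \<in> QQ ==> dist z (x0, t0) < d ==> dist ((%(x, t). u x t) z) ((%(x, t). u x t) (x0, t0)) < e"
  using QQ(2) inQ e unfolding continuous_on_iff by blast
 have "(x, t) \<in> QQ & \<bar>u x t - u0\<bar> < e" if "norm (x - x0) <= min r (d / 3)" "\<bar>t - t0\<bar> <= min r (d / 3)" for x t
 proof -
  have "dist (x, t) (x0, t0) <= norm (x - x0) + \<bar>t - t0\<bar>"
   using norm_Pair_le[of "x - x0" "t - t0"] by (simp add: dist_norm)
  then have "dist (x, t) (x0, t0) < d" using that d by linarith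
  then show ?thesis using d(2)[of "(x, t)"] r(2)[of x t] that by (auto simp: dist_real_def)
 qed
 then show ?thesis using r d by (intro exI[of _ "min r (d / 3)"]) auto
qed

text \<open>The vertical cone spanned by this vector lies above a Lipschitz graph.\<close>

definition "lam = 1 / (2 * (\<bar>C\<bar> * norm n1 + 1))"

lemma lam: "lam > 0" "\<bar>C\<bar> * norm (lam *\<^sub>R n1) < 1"
proof -
 have "\<bar>C\<bar> * norm n1 + 1 > 0" by (smt (verit) mult_nonneg_nonneg norm_ge_zero abs_ge_zero)
 then show "lam > 0" by (simp add: lam_def)
 then show "\<bar>C\<bar> * norm (lam *\<^sub>R n1) < 1"
  using \<open>\<bar>C\<bar> * norm n1 + 1 > 0\<close> by (simp add: lam_def field_simps)
qed

lemma vertical_of_pos: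
 assumes "m >= lam * (norm n1)\<^sup>2"
 shows "m > 0"
proof (cases "n1 = 0")
 case True
 then have "m ~= 0" using N0 L(3) by (auto simp: L.zero zero_prod_def[symmetric])
 then show ?thesis using assms True by simp
next
 case False
 then have "lam * (norm n1)\<^sup>2 > 0" using lam by simp
 then show ?thesis using assms by simp
qed

lemma lip_s:
 assumes "(x0 + sg *\<^sub>R (lam *\<^sub>R n1), t0) \<in> QQ" "sg ~= 0"
 shows "\<bar>u (x0 + sg *\<^sub>R (lam *\<^sub>R n1)) t0 - u0\<bar> < \<bar>sg\<bar>"
proof -
 have "\<bar>u (x0 + sg *\<^sub>R (lam *\<^sub>R n1)) t0 - u0\<bar> <= C * norm (sg *\<^sub>R (lam *\<^sub>R n1))"
  using lip[OF assms(1) inQ] by simp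
 also have "... <= \<bar>C\<bar> * norm (sg *\<^sub>R (lam *\<^sub>R n1))"
  by (intro mult_right_mono) auto
 also have "... = \<bar>sg\<bar> * (\<bar>C\<bar> * norm (lam *\<^sub>R n1))" by (simp add: abs_mult)
 also have "... < \<bar>sg\<bar> * 1" using lam(2) assms(2) by (intro mult_strict_left_mono) auto
 finally show ?thesis by simp
qed

text \<open>A step along (- lam n1, 1) leads into the enclosed region, since it rises faster than
  the slope bound allows the graph to. There \<open>hyp_fun\<close> is nonnegative, and its
  first-order part gives m >= lam |n1|^2, so the contact plane is not vertical in the chart.\<close>

lemma vertical_super:
 assumes r: "r > 0" and F: "!!z. z \<in> M t0 \<union> inside (M t0) ==> dist z z0 < r ==> F (z - z0) 0 >= 0"
 shows "m > 0"
proof (rule vertical_of_pos)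
 define w where "w = (- (lam *\<^sub>R n1), 1 :: real)"
 obtain r1 where r1: "r1 > 0" "!!x t. norm (x - x0) <= r1 ==> \<bar>t - t0\<bar> <= r1 ==> (x, t) \<in> QQ"
  using near_Q by blast
 have bb: "u0 < bb" using graph(1)[OF inQ] by simp
 have ev: "eventually (%s. (n1, m) \<bullet> w - s * q w w / 2 >= 0) (at_right 0)"
 proof -
  have w0: "norm w > 0" by (simp add: w_def zero_prod_def)
  have "eventually (%s::real. 0 < s & s < bb - u0 & s < r / norm w & s < r1 / (norm (lam *\<^sub>R n1) + 1)) (at_right 0)"
   using bb r r1(1) w0
   by (intro eventually_conj eventually_at_right_less eventually_at_rightI[of 0] order_tendstoD(2)[OF tendsto_ident_at])
    (auto intro!: divide_pos_pos add_nonneg_pos)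
  then show ?thesis
  proof eventually_elim
   case (elim s)
   define x where "x = x0 + (- s) *\<^sub>R (lam *\<^sub>R n1)"
   have "s * (norm (lam *\<^sub>R n1) + 1) < r1"
    using elim by (subst (asm) pos_less_divide_eq) (auto intro!: add_nonneg_pos)
   then have "norm (x - x0) <= r1" using elim by (simp add: x_def algebra_simps abs_mult)
   then have xQ: "(x, t0) \<in> QQ" using r1 by simp
   then have "\<bar>u x t0 - u0\<bar> < s" using lip_s[of "- s"] elim by (simp add: x_def)
   then have "psi (x, u0 + s) \<in> inside (M t0)" using elim by (intro graph(2)[OF xQ]) auto
   moreover have d: "(x - x0, u0 + s - u0) = s *\<^sub>R w" by (simp add: x_def w_def)
   moreover have "dist (psi (x, u0 + s)) z0 < r"
    unfolding dist_psi d using elim w0 by (simp add: pos_less_divide_eq)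
   ultimately have "F (L (s *\<^sub>R w)) 0 >= 0"
    using F[of "psi (x, u0 + s)"] unfolding psi_diff by simp
   then have "s * ((n1, m) \<bullet> w - s * q w w / 2) >= 0"
    unfolding F_L by (simp add: bilinear_simps[OF q] algebra_simps)
   then show ?case using elim by (simp add: zero_le_mult_iff)
  qed
 qed
 have "((%s. (n1, m) \<bullet> w - s * q w w / 2) \<longlongrightarrow> (n1, m) \<bullet> w - 0 * q w w / 2) (at_right 0)"
  by (intro tendsto_intros) auto
 then have "(n1, m) \<bullet> w >= 0" using tendsto_lowerbound[OF _ ev] by simp
 then show "m >= lam * (norm n1)\<^sup>2" by (simp add: w_def power2_norm_eq_inner)
qed

text \<open>If m < lam |n1|^2, then \<open>hyp_fun\<close> is positive after a small step along (lam
  n1, - 1), at a point below the graph at time t0. Both facts persist at slightly earlier times,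
  where the point would be inside and outside at once.\<close>

lemma vertical_sub:
 assumes r: "r > 0" and F: "!!z t. t0 - r < t ==> t < t0 ==> dist z z0 < r ==> F (z - z0) (t - t0) > 0 ==> z \<in> inside (M t)"
 shows "m > 0"
proof (rule vertical_of_pos, rule ccontr)
 assume neg: "\<not> m >= lam * (norm n1)\<^sup>2"
 define w where "w = (lam *\<^sub>R n1, - 1 :: real)"
 have w0: "norm w > 0" by (simp add: w_def zero_prod_def)
 have pw: "(n1, m) \<bullet> w > 0" using neg by (simp add: w_def power2_norm_eq_inner)
 obtain r1 where r1: "r1 > 0" "!!x t. norm (x - x0) <= r1 ==> \<bar>t - t0\<bar> <= r1 ==> (x, t) \<in> QQ"
  using near_Q by blast
 have aa: "aa < u0" using graph(1)[OF inQ] by simp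
 have "((%s. (n1, m) \<bullet> w - s * q w w / 2) \<longlongrightarrow> (n1, m) \<bullet> w - 0 * q w w / 2) (at_right 0)"
  by (intro tendsto_intros) auto
 then have "eventually (%s. (n1, m) \<bullet> w - s * q w w / 2 > 0) (at_right 0)"
  using pw by (intro order_tendstoD(1)) auto
 moreover have "eventually (%s::real. 0 < s & s < u0 - aa & s < r / norm w & s < r1 / (norm (lam *\<^sub>R n1) + 1)) (at_right 0)"
   using aa r r1(1) w0
   by (intro eventually_conj eventually_at_right_less eventually_at_rightI[of 0] order_tendstoD(2)[OF tendsto_ident_at])
    (auto intro!: divide_pos_pos add_nonneg_pos)
 ultimately have "eventually (%s. (n1, m) \<bullet> w - s * q w w / 2 > 0 & 0 < s & s < u0 - aa & s < r / norm w & s < r1 / (norm (lam *\<^sub>R n1) + 1)) (at_right 0)"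
  by eventually_elim simp
 then obtain s where s: "(n1, m) \<bullet> w - s * q w w / 2 > 0" "0 < s" "s < u0 - aa" "s < r / norm w" "s < r1 / (norm (lam *\<^sub>R n1) + 1)"
  using eventually_happens'[of "at_right (0::real)"] by force
 define x where "x = x0 + s *\<^sub>R (lam *\<^sub>R n1)"
 have "s * (norm (lam *\<^sub>R n1) + 1) < r1"
  using s by (subst (asm) pos_less_divide_eq[of "norm (lam *\<^sub>R n1) + 1"]) (auto intro!: add_nonneg_pos)
 then have xr: "norm (x - x0) <= r1" using s by (simp add: x_def algebra_simps abs_mult)
 then have xQ: "(x, t0) \<in> QQ" using r1 by simp
 have ux: "u x t0 > u0 - s" using lip_s[of s] s xQ by (auto simp: x_def)
 have d: "(x - x0, u0 - s - u0) = s *\<^sub>R w" by (simp add: x_def w_def)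
 have ds: "dist (psi (x, u0 - s)) z0 < r"
  unfolding dist_psi d using s w0 by (simp add: pos_less_divide_eq)
 have "(%t. u x t) \<midarrow>t0\<rightarrow> u x t0"
 proof -
  have "isCont (%(x, t). u x t) (x, t0)" using QQ xQ by (simp add: continuous_on_eq_continuous_at)
  then have "((%(x, t). u x t) \<longlongrightarrow> (%(x, t). u x t) (x, t0)) (nhds (x, t0))"
   by (simp only: isCont_def tendsto_at_iff_tendsto_nhds)
  moreover have "filterlim (%t. (x, t)) (nhds (x, t0)) (at t0)"
   by (intro tendsto_intros)
  ultimately show ?thesis by (auto dest: filterlim_compose)
 qed
 then have 1: "eventually (%t. u x t > u0 - s) (at t0)"
  using ux by (rule order_tendstoD(1))
 have Fs: "F (L (s *\<^sub>R w)) (t - t0) = s * ((n1, m) \<bullet> w - s * q w w / 2) - \<alpha> * (t - t0)" for t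
  unfolding F_L by (simp add: bilinear_simps[OF q] algebra_simps)
 have lim: "((%t. F (L (s *\<^sub>R w)) (t - t0)) \<longlongrightarrow> s * ((n1, m) \<bullet> w - s * q w w / 2) - \<alpha> * (t0 - t0)) (at t0)"
  unfolding Fs by (intro tendsto_intros)
 have 2: "eventually (%t. F (L (s *\<^sub>R w)) (t - t0) > 0) (at t0)"
  by (rule order_tendstoD(1)[OF lim]) (use s in simp)
 have 3: "eventually (%t. t \<in> {t0 - min r r1<..<t0}) (at_left t0)"
  using r r1 by (intro eventually_at_leftI[of "t0 - min r r1"]) auto
 have "eventually (%t. u x t > u0 - s & F (L (s *\<^sub>R w)) (t - t0) > 0 & t \<in> {t0 - min r r1<..<t0}) (at_left t0)"
  using 1[unfolded eventually_at_split, THEN conjunct1] 2[unfolded eventually_at_split, THEN conjunct1] 3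
  by eventually_elim simp
 then obtain t where t: "u x t > u0 - s" "F (L (s *\<^sub>R w)) (t - t0) > 0" "t0 - min r r1 < t" "t < t0"
  using eventually_happens'[of "at_left t0"] by force
 have "F (psi (x, u0 - s) - z0) (t - t0) > 0"
  unfolding psi_diff d using t by simp
 then have "psi (x, u0 - s) \<in> inside (M t)"
  using t ds by (intro F) auto
 moreover have "(x, t) \<in> QQ" using xr t by (intro r1) auto
 then have "psi (x, u0 - s) \<in> outside (M t)" using t s by (intro graph(3)) auto
 ultimately show False using inside_Int_outside by blast
qed

lemma F_graph:
 assumes m: "m > 0" and p: "p = - (n1 /\<^sub>R m)"
 shows "F (L (xi, p \<bullet> xi + kp)) tau = m * kp - q (xi, p \<bullet> xi) (xi, p \<bullet> xi) / 2 -
  kp * q (xi, p \<bullet> xi) (0, 1) - kp\<^sup>2 * q (0, 1) (0, 1) / 2 - \<alpha> * tau"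
proof -
 have n1: "n1 = - (m *\<^sub>R p)" using m by (simp add: p)
 have e: "(xi, p \<bullet> xi + kp) = (xi, p \<bullet> xi) + kp *\<^sub>R (0, 1)" by simp
 have 1: "(n1, m) \<bullet> (xi, p \<bullet> xi + kp) = m * kp" by (simp add: n1 algebra_simps)
 show ?thesis
  unfolding F_L 1
  unfolding e bilinear_simps[OF q] q_sym[of "(0, 1)" "(xi, p \<bullet> xi)"]
  by (simp add: power2_eq_square algebra_simps add_divide_distrib)
qed

lemma q_tangent:
 assumes m: "m > 0" and p: "p = - (n1 /\<^sub>R m)"
 shows "q (xi, p \<bullet> xi) (xi, p \<bullet> xi) >= c0 * (norm xi)\<^sup>2"
proof -
 have n1: "n1 = - (m *\<^sub>R p)" using m by (simp add: p)
 have "N \<bullet> L (xi, p \<bullet> xi) = 0" using L(1) by (simp add: L(3) orthogonal_transformation_def n1)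
 from c0(2)[OF this] have "q (xi, p \<bullet> xi) (xi, p \<bullet> xi) >= c0 * (norm (L (xi, p \<bullet> xi)))\<^sup>2"
  by (simp add: q_def)
 moreover have "norm (L (xi, p \<bullet> xi)) = norm (xi, p \<bullet> xi)" using L(1) by (simp add: orthogonal_transformation_norm)
 moreover have "c0 * (norm xi)\<^sup>2 <= c0 * (norm (xi, p \<bullet> xi))\<^sup>2"
  using c0 norm_fst_le[of xi "p \<bullet> xi"] by (intro mult_left_mono power_mono) auto
 ultimately show ?thesis by simp
qed

text \<open>This turns signs and sizes of \<open>F\<close> into differences of height;
  \<open>th\<close> is the exact difference quotient of the quadratic \<open>F\<close>.\<close>

lemma F_vertical:
 assumes m: "m > 0"
 shows "\<exists>r>0. \<forall>zt d tau. norm zt <= r --> norm (zt + d *\<^sub>R (0, 1)) <= r -->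
  (\<exists>th. m / 2 <= th & th <= 2 * m & F (L (zt + d *\<^sub>R (0, 1))) tau - F (L zt) tau = d * th)"
proof -
 obtain K where K: "K > 0" "!!u v. \<bar>q u v\<bar> <= K * norm u * norm v" using bounded_q by blast
 show ?thesis
 proof (rule exI[of _ "m / (2 * K)"], intro conjI allI impI)
  show "m / (2 * K) > 0" using m K by simp
  fix zt :: "(real^'n) \<times> real" and d tau :: real
  define zt' where "zt' = zt + d *\<^sub>R (0, 1)"
  assume b: "norm zt <= m / (2 * K)" "norm (zt + d *\<^sub>R (0, 1)) <= m / (2 * K)"
  have q1: "\<bar>q z (0, 1)\<bar> <= m / 2" if "norm z <= m / (2 * K)" for z
  proof -
   have "\<bar>q z (0, 1)\<bar> <= K * norm z" using K(2)[of z "(0, 1)"] by simp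
   also have "... <= K * (m / (2 * K))" using that K by (intro mult_left_mono) auto
   finally show ?thesis using K by simp
  qed
  define th where "th = m - (q zt (0, 1) + q zt' (0, 1)) / 2"
  have "\<bar>q zt (0, 1)\<bar> <= m / 2" "\<bar>q zt' (0, 1)\<bar> <= m / 2"
   using q1[OF b(1)] q1[OF b(2)] by (auto simp: zt'_def)
  then have "m / 2 <= th & th <= 2 * m"
   using m by (auto simp: th_def abs_le_iff field_simps)
  moreover have "F (L (zt + d *\<^sub>R (0, 1))) tau - F (L zt) tau = d * th"
   unfolding F_L th_def zt'_def bilinear_simps[OF q] q_sym[of "(0, 1)" zt]
   by (simp add: algebra_simps add_divide_distrib inner_add_right)
  ultimately show "\<exists>th. m / 2 <= th & th <= 2 * m & F (L (zt + d *\<^sub>R (0, 1))) tau - F (L zt) tau = d * th" by blast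
 qed
qed

lemma near_test:
 fixes p :: "real^'n"
 assumes "e > 0"
 shows "\<exists>r>0. \<forall>x t. norm (x - x0) <= r --> \<bar>t - t0\<bar> <= r -->
   norm (x - x0) < e & \<bar>quadratic_test p A a (x - x0) (t - t0)\<bar> < e"
proof -
 define f where "f z = quadratic_test p A a (fst z - x0) (snd z - t0)" for z
 have "isCont f (x0, t0)"
  using continuous_quadratic_test[where S=UNIV and p=p and A=A and a=a and ?x0.0=x0 and ?t0.0=t0]
  unfolding f_def by (simp add: continuous_on_eq_continuous_at)
 then have "(f \<longlongrightarrow> f (x0, t0)) (nhds (x0, t0))"
  by (simp only: isCont_def tendsto_at_iff_tendsto_nhds)
 then have "(f \<longlongrightarrow> 0) (nhds (x0, t0))"
  by (simp add: f_def quadratic_test_def)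
 then have "eventually (%z. \<bar>quadratic_test p A a (fst z - x0) (snd z - t0)\<bar> < e) (nhds (x0, t0))"
  using assms unfolding f_def by (auto simp: tendsto_iff dist_real_def)
 then obtain d where d: "d > 0" "!!z. dist z (x0, t0) < d ==> \<bar>quadratic_test p A a (fst z - x0) (snd z - t0)\<bar> < e"
  by (auto simp: eventually_nhds_metric)
 have "norm (x - x0) < e & \<bar>quadratic_test p A a (x - x0) (t - t0)\<bar> < e"
  if "norm (x - x0) <= min (e / 2) (d / 3)" "\<bar>t - t0\<bar> <= min (e / 2) (d / 3)" for x t
 proof -
  have "dist (x, t) (x0, t0) <= norm (x - x0) + \<bar>t - t0\<bar>"
   using norm_Pair_le[of "x - x0" "t - t0"] by (simp add: dist_norm)
  then have "dist (x, t) (x0, t0) < d" using that d by linarith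
  then show ?thesis using d(2)[of "(x, t)"] that assms by auto
 qed
 then show ?thesis using d assms by (intro exI[of _ "min (e / 2) (d / 3)"]) auto
qed

text \<open>The test function has its Hessian shrunk by 1 - dl and its speed raised to \<alpha> +
  dl. In the past both changes lower it, by a multiple of |xi|^2 + |tau| that outweighs the
  remainder eps h; the contact is then strict.\<close>

lemma super_aux:
 assumes m: "m > 0" and rho: "rho > 0"
  and F: "!!z t. t0 - rho < t ==> t < t0 ==> z \<in> M t ==> dist z z0 < rho ==> F (z - z0) (t - t0) >= 0"
  and adm: "tangent_trace N Q > 0" "hyp_speed N Q > 0" and dl: "0 < dl" "dl < 1"
 shows "(1 - dl)\<^sup>2 * hyp_speed N Q <= \<alpha> + dl"
proof -
 define p where "p = - (n1 /\<^sub>R m)"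
 have N: "L (m *\<^sub>R (- p, 1)) = N" using m by (simp add: p_def L(3))
 define s where "s = 1 - dl"
 define A where "A = (\<chi> i j. (s / m) * Q (L (axis i 1, p $ i)) (L (axis j 1, p $ j)))"
 note A = graph_frame[OF L(1) Q sym m, where s=s and p=p, folded A_def, unfolded N]
 define a where "a = (\<alpha> + dl) / m"
 define eps where "eps = dl * min c0 1 / 4"
 have eps: "eps > 0" "2 * eps <= dl" "2 * eps <= dl / 2 * c0" using dl c0 by (auto simp: eps_def min_def)
 define k1 where "k1 = s / (2 * m)"
 obtain r1 where r1: "r1 > 0" "!!xi tau. norm xi <= r1 ==> \<bar>tau\<bar> <= r1 ==>
  \<bar>(k1 * q (xi, p \<bullet> xi) (xi, p \<bullet> xi) + a * tau) * q (xi, p \<bullet> xi) (0, 1)\<bar> +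
  (k1 * q (xi, p \<bullet> xi) (xi, p \<bullet> xi) + a * tau)\<^sup>2 * \<bar>q (0, 1) (0, 1)\<bar> <= eps * ((norm xi)\<^sup>2 + \<bar>tau\<bar>)"
  using graph_remainder[OF q eps(1), of k1 p a] by metis
 obtain r2 where r2: "r2 > 0" "!!zt d tau. norm zt <= r2 ==> norm (zt + d *\<^sub>R (0, 1)) <= r2 ==>
  (\<exists>th. m / 2 <= th & th <= 2 * m & F (L (zt + d *\<^sub>R (0, 1))) tau - F (L zt) tau = d * th)"
  using F_vertical[OF m] by metis
 define e where "e = min (r2 / 2) (rho / 2)"
 have e: "e > 0" "2 * e <= r2" "2 * e <= rho" using r2 rho by (auto simp: e_def)
 obtain r3 where r3: "r3 > 0" "!!x t. norm (x - x0) <= r3 ==> \<bar>t - t0\<bar> <= r3 ==>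
   norm (x - x0) < e & \<bar>quadratic_test p A a (x - x0) (t - t0)\<bar> < e"
  using near_test[OF e(1), of p A a] by metis
 obtain r4 where r4: "r4 > 0" "!!x t. norm (x - x0) <= r4 ==> \<bar>t - t0\<bar> <= r4 ==> (x, t) \<in> QQ & \<bar>u x t - u0\<bar> < e"
  using cont_u[OF e(1)] by metis
 define r where "r = min (min r1 (rho / 2)) (min r3 r4)"
 have r: "r > 0" "r <= r1" "r < rho" "r <= r3" "r <= r4" using r1 r3 r4 rho by (auto simp: r_def)
 have "graph_speed p A <= a"
 proof (rule viscosity_supersolution_past[where Q=QQ and u=u and ?x0.0=x0 and ?t0.0=t0 and rho=r and c="eps / (2 * m)"])
  show "viscosity_supersolution QQ u" using vs by (simp add: viscosity_solution_def)
  show "graph_speed p A > 0" "graph_mean_curvature p A > 0"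
   unfolding A using m dl adm by (auto simp: s_def intro!: divide_pos_pos mult_pos_pos add_pos_nonneg)
  show "A $ i $ j = A $ j $ i" for i j by (rule A(1))
  fix x t assume b: "norm (x - x0) <= r" "t0 - r <= t" "t < t0"
  define xi where "xi = x - x0"
  define tau where "tau = t - t0"
  have b': "norm xi <= r" "\<bar>tau\<bar> <= r" "\<bar>tau\<bar> = - tau" using b by (auto simp: xi_def tau_def)
  define h where "h = (norm xi)\<^sup>2 + \<bar>tau\<bar>"
  have h0: "h >= 0" by (simp add: h_def)
  define kp where "kp = k1 * q (xi, p \<bullet> xi) (xi, p \<bullet> xi) + a * tau"
  have qt: "quadratic_test p A a xi tau = p \<bullet> xi + kp"
   by (simp add: quadratic_test_def A(4) kp_def k1_def q_def)
  have small: "norm xi < e" "\<bar>p \<bullet> xi + kp\<bar> < e"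
   using r3(2)[of x t] b' r unfolding xi_def[symmetric] tau_def[symmetric] qt by auto
  have xQ: "(x, t) \<in> QQ" "\<bar>u x t - u0\<bar> < e" using r4(2)[of x t] b r by auto
  \<comment> \<open>The height of the surface above the test graph. Its sign and size follow from F
    >= 0 on the surface and F <= - eps h on the test graph.\<close>
  define d where "d = u x t - u0 - (p \<bullet> xi + kp)"
  have ze: "(xi, p \<bullet> xi + kp) + d *\<^sub>R (0, 1) = (xi, u x t - u0)" by (simp add: d_def)
  have nz: "norm (xi, p \<bullet> xi + kp) < 2 * e" "norm (xi, u x t - u0) < 2 * e"
   using norm_Pair_le[of xi "p \<bullet> xi + kp"] norm_Pair_le[of xi "u x t - u0"] small xQ(2) by auto
  obtain th where th: "m / 2 <= th" "th <= 2 * m" "F (L (xi, u x t - u0)) tau - F (L (xi, p \<bullet> xi + kp)) tau = d * th"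
   using r2(2)[of "(xi, p \<bullet> xi + kp)" d tau] nz e unfolding ze by auto
  have "F (psi (x, u x t) - z0) (t - t0) >= 0"
   using graph(1)[OF xQ(1)] b r nz e by (intro F) (auto simp: dist_psi xi_def)
  then have F1: "F (L (xi, u x t - u0)) tau >= 0" by (simp add: psi_diff xi_def tau_def)
  have mk: "m * kp = s / 2 * q (xi, p \<bullet> xi) (xi, p \<bullet> xi) + (\<alpha> + dl) * tau"
   using m by (simp add: kp_def k1_def a_def algebra_simps add_divide_distrib)
  have rem: "\<bar>kp * q (xi, p \<bullet> xi) (0, 1)\<bar> + kp\<^sup>2 * \<bar>q (0, 1) (0, 1)\<bar> <= eps * h"
   unfolding kp_def h_def using b' r by (intro r1(2)) auto
  have rem2: "- (kp * q (xi, p \<bullet> xi) (0, 1)) - kp\<^sup>2 * q (0, 1) (0, 1) / 2 <= eps * h"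
  proof -
   have "- (kp * q (xi, p \<bullet> xi) (0, 1)) <= \<bar>kp * q (xi, p \<bullet> xi) (0, 1)\<bar>" by (rule abs_ge_minus_self)
   moreover have "- (kp\<^sup>2 * q (0, 1) (0, 1)) <= kp\<^sup>2 * \<bar>q (0, 1) (0, 1)\<bar>"
    using mult_left_mono[OF abs_ge_minus_self[of "q (0, 1) (0, 1)"], of "kp\<^sup>2"] by simp
   moreover have "0 <= kp\<^sup>2 * \<bar>q (0, 1) (0, 1)\<bar>" by simp
   ultimately show ?thesis using rem by linarith
  qed
  have "F (L (xi, p \<bullet> xi + kp)) tau <= - (dl / 2 * q (xi, p \<bullet> xi) (xi, p \<bullet> xi)) + dl * tau + eps * h"
   unfolding F_graph[OF m p_def] mk using rem2 by (simp add: s_def algebra_simps diff_divide_distrib)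
  also have "... <= - (eps * h)"
  proof -
   have "2 * eps * (norm xi)\<^sup>2 <= dl / 2 * c0 * (norm xi)\<^sup>2" using eps(3) by (rule mult_right_mono) simp
   also have "... <= dl / 2 * q (xi, p \<bullet> xi) (xi, p \<bullet> xi)"
    unfolding mult.assoc using q_tangent[OF m p_def, of xi] dl by (intro mult_left_mono) auto
   finally have "2 * eps * (norm xi)\<^sup>2 <= dl / 2 * q (xi, p \<bullet> xi) (xi, p \<bullet> xi)" .
   moreover have "2 * eps * \<bar>tau\<bar> <= dl * \<bar>tau\<bar>" using eps(2) by (rule mult_right_mono) simp
   ultimately show ?thesis unfolding h_def b'(3) by (simp add: algebra_simps)
  qed
  finally have "d * th >= eps * h" using F1 th(3) by linarith
  moreover have "d >= 0"
  proof (rule ccontr)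
   assume "\<not> d >= 0"
   then have "d * th < 0" using th m by (intro mult_neg_pos) auto
   moreover have "eps * h >= 0" using eps h0 by simp
   ultimately show False using \<open>d * th >= eps * h\<close> by linarith
  qed
  moreover have "d * th <= d * (2 * m)" using th \<open>d >= 0\<close> by (intro mult_left_mono)
  ultimately have "d >= eps / (2 * m) * h" using m by (simp add: field_simps)
  then show "u x t >= u0 + quadratic_test p A a (x - x0) (t - t0) + eps / (2 * m) * ((norm (x - x0))\<^sup>2 + (t0 - t))"
   unfolding xi_def[symmetric] tau_def[symmetric] qt using b by (simp add: d_def h_def tau_def xi_def)
 qed (use QQ inQ r eps m in auto)
 then have "(1 - dl)\<^sup>2 / m * hyp_speed N Q <= (\<alpha> + dl) / m"
  unfolding A(2) by (simp add: s_def a_def)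
 then show ?thesis using m by (simp add: divide_le_cancel)
qed

text \<open>The opposite perturbation: with Hessian times 1 + dl and speed \<alpha> - dl,
  \<open>F\<close> is at least eps h on the test graph and still positive at depth c h below it.
  Points there are inside, so the surface does not pass above them.\<close>

lemma sub_aux:
 assumes m: "m > 0" and rho: "rho > 0"
  and F: "!!z t. t0 - rho < t ==> t < t0 ==> dist z z0 < rho ==> F (z - z0) (t - t0) > 0 ==> z \<in> inside (M t)"
  and dl: "0 < dl"
 shows "\<alpha> - dl <= (1 + dl)\<^sup>2 * hyp_speed N Q"
proof -
 define p where "p = - (n1 /\<^sub>R m)"
 have N: "L (m *\<^sub>R (- p, 1)) = N" using m by (simp add: p_def L(3))
 define s where "s = 1 + dl"
 define A where "A = (\<chi> i j. (s / m) * Q (L (axis i 1, p $ i)) (L (axis j 1, p $ j)))"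
 note A = graph_frame[OF L(1) Q sym m, where s=s and p=p, folded A_def, unfolded N]
 define a where "a = (\<alpha> - dl) / m"
 define eps where "eps = dl * min c0 1 / 4"
 have eps: "eps > 0" "2 * eps <= dl" "2 * eps <= dl / 2 * c0" using dl c0 by (auto simp: eps_def min_def)
 define k1 where "k1 = s / (2 * m)"
 obtain r1 where r1: "r1 > 0" "!!xi tau. norm xi <= r1 ==> \<bar>tau\<bar> <= r1 ==>
  \<bar>(k1 * q (xi, p \<bullet> xi) (xi, p \<bullet> xi) + a * tau) * q (xi, p \<bullet> xi) (0, 1)\<bar> +
  (k1 * q (xi, p \<bullet> xi) (xi, p \<bullet> xi) + a * tau)\<^sup>2 * \<bar>q (0, 1) (0, 1)\<bar> <= eps * ((norm xi)\<^sup>2 + \<bar>tau\<bar>)"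
  using graph_remainder[OF q eps(1), of k1 p a] by metis
 obtain r2 where r2: "r2 > 0" "!!zt d tau. norm zt <= r2 ==> norm (zt + d *\<^sub>R (0, 1)) <= r2 ==>
  (\<exists>th. m / 2 <= th & th <= 2 * m & F (L (zt + d *\<^sub>R (0, 1))) tau - F (L zt) tau = d * th)"
  using F_vertical[OF m] by metis
 have ab: "aa < u0" "u0 < bb" using graph(1)[OF inQ] by auto
 define e where "e = min (min (r2 / 3) (rho / 3)) ((u0 - aa) / 2)"
 have "e <= (u0 - aa) / 2" unfolding e_def by (rule min.cobounded2)
 moreover have "e > 0" "3 * e <= r2" "3 * e <= rho" using r2 rho ab by (auto simp: e_def)
 ultimately have e: "e > 0" "3 * e <= r2" "3 * e <= rho" "2 * e <= u0 - aa" by (simp_all add: field_simps)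
 obtain r3 where r3: "r3 > 0" "!!x t. norm (x - x0) <= r3 ==> \<bar>t - t0\<bar> <= r3 ==>
   norm (x - x0) < e & \<bar>quadratic_test p A a (x - x0) (t - t0)\<bar> < e"
  using near_test[OF e(1), of p A a] by metis
 obtain r4 where r4: "r4 > 0" "!!x t. norm (x - x0) <= r4 ==> \<bar>t - t0\<bar> <= r4 ==> (x, t) \<in> QQ & \<bar>u x t - u0\<bar> < e"
  using cont_u[OF e(1)] by metis
 define c where "c = eps / (4 * m)"
 have c: "c > 0" using eps m by (simp add: c_def)
 define r where "r = min (min (min r1 (rho / 2)) (min r3 r4)) (min 1 (e / (2 * c)))"
 have r: "r > 0" "r <= r1" "r < rho" "r <= r3" "r <= r4" "r <= 1" "r <= e / (2 * c)"
  using r1 r3 r4 rho e c by (auto simp: r_def)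
 have rc: "2 * c * r <= e" using r(7) c by (simp add: field_simps)
 have "a <= graph_speed p A"
 proof (rule viscosity_subsolution_past[where Q=QQ and u=u and ?x0.0=x0 and ?t0.0=t0 and rho=r and c=c])
  show "viscosity_subsolution QQ u" using vs by (simp add: viscosity_solution_def)
  show "A $ i $ j = A $ j $ i" for i j by (rule A(1))
  fix x t assume b: "norm (x - x0) <= r" "t0 - r <= t" "t < t0"
  define xi where "xi = x - x0"
  define tau where "tau = t - t0"
  have b': "norm xi <= r" "\<bar>tau\<bar> <= r" "\<bar>tau\<bar> = - tau" "\<bar>tau\<bar> > 0" using b by (auto simp: xi_def tau_def)
  define h where "h = (norm xi)\<^sup>2 + \<bar>tau\<bar>"
  have h0: "h > 0" unfolding h_def using b'(4) by (intro add_nonneg_pos) simp_all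
  have "(norm xi)\<^sup>2 <= r * 1" unfolding power2_eq_square using b' r by (intro mult_mono) auto
  then have h2: "h <= 2 * r" using b' by (simp add: h_def)
  have "c * h <= 2 * c * r" using mult_left_mono[OF h2, of c] c by simp
  then have ch: "c * h <= e" "c * h > 0" using rc c h0 by (linarith, simp)
  define kp where "kp = k1 * q (xi, p \<bullet> xi) (xi, p \<bullet> xi) + a * tau"
  have qt: "quadratic_test p A a xi tau = p \<bullet> xi + kp"
   by (simp add: quadratic_test_def A(4) kp_def k1_def q_def)
  have small: "norm xi < e" "\<bar>p \<bullet> xi + kp\<bar> < e"
   using r3(2)[of x t] b' r unfolding xi_def[symmetric] tau_def[symmetric] qt by auto
  have xQ: "(x, t) \<in> QQ" "\<bar>u x t - u0\<bar> < e" using r4(2)[of x t] b r by auto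
  define d where "d = - (c * h)"
  have ze: "(xi, p \<bullet> xi + kp) + d *\<^sub>R (0, 1) = (xi, p \<bullet> xi + kp + d)" by simp
  have nz: "norm (xi, p \<bullet> xi + kp) < 2 * e" "norm (xi, p \<bullet> xi + kp + d) < 3 * e"
   using norm_Pair_le[of xi "p \<bullet> xi + kp"] norm_Pair_le[of xi "p \<bullet> xi + kp + d"] small ch by (auto simp: d_def)
  obtain th where th: "m / 2 <= th" "th <= 2 * m" "F (L (xi, p \<bullet> xi + kp + d)) tau - F (L (xi, p \<bullet> xi + kp)) tau = d * th"
   using r2(2)[of "(xi, p \<bullet> xi + kp)" d tau] nz e unfolding ze by auto
  have mk: "m * kp = s / 2 * q (xi, p \<bullet> xi) (xi, p \<bullet> xi) + (\<alpha> - dl) * tau"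
   using m by (simp add: kp_def k1_def a_def algebra_simps add_divide_distrib diff_divide_distrib)
  have rem: "\<bar>kp * q (xi, p \<bullet> xi) (0, 1)\<bar> + kp\<^sup>2 * \<bar>q (0, 1) (0, 1)\<bar> <= eps * h"
   unfolding kp_def h_def using b' r by (intro r1(2)) auto
  have rem2: "kp * q (xi, p \<bullet> xi) (0, 1) + kp\<^sup>2 * q (0, 1) (0, 1) / 2 <= eps * h"
  proof -
   have "kp * q (xi, p \<bullet> xi) (0, 1) <= \<bar>kp * q (xi, p \<bullet> xi) (0, 1)\<bar>" by (rule abs_ge_self)
   moreover have "kp\<^sup>2 * q (0, 1) (0, 1) <= kp\<^sup>2 * \<bar>q (0, 1) (0, 1)\<bar>"
    using mult_left_mono[OF abs_ge_self[of "q (0, 1) (0, 1)"], of "kp\<^sup>2"] by simp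
   moreover have "0 <= kp\<^sup>2 * \<bar>q (0, 1) (0, 1)\<bar>" by simp
   ultimately show ?thesis using rem by linarith
  qed
  have "eps * h <= dl / 2 * q (xi, p \<bullet> xi) (xi, p \<bullet> xi) - dl * tau - eps * h"
  proof -
   have "2 * eps * (norm xi)\<^sup>2 <= dl / 2 * c0 * (norm xi)\<^sup>2" using eps(3) by (rule mult_right_mono) simp
   also have "... <= dl / 2 * q (xi, p \<bullet> xi) (xi, p \<bullet> xi)"
    unfolding mult.assoc using q_tangent[OF m p_def, of xi] dl by (intro mult_left_mono) auto
   finally have "2 * eps * (norm xi)\<^sup>2 <= dl / 2 * q (xi, p \<bullet> xi) (xi, p \<bullet> xi)" .
   moreover have "2 * eps * \<bar>tau\<bar> <= dl * \<bar>tau\<bar>" using eps(2) by (rule mult_right_mono) simp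
   ultimately show ?thesis unfolding h_def b'(3) by (simp add: algebra_simps)
  qed
  also have "... <= F (L (xi, p \<bullet> xi + kp)) tau"
   unfolding F_graph[OF m p_def] mk using rem2 by (simp add: s_def algebra_simps add_divide_distrib diff_divide_distrib)
  finally have F1: "F (L (xi, p \<bullet> xi + kp)) tau >= eps * h" .
  have "d * th >= - (eps * h / 2)"
  proof -
   have "c * h * th <= c * h * (2 * m)" using th ch by (intro mult_left_mono) auto
   also have "... = eps * h / 2" using m by (simp add: c_def)
   finally show ?thesis by (simp add: d_def)
  qed
  moreover have "eps * h > 0" using eps h0 by simp
  ultimately have "F (L (xi, p \<bullet> xi + kp + d)) tau > 0" using F1 th(3) by linarith
  define y where "y = u0 + p \<bullet> xi + kp + d"
  have yd: "(x - x0, y - u0) = (xi, p \<bullet> xi + kp + d)" by (simp add: y_def xi_def)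
  have "psi (x, y) \<in> inside (M t)"
  proof (rule F)
   show "dist (psi (x, y)) z0 < rho" unfolding dist_psi yd using nz e by linarith
   show "F (psi (x, y) - z0) (t - t0) > 0"
    unfolding psi_diff yd tau_def[symmetric] by fact
  qed (use b r in auto)
  moreover have "aa < y" using small ch e unfolding y_def d_def by linarith
  ultimately have "\<not> y < u x t" using graph(3)[OF xQ(1), of y] inside_Int_outside by blast
  then show "u x t + c * ((norm (x - x0))\<^sup>2 + (t0 - t)) <= u0 + quadratic_test p A a (x - x0) (t - t0)"
   unfolding xi_def[symmetric] tau_def[symmetric] qt using b by (simp add: y_def d_def h_def tau_def xi_def)
 qed (use QQ inQ r c in auto)
 then have "(\<alpha> - dl) / m <= (1 + dl)\<^sup>2 / m * hyp_speed N Q"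
  unfolding A(2) by (simp add: s_def a_def)
 then show ?thesis using m by (simp add: divide_le_cancel)
qed

lemma touching_super:
 assumes rho: "rho > 0"
  and F: "!!z t. t0 - rho < t ==> t <= t0 ==> z \<in> M t \<union> inside (M t) ==> dist z z0 < rho ==> F (z - z0) (t - t0) >= 0"
  and adm: "tangent_trace N Q > 0" "hyp_speed N Q > 0"
 shows "hyp_speed N Q <= \<alpha>"
proof -
 have m: "m > 0" using F[of t0] rho by (intro vertical_super[OF rho]) auto
 have *: "(1 - dl)\<^sup>2 * hyp_speed N Q <= \<alpha> + dl" if "0 < dl" "dl < 1" for dl
  using F by (intro super_aux[OF m rho _ adm that]) auto
 have ev: "eventually (%dl::real. (1 - dl)\<^sup>2 * hyp_speed N Q <= \<alpha> + dl) (at_right 0)"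
  by (rule eventually_at_rightI[of 0 1]) (use * in auto)
 have l1: "((%dl::real. (1 - dl)\<^sup>2 * hyp_speed N Q) \<longlongrightarrow> (1 - 0)\<^sup>2 * hyp_speed N Q) (at_right 0)"
  by (intro tendsto_intros)
 have l2: "((%dl::real. \<alpha> + dl) \<longlongrightarrow> \<alpha> + 0) (at_right 0)"
  by (intro tendsto_intros)
 show ?thesis using tendsto_le[OF _ l2 l1 ev] by simp
qed

lemma touching_sub:
 assumes rho: "rho > 0"
  and F: "!!z t. t0 - rho < t ==> t < t0 ==> dist z z0 < rho ==> F (z - z0) (t - t0) > 0 ==> z \<in> inside (M t)"
 shows "\<alpha> <= hyp_speed N Q"
proof -
 have m: "m > 0" using F by (intro vertical_sub[OF rho]) auto
 have *: "\<alpha> - dl <= (1 + dl)\<^sup>2 * hyp_speed N Q" if "0 < dl" for dl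
  using F by (intro sub_aux[OF m rho _ that]) auto
 have ev: "eventually (%dl::real. \<alpha> - dl <= (1 + dl)\<^sup>2 * hyp_speed N Q) (at_right 0)"
  by (rule eventually_at_rightI[of 0 1]) (use * in auto)
 have l1: "((%dl::real. (1 + dl)\<^sup>2 * hyp_speed N Q) \<longlongrightarrow> (1 + 0)\<^sup>2 * hyp_speed N Q) (at_right 0)"
  by (intro tendsto_intros)
 have l2: "((%dl::real. \<alpha> - dl) \<longlongrightarrow> \<alpha> - 0) (at_right 0)"
  by (intro tendsto_intros)
 show ?thesis using tendsto_le[OF _ l1 l2 ev] by simp
qed

end

section \<open>Gaussian averages on a cube\<close>

lemma lborel_integral_prod:
 fixes f :: "'a::euclidean_space => real => real"
 assumes f: "!!b. b \<in> Basis ==> integrable lborel (f b)"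
 shows "has_bochner_integral lborel (%x. \<Prod>b\<in>Basis. f b (x \<bullet> b)) (\<Prod>b\<in>Basis. integral\<^sup>L lborel (f b))"
proof -
 interpret product_sigma_finite "%_::'a. lborel :: real measure" ..
 have m[measurable]: "f b \<in> borel_measurable borel" if "b \<in> Basis" for b
  using borel_measurable_integrable[OF f[OF that]] by simp
 let ?P = "\<Pi>\<^sub>M b\<in>(Basis :: 'a set). (lborel :: real measure)"
 have h: "has_bochner_integral ?P (%x. \<Prod>b\<in>Basis. f b (x b)) (\<Prod>b\<in>Basis. integral\<^sup>L lborel (f b))"
  unfolding has_bochner_integral_iff
  using product_integrable_prod[OF finite_Basis f] product_integral_prod[OF finite_Basis f] by auto
 have e: "(\<Prod>b\<in>Basis. f b ((\<Sum>b\<in>Basis. x b *\<^sub>R b) \<bullet> b)) = (\<Prod>b\<in>Basis. f b (x b))" for x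
  by (rule prod.cong) auto
 have "has_bochner_integral (distr ?P borel (%f. \<Sum>b\<in>Basis. f b *\<^sub>R b)) (%x. \<Prod>b\<in>Basis. f b (x \<bullet> b)) (\<Prod>b\<in>Basis. integral\<^sup>L lborel (f b))"
  by (rule has_bochner_integral_distr[where 'a='a]) (simp_all add: e h)
 then show ?thesis unfolding lborel_eq[where 'a='a, symmetric] .
qed

lemma prod_Basis_cart: "(\<Prod>b\<in>(Basis :: (real^'n) set). f b) = (\<Prod>i\<in>UNIV. f (axis i 1))"
proof -
 have B: "(Basis :: (real^'n) set) = (%i. axis i 1) ` UNIV"
  by (auto simp: Basis_vec_def)
 have i: "inj (%i. axis i 1 :: real^'n)"
  by (simp add: inj_on_def axis_eq_axis)
 show ?thesis
  unfolding B prod.reindex[OF i] by simp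
qed

lemma has_integral_prod_cart:
 fixes f :: "'n::finite => real => real"
 assumes f: "!!i. integrable lborel (f i)"
 shows "((%x::real^'n. \<Prod>i\<in>UNIV. f i (x $ i)) has_integral (\<Prod>i\<in>UNIV. integral\<^sup>L lborel (f i))) UNIV"
proof -
 define F where "F b = f (THE i. b = axis i 1)" for b :: "real^'n"
 have F: "F (axis i 1) = f i" for i
  by (simp add: F_def axis_eq_axis)
 have "has_bochner_integral lborel (%x::real^'n. \<Prod>b\<in>Basis. F b (x \<bullet> b)) (\<Prod>b\<in>Basis. integral\<^sup>L lborel (F b))"
  by (rule lborel_integral_prod) (auto simp: Basis_vec_def F f)
 then have "has_bochner_integral lborel (%x::real^'n. \<Prod>i\<in>UNIV. f i (x $ i)) (\<Prod>i\<in>UNIV. integral\<^sup>L lborel (f i))"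
  unfolding prod_Basis_cart F by (simp add: inner_axis)
 then show ?thesis
  using has_integral_integral_lborel[of "%x::real^'n. \<Prod>i\<in>UNIV. f i (x $ i)"]
  by (simp add: has_bochner_integral_iff)
qed

text \<open>A cube rather than a ball: Gaussian integrals over it factor into one-dimensional ones,
  and odd and mixed moments vanish by symmetry.\<close>

definition cube :: "real => (real^'n) set" where
 "cube d = cbox (- (\<chi> i. d)) (\<chi> i. d)"

lemma mem_cube: "x \<in> cube d \<longleftrightarrow> (\<forall>i. \<bar>x $ i\<bar> <= d)"
 by (simp add: cube_def mem_box_cart abs_le_iff) (metis minus_le_iff)

lemma compact_cube: "compact (cube d)"
 by (simp add: cube_def)

lemma norm_cube: "x \<in> cube d ==> norm (x :: real^'n) <= real CARD('n) * d"
proof -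
 assume "x \<in> cube d"
 then have "(\<Sum>i\<in>UNIV. \<bar>x $ i\<bar>) <= real CARD('n) * d"
  using sum_bounded_above[of "UNIV :: 'n set" "%i. \<bar>x $ i\<bar>" d] by (simp add: mem_cube)
 then show ?thesis using norm_le_l1_cart[of x] by linarith
qed

text \<open>The heat kernel (4 pi tau)^(-n/2) exp (- |y|^2 / (4 tau)) for tau > 0, with the power
  written through \<open>ln\<close> so that the kernel is a single exponential.\<close>

definition gauss :: "real => real^'n => real" where
 "gauss tau y = exp (- (norm y)\<^sup>2 / (4 * tau) - real CARD('n) / 2 * ln (4 * pi * tau))"

lemma gauss_pos: "gauss tau y > 0" by (simp add: gauss_def)

lemma gauss_minus: "gauss tau (- y) = gauss tau y" by (simp add: gauss_def)

lemma gauss_prod: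
 assumes "tau > 0"
 shows "gauss tau (y :: real^'n) = (\<Prod>i\<in>UNIV. normal_density 0 (sqrt (2 * tau)) (y $ i))"
proof -
 have "normal_density 0 (sqrt (2 * tau)) x = exp (- x\<^sup>2 / (4 * tau) - ln (4 * pi * tau) / 2)" for x
 proof -
  have "sqrt (4 * pi * tau) = exp (ln (4 * pi * tau) / 2)"
   using assms by (simp add: ln_sqrt[symmetric])
  then show ?thesis
   using assms by (simp add: normal_density_def exp_diff mult_ac)
 qed
 then have "(\<Prod>i\<in>UNIV. normal_density 0 (sqrt (2 * tau)) (y $ i)) =
   exp (\<Sum>i\<in>UNIV. - (y $ i)\<^sup>2 / (4 * tau) - ln (4 * pi * tau) / 2)"
  by (simp add: exp_sum)
 also have "(\<Sum>i\<in>UNIV. - (y $ i)\<^sup>2 / (4 * tau) - ln (4 * pi * tau) / 2) =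
   - (norm y)\<^sup>2 / (4 * tau) - real CARD('n) / 2 * ln (4 * pi * tau)"
  by (simp add: sum_subtractf norm2_cart sum_negf sum_divide_distrib)
 finally show ?thesis by (simp add: gauss_def)
qed

lemma continuous_on_gauss:
 assumes "!!x. x \<in> S ==> tau x > 0" "continuous_on S tau" "continuous_on S y"
 shows "continuous_on S (%x. gauss (tau x) (y x :: real^'n))"
 unfolding gauss_def using assms(1)
 by (intro continuous_intros assms(2,3)) (fastforce)+

lemma cube_moment:
 fixes h :: "'n::finite => real => real"
 assumes tau: "tau > 0" and h: "!!i. integrable lborel (%x. normal_density 0 (sqrt (2 * tau)) x * h i x)"
 shows "((%y::real^'n. gauss tau y * (\<Prod>i\<in>UNIV. h i (y $ i))) has_integral
  (\<Prod>i\<in>UNIV. \<integral>x. normal_density 0 (sqrt (2 * tau)) x * h i x * indicator {-d..d} x \<partial>lborel)) (cube d)"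
proof -
 let ?k = "normal_density 0 (sqrt (2 * tau))"
 have I: "integrable lborel (%x. ?k x * h i x * indicator {-d..d} x)" for i
  using integrable_real_mult_indicator[OF _ h[of i], of "{-d..d}"] by simp
 have "((%y::real^'n. \<Prod>i\<in>UNIV. ?k (y $ i) * h i (y $ i) * indicator {-d..d} (y $ i)) has_integral
  (\<Prod>i\<in>UNIV. \<integral>x. ?k x * h i x * indicator {-d..d} x \<partial>lborel)) UNIV"
  by (rule has_integral_prod_cart[OF I])
 moreover have "(\<Prod>i\<in>UNIV. ?k (y $ i) * h i (y $ i) * indicator {-d..d} (y $ i)) =
   (if y \<in> cube d then gauss tau y * (\<Prod>i\<in>UNIV. h i (y $ i)) else 0)" for y :: "real^'n"
 proof (cases "y \<in> cube d")
  case True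
  then have "y $ i \<in> {-d..d}" for i by (auto simp: mem_cube abs_le_iff) (metis minus_le_iff)
  then show ?thesis using True by (simp add: gauss_prod[OF tau] prod.distrib)
 next
  case False
  then obtain i where "\<not> \<bar>y $ i\<bar> <= d" by (auto simp: mem_cube)
  then have "(indicator {-d..d} (y $ i) :: real) = 0" by (auto simp: indicator_def abs_le_iff)
  then show ?thesis using False by (auto intro!: prod_zero)
 qed
 ultimately show ?thesis by (simp add: has_integral_restrict_UNIV)
qed

lemma normal_second_moment:
 assumes "tau > 0"
 shows "has_bochner_integral lborel (%x. normal_density 0 (sqrt (2 * tau)) x * x\<^sup>2) (2 * tau)"
 using normal_moment_even[of "sqrt (2 * tau)" 0 1] assms by (simp add: fact_numeral field_simps power2_eq_square)

lemma normal_indicator_le: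
 assumes "tau > 0"
 shows "(\<integral>x. normal_density 0 (sqrt (2 * tau)) x * indicator {-d..d} x \<partial>lborel) <= 1"
  "0 <= (\<integral>x. normal_density 0 (sqrt (2 * tau)) x * indicator {-d..d} x \<partial>lborel)"
  "(\<integral>x. normal_density 0 (sqrt (2 * tau)) x * x\<^sup>2 * indicator {-d..d} x \<partial>lborel) <= 2 * tau"
  "0 <= (\<integral>x. normal_density 0 (sqrt (2 * tau)) x * x\<^sup>2 * indicator {-d..d} x \<partial>lborel)"
proof -
 let ?k = "normal_density 0 (sqrt (2 * tau))"
 have s: "sqrt (2 * tau) > 0" using assms by simp
 have i1: "integrable lborel ?k" using s by simp
 have i2: "integrable lborel (%x. ?k x * x\<^sup>2)" using normal_second_moment[OF assms] by (simp add: has_bochner_integral_iff)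
 have "(\<integral>x. ?k x * indicator {-d..d} x \<partial>lborel) <= (\<integral>x. ?k x \<partial>lborel)"
  by (intro integral_mono i1 integrable_real_mult_indicator) (auto simp: indicator_def)
 then show "(\<integral>x. ?k x * indicator {-d..d} x \<partial>lborel) <= 1" using s by simp
 have "(\<integral>x. ?k x * x\<^sup>2 * indicator {-d..d} x \<partial>lborel) <= (\<integral>x. ?k x * x\<^sup>2 \<partial>lborel)"
  by (intro integral_mono i2 integrable_real_mult_indicator) (auto simp: indicator_def)
 then show "(\<integral>x. ?k x * x\<^sup>2 * indicator {-d..d} x \<partial>lborel) <= 2 * tau"
  using normal_second_moment[OF assms] by (simp add: has_bochner_integral_iff)
qed (auto intro!: integral_nonneg)

text \<open>Chebyshev's inequality in pointwise form: 1 - x^2 / d^2 is at most the indicator of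
  [-d, d], and the variance is 2 tau.\<close>

lemma normal_mass_ge:
 assumes "tau > 0" "d > 0"
 shows "1 - 2 * tau / d\<^sup>2 <= (\<integral>x. normal_density 0 (sqrt (2 * tau)) x * indicator {-d..d} x \<partial>lborel)"
proof -
 let ?k = "normal_density 0 (sqrt (2 * tau))"
 have s: "sqrt (2 * tau) > 0" using assms by simp
 have i1: "integrable lborel ?k" using s by simp
 have i2: "integrable lborel (%x. ?k x * x\<^sup>2)" using normal_second_moment[OF assms(1)] by (simp add: has_bochner_integral_iff)
 have "(\<integral>x. ?k x - ?k x * x\<^sup>2 / d\<^sup>2 \<partial>lborel) <= (\<integral>x. ?k x * indicator {-d..d} x \<partial>lborel)"
 proof (rule integral_mono)
  show "integrable lborel (%x. ?k x - ?k x * x\<^sup>2 / d\<^sup>2)" using i1 i2 by simp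
  show "integrable lborel (%x. ?k x * indicator {-d..d} x)"
   using i1 by (intro integrable_real_mult_indicator) auto
  fix x
  show "?k x - ?k x * x\<^sup>2 / d\<^sup>2 <= ?k x * indicator {-d..d} x"
  proof (cases "x \<in> {-d..d}")
   case False
   then have "\<bar>d\<bar> <= \<bar>x\<bar>" using assms by auto
   then have "d\<^sup>2 <= x\<^sup>2" by (simp add: abs_le_square_iff)
   then have "?k x * 1 <= ?k x * (x\<^sup>2 / d\<^sup>2)" using assms by (intro mult_left_mono) (auto simp: field_simps)
   then show ?thesis using False by simp
  qed auto
 qed
 also have "(\<integral>x. ?k x - ?k x * x\<^sup>2 / d\<^sup>2 \<partial>lborel) = 1 - 2 * tau / d\<^sup>2"
  using i1 i2 s normal_second_moment[OF assms(1)] by (simp add: has_bochner_integral_iff)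
 finally show ?thesis .
qed

lemma gauss_mass:
 assumes "tau > 0"
 shows "gauss tau integrable_on (cube d :: (real^'n) set)" "integral (cube d) (gauss tau :: real^'n => real) <= 1"
  "d > 0 ==> 2 * tau <= d\<^sup>2 ==> (1 - 2 * tau / d\<^sup>2) ^ CARD('n) <= integral (cube d) (gauss tau :: real^'n => real)"
proof -
 let ?k = "normal_density 0 (sqrt (2 * tau))"
 have s: "sqrt (2 * tau) > 0" using assms by simp
 have h: "((gauss tau :: real^'n => real) has_integral (\<integral>x. ?k x * indicator {-d..d} x \<partial>lborel) ^ CARD('n)) (cube d)"
  using cube_moment[OF assms, of "%i::'n. %x. 1" d] s by simp
 then show "gauss tau integrable_on (cube d :: (real^'n) set)" by blast
 have e: "integral (cube d) (gauss tau :: real^'n => real) = (\<integral>x. ?k x * indicator {-d..d} x \<partial>lborel) ^ CARD('n)"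
  using h by (rule integral_unique)
 show "integral (cube d) (gauss tau :: real^'n => real) <= 1"
  unfolding e using normal_indicator_le[OF assms] by (intro power_le_one) auto
 show "(1 - 2 * tau / d\<^sup>2) ^ CARD('n) <= integral (cube d) (gauss tau :: real^'n => real)" if "d > 0" "2 * tau <= d\<^sup>2"
  unfolding e using normal_mass_ge[OF assms that(1)] that by (intro power_mono) auto
qed

lemma gauss_second_moment:
 assumes "tau > 0"
 shows "(%y::real^'n. gauss tau y * (y $ i * y $ j)) integrable_on cube d"
  "integral (cube d) (%y::real^'n. gauss tau y * (y $ i * y $ i)) <= 2 * tau"
  "i ~= j ==> integral (cube d) (%y::real^'n. gauss tau y * (y $ i * y $ j)) = 0"
proof -
 let ?k = "normal_density 0 (sqrt (2 * tau))"
 have s: "sqrt (2 * tau) > 0" using assms by simp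
 show "(%y::real^'n. gauss tau y * (y $ i * y $ j)) integrable_on cube d"
  unfolding cube_def using assms by (intro integrable_continuous continuous_intros continuous_on_gauss) auto
 have i2: "integrable lborel (%x. ?k x * x\<^sup>2)" using normal_second_moment[OF assms] by (simp add: has_bochner_integral_iff)
 have i1: "integrable lborel (%x. ?k x * x)" using s by (rule integrable_normal_moment_nz_1)
 show "integral (cube d) (%y::real^'n. gauss tau y * (y $ i * y $ i)) <= 2 * tau"
 proof -
  define h where "h k x = (if k = i then x\<^sup>2 else 1)" for k and x :: real
  have "((%y::real^'n. gauss tau y * (\<Prod>k\<in>UNIV. h k (y $ k))) has_integral
   (\<Prod>k\<in>UNIV. \<integral>x. ?k x * h k x * indicator {-d..d} x \<partial>lborel)) (cube d)"
  proof (rule cube_moment[OF assms])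
   show "integrable lborel (%x. ?k x * h k x)" for k
    using i2 s by (cases "k = i") (simp_all add: h_def)
  qed
  moreover have "(\<Prod>k\<in>UNIV. h k (y $ k)) = y $ i * y $ i" for y :: "real^'n"
   by (simp add: h_def power2_eq_square)
  ultimately have "integral (cube d) (%y::real^'n. gauss tau y * (y $ i * y $ i)) =
    (\<Prod>k\<in>UNIV. \<integral>x. ?k x * h k x * indicator {-d..d} x \<partial>lborel)"
   by (simp add: integral_unique)
  also have "... = (\<integral>x. ?k x * x\<^sup>2 * indicator {-d..d} x \<partial>lborel) *
    (\<Prod>k\<in>UNIV - {i}. \<integral>x. ?k x * indicator {-d..d} x \<partial>lborel)"
   by (subst prod.remove[of _ i]) (auto simp: h_def)
  also have "... <= 2 * tau * 1"
   using normal_indicator_le[OF assms, of d] assms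
   by (intro mult_mono prod_le_1) (auto intro!: prod_nonneg)
  finally show ?thesis by simp
 qed
 show "integral (cube d) (%y::real^'n. gauss tau y * (y $ i * y $ j)) = 0" if "i ~= j"
 proof -
  define h where "h k x = (if k = i \<or> k = j then x else 1)" for k and x :: real
  have "((%y::real^'n. gauss tau y * (\<Prod>k\<in>UNIV. h k (y $ k))) has_integral
   (\<Prod>k\<in>UNIV. \<integral>x. ?k x * h k x * indicator {-d..d} x \<partial>lborel)) (cube d)"
  proof (rule cube_moment[OF assms])
   show "integrable lborel (%x. ?k x * h k x)" for k
    using i1 s by (cases "k = i \<or> k = j") (simp_all add: h_def)
  qed
  moreover have "(\<Prod>k\<in>UNIV. h k (y $ k)) = y $ i * y $ j" for y :: "real^'n"
  proof -
   have "(\<Prod>k\<in>UNIV. h k (y $ k)) = h i (y $ i) * (h j (y $ j) * (\<Prod>k\<in>UNIV - {i} - {j}. h k (y $ k)))"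
    using that by (subst prod.remove[of _ i]) (auto simp: prod.remove[of _ j])
   also have "(\<Prod>k\<in>UNIV - {i} - {j}. h k (y $ k)) = 1" by (rule prod.neutral) (auto simp: h_def)
   finally show ?thesis by (simp add: h_def)
  qed
  \<comment> \<open>An odd integrand on a symmetric interval; this one factor annihilates the
    product over all coordinates.\<close>
  moreover have "(\<integral>x. ?k x * h i x * indicator {-d..d} x \<partial>lborel) = 0"
  proof -
   have "(\<integral>x. ?k x * x * indicator {-d..d} x \<partial>lborel) =
    (\<integral>x. ?k (0 + (-1) * x) * (0 + (-1) * x) * indicator {-d..d} (0 + (-1) * x) \<partial>lborel)"
    using lborel_integral_real_affine[of "-1" "%x. ?k x * x * indicator {-d..d} x" 0] by simp
   also have "... = (\<integral>x. - (?k x * x * indicator {-d..d} x) \<partial>lborel)"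
    by (rule Bochner_Integration.integral_cong) (auto simp: normal_density_def indicator_def)
   finally show ?thesis by (simp add: h_def)
  qed
  ultimately show ?thesis
   by (simp add: integral_unique) (metis (no_types, lifting) UNIV_I finite prod_zero)
 qed
qed

section \<open>Taylor expansion of the heat kernel\<close>

lemma exp_taylor2:
 fixes X :: real assumes "\<bar>X\<bar> <= 1"
 shows "\<bar>exp X - (1 + X + X\<^sup>2 / 2)\<bar> <= \<bar>X\<bar> ^ 3"
proof -
 obtain t where t: "\<bar>t\<bar> <= \<bar>X\<bar>" "exp X = (\<Sum>m<3. X ^ m / fact m) + exp t / fact 3 * X ^ 3"
  using Maclaurin_exp_le[of X 3] by blast
 have "exp t <= exp 1" using t assms by simp
 also have "... <= (3::real)" by (rule exp_le)
 finally have e: "exp t <= 6" by simp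
 have "exp X - (1 + X + X\<^sup>2 / 2) = exp t / 6 * X ^ 3"
  using t(2) by (simp add: eval_nat_numeral)
 then have "\<bar>exp X - (1 + X + X\<^sup>2 / 2)\<bar> = \<bar>exp t / 6 * X ^ 3\<bar>" by (rule arg_cong)
 also have "... = exp t / 6 * \<bar>X\<bar> ^ 3" by (simp add: abs_mult power_abs)
 finally have "\<bar>exp X - (1 + X + X\<^sup>2 / 2)\<bar> = exp t / 6 * \<bar>X\<bar> ^ 3" .
 also have "... <= 1 * \<bar>X\<bar> ^ 3" using e by (intro mult_right_mono) auto
 finally show ?thesis by simp
qed

text \<open>The exponent changes by X = - (2 y . xi + |xi|^2) / (4 tau), and exp X is replaced by 1
  + X + X^2 / 2 without its terms of order three and four in xi. Uniformity over |y| <= D allows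
  integration over the cube.\<close>

lemma gauss_space_taylor:
 assumes tau: "tau > 0" and D: "D >= 0" and dl: "dl > 0"
 shows "\<exists>rho>0. \<forall>(y::real^'n) xi. norm y <= D --> norm xi < rho -->
  \<bar>gauss tau (y + xi) - gauss tau y * (1 - y \<bullet> xi / (2 * tau) - (norm xi)\<^sup>2 / (4 * tau) + (y \<bullet> xi)\<^sup>2 / (8 * tau\<^sup>2))\<bar>
   <= dl * (norm xi)\<^sup>2"
proof -
 define G where "G = exp (- (real CARD('n) / 2 * ln (4 * pi * tau)))"
 have G: "G > 0" by (simp add: G_def)
 have gG: "gauss tau y <= G" for y :: "real^'n" using tau by (simp add: gauss_def G_def)
 define C1 where "C1 = (2 * D + 1) / (4 * tau)"
 define C2 where "C2 = (4 * D + 1) / (32 * tau\<^sup>2)"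
 have C: "C1 > 0" "C2 > 0" using D tau by (auto simp: C1_def C2_def)
 define K where "K = G * (C1 ^ 3 + C2)"
 have K: "K > 0" unfolding K_def using G C by (intro mult_pos_pos add_pos_pos zero_less_power)
 define rho where "rho = min (min 1 (1 / C1)) (dl / K)"
 have rho: "rho > 0" "rho <= 1" "C1 * rho <= 1" "K * rho <= dl"
 proof -
  have "C1 * rho <= C1 * (1 / C1)" using C by (intro mult_left_mono) (auto simp: rho_def)
  then show "C1 * rho <= 1" using C by simp
  have "K * rho <= K * (dl / K)" using K by (intro mult_left_mono) (auto simp: rho_def)
  then show "K * rho <= dl" using K by simp
 qed (use C K dl in \<open>auto simp: rho_def\<close>)
 show ?thesis
 proof (rule exI[of _ rho], intro conjI allI impI)
  show "rho > 0" by fact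
  fix y xi :: "real^'n" assume y: "norm y <= D" and x: "norm xi < rho"
  define e where "e = norm xi"
  have e0: "0 <= e" "e <= rho" using x by (auto simp: e_def)
  have "C1 * e <= C1 * rho" "K * e <= K * rho" using e0 C K by (auto intro!: mult_left_mono)
  then have e: "0 <= e" "e <= 1" "C1 * e <= 1" "K * e <= dl"
   using e0 rho by linarith+
  have yx: "\<bar>y \<bullet> xi\<bar> <= D * e"
   using Cauchy_Schwarz_ineq2[of y xi] mult_right_mono[OF y, of e] e by (simp add: e_def)
  define s where "s = 2 * (y \<bullet> xi) + e\<^sup>2"
  define X where "X = - s / (4 * tau)"
  have e2: "e\<^sup>2 <= e" using e by (simp add: power2_eq_square mult_left_le)
  have s: "\<bar>s\<bar> <= (2 * D + 1) * e" using yx e2 abs_triangle_ineq[of "2 * (y \<bullet> xi)" "e\<^sup>2"] by (simp add: s_def algebra_simps)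
  have X: "\<bar>X\<bar> <= C1 * e" using s tau by (simp add: X_def C1_def divide_right_mono)
  then have X1: "\<bar>X\<bar> <= 1" using e by linarith
  have n: "(norm (y + xi))\<^sup>2 = (norm y)\<^sup>2 + s"
   by (simp add: s_def e_def power2_norm_eq_inner inner_add_left inner_add_right inner_commute)
  have g: "gauss tau (y + xi) = gauss tau y * exp X"
   unfolding gauss_def n X_def by (simp add: exp_add[symmetric] add_divide_distrib diff_divide_distrib)
  have X2: "X\<^sup>2 / 2 = (y \<bullet> xi)\<^sup>2 / (8 * tau\<^sup>2) + (4 * (y \<bullet> xi) * e\<^sup>2 + e ^ 4) / (32 * tau\<^sup>2)"
   using tau by (simp add: X_def s_def power2_eq_square field_simps eval_nat_numeral)
  have Xl: "X = - (y \<bullet> xi) / (2 * tau) - e\<^sup>2 / (4 * tau)"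
   using tau by (simp add: X_def s_def field_simps)
  have r2: "\<bar>(4 * (y \<bullet> xi) * e\<^sup>2 + e ^ 4) / (32 * tau\<^sup>2)\<bar> <= C2 * e ^ 3"
  proof -
   have "e ^ 4 <= e ^ 3" using e by (intro power_decreasing) auto
   moreover have "\<bar>y \<bullet> xi\<bar> * e\<^sup>2 <= (D * e) * e\<^sup>2" using yx by (rule mult_right_mono) simp
   then have "\<bar>4 * (y \<bullet> xi) * e\<^sup>2\<bar> <= 4 * D * e ^ 3" by (simp add: abs_mult eval_nat_numeral mult_ac)
   moreover have "\<bar>e ^ 4\<bar> = e ^ 4" using e by simp
   ultimately have "\<bar>4 * (y \<bullet> xi) * e\<^sup>2 + e ^ 4\<bar> <= (4 * D + 1) * e ^ 3"
    using abs_triangle_ineq[of "4 * (y \<bullet> xi) * e\<^sup>2" "e ^ 4"] by (simp add: distrib_right)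
   then show ?thesis using tau by (simp add: C2_def divide_right_mono)
  qed
  have r1: "\<bar>exp X - (1 + X + X\<^sup>2 / 2)\<bar> <= C1 ^ 3 * e ^ 3"
  proof -
   have "\<bar>X\<bar> ^ 3 <= (C1 * e) ^ 3" using X by (intro power_mono) auto
   then show ?thesis using exp_taylor2[OF X1] by (simp add: power_mult_distrib)
  qed
  define T where "T = 1 - y \<bullet> xi / (2 * tau) - (norm xi)\<^sup>2 / (4 * tau) + (y \<bullet> xi)\<^sup>2 / (8 * tau\<^sup>2)"
  have "exp X - T = (exp X - (1 + X + X\<^sup>2 / 2)) + (4 * (y \<bullet> xi) * e\<^sup>2 + e ^ 4) / (32 * tau\<^sup>2)"
   unfolding X2 T_def by (simp add: Xl e_def)
  then have "\<bar>exp X - T\<bar> <= (C1 ^ 3 + C2) * e ^ 3" using r1 r2 unfolding distrib_right by linarith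
  then have "gauss tau y * \<bar>exp X - T\<bar> <= G * ((C1 ^ 3 + C2) * e ^ 3)"
   using gG[of y] gauss_pos[of tau y] G by (intro mult_mono) auto
  also have "... = (K * e) * e\<^sup>2" by (simp add: K_def eval_nat_numeral)
  also have "... <= dl * e\<^sup>2" using e by (intro mult_right_mono) auto
  finally have "gauss tau y * \<bar>exp X - T\<bar> <= dl * e\<^sup>2" .
  moreover have "\<bar>gauss tau (y + xi) - gauss tau y * T\<bar> = gauss tau y * \<bar>exp X - T\<bar>"
   unfolding g right_diff_distrib[symmetric] abs_mult using gauss_pos[of tau y] by simp
  ultimately show "\<bar>gauss tau (y + xi) - gauss tau y * (1 - y \<bullet> xi / (2 * tau) - (norm xi)\<^sup>2 / (4 * tau) + (y \<bullet> xi)\<^sup>2 / (8 * tau\<^sup>2))\<bar>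
   <= dl * (norm xi)\<^sup>2" by (simp add: T_def e_def)
 qed
qed

definition gauss_dt :: "real => real^'n => real" where
 "gauss_dt tau y = ((norm y)\<^sup>2 / (4 * tau\<^sup>2) - CARD('n) / (2 * tau)) * gauss tau y"

lemma gauss_has_derivative:
 assumes "tau > 0"
 shows "((%tau. gauss tau (y::real^'n)) has_real_derivative gauss_dt tau y) (at tau)"
 unfolding gauss_def gauss_dt_def using assms
 by (auto intro!: derivative_eq_intros simp: power2_eq_square field_simps)

text \<open>The point y + xi moves together with the time, so the mean value theorem is combined
  with uniform continuity of \<open>gauss_dt\<close> on a compact set.\<close>

lemma gauss_time_taylor:
 assumes tau: "tau > 0" and D: "D >= 0" and dl: "dl > 0"
 shows "\<exists>rho>0. \<forall>(y::real^'n) xi th. norm y <= D --> norm xi < rho --> - rho < th --> th <= 0 -->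
  \<bar>gauss (tau + th) (y + xi) - gauss tau (y + xi) - gauss_dt tau y * th\<bar> <= dl * (- th)"
proof -
 let ?S = "{tau / 2..tau} \<times> cball (0::real^'n) (D + 1)"
 have "continuous_on ?S (%z. gauss_dt (fst z) (snd z))"
  unfolding gauss_dt_def using tau
  by (intro continuous_intros continuous_on_gauss) (auto simp: dist_norm)
 moreover have "compact ?S" by (intro compact_Times) auto
 ultimately have "uniformly_continuous_on ?S (%z. gauss_dt (fst z) (snd z))"
  by (rule compact_uniformly_continuous)
 then obtain d where d: "d > 0" "!!z z'. z \<in> ?S ==> z' \<in> ?S ==> dist z' z < d ==>
   dist (gauss_dt (fst z') (snd z')) (gauss_dt (fst z) (snd z)) < dl"
  unfolding uniformly_continuous_on_def using dl by meson
 define rho where "rho = min (min 1 (tau / 2)) (d / 2)"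
 have rho: "rho > 0" "rho <= 1" "rho <= tau / 2" "2 * rho <= d" using tau d by (auto simp: rho_def)
 show ?thesis
 proof (rule exI[of _ rho], intro conjI allI impI)
  show "rho > 0" by fact
  fix y xi :: "real^'n" and th :: real
  assume y: "norm y <= D" and x: "norm xi < rho" and t: "- rho < th" "th <= 0"
  show "\<bar>gauss (tau + th) (y + xi) - gauss tau (y + xi) - gauss_dt tau y * th\<bar> <= dl * (- th)"
  proof (cases "th = 0")
   case False
   then have t': "tau + th < tau" using t by simp
   have "\<exists>z>tau + th. z < tau & gauss tau (y + xi) - gauss (tau + th) (y + xi) = (tau - (tau + th)) * gauss_dt z (y + xi)"
    using t t' rho tau by (intro MVT2 gauss_has_derivative) auto
   then obtain z where z: "tau + th < z" "z < tau" "gauss tau (y + xi) - gauss (tau + th) (y + xi) = - th * gauss_dt z (y + xi)"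
    by auto
   have "dist (z, y + xi) (tau, y) <= \<bar>z - tau\<bar> + norm xi"
    using norm_Pair_le[of "z - tau" xi] by (simp add: dist_norm)
   also have "... < d" using z t x rho by linarith
   finally have "dist (gauss_dt z (y + xi)) (gauss_dt tau y) < dl"
    using d(2)[of "(tau, y)" "(z, y + xi)"] y x z t rho tau norm_triangle_ineq[of y xi] by auto
   then have "\<bar>gauss_dt z (y + xi) - gauss_dt tau y\<bar> <= dl" by (simp add: dist_real_def)
   then have "- th * \<bar>gauss_dt z (y + xi) - gauss_dt tau y\<bar> <= - th * dl" using t by (intro mult_left_mono) auto
   moreover have "gauss (tau + th) (y + xi) - gauss tau (y + xi) - gauss_dt tau y * th = th * (gauss_dt z (y + xi) - gauss_dt tau y)"
    using z(3) by (simp add: algebra_simps)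
   ultimately show ?thesis using t by (simp add: abs_mult mult.commute)
  qed simp
 qed
qed

lemma gauss_taylor:
 assumes tau: "tau > 0" and D: "D >= 0" and dl: "dl > 0"
 shows "\<exists>rho>0. \<forall>(y::real^'n) xi th. norm y <= D --> norm xi < rho --> - rho < th --> th <= 0 -->
  \<bar>gauss (tau + th) (y + xi) - gauss tau y * (1 - y \<bullet> xi / (2 * tau) - (norm xi)\<^sup>2 / (4 * tau) + (y \<bullet> xi)\<^sup>2 / (8 * tau\<^sup>2)
    + ((norm y)\<^sup>2 / (4 * tau\<^sup>2) - CARD('n) / (2 * tau)) * th)\<bar> <= dl * ((norm xi)\<^sup>2 - th)"
proof -
 obtain r1 where r1: "r1 > 0" "!!(y::real^'n) xi. norm y <= D ==> norm xi < r1 ==>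
  \<bar>gauss tau (y + xi) - gauss tau y * (1 - y \<bullet> xi / (2 * tau) - (norm xi)\<^sup>2 / (4 * tau) + (y \<bullet> xi)\<^sup>2 / (8 * tau\<^sup>2))\<bar>
   <= dl * (norm xi)\<^sup>2"
  using gauss_space_taylor[OF assms, where 'n='n] by metis
 obtain r2 where r2: "r2 > 0" "!!(y::real^'n) xi th. norm y <= D ==> norm xi < r2 ==> - r2 < th ==> th <= 0 ==>
  \<bar>gauss (tau + th) (y + xi) - gauss tau (y + xi) - gauss_dt tau y * th\<bar> <= dl * (- th)"
  using gauss_time_taylor[OF assms, where 'n='n] by metis
 show ?thesis
 proof (rule exI[of _ "min r1 r2"], intro conjI allI impI)
  show "min r1 r2 > 0" using r1 r2 by simp
  fix y xi :: "real^'n" and th :: real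
  assume a: "norm y <= D" "norm xi < min r1 r2" "- min r1 r2 < th" "th <= 0"
  define A where "A = gauss tau y * (1 - y \<bullet> xi / (2 * tau) - (norm xi)\<^sup>2 / (4 * tau) + (y \<bullet> xi)\<^sup>2 / (8 * tau\<^sup>2))"
  have e: "gauss tau y * (1 - y \<bullet> xi / (2 * tau) - (norm xi)\<^sup>2 / (4 * tau) + (y \<bullet> xi)\<^sup>2 / (8 * tau\<^sup>2)
    + ((norm y)\<^sup>2 / (4 * tau\<^sup>2) - CARD('n) / (2 * tau)) * th) = A + gauss_dt tau y * th"
   by (simp add: A_def gauss_dt_def algebra_simps)
  have "\<bar>gauss tau (y + xi) - A\<bar> <= dl * (norm xi)\<^sup>2" unfolding A_def using a by (intro r1(2)) auto
  moreover have "\<bar>gauss (tau + th) (y + xi) - gauss tau (y + xi) - gauss_dt tau y * th\<bar> <= dl * (- th)"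
   using a by (intro r2(2)) auto
  ultimately show "\<bar>gauss (tau + th) (y + xi) - gauss tau y * (1 - y \<bullet> xi / (2 * tau) - (norm xi)\<^sup>2 / (4 * tau) + (y \<bullet> xi)\<^sup>2 / (8 * tau\<^sup>2)
    + ((norm y)\<^sup>2 / (4 * tau\<^sup>2) - CARD('n) / (2 * tau)) * th)\<bar> <= dl * ((norm xi)\<^sup>2 - th)"
   unfolding e right_diff_distrib by linarith
 qed
qed

text \<open>Second order in space, first order in time, and only towards the past th <= 0, the
  direction in which contact is tested.\<close>

definition parab_taylor :: "(real^'n => real => real) => real^'n => real => real^'n => real^'n^'n => real => bool" where
 "parab_taylor U q tau b V a \<longleftrightarrow> (\<forall>dl>0. \<exists>rho>0. \<forall>xi th. norm xi < rho --> - rho < th --> th <= 0 -->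
   \<bar>U (q + xi) (tau + th) - U q tau - quadratic_test b V a xi th\<bar> <= dl * ((norm xi)\<^sup>2 - th))"

section \<open>Calculus of parabolic expansions\<close>

lemma quadratic_test_add:
 "quadratic_test (b + b') (V + V') (a + a') xi th = quadratic_test b V a xi th + quadratic_test b' V' a' xi th"
 by (simp add: quadratic_test_def inner_add_left matrix_vector_mult_add_rdistrib inner_add_right
   add_divide_distrib algebra_simps)

lemma quadratic_test_scale:
 "quadratic_test (k *\<^sub>R b) (k *\<^sub>R V) (k * a) xi th = k * quadratic_test b V a xi th"
 by (simp add: quadratic_test_def scaleR_matrix_vector_assoc[symmetric] algebra_simps)

lemma parab_taylor_add:
 fixes q :: "real^'n"
 assumes U: "parab_taylor U q tau b V a" and U': "parab_taylor U' q tau b' V' a'"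
 shows "parab_taylor (%x t. U x t + U' x t) q tau (b + b') (V + V') (a + a')"
 unfolding parab_taylor_def
proof (intro allI impI)
 fix dl :: real assume "dl > 0"
 then have h: "dl / 2 > 0" by simp
 obtain r1 where r1: "r1 > 0" "!!(xi :: real^'n) th. norm xi < r1 ==> - r1 < th ==> th <= 0 ==>
   \<bar>U (q + xi) (tau + th) - U q tau - quadratic_test b V a xi th\<bar> <= dl / 2 * ((norm xi)\<^sup>2 - th)"
  using U h unfolding parab_taylor_def by metis
 obtain r2 where r2: "r2 > 0" "!!(xi :: real^'n) th. norm xi < r2 ==> - r2 < th ==> th <= 0 ==>
   \<bar>U' (q + xi) (tau + th) - U' q tau - quadratic_test b' V' a' xi th\<bar> <= dl / 2 * ((norm xi)\<^sup>2 - th)"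
  using U' h unfolding parab_taylor_def by metis
 show "\<exists>rho>0. \<forall>xi th. norm xi < rho --> - rho < th --> th <= 0 -->
   \<bar>U (q + xi) (tau + th) + U' (q + xi) (tau + th) - (U q tau + U' q tau) - quadratic_test (b + b') (V + V') (a + a') xi th\<bar>
   <= dl * ((norm xi)\<^sup>2 - th)"
 proof (rule exI[of _ "min r1 r2"], intro conjI allI impI)
  show "min r1 r2 > 0" using r1 r2 by simp
  fix xi :: "real^'n" and th :: real assume "norm xi < min r1 r2" "- min r1 r2 < th" "th <= 0"
  then have "norm xi < r1" "norm xi < r2" "- r1 < th" "- r2 < th" "th <= 0" by auto
  then show "\<bar>U (q + xi) (tau + th) + U' (q + xi) (tau + th) - (U q tau + U' q tau) - quadratic_test (b + b') (V + V') (a + a') xi th\<bar>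
   <= dl * ((norm xi)\<^sup>2 - th)"
   using add_mono[OF r1(2)[of xi th] r2(2)[of xi th]]
    abs_triangle_ineq[of "U (q + xi) (tau + th) - U q tau - quadratic_test b V a xi th" "U' (q + xi) (tau + th) - U' q tau - quadratic_test b' V' a' xi th"]
   unfolding quadratic_test_add by (simp add: algebra_simps)
 qed
qed

lemma parab_taylor_scale:
 fixes q :: "real^'n"
 assumes U: "parab_taylor U q tau b V a" and k: "k > 0"
 shows "parab_taylor (%x t. k * U x t) q tau (k *\<^sub>R b) (k *\<^sub>R V) (k * a)"
 unfolding parab_taylor_def
proof (intro allI impI)
 fix dl :: real assume "dl > 0"
 then have h: "dl / k > 0" using k by simp
 obtain r1 where r1: "r1 > 0" "!!(xi :: real^'n) th. norm xi < r1 ==> - r1 < th ==> th <= 0 ==>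
   \<bar>U (q + xi) (tau + th) - U q tau - quadratic_test b V a xi th\<bar> <= dl / k * ((norm xi)\<^sup>2 - th)"
  using U h unfolding parab_taylor_def by metis
 show "\<exists>rho>0. \<forall>xi th. norm xi < rho --> - rho < th --> th <= 0 -->
   \<bar>k * U (q + xi) (tau + th) - k * U q tau - quadratic_test (k *\<^sub>R b) (k *\<^sub>R V) (k * a) xi th\<bar> <= dl * ((norm xi)\<^sup>2 - th)"
 proof (rule exI[of _ r1], intro conjI allI impI)
  fix xi :: "real^'n" and th :: real assume "norm xi < r1" "- r1 < th" "th <= 0"
  then have "k * \<bar>U (q + xi) (tau + th) - U q tau - quadratic_test b V a xi th\<bar> <= k * (dl / k * ((norm xi)\<^sup>2 - th))"
   using r1(2)[of xi th] k by (intro mult_left_mono) auto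
  then show "\<bar>k * U (q + xi) (tau + th) - k * U q tau - quadratic_test (k *\<^sub>R b) (k *\<^sub>R V) (k * a) xi th\<bar> <= dl * ((norm xi)\<^sup>2 - th)"
   unfolding quadratic_test_scale using k by (simp add: abs_mult_pos' right_diff_distrib)
 qed fact
qed

lemma parab_taylor_time: "parab_taylor (%x t. k * t) q tau 0 0 k"
 unfolding parab_taylor_def quadratic_test_def
proof (intro allI impI exI[of _ 1] conjI)
 fix dl th :: real and xi :: "real^'n" assume "dl > 0" "th <= 0"
 then have "0 <= dl * ((norm xi)\<^sup>2 - th)" by (intro mult_nonneg_nonneg) (auto intro: order_trans[of _ 0])
 then show "\<bar>k * (tau + th) - k * tau - (0 \<bullet> xi + xi \<bullet> (0 *v xi) / 2 + k * th)\<bar> <= dl * ((norm xi)\<^sup>2 - th)"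
  by (simp add: distrib_left)
qed simp

lemma inner_matrix_vector:
 "(xi::real^'n) \<bullet> (V *v xi) = (\<Sum>i\<in>UNIV. \<Sum>j\<in>UNIV. xi $ i * xi $ j * V $ i $ j)"
 by (simp add: inner_vec_def matrix_vector_mult_def sum_distrib_left mult_ac)

lemma inner_square_cart: "((y::real^'n) \<bullet> xi)\<^sup>2 = (\<Sum>i\<in>UNIV. \<Sum>j\<in>UNIV. xi $ i * xi $ j * (y $ i * y $ j))"
 by (simp add: inner_vec_def power2_eq_square sum_product mult_ac)

lemma norm_square_cart2: "(norm (xi::real^'n))\<^sup>2 = (\<Sum>i\<in>UNIV. \<Sum>j\<in>UNIV. xi $ i * xi $ j * (if i = j then 1 else 0))"
 unfolding norm2_cart by (simp add: power2_eq_square if_distrib cong: if_cong)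

text \<open>The caloric polynomial with initial value |q|^4. It serves as the lateral penalty in
  \<open>heat_comparison\<close>: at q = 0 it costs only order tau^2, whereas the one starting from
  |q|^2 would cost order tau, the size of the effect to be measured.\<close>

definition quartic :: "real^'n => real => real" where
 "quartic q tau = (norm q) ^ 4 + (4 * real CARD('n) + 8) * tau * (norm q)\<^sup>2 + real CARD('n) * (4 * real CARD('n) + 8) * tau\<^sup>2"

lemma quartic_taylor:
 fixes q :: "real^'n"
 shows "\<exists>b V. parab_taylor quartic q tau b V (trace V) & (\<forall>i j. V $ i $ j = V $ j $ i)"
proof -
 define m where "m = (4 * real CARD('n) + 8)"
 define N where "N = (norm q)\<^sup>2"
 define b where "b = (4 * N + 2 * m * tau) *\<^sub>R q"
 define V where "V = (\<chi> i j. 8 * (q $ i * q $ j) + (4 * N + 2 * m * tau) * (if i = j then 1 else 0) :: real^'n^'n)"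
 have qV: "xi \<bullet> (V *v xi) = 8 * (q \<bullet> xi)\<^sup>2 + (4 * N + 2 * m * tau) * (norm xi)\<^sup>2" for xi
  unfolding inner_matrix_vector inner_square_cart norm_square_cart2
  by (simp add: V_def distrib_left sum.distrib sum_distrib_left mult_ac)
 have tr: "trace V = m * N + 2 * CARD('n) * m * tau"
 proof -
  have "trace V = (\<Sum>i\<in>UNIV. 8 * (q $ i)\<^sup>2 + (4 * N + 2 * m * tau))"
   by (simp add: V_def trace_def power2_eq_square)
  also have "... = 8 * N + CARD('n) * (4 * N + 2 * m * tau)"
   by (simp add: sum.distrib sum_distrib_left[symmetric] N_def norm2_cart)
  finally show ?thesis by (simp add: m_def algebra_simps)
 qed
 have sym: "V $ i $ j = V $ j $ i" for i j by (simp add: V_def)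
 have "parab_taylor quartic q tau b V (trace V)"
  unfolding parab_taylor_def
 proof (intro allI impI)
  fix dl :: real assume dl: "dl > 0"
  define n where "n = real CARD('n)"
  define C where "C = (4 * norm q + 1) + m * (2 * norm q + 1) + n * m"
  have mn: "m > 0" "n > 0" by (auto simp: m_def n_def add_nonneg_pos)
  then have C: "C > 0" "4 * norm q + 1 <= C" "m * (2 * norm q + 1) + n * m <= C"
   by (auto simp: C_def add_pos_nonneg add_nonneg_pos)
  define r where "r = min 1 (dl / C)"
  have r: "r > 0" "r <= 1" "C * r <= dl" using dl C by (auto simp: r_def min_def field_simps)
  show "\<exists>rho>0. \<forall>xi th. norm xi < rho --> - rho < th --> th <= 0 -->
   \<bar>quartic (q + xi) (tau + th) - quartic q tau - quadratic_test b V (trace V) xi th\<bar> <= dl * ((norm xi)\<^sup>2 - th)"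
  proof (rule exI[of _ r], intro conjI allI impI)
   show "r > 0" by fact
   fix xi :: "real^'n" and th :: real assume a: "norm xi < r" "- r < th" "th <= 0"
   have qf: "quartic x t = norm x ^ 4 + m * t * (norm x)\<^sup>2 + n * m * t\<^sup>2" for x :: "real^'n" and t
    by (simp add: quartic_def m_def n_def)
   define e where "e = norm xi"
   define s where "s = q \<bullet> xi"
   have e: "0 <= e" "e <= 1" "e < r" using a r by (auto simp: e_def)
   have s: "\<bar>s\<bar> <= norm q * e" using Cauchy_Schwarz_ineq2[of q xi] by (simp add: s_def e_def)
   have n2: "(norm (q + xi))\<^sup>2 = N + (2 * s + e\<^sup>2)"
    by (simp add: N_def s_def e_def power2_norm_eq_inner inner_add_left inner_add_right inner_commute)
   have n4: "norm (q + xi) ^ 4 = (N + (2 * s + e\<^sup>2))\<^sup>2" "norm q ^ 4 = N\<^sup>2"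
    by (simp only: n2[symmetric], simp) (simp add: N_def)
   have qt: "quadratic_test b V (trace V) xi th = (4 * N + 2 * m * tau) * s + (4 * s\<^sup>2 + (2 * N + m * tau) * e\<^sup>2) + (m * N + 2 * n * m * tau) * th"
   proof -
    have "b \<bullet> xi = (4 * N + 2 * m * tau) * s" by (simp add: b_def s_def)
    moreover have "(8 * s\<^sup>2 + (4 * N + 2 * m * tau) * e\<^sup>2) / 2 = 4 * s\<^sup>2 + (2 * N + m * tau) * e\<^sup>2"
     by (simp add: field_simps)
    ultimately show ?thesis unfolding quadratic_test_def qV tr by (simp add: s_def e_def n_def)
   qed
   have "quartic (q + xi) (tau + th) - quartic q tau - quadratic_test b V (trace V) xi th =
     (4 * s * e\<^sup>2 + e ^ 4) + (m * (2 * s + e\<^sup>2) * th + n * m * th\<^sup>2)"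
    unfolding qf qt n2 n4 N_def[symmetric]
    by (simp add: power2_eq_square eval_nat_numeral algebra_simps)
   moreover have "\<bar>4 * s * e\<^sup>2 + e ^ 4\<bar> <= dl * e\<^sup>2"
   proof -
    have "4 * s * e\<^sup>2 + e ^ 4 = (4 * s + e\<^sup>2) * e\<^sup>2" by (simp add: algebra_simps eval_nat_numeral)
    moreover have "e\<^sup>2 <= e" using e by (simp add: power2_eq_square mult_left_le)
    then have "\<bar>4 * s + e\<^sup>2\<bar> <= (4 * norm q + 1) * e" using s abs_triangle_ineq[of "4 * s" "e\<^sup>2"] by (simp add: algebra_simps)
    then have "\<bar>4 * s + e\<^sup>2\<bar> <= dl"
     using mult_mono[OF C(2), of e r] e r C by linarith
    ultimately show ?thesis by (simp add: abs_mult mult_right_mono)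
   qed
   moreover have "\<bar>m * (2 * s + e\<^sup>2) * th + n * m * th\<^sup>2\<bar> <= dl * (- th)"
   proof -
    have "m * (2 * s + e\<^sup>2) * th + n * m * th\<^sup>2 = (m * (2 * s + e\<^sup>2) + n * m * th) * th"
     by (simp add: algebra_simps power2_eq_square)
    moreover have "\<bar>m * (2 * s + e\<^sup>2) + n * m * th\<bar> <= dl"
    proof -
     have "e\<^sup>2 <= e" using e by (simp add: power2_eq_square mult_left_le)
     then have "\<bar>2 * s + e\<^sup>2\<bar> <= (2 * norm q + 1) * e" using s abs_triangle_ineq[of "2 * s" "e\<^sup>2"] by (simp add: algebra_simps)
     also have "... <= (2 * norm q + 1) * r" using e by (intro mult_left_mono) auto
     finally have "m * \<bar>2 * s + e\<^sup>2\<bar> <= m * ((2 * norm q + 1) * r)" using mn by (intro mult_left_mono) auto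
     moreover have "n * m * \<bar>th\<bar> <= n * m * r" using a mn by (intro mult_left_mono) auto
     moreover have "\<bar>m * (2 * s + e\<^sup>2) + n * m * th\<bar> <= m * \<bar>2 * s + e\<^sup>2\<bar> + n * m * \<bar>th\<bar>"
      using mn abs_triangle_ineq[of "m * (2 * s + e\<^sup>2)" "n * m * th"] by (simp add: abs_mult)
     moreover have "m * ((2 * norm q + 1) * r) + n * m * r <= C * r"
      using mult_right_mono[OF C(3), of r] r by (simp add: algebra_simps)
     ultimately show ?thesis using r(3) by linarith
    qed
    ultimately show ?thesis using a by (simp add: abs_mult mult_right_mono_neg)
   qed
   ultimately show "\<bar>quartic (q + xi) (tau + th) - quartic q tau - quadratic_test b V (trace V) xi th\<bar> <= dl * ((norm xi)\<^sup>2 - th)"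
    unfolding e_def[symmetric] right_diff_distrib by linarith
  qed
 qed
 then show ?thesis using sym by blast
qed

text \<open>The heat evolution of \<open>G\<close> set to zero outside the cube; for nonnegative
  \<open>G\<close> the cut-off does no harm to lower bounds near the centre.\<close>

definition heat :: "real => (real^'n => real) => real^'n => real => real" where
 "heat d G q tau = integral (cube d) (%z. gauss tau (q - z) * G z)"

lemma heat_integrable:
 assumes "tau > 0" "continuous_on (cube d) G" "continuous_on (cube d) f"
 shows "(%z. gauss tau (q - z) * G z * f z) integrable_on (cube d :: (real^'n) set)"
 using assms unfolding cube_def
 by (intro integrable_continuous continuous_intros continuous_on_gauss) auto

text \<open>The expansion of the kernel is uniform on the cube and so integrates against
  \<open>G\<close>. By \<open>trf\<close> the time coefficient of the kernel is the trace of its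
  Hessian coefficient; the heat equation therefore appears as \<open>trace V\<close> in the slot of
  the time derivative.\<close>

lemma heat_taylor:
 fixes q :: "real^'n"
 assumes tau: "tau > 0" and G: "continuous_on (cube d) G"
 shows "\<exists>b V. parab_taylor (heat d G) q tau b V (trace V) & (\<forall>i j. V $ i $ j = V $ j $ i)"
proof -
 define I where "I f = integral (cube d) (%z. gauss tau (q - z) * G z * f z)" for f :: "real^'n => real"
 have int: "(%z. gauss tau (q - z) * G z * f z) integrable_on cube d" if "continuous_on (cube d) f" for f :: "real^'n => real"
  by (rule heat_integrable[OF tau G that])
 have hI: "((%z. gauss tau (q - z) * G z * f z) has_integral I f) (cube d)" if "continuous_on (cube d) f" for f :: "real^'n => real"
  unfolding I_def by (rule integrable_integral[OF int[OF that]])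
 define bf where "bf i z = - (q - z) $ i / (2 * tau)" for i and z :: "real^'n"
 define Vf where "Vf i j z = (q - z) $ i * (q - z) $ j / (4 * tau\<^sup>2) - (if i = j then 1 / (2 * tau) else 0)" for i j and z :: "real^'n"
 have cb: "continuous_on (cube d) (bf i)" for i unfolding bf_def by (intro continuous_intros) (use tau in auto)
 have cV: "continuous_on (cube d) (Vf i j)" for i j unfolding Vf_def by (intro continuous_intros) (use tau in auto)
 define b where "b = (\<chi> i. I (bf i))"
 define V where "V = (\<chi> i j. I (Vf i j))"
 have sym: "V $ i $ j = V $ j $ i" for i j
 proof -
  have "Vf i j = Vf j i" by (rule ext) (auto simp: Vf_def mult.commute)
  then show ?thesis by (simp add: V_def)
 qed
 have tr: "((%z. gauss tau (q - z) * G z * (\<Sum>i\<in>UNIV. Vf i i z)) has_integral trace V) (cube d)"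
 proof -
  have "((%z. \<Sum>i\<in>UNIV. gauss tau (q - z) * G z * Vf i i z) has_integral (\<Sum>i\<in>UNIV. I (Vf i i))) (cube d)"
   by (intro has_integral_sum hI cV) auto
  then show ?thesis by (simp add: trace_def V_def sum_distrib_left)
 qed
 have hb: "((%z. gauss tau (q - z) * G z * (\<Sum>i\<in>UNIV. bf i z * xi $ i)) has_integral b \<bullet> xi) (cube d)" for xi
 proof -
  have "((%z. \<Sum>i\<in>UNIV. gauss tau (q - z) * G z * bf i z * xi $ i) has_integral (\<Sum>i\<in>UNIV. I (bf i) * xi $ i)) (cube d)"
   by (intro has_integral_sum has_integral_mult_left hI cb) auto
  then show ?thesis by (simp add: inner_vec_def b_def sum_distrib_left mult.assoc)
 qed
 have hV: "((%z. gauss tau (q - z) * G z * (\<Sum>i\<in>UNIV. \<Sum>j\<in>UNIV. Vf i j z * (xi $ i * xi $ j))) has_integral xi \<bullet> (V *v xi)) (cube d)" for xi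
 proof -
  have "((%z. \<Sum>i\<in>UNIV. \<Sum>j\<in>UNIV. gauss tau (q - z) * G z * Vf i j z * (xi $ i * xi $ j)) has_integral (\<Sum>i\<in>UNIV. \<Sum>j\<in>UNIV. I (Vf i j) * (xi $ i * xi $ j))) (cube d)"
   by (intro has_integral_sum has_integral_mult_left hI cV) auto
  then show ?thesis unfolding inner_matrix_vector
   by (simp add: V_def sum_distrib_left mult_ac)
 qed
 have trf: "(\<Sum>i\<in>UNIV. Vf i i z) = (norm (q - z))\<^sup>2 / (4 * tau\<^sup>2) - real CARD('n) / (2 * tau)" for z
 proof -
  have n: "(norm (q - z))\<^sup>2 = (\<Sum>i\<in>UNIV. (q - z) $ i * (q - z) $ i)"
   unfolding norm2_cart by (simp add: power2_eq_square)
  show ?thesis unfolding n by (simp add: Vf_def sum_subtractf sum_divide_distrib[symmetric])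
 qed
 have bff: "(\<Sum>i\<in>UNIV. bf i z * xi $ i) = - ((q - z) \<bullet> xi / (2 * tau))" for z xi
 proof -
  have "bf i z * xi $ i = - ((q - z) $ i * xi $ i / (2 * tau))" for i
   unfolding bf_def by (simp only: minus_mult_left minus_divide_left times_divide_eq_left)
  then show ?thesis by (simp only: sum_negf inner_vec_def inner_real_def sum_divide_distrib)
 qed
 have Vff: "(\<Sum>i\<in>UNIV. \<Sum>j\<in>UNIV. Vf i j z * (xi $ i * xi $ j)) = ((q - z) \<bullet> xi)\<^sup>2 / (4 * tau\<^sup>2) - (norm xi)\<^sup>2 / (2 * tau)" for z xi
 proof -
  have "Vf i j z * (xi $ i * xi $ j) = xi $ i * xi $ j * ((q - z) $ i * (q - z) $ j) / (4 * tau\<^sup>2)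
    - xi $ i * xi $ j * (if i = j then 1 else 0) / (2 * tau)" for i j
  proof -
   have "(x * y / k - (if i = j then 1 / l else 0)) * u = u * (x * y) / k - u * (if i = j then 1 else 0) / l" for x y k l u :: real
    by (cases "i = j") (simp_all add: right_diff_distrib mult_ac)
   then show ?thesis unfolding Vf_def .
  qed
  then show ?thesis
   unfolding inner_square_cart norm_square_cart2 by (simp only: sum_subtractf sum_divide_distrib)
 qed
 obtain B where B: "B > 0" "!!z. z \<in> cube d ==> \<bar>G z\<bar> <= B"
 proof -
  have "bounded (G ` cube d)" using G compact_cube by (intro compact_imp_bounded compact_continuous_image) auto
  then show thesis using that unfolding bounded_pos by force
 qed
 define D where "D = norm q + real CARD('n) * \<bar>d\<bar>"
 have D: "D >= 0" by (simp add: D_def)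
 have yD: "norm (q - z) <= D" if "z \<in> cube d" for z
 proof -
  have "norm z <= real CARD('n) * d" using that by (rule norm_cube)
  also have "... <= real CARD('n) * \<bar>d\<bar>" by (intro mult_left_mono) auto
  finally show ?thesis using norm_triangle_ineq4[of q z] by (simp add: D_def)
 qed
 define c where "c = measure lborel (cube d :: (real^'n) set)"
 have c: "c >= 0" by (simp add: c_def)
 have "parab_taylor (heat d G) q tau b V (trace V)"
  unfolding parab_taylor_def
 proof (intro allI impI)
  fix dl :: real assume dl: "dl > 0"
  define dl' where "dl' = dl / (B * c + 1)"
  have Bc: "B * c >= 0" using B c by simp
  have dl': "dl' > 0" using dl Bc by (simp add: dl'_def)
  have dl2: "dl' * B * c <= dl"
  proof -
   have "dl' * (B * c) <= dl' * (B * c + 1)" using dl' by (intro mult_left_mono) auto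
   then show ?thesis using Bc by (simp add: dl'_def mult.assoc)
  qed
  obtain r where r: "r > 0" "!!(y::real^'n) xi th. norm y <= D ==> norm xi < r ==> - r < th ==> th <= 0 ==>
   \<bar>gauss (tau + th) (y + xi) - gauss tau y * (1 - y \<bullet> xi / (2 * tau) - (norm xi)\<^sup>2 / (4 * tau) + (y \<bullet> xi)\<^sup>2 / (8 * tau\<^sup>2)
    + ((norm y)\<^sup>2 / (4 * tau\<^sup>2) - real CARD('n) / (2 * tau)) * th)\<bar> <= dl' * ((norm xi)\<^sup>2 - th)"
   using gauss_taylor[OF tau D dl', where 'n='n] by metis
  show "\<exists>rho>0. \<forall>xi th. norm xi < rho --> - rho < th --> th <= 0 -->
   \<bar>heat d G (q + xi) (tau + th) - heat d G q tau - quadratic_test b V (trace V) xi th\<bar> <= dl * ((norm xi)\<^sup>2 - th)"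
  proof (rule exI[of _ "min r (tau / 2)"], intro conjI allI impI)
   show "min r (tau / 2) > 0" using r tau by simp
   fix xi :: "real^'n" and th :: real
   assume a: "norm xi < min r (tau / 2)" "- min r (tau / 2) < th" "th <= 0"
   have t': "tau + th > 0" using a tau by auto
   define K where "K = (norm xi)\<^sup>2 - th"
   have K: "K >= 0" using a by (simp add: K_def order_trans[of _ 0])
   define T where "T z = (\<Sum>i\<in>UNIV. bf i z * xi $ i) + (\<Sum>i\<in>UNIV. \<Sum>j\<in>UNIV. Vf i j z * (xi $ i * xi $ j)) / 2 + (\<Sum>i\<in>UNIV. Vf i i z) * th" for z
   have h1: "((%z. gauss (tau + th) (q + xi - z) * G z) has_integral heat d G (q + xi) (tau + th)) (cube d)"
    unfolding heat_def using heat_integrable[OF t' G, of "%z. 1" "q + xi"] by (simp add: integrable_integral)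
   have h2: "((%z. gauss tau (q - z) * G z) has_integral heat d G q tau) (cube d)"
    unfolding heat_def using heat_integrable[OF tau G, of "%z. 1" q] by (simp add: integrable_integral)
   have h3: "((%z. gauss tau (q - z) * G z * T z) has_integral quadratic_test b V (trace V) xi th) (cube d)"
    using has_integral_add[OF has_integral_add[OF hb[of xi] has_integral_mult_left[OF hV[of xi], of "1 / 2"]]
     has_integral_mult_left[OF tr, of th]]
    by (simp add: quadratic_test_def T_def distrib_left mult.assoc)
   have h: "((%z. gauss (tau + th) (q + xi - z) * G z - gauss tau (q - z) * G z - gauss tau (q - z) * G z * T z) has_integral
     heat d G (q + xi) (tau + th) - heat d G q tau - quadratic_test b V (trace V) xi th) (cube d)"
    by (intro has_integral_diff h1 h2 h3)
   have "norm (heat d G (q + xi) (tau + th) - heat d G q tau - quadratic_test b V (trace V) xi th) <= dl' * K * B * c"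
    unfolding c_def cube_def
   proof (rule has_integral_bound[OF _ h[unfolded cube_def]])
    show "0 <= dl' * K * B" using dl' K B by simp
    fix z :: "real^'n" assume z: "z \<in> cbox (- (\<chi> i. d)) (\<chi> i. d)"
    then have z': "z \<in> cube d" by (simp add: cube_def)
    have "\<bar>gauss (tau + th) ((q - z) + xi) - gauss tau (q - z) * (1 + T z)\<bar> <= dl' * K"
     using r(2)[OF yD[OF z'], of xi th] a unfolding K_def T_def trf bff Vff
     by (simp add: diff_divide_distrib algebra_simps)
    then have "\<bar>gauss (tau + th) ((q - z) + xi) - gauss tau (q - z) * (1 + T z)\<bar> * \<bar>G z\<bar> <= dl' * K * B"
     using B(2)[OF z'] dl' K by (intro mult_mono) auto
    moreover have "gauss (tau + th) (q + xi - z) * G z - gauss tau (q - z) * G z - gauss tau (q - z) * G z * T z =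
     (gauss (tau + th) ((q - z) + xi) - gauss tau (q - z) * (1 + T z)) * G z"
     by (simp add: algebra_simps)
    ultimately show "norm (gauss (tau + th) (q + xi - z) * G z - gauss tau (q - z) * G z - gauss tau (q - z) * G z * T z) <= dl' * K * B"
     by (simp add: abs_mult)
   qed
   also have "... = dl' * B * c * K" by simp
   also have "... <= dl * K" using dl2 K by (rule mult_right_mono)
   finally show "\<bar>heat d G (q + xi) (tau + th) - heat d G q tau - quadratic_test b V (trace V) xi th\<bar> <= dl * ((norm xi)\<^sup>2 - th)"
    by (simp add: K_def)
  qed
 qed
 then show ?thesis using sym by blast
qed

lemma heat_nonneg:
 fixes q :: "real^'n"
 assumes "!!z. z \<in> cube d ==> G z >= 0"
 shows "heat d G q tau >= 0"
 unfolding heat_def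
 by (cases "(%z. gauss tau (q - z) * G z) integrable_on cube d")
  (auto simp: not_integrable_integral intro!: Henstock_Kurzweil_Integration.integral_nonneg mult_nonneg_nonneg assms less_imp_le[OF gauss_pos])

lemma translated_gauss_integral:
 fixes q :: "real^'n"
 shows "integral (cbox (q - (\<chi> i. s)) (q + (\<chi> i. s))) (%z. gauss tau (q - z)) = integral (cube s) (gauss tau :: real^'n => real)"
proof -
 have "integral (cbox (- (\<chi> i. s)) (\<chi> i. s)) (gauss tau :: real^'n => real) =
  integral (cbox (- (\<chi> i. s)) (\<chi> i. s)) ((%z. gauss tau (q - z)) \<circ> (%z. q + z))"
  by (simp add: o_def gauss_minus)
 also have "... = integral (cbox (- (\<chi> i. s) + q) ((\<chi> i. s) + q)) (%z. gauss tau (q - z))"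
  using integral_shift_cbox_plus[of "- (\<chi> i. s)" "\<chi> i. s" "%z. gauss tau (q - z)" q]
  by (simp add: o_def add.commute)
 finally show ?thesis by (simp add: cube_def add.commute)
qed

text \<open>A lower bound suffices because the heat solution acts as an upper barrier. Since
  \<open>G\<close> >= 0 the integral may be restricted to a small cube about q, where
  \<open>G\<close> is close to G q and the kernel has almost full mass.\<close>

lemma heat_initial:
 fixes G :: "real^'n => real"
 assumes G: "continuous_on (cube d) G" and pos: "!!z. z \<in> cube d ==> G z >= 0" and R: "0 < R" "R < d" and e: "e > 0"
 shows "\<exists>T>0. \<forall>tau q. 0 < tau --> tau <= T --> norm q <= R --> G q - e <= heat d G q tau"
proof -
 obtain B where B: "B > 0" "!!z. z \<in> cube d ==> G z <= B"
 proof -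
  have "bounded (G ` cube d)" using G compact_cube by (intro compact_imp_bounded compact_continuous_image) auto
  then show thesis using that unfolding bounded_pos by (metis abs_le_D1 imageI real_norm_def)
 qed
 have "uniformly_continuous_on (cube d) G" using G compact_cube by (rule compact_uniformly_continuous)
 then obtain h where h: "h > 0" "!!z z'. z \<in> cube d ==> z' \<in> cube d ==> dist z' z < h ==> dist (G z') (G z) < e / 2"
  unfolding uniformly_continuous_on_def using e by (metis half_gt_zero)
 define s where "s = min (d - R) (h / (2 * real CARD('n)))"
 have s: "s > 0" "s <= d - R" "real CARD('n) * s < h"
 proof -
  show "s > 0" using R h by (simp add: s_def)
  show "s <= d - R" by (simp add: s_def)
  have "real CARD('n) * s <= real CARD('n) * (h / (2 * real CARD('n)))" by (intro mult_left_mono) (auto simp: s_def)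
  then show "real CARD('n) * s < h" using h by simp
 qed
 have lim: "((%tau. (1 - 2 * tau / s\<^sup>2) ^ CARD('n) * B) \<longlongrightarrow> (1 - 2 * 0 / s\<^sup>2) ^ CARD('n) * B) (at_right 0)"
  by (intro tendsto_intros) (use s in auto)
 then have "eventually (%tau. B - e / 2 < (1 - 2 * tau / s\<^sup>2) ^ CARD('n) * B) (at_right 0)"
  using e by (intro order_tendstoD(1)[OF lim]) auto
 then obtain T0 where T0: "T0 > 0" "!!tau. 0 < tau ==> tau < T0 ==> B - e / 2 < (1 - 2 * tau / s\<^sup>2) ^ CARD('n) * B"
  unfolding eventually_at_right_field by auto
 define T where "T = min (T0 / 2) (s\<^sup>2 / 2)"
 have T: "T > 0" using T0 s by (simp add: T_def)
 show ?thesis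
 proof (rule exI[of _ T], intro conjI allI impI)
  show "T > 0" by fact
  fix tau and q :: "real^'n" assume t: "0 < tau" "tau <= T" and q: "norm q <= R"
  let ?c = "cbox (q - (\<chi> i. s)) (q + (\<chi> i. s))"
  have sub: "?c \<subseteq> cube d"
  proof
   fix z assume z: "z \<in> ?c"
   have "\<bar>z $ i\<bar> <= d" for i
   proof -
    have "\<bar>q $ i\<bar> <= R" using component_le_norm_cart[of q i] q by simp
    moreover have "q $ i - s <= z $ i" "z $ i <= q $ i + s" using z by (auto simp: mem_box_cart)
    ultimately show ?thesis using s by linarith
   qed
   then show "z \<in> cube d" by (simp add: mem_cube)
  qed
  have qd: "q \<in> cube d" using sub s by (auto simp: mem_box_cart)
  have near: "G z >= G q - e / 2" if "z \<in> ?c" for z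
  proof -
   have "z - q \<in> cube s" using that by (auto simp: mem_box_cart mem_cube abs_le_iff algebra_simps)
   then have "norm (z - q) <= real CARD('n) * s" using norm_cube[of "z - q" s] by simp
   then have "dist (G z) (G q) < e / 2" using h(2)[OF qd, of z] sub that s by (auto simp: dist_norm)
   then show ?thesis unfolding dist_real_def by linarith
  qed
  have gi: "(%z. gauss tau (q - z)) integrable_on ?c"
   using t by (intro integrable_continuous continuous_on_gauss continuous_intros) auto
  have gG: "(%z. gauss tau (q - z) * G z) integrable_on ?c"
   using t continuous_on_subset[OF G sub] by (intro integrable_continuous continuous_on_gauss continuous_intros) auto
  have gG': "(%z. gauss tau (q - z) * G z) integrable_on cube d"
   using heat_integrable[OF t(1) G, of "%z. 1" q] by simp
  define m where "m = integral (cube s) (gauss tau :: real^'n => real)"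
  have m1: "m <= 1" unfolding m_def by (rule gauss_mass(2)[OF t(1)])
  have m2: "(1 - 2 * tau / s\<^sup>2) ^ CARD('n) <= m"
   unfolding m_def using t s by (intro gauss_mass(3)) (auto simp: T_def)
  have m0: "m >= 0"
  proof -
   have "0 <= (1 - 2 * tau / s\<^sup>2) ^ CARD('n)" using t s by (intro zero_le_power) (auto simp: T_def field_simps)
   then show ?thesis using m2 by linarith
  qed
  have mm: "integral ?c (%z. gauss tau (q - z)) = m"
   unfolding m_def by (rule translated_gauss_integral)
  have "(G q - e / 2) * m = integral ?c (%z. gauss tau (q - z) * (G q - e / 2))"
   by (simp add: mm mult.commute)
  also have "... <= integral ?c (%z. gauss tau (q - z) * G z)"
   using near by (intro integral_le gG integrable_on_mult_left gi mult_left_mono less_imp_le[OF gauss_pos]) auto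
  also have "... <= heat d G q tau"
   unfolding heat_def
   by (intro integral_subset_le sub gG gG' ballI mult_nonneg_nonneg pos less_imp_le[OF gauss_pos]) auto
  finally have 1: "(G q - e / 2) * m <= heat d G q tau" .
  have "tau < T0" using t T0(1) by (simp add: T_def)
  then have "B - e / 2 < (1 - 2 * tau / s\<^sup>2) ^ CARD('n) * B" using t by (intro T0(2))
  moreover have "(1 - 2 * tau / s\<^sup>2) ^ CARD('n) * B <= m * B" using m2 B by (intro mult_right_mono) auto
  ultimately have "B - e / 2 <= m * B" by linarith
  then have "(1 - m) * B <= e / 2" by (simp add: algebra_simps)
  moreover have "(1 - m) * G q <= (1 - m) * B" using B(2)[OF qd] m1 by (intro mult_left_mono) auto
  ultimately have "G q - e / 2 <= G q * m" by (simp add: algebra_simps)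
  moreover have "e / 2 * m <= e / 2" using e m1 by (simp add: mult_left_le)
  ultimately show "G q - e <= heat d G q tau" using 1 by (simp add: algebra_simps)
 qed
qed

section \<open>Comparison with the heat flow\<close>

lemma continuous_on_heat:
 fixes G :: "real^'n => real"
 assumes G: "continuous_on (cube d) G" and tau0: "tau0 > 0"
 shows "continuous_on (S \<times> {tau0..}) (%z. heat d G (fst z) (snd z))"
proof -
 have "continuous_on ((S \<times> {tau0..}) \<times> cbox (- (\<chi> i. d)) (\<chi> i. d)) (%(x, z). gauss (snd x) (fst x - z) * G z)"
  unfolding split_beta'
 proof (intro continuous_intros continuous_on_gauss)
  show "continuous_on ((S \<times> {tau0..}) \<times> cbox (- (\<chi> i. d)) (\<chi> i. d)) (%x. G (snd x))"
   using G unfolding cube_def by (rule continuous_on_compose2) (auto intro: continuous_intros)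
 qed (use tau0 in auto)
 then show ?thesis
  unfolding heat_def cube_def by (rule integral_continuous_on_param)
qed

lemma quadratic_test_mat:
 "quadratic_test b (V + k *\<^sub>R mat 1) (a - k') xi th = quadratic_test b V a xi th + k / 2 * (norm xi)\<^sup>2 - k' * th"
 by (simp add: quadratic_test_def matrix_vector_mult_add_rdistrib inner_add_right add_divide_distrib
   scaleR_matrix_vector_assoc[symmetric] power2_norm_eq_inner algebra_simps)

text \<open>The premise \<open>touch\<close> makes g a viscosity subsolution of g_t = Laplacian g -
  c, tested in the past and only with positive definite Hessians; convexity of g in x makes this
  class of tests sufficient. The comparison function is the heat solution with the initial values of
  g, minus c tau, plus a multiple of \<open>quartic\<close>.\<close>

lemma heat_comparison:
 fixes g :: "real^'n => real => real"
 assumes cont: "continuous_on (cube d \<times> {s1..s2}) (%(x, t). g x t)"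
  and conv: "!!t. t \<in> {s1..s2} ==> convex_on UNIV (%x. g x t)"
  and bd: "!!x t. x \<in> cube d ==> t \<in> {s1..s2} ==> 0 <= g x t & g x t <= B"
  and R: "0 < R" "R < d" and c: "c >= 0" and B: "B > 0"
  and touch: "!!x1 t1 b V a rho. norm x1 < R ==> s1 < t1 ==> t1 <= s2 ==> (!!i j. V $ i $ j = V $ j $ i) ==>
   (!!xi. xi ~= 0 ==> xi \<bullet> (V *v xi) > 0) ==> rho > 0 ==>
   (!!xi th. norm xi < rho ==> - rho < th ==> th <= 0 ==> g (x1 + xi) (t1 + th) <= g x1 t1 + quadratic_test b V a xi th) ==>
   a <= trace V - c"
  and t: "s1 < t" "t <= s2"
 shows "g 0 t <= heat d (%z. g z s1) 0 (t - s1) - c * (t - s1) +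
   (B + c * (s2 - s1)) / R ^ 4 * (real CARD('n) * (4 * real CARD('n) + 8)) * (t - s1)\<^sup>2"
proof -
 define T where "T = s2 - s1"
 have T: "T > 0" "t - s1 <= T" using t by (auto simp: T_def)
 \<comment> \<open>On |x| = R the penalty is then at least B + c T, which exceeds g and compensates
   the subtracted c tau; so no positive maximum sits on the lateral boundary.\<close>
 define K where "K = (B + c * T) / R ^ 4"
 have K: "K > 0" using B c T R by (simp add: K_def add_pos_nonneg)
 define G where "G z = g z s1" for z
 have contG: "continuous_on (cube d) G"
 proof -
  have "continuous_on (cube d) ((%(x, t). g x t) \<circ> (%x. (x, s1)))"
   using t by (intro continuous_on_compose continuous_on_subset[OF cont] continuous_intros) auto
  then show ?thesis by (simp add: o_def G_def)
 qed
 have G0: "G z >= 0" if "z \<in> cube d" for z using bd[OF that] t by (simp add: G_def)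
 have ballR: "x \<in> cube d" if "norm x <= R" for x :: "real^'n"
  using that R component_le_norm_cart[of x] by (auto simp: mem_cube intro: order_trans less_imp_le)
 have main: "g 0 t <= heat d G 0 (t - s1) + (K * quartic (0::real^'n) (t - s1) + (ez - c) * (t - s1)) + ez" if ez: "ez > 0" for ez
 proof (rule ccontr)
  assume neg: "\<not> ?thesis"
  define U where "U x tau = heat d G x tau + (K * quartic x tau + (ez - c) * tau)" for x tau
  define w where "w x tau = g x (s1 + tau) - U x tau" for x tau
  have w0: "w 0 (t - s1) > ez" using neg by (simp add: w_def U_def)
  have qn: "quartic x tau >= norm x ^ 4" if "tau >= 0" for x :: "real^'n" and tau
   using that by (simp add: quartic_def)
  obtain T0 where T0: "T0 > 0" "!!tau q. 0 < tau ==> tau <= T0 ==> norm q <= R ==> G q - ez / 3 <= heat d G q tau"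
   using heat_initial[OF contG G0 R, of "ez / 3"] ez by auto
  have "uniformly_continuous_on (cube d \<times> {s1..s2}) (%(x, t). g x t)"
   using cont by (rule compact_uniformly_continuous) (intro compact_Times compact_cube compact_Icc)
  then obtain h where h: "h > 0" "!!z z'. z \<in> cube d \<times> {s1..s2} ==> z' \<in> cube d \<times> {s1..s2} ==> dist z' z < h ==>
    dist ((%(x, t). g x t) z') ((%(x, t). g x t) z) < ez / 3"
   unfolding uniformly_continuous_on_def using ez by (metis divide_pos_pos zero_less_numeral)
  \<comment> \<open>The comparison starts after a positive time because \<open>gauss\<close>
    degenerates at 0. The heat solution, the change of g and c tau0 may then each cost ez /
    3.\<close>
  define tau0 where "tau0 = min (min T0 (h / 2)) (min (t - s1) (ez / (3 * (c + 1))))"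
  have tau0: "tau0 > 0" "tau0 <= T0" "tau0 < h" "tau0 <= t - s1"
  proof -
   show "tau0 > 0" using T0 h t ez c by (simp add: tau0_def)
   show "tau0 <= T0" "tau0 <= t - s1" by (auto simp: tau0_def)
   have "tau0 <= h / 2" unfolding tau0_def by (rule order_trans[OF min.cobounded1 min.cobounded2])
   then show "tau0 < h" using h by linarith
  qed
  have ctau0: "c * tau0 <= ez / 3"
  proof -
   have "(c + 1) * tau0 <= (c + 1) * (ez / (3 * (c + 1)))" using c by (intro mult_left_mono) (auto simp: tau0_def)
   also have "... = ez / 3" using c by (simp add: divide_simps)
   finally show ?thesis using tau0(1) unfolding distrib_right by linarith
  qed
  have bottom: "w x tau0 <= ez" if x: "norm x <= R" for x
  proof -
   have "dist (g x (s1 + tau0)) (g x s1) < ez / 3"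
    using h(2)[of "(x, s1)" "(x, s1 + tau0)"] ballR[OF x] tau0 t by (auto simp: dist_Pair_Pair dist_real_def)
   then have "g x (s1 + tau0) <= G x + ez / 3" unfolding G_def dist_real_def by linarith
   moreover have "G x - ez / 3 <= heat d G x tau0" using T0(2) tau0 x by simp
   moreover have "K * quartic x tau0 >= 0" using K qn[of tau0 x] tau0 by (simp add: order_trans[of 0 "norm x ^ 4"])
   moreover have "ez * tau0 >= 0" using ez tau0 by simp
   ultimately show ?thesis using ctau0 unfolding w_def U_def left_diff_distrib by linarith
  qed
  have side: "w x tau <= 0" if x: "norm x = R" and tau: "tau \<in> {tau0..T}" for x tau
  proof -
   have "g x (s1 + tau) <= B" using bd[OF ballR, of x "s1 + tau"] x tau tau0 t by (auto simp: T_def)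
   moreover have "heat d G x tau >= 0" by (intro heat_nonneg G0)
   moreover have "K * quartic x tau >= B + c * T"
   proof -
    have "K * R ^ 4 <= K * quartic x tau" using qn[of tau x] x tau tau0 K by (intro mult_left_mono) auto
    then show ?thesis using R by (simp add: K_def)
   qed
   moreover have "c * tau <= c * T" using tau c by (intro mult_left_mono) auto
   moreover have "ez * tau >= 0" using ez tau tau0 by simp
   ultimately show ?thesis unfolding w_def U_def left_diff_distrib by linarith
  qed
  let ?Z = "cball (0::real^'n) R \<times> {tau0..T}"
  have "continuous_on ?Z (%z. w (fst z) (snd z))"
  proof -
   have 1: "continuous_on ?Z (%z. heat d G (fst z) (snd z))"
    by (rule continuous_on_subset[OF continuous_on_heat[OF contG tau0(1), of UNIV]]) auto
   have "continuous_on ?Z ((%(x, t). g x t) \<circ> (%z. (fst z, s1 + snd z)))"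
    using tau0 t ballR by (intro continuous_on_compose continuous_on_subset[OF cont] continuous_intros) (auto simp: T_def)
   then have 2: "continuous_on ?Z (%z. g (fst z) (s1 + snd z))" by (simp add: o_def)
   show ?thesis unfolding w_def U_def quartic_def by (intro continuous_intros 1 2)
  qed
  moreover have "compact ?Z" by (intro compact_Times) auto
  moreover have z0: "(0, t - s1) \<in> ?Z" using R tau0 T by auto
  ultimately obtain z1 where z1: "z1 \<in> ?Z" "!!z. z \<in> ?Z ==> w (fst z) (snd z) <= w (fst z1) (snd z1)"
   using continuous_attains_sup[of ?Z "%z. w (fst z) (snd z)"] by blast
  obtain x1 tau1 where e1: "z1 = (x1, tau1)" by force
  have w1: "w x1 tau1 > ez" using z1(2)[OF z0] w0 by (simp add: e1)
  have "norm x1 < R" using side[of x1 tau1] w1 ez z1(1) by (force simp: e1)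
  moreover have "tau1 ~= tau0" using bottom[of x1] w1 z1(1) by (auto simp: e1)
  ultimately have in1: "norm x1 < R" "tau0 < tau1" "tau1 <= T" using z1(1) by (auto simp: e1)
  obtain b1 V1 where 1: "parab_taylor (heat d G) x1 tau1 b1 V1 (trace V1)" "!!i j. V1 $ i $ j = V1 $ j $ i"
   using heat_taylor[OF _ contG, of tau1 x1] in1 tau0 by auto
  obtain b2 V2 where 2: "parab_taylor quartic x1 tau1 b2 V2 (trace V2)" "!!i j. V2 $ i $ j = V2 $ j $ i"
   using quartic_taylor[of x1 tau1] by blast
  define b where "b = b1 + (K *\<^sub>R b2 + 0)"
  define V where "V = V1 + (K *\<^sub>R V2 + 0)"
  define a where "a = trace V1 + (K * trace V2 + (ez - c))"
  have tU: "parab_taylor U x1 tau1 b V a"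
   unfolding U_def b_def V_def a_def
   by (intro parab_taylor_add parab_taylor_scale parab_taylor_time 1 2 K)
  have a: "a = trace V + ez - c"
   by (simp add: a_def V_def trace_def sum.distrib sum_distrib_left)
  \<comment> \<open>The Taylor error and the two enlargements of the Hessian below cost (4 n + 1) dl
    altogether, strictly less than ez.\<close>
  define dl where "dl = ez / (4 * real CARD('n) + 2)"
  have dl: "dl > 0" using ez by (simp add: dl_def add_nonneg_pos)
  obtain r where r: "r > 0" "!!xi th. norm xi < r ==> - r < th ==> th <= 0 ==>
    \<bar>U (x1 + xi) (tau1 + th) - U x1 tau1 - quadratic_test b V a xi th\<bar> <= dl * ((norm xi)\<^sup>2 - th)"
   using tU dl unfolding parab_taylor_def by metis
  define rho where "rho = min r (min (R - norm x1) (tau1 - tau0))"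
  have rho: "rho > 0" "rho <= r" "rho <= R - norm x1" "rho <= tau1 - tau0" using r in1 by (auto simp: rho_def)
  have le: "g (x1 + xi) (s1 + tau1 + th) <= g x1 (s1 + tau1) + quadratic_test b (V + (2 * dl) *\<^sub>R mat 1) (a - dl) xi th"
   if "norm xi < rho" "- rho < th" "th <= 0" for xi th
  proof -
   have "(x1 + xi, tau1 + th) \<in> ?Z"
    using that rho in1 norm_triangle_ineq[of x1 xi] by auto
   from z1(2)[OF this] have "w (x1 + xi) (tau1 + th) <= w x1 tau1" by (simp add: e1)
   moreover have "\<bar>U (x1 + xi) (tau1 + th) - U x1 tau1 - quadratic_test b V a xi th\<bar> <= dl * ((norm xi)\<^sup>2 - th)"
    using that rho by (intro r(2)) auto
   ultimately show ?thesis
    unfolding quadratic_test_mat by (simp add: w_def algebra_simps)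
  qed
  define V' where "V' = V + (2 * dl) *\<^sub>R mat 1"
  have qV': "quadratic_test b V' (a - dl) xi 0 = b \<bullet> xi + xi \<bullet> (V' *v xi) / 2" for xi
   by (simp add: quadratic_test_def)
  \<comment> \<open>A convex function touched from above: midpoint convexity at x1 + k xi and x1 - k
    xi makes the second difference of the touching quadratic nonnegative. Another 2 dl makes
    \<open>V''\<close> definite.\<close>
  have psd: "xi \<bullet> (V' *v xi) >= 0" for xi
  proof (cases "xi = 0")
   case False
   define k where "k = rho / (2 * norm xi)"
   have k: "k > 0" "norm (k *\<^sub>R xi) < rho" "norm (- (k *\<^sub>R xi)) < rho"
    using False rho by (auto simp: k_def)
   have s: "s1 + tau1 \<in> {s1..s2}" using in1 tau0 by (auto simp: T_def)
   have "g ((1 / 2) *\<^sub>R (x1 + k *\<^sub>R xi) + (1 / 2) *\<^sub>R (x1 + - (k *\<^sub>R xi))) (s1 + tau1) <=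
    1 / 2 * g (x1 + k *\<^sub>R xi) (s1 + tau1) + 1 / 2 * g (x1 + - (k *\<^sub>R xi)) (s1 + tau1)"
   proof -
    have "g ((1 / 2) *\<^sub>R y1 + (1 / 2) *\<^sub>R y2) (s1 + tau1) <= 1 / 2 * g y1 (s1 + tau1) + 1 / 2 * g y2 (s1 + tau1)" for y1 y2
     using convex_onD[OF conv[OF s], of "1 / 2" y1 y2] by simp
    then show ?thesis .
   qed
   moreover have "(1 / 2) *\<^sub>R (x1 + k *\<^sub>R xi) + (1 / 2) *\<^sub>R (x1 + - (k *\<^sub>R xi)) = x1"
    by (simp add: algebra_simps scaleR_2[symmetric])
   ultimately have "2 * g x1 (s1 + tau1) <= g (x1 + k *\<^sub>R xi) (s1 + tau1) + g (x1 + - (k *\<^sub>R xi)) (s1 + tau1)"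
    by simp
   moreover have "g (x1 + k *\<^sub>R xi) (s1 + tau1) <= g x1 (s1 + tau1) + (b \<bullet> (k *\<^sub>R xi) + (k *\<^sub>R xi) \<bullet> (V' *v (k *\<^sub>R xi)) / 2)"
    using le[of "k *\<^sub>R xi" 0] k rho unfolding V'_def[symmetric] qV' by simp
   moreover have "g (x1 + - (k *\<^sub>R xi)) (s1 + tau1) <= g x1 (s1 + tau1) + (b \<bullet> (- (k *\<^sub>R xi)) + (- (k *\<^sub>R xi)) \<bullet> (V' *v (- (k *\<^sub>R xi))) / 2)"
    using le[of "- (k *\<^sub>R xi)" 0] k rho unfolding V'_def[symmetric] qV' by simp
   moreover have "V' *v (- (k *\<^sub>R xi)) = - (V' *v (k *\<^sub>R xi))"
    using matrix_vector_mult_diff_distrib[of V' 0 "k *\<^sub>R xi"] by simp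
   ultimately have "0 <= (k *\<^sub>R xi) \<bullet> (V' *v (k *\<^sub>R xi))" by simp
   then have "0 <= k * (k * (xi \<bullet> (V' *v xi)))"
    by (simp add: matrix_vector_mult_scaleR)
   then show ?thesis using k(1) by (simp add: zero_le_mult_iff)
  qed simp
  define V'' where "V'' = V' + (2 * dl) *\<^sub>R mat 1"
  have qV'': "xi \<bullet> (V'' *v xi) = xi \<bullet> (V' *v xi) + 2 * dl * (norm xi)\<^sup>2" for xi
   by (simp add: V''_def matrix_vector_mult_add_rdistrib inner_add_right
     scaleR_matrix_vector_assoc[symmetric] power2_norm_eq_inner)
  have "a - dl <= trace V'' - c"
  proof (rule touch[where ?x1.0=x1 and ?t1.0="s1 + tau1" and rho=rho and b=b])
   show "V'' $ i $ j = V'' $ j $ i" for i j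
    by (simp add: V''_def V'_def V_def 1(2)[of i j] 2(2)[of i j] mat_def)
   show "xi \<bullet> (V'' *v xi) > 0" if "xi ~= 0" for xi
    unfolding qV'' using psd[of xi] dl that by (simp add: add_nonneg_pos)
   show "g (x1 + xi) (s1 + tau1 + th) <= g x1 (s1 + tau1) + quadratic_test b V'' (a - dl) xi th"
    if "norm xi < rho" "- rho < th" "th <= 0" for xi th
   proof -
    have "quadratic_test b V' (a - dl) xi th <= quadratic_test b V'' (a - dl) xi th"
     unfolding quadratic_test_def qV'' using dl by simp
    then show ?thesis using le[OF that] unfolding V'_def[symmetric] by linarith
   qed
  qed (use in1 tau0 rho in \<open>auto simp: T_def\<close>)
  moreover have "trace V'' = trace V + 4 * dl * CARD('n)"
   by (simp add: V''_def V'_def trace_def sum.distrib mat_def)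
  ultimately have "ez <= dl * (4 * real CARD('n) + 1)" by (simp add: a algebra_simps)
  also have "... < dl * (4 * real CARD('n) + 2)" using dl by (intro mult_strict_left_mono) auto
  also have "... = ez"
  proof -
   have "4 * real CARD('n) + 2 > 0" by (intro add_nonneg_pos) auto
   then show ?thesis by (simp add: dl_def)
  qed
  finally show False by simp
 qed
 have q0: "quartic (0::real^'n) (t - s1) = real CARD('n) * (4 * real CARD('n) + 8) * (t - s1)\<^sup>2"
  by (simp add: quartic_def)
 define X where "X = heat d G 0 (t - s1) + K * quartic (0::real^'n) (t - s1) - c * (t - s1)"
 have "g 0 t <= X + e" if e: "e > 0" for e
 proof -
  define ez where "ez = e / (T + 1)"
  have ez: "ez > 0" using e T by (simp add: ez_def)
  have "ez * (t - s1) <= ez * T" using ez T by (intro mult_left_mono) auto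
  then have "ez * (t - s1) + ez <= ez * (T + 1)" by (simp add: distrib_left)
  also have "... = e" using T by (simp add: ez_def)
  finally show ?thesis using main[OF ez] unfolding X_def left_diff_distrib by linarith
 qed
 then have "g 0 t <= X" by (rule field_le_epsilon)
 moreover have "G = (%z. g z s1)" by (simp add: fun_eq_iff G_def)
 ultimately show ?thesis
  unfolding X_def q0 K_def T_def by (simp only: mult.assoc add.assoc diff_add_eq add.commute)
qed

section \<open>Positive definite matrices\<close>

definition pos_def :: "real^'n^'n => bool" where
 "pos_def A \<longleftrightarrow> (\<forall>i j. A $ i $ j = A $ j $ i) & (\<forall>x. x ~= 0 --> x \<bullet> (A *v x) > 0)"

text \<open>The second symmetric function of the eigenvalues of a symmetric matrix: terms with i = j
  vanish and each pair is counted twice.\<close>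

definition minors2 :: "real^'n^'n => real" where
 "minors2 A = (\<Sum>i\<in>UNIV. \<Sum>j\<in>UNIV. A $ i $ i * A $ j $ j - (A $ i $ j)\<^sup>2) / 2"

lemma sym_inner_matrix:
 fixes A :: "real^'n^'n"
 assumes "!!i j. A $ i $ j = A $ j $ i"
 shows "x \<bullet> (A *v y) = (A *v x) \<bullet> y" "x \<bullet> (A *v y) = y \<bullet> (A *v x)"
proof -
 have "transpose A = A" using assms by (simp add: transpose_def vec_eq_iff)
 then show "x \<bullet> (A *v y) = (A *v x) \<bullet> y" by (metis dot_lmul_matrix transpose_matrix_vector)
 then show "x \<bullet> (A *v y) = y \<bullet> (A *v x)" by (simp add: inner_commute)
qed

lemma axis_inner_matrix: "axis i 1 \<bullet> (A *v axis j 1) = (A :: real^'n^'n) $ i $ j"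
 by (simp add: inner_axis' matrix_vector_mult_basis column_def)

lemma psd_Cauchy_Schwarz:
 fixes A :: "real^'n^'n"
 assumes sym: "!!i j. A $ i $ j = A $ j $ i" and psd: "!!x. x \<bullet> (A *v x) >= 0"
 shows "(x \<bullet> (A *v y))\<^sup>2 <= (x \<bullet> (A *v x)) * (y \<bullet> (A *v y))"
proof -
 define a where "a = y \<bullet> (A *v y)"
 define b where "b = x \<bullet> (A *v y)"
 define c where "c = x \<bullet> (A *v x)"
 have q: "0 <= c + 2 * t * b + t\<^sup>2 * a" for t
 proof -
  have "(x + t *\<^sub>R y) \<bullet> (A *v (x + t *\<^sub>R y)) = c + t * b + t * (y \<bullet> (A *v x)) + t\<^sup>2 * a"
   by (simp add: matrix_vector_right_distrib matrix_vector_mult_scaleR inner_add_left inner_add_right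
     a_def b_def c_def power2_eq_square algebra_simps)
  also have "y \<bullet> (A *v x) = b" using sym_inner_matrix(2)[OF sym] by (simp add: b_def)
  finally show ?thesis using psd[of "x + t *\<^sub>R y"] by (simp add: mult_ac)
 qed
 have a0: "a >= 0" by (simp add: a_def psd)
 show ?thesis
 proof (cases "a = 0")
  case True
  have "b = 0"
  proof (rule ccontr)
   assume b: "b ~= 0"
   have "0 <= c + 2 * (- (c + 1) / (2 * b)) * b" using q[of "- (c + 1) / (2 * b)"] True by simp
   then show False using b by (simp add: field_simps)
  qed
  then show ?thesis using True by (simp add: a_def b_def)
 next
  case False
  then have a: "a > 0" using a0 by simp
  have "0 <= (c + 2 * (- b / a) * b + (- b / a)\<^sup>2 * a) * a" using q[of "- b / a"] a by simp
  also have "... = c * a - b\<^sup>2" using a by (simp add: power2_eq_square field_simps)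
  finally show ?thesis by (simp add: a_def b_def c_def)
 qed
qed

text \<open>The largest eigenvalue is at most the trace; obtained from |A_ij| <= sqrt (A_ii A_jj)
  and Cauchy-Schwarz, without eigenvalues.\<close>

lemma psd_le_trace:
 fixes A :: "real^'n^'n"
 assumes sym: "!!i j. A $ i $ j = A $ j $ i" and psd: "!!x. x \<bullet> (A *v x) >= 0"
 shows "x \<bullet> (A *v x) <= (norm x)\<^sup>2 * trace A"
proof -
 have d: "A $ i $ i >= 0" for i using psd[of "axis i 1"] by (simp add: axis_inner_matrix)
 have e: "A $ i $ j <= sqrt (A $ i $ i) * sqrt (A $ j $ j)" "- A $ i $ j <= sqrt (A $ i $ i) * sqrt (A $ j $ j)" for i j
 proof -
  have "(A $ i $ j)\<^sup>2 <= A $ i $ i * A $ j $ j"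
   using psd_Cauchy_Schwarz[OF sym psd, of "axis i 1" "axis j 1"] by (simp add: axis_inner_matrix)
  then have "sqrt ((A $ i $ j)\<^sup>2) <= sqrt (A $ i $ i * A $ j $ j)" by (rule real_sqrt_le_mono)
  then have "\<bar>A $ i $ j\<bar> <= sqrt (A $ i $ i) * sqrt (A $ j $ j)" by (simp add: real_sqrt_mult)
  then show "A $ i $ j <= sqrt (A $ i $ i) * sqrt (A $ j $ j)" "- A $ i $ j <= sqrt (A $ i $ i) * sqrt (A $ j $ j)" by auto
 qed
 have "x \<bullet> (A *v x) = (\<Sum>i\<in>UNIV. \<Sum>j\<in>UNIV. x $ i * x $ j * A $ i $ j)" by (rule inner_matrix_vector)
 also have "... <= (\<Sum>i\<in>UNIV. \<Sum>j\<in>UNIV. (\<bar>x $ i\<bar> * sqrt (A $ i $ i)) * (\<bar>x $ j\<bar> * sqrt (A $ j $ j)))"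
 proof (intro sum_mono)
  fix i j
  have "x $ i * x $ j * A $ i $ j <= \<bar>x $ i * x $ j\<bar> * \<bar>A $ i $ j\<bar>" by (metis abs_ge_self abs_mult)
  also have "... <= \<bar>x $ i * x $ j\<bar> * (sqrt (A $ i $ i) * sqrt (A $ j $ j))"
   using e[of i j] by (intro mult_left_mono) auto
  finally show "x $ i * x $ j * A $ i $ j <= (\<bar>x $ i\<bar> * sqrt (A $ i $ i)) * (\<bar>x $ j\<bar> * sqrt (A $ j $ j))"
   by (simp add: abs_mult mult_ac)
 qed
 also have "... = (\<Sum>i\<in>UNIV. \<bar>x $ i\<bar> * sqrt (A $ i $ i))\<^sup>2" by (simp add: power2_eq_square sum_product)
 also have "... <= (\<Sum>i\<in>UNIV. \<bar>x $ i\<bar>\<^sup>2) * (\<Sum>i\<in>UNIV. (sqrt (A $ i $ i))\<^sup>2)"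
  by (rule Cauchy_Schwarz_ineq_sum)
 also have "... = (norm x)\<^sup>2 * trace A" using d by (simp add: norm2_cart trace_def)
 finally show ?thesis .
qed

lemma pos_defD:
 assumes "pos_def A"
 shows "A $ i $ j = A $ j $ i" "x \<bullet> (A *v x) >= 0" "x ~= 0 ==> x \<bullet> (A *v x) > 0" "A $ i $ i > 0"
proof -
 show "A $ i $ j = A $ j $ i" and p: "!!x. x ~= 0 ==> x \<bullet> (A *v x) > 0"
  using assms by (auto simp: pos_def_def)
 show "x \<bullet> (A *v x) >= 0" using p[of x] by (cases "x = 0") auto
 show "A $ i $ i > 0" using p[of "axis i 1"] by (simp add: axis_inner_matrix axis_eq_0_iff)
qed

lemma pos_def_minor:
 assumes "pos_def A" shows "(A $ i $ j)\<^sup>2 <= A $ i $ i * A $ j $ j"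
 using psd_Cauchy_Schwarz[OF pos_defD(1,2)[OF assms], of "axis i 1" "axis j 1"] by (simp add: axis_inner_matrix)

lemma pos_def_lower:
 fixes A :: "real^'n^'n"
 assumes "pos_def A" shows "\<exists>c>0. \<forall>x. x \<bullet> (A *v x) >= c * (norm x)\<^sup>2"
proof -
 have "continuous_on (sphere 0 1) (%x::real^'n. x \<bullet> (A *v x))"
  by (intro continuous_intros linear_continuous_on matrix_vector_mul_bounded_linear)
 moreover have "compact (sphere (0::real^'n) 1)" "sphere (0::real^'n) 1 ~= {}" by auto
 ultimately obtain x0 where x0: "x0 \<in> sphere 0 1" "!!x. x \<in> sphere 0 1 ==> x0 \<bullet> (A *v x0) <= x \<bullet> (A *v x)"
  using continuous_attains_inf[of "sphere (0::real^'n) 1" "%x. x \<bullet> (A *v x)"] by blast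
 define c where "c = x0 \<bullet> (A *v x0)"
 have "c > 0" using x0(1) pos_defD(3)[OF assms, of x0] by (cases "x0 = 0") (auto simp: c_def)
 moreover have "x \<bullet> (A *v x) >= c * (norm x)\<^sup>2" for x
 proof (cases "x = 0")
  case False
  have "(x /\<^sub>R norm x) \<bullet> (A *v (x /\<^sub>R norm x)) >= c" using x0(2)[of "x /\<^sub>R norm x"] False by (simp add: c_def)
  then have "x \<bullet> (A *v x) / (norm x)\<^sup>2 >= c"
   by (simp add: matrix_vector_mult_scaleR power2_eq_square field_simps)
  then show ?thesis using False by (simp add: pos_le_divide_eq)
 qed simp
 ultimately show ?thesis by blast
qed

lemma pos_def_inverse:
 fixes A :: "real^'n^'n"
 assumes A: "pos_def A"
 obtains B where "pos_def B" "A ** B = mat 1" "B ** A = mat 1"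
proof -
 have "x = 0" if "A *v x = 0" for x using pos_defD(3)[OF A, of x] that by auto
 then obtain B where B: "B ** A = mat 1" using matrix_left_invertible_ker[of A] by auto
 then have AB: "A ** B = mat 1" using matrix_left_right_inverse by blast
 have tA: "transpose A = A" using pos_defD(1)[OF A] by (simp add: transpose_def vec_eq_iff)
 have "transpose B = transpose B ** (A ** B)" by (simp add: AB)
 also have "... = transpose (A ** B) ** B" by (simp add: matrix_transpose_mul tA matrix_mul_assoc)
 also have "... = B" by (simp add: AB transpose_mat)
 finally have tB: "transpose B = B" .
 have sB: "B $ i $ j = B $ j $ i" for i j
  using arg_cong[OF tB, of "%C. C $ j $ i"] by (simp add: transpose_def)
 have "x \<bullet> (B *v x) > 0" if "x ~= 0" for x
 proof -
  have x: "A *v (B *v x) = x" by (simp add: matrix_vector_mul_assoc AB)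
  then have "B *v x ~= 0" using that by auto
  then have "(B *v x) \<bullet> (A *v (B *v x)) > 0" by (rule pos_defD(3)[OF A])
  then show ?thesis unfolding x by (simp add: inner_commute)
 qed
 then show thesis using that[of B] sB AB B by (auto simp: pos_def_def)
qed

lemma minors2_pos:
 fixes A :: "real^'n^'n"
 assumes A: "pos_def A" and n: "CARD('n) >= 2"
 shows "minors2 A > 0"
proof -
 have t: "A $ i $ i * A $ j $ j - (A $ i $ j)\<^sup>2 >= 0" for i j using pos_def_minor[OF A, of i j] by simp
 obtain i j :: 'n where ij: "i ~= j"
 proof -
  have "\<not> (\<forall>i j :: 'n. i = j)"
  proof
   assume "\<forall>i j :: 'n. i = j"
   then have "UNIV = {undefined :: 'n}" by auto
   then have "CARD('n) = 1" by (metis card.empty card_insert_disjoint empty_iff finite.emptyI One_nat_def)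
   then show False using n by simp
  qed
  then show thesis using that by blast
 qed
 define x where "x = axis i 1 - (A $ i $ j / A $ j $ j) *\<^sub>R (axis j 1 :: real^'n)"
 have "x $ i = 1" using ij by (simp add: x_def axis_def)
 then have "x ~= 0" by auto
 then have "x \<bullet> (A *v x) > 0" by (rule pos_defD(3)[OF A])
 moreover have "x \<bullet> (A *v x) = A $ i $ i - (A $ i $ j)\<^sup>2 / A $ j $ j"
  using pos_defD(4)[OF A, of j]
  by (simp add: x_def matrix_vector_mult_diff_distrib matrix_vector_mult_scaleR inner_diff_left inner_diff_right
    axis_inner_matrix pos_defD(1)[OF A, of j i] power2_eq_square field_simps)
 ultimately have p: "A $ i $ i * A $ j $ j - (A $ i $ j)\<^sup>2 > 0"
  using pos_defD(4)[OF A, of j] by (simp add: field_simps)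
 have "(\<Sum>i\<in>UNIV. \<Sum>j\<in>UNIV. A $ i $ i * A $ j $ j - (A $ i $ j)\<^sup>2) > 0"
  using p t by (intro sum_pos2[of _ i] sum_pos2[of _ j] sum_nonneg) auto
 then show ?thesis by (simp add: minors2_def)
qed

text \<open>Cauchy-Schwarz for dual quadratic forms: the form of \<open>A\<close> is nonnegative at
  B u - s e_i, and s = u_i / A_ii is the optimal choice.\<close>

lemma inverse_diagonal:
 fixes A :: "real^'n^'n"
 assumes A: "pos_def A" and B: "pos_def B" and AB: "A ** B = mat 1"
 shows "u \<bullet> (B *v u) >= (u $ i)\<^sup>2 / A $ i $ i"
proof -
 define s where "s = u $ i / A $ i $ i"
 have a: "A $ i $ i > 0" by (rule pos_defD(4)[OF A])
 define v where "v = B *v u - s *\<^sub>R axis i 1"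
 have Av: "A *v v = u - s *\<^sub>R (A *v axis i 1)"
  by (simp add: v_def matrix_vector_mult_diff_distrib matrix_vector_mult_scaleR matrix_vector_mul_assoc AB)
 have "0 <= v \<bullet> (A *v v)" by (rule pos_defD(2)[OF A])
 also have "v \<bullet> (A *v v) = (B *v u) \<bullet> u - s * ((B *v u) \<bullet> (A *v axis i 1)) - s * (axis i 1 \<bullet> u) + s\<^sup>2 * A $ i $ i"
  unfolding Av unfolding v_def
  by (simp add: inner_diff_left inner_diff_right axis_inner_matrix power2_eq_square algebra_simps)
 also have "(B *v u) \<bullet> (A *v axis i 1) = u $ i"
 proof -
  have "(B *v u) \<bullet> (A *v axis i 1) = (A *v (B *v u)) \<bullet> axis i 1"
   by (rule sym_inner_matrix(1)[OF pos_defD(1)[OF A]])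
  also have "... = u $ i" by (simp add: matrix_vector_mul_assoc AB inner_axis)
  finally show ?thesis .
 qed
 also have "axis i 1 \<bullet> u = u $ i" by (simp add: inner_axis')
 finally have "u \<bullet> (B *v u) >= 2 * s * u $ i - s\<^sup>2 * A $ i $ i" by (simp add: inner_commute)
 also have "2 * s * u $ i - s\<^sup>2 * A $ i $ i = (u $ i)\<^sup>2 / A $ i $ i"
  using a by (simp add: s_def power2_eq_square field_simps)
 finally show ?thesis .
qed

text \<open>The minor is B_jj times a Schur complement, and the latter is the value of the form of
  \<open>B\<close> at a vector with i-th coordinate 1. \<open>inverse_diagonal\<close> bounds both
  factors.\<close>

lemma inverse_minor:
 fixes A :: "real^'n^'n"
 assumes A: "pos_def A" and B: "pos_def B" and AB: "A ** B = mat 1" and ij: "i ~= j"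
 shows "B $ i $ i * B $ j $ j - (B $ i $ j)\<^sup>2 >= 1 / (A $ i $ i * A $ j $ j)"
proof -
 have bj: "B $ j $ j > 0" "A $ i $ i > 0" "A $ j $ j > 0" by (rule pos_defD(4)[OF B] pos_defD(4)[OF A])+
 have 1: "B $ j $ j >= 1 / A $ j $ j"
  using inverse_diagonal[OF A B AB, of "axis j 1" j] by (simp add: axis_inner_matrix)
 define x where "x = axis i 1 - (B $ i $ j / B $ j $ j) *\<^sub>R (axis j 1 :: real^'n)"
 have xi: "x $ i = 1" using ij by (simp add: x_def axis_def)
 have "x \<bullet> (B *v x) = B $ i $ i - (B $ i $ j)\<^sup>2 / B $ j $ j"
  using bj
  by (simp add: x_def matrix_vector_mult_diff_distrib matrix_vector_mult_scaleR inner_diff_left inner_diff_right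
    axis_inner_matrix pos_defD(1)[OF B, of j i] power2_eq_square field_simps)
 then have "B $ i $ i - (B $ i $ j)\<^sup>2 / B $ j $ j >= 1 / A $ i $ i"
  using inverse_diagonal[OF A B AB, of x i] xi by simp
 moreover have "1 / A $ i $ i > 0" "1 / A $ j $ j > 0" using bj by simp_all
 ultimately have "(B $ i $ i - (B $ i $ j)\<^sup>2 / B $ j $ j) * B $ j $ j >= 1 / A $ i $ i * (1 / A $ j $ j)"
  using 1 bj by (intro mult_mono) linarith+
 then show ?thesis using bj by (simp add: left_diff_distrib)
qed

text \<open>The tangent-plane inequality for the convex function \<open>\<sigma>\<^sub>2(A\<^sup>-\<^sup>1)\<close> at a diagonal matrix;
 each 2-by-2 minor is estimated separately by the AM-GM inequality.\<close>

lemma minors2_inverse_ge: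
 fixes A :: "real^'n^'n" and b :: "'n => real"
 assumes A: "pos_def A" and B: "pos_def B" and AB: "A ** B = mat 1" and b: "!!i. b i > 0"
 shows "minors2 B >= 3 * ((\<Sum>i\<in>UNIV. \<Sum>j\<in>UNIV - {i}. b i * b j) / 2) -
  (\<Sum>i\<in>UNIV. (b i)\<^sup>2 * (\<Sum>j\<in>UNIV - {i}. b j) * A $ i $ i)"
proof -
 \<comment> \<open>The tangent plane of 1 / (x y) at (1, 1). With s = (x + y) / 2 it reduces to (s -
   1)^2 (2 s + 1) >= 0. It is applied to x = b_i A_ii and y = b_j A_jj.\<close>
 have amgm: "1 / (x * y) >= 3 - x - y" if "x > 0" "y > 0" for x y :: real
 proof -
  have "0 <= (x - 1)\<^sup>2 * y + x * (y - 1)\<^sup>2 + (x * y - 1)\<^sup>2 / (x * y) * 0" using that by simp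
  have "x * y * (3 - x - y) <= 1"
  proof (cases "3 - x - y <= 0")
   case True
   then have "x * y * (3 - x - y) <= 0" using that by (intro mult_nonneg_nonpos) auto
   then show ?thesis by simp
  next
   case False
   define s where "s = (x + y) / 2"
   have s: "0 < s" "s < 3 / 2" using that False by (auto simp: s_def)
   have "x * y <= s\<^sup>2"
   proof -
    have "0 <= (x - y)\<^sup>2" by simp
    then show ?thesis by (simp add: s_def power2_eq_square field_simps)
   qed
   then have "x * y * (3 - x - y) <= s\<^sup>2 * (3 - x - y)" using False by (intro mult_right_mono) auto
   also have "... = s\<^sup>2 * (3 - 2 * s)" by (simp add: s_def field_simps)
   also have "... <= 1"
   proof -
    have "0 <= (s - 1)\<^sup>2 * (2 * s + 1)" using s by simp
    then show ?thesis by (simp add: power2_eq_square algebra_simps)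
   qed
   finally show ?thesis .
  qed
  then show ?thesis using that by (simp add: field_simps)
 qed
 have pair: "B $ i $ i * B $ j $ j - (B $ i $ j)\<^sup>2 >= b i * b j * (3 - b i * A $ i $ i - b j * A $ j $ j)" if "i ~= j" for i j
 proof -
  have p: "A $ i $ i > 0" "A $ j $ j > 0" by (rule pos_defD(4)[OF A])+
  have "b i * b j * (1 / ((b i * A $ i $ i) * (b j * A $ j $ j))) >= b i * b j * (3 - b i * A $ i $ i - b j * A $ j $ j)"
   using b[of i] b[of j] p by (intro mult_left_mono amgm) auto
  moreover have "b i * b j * (1 / ((b i * A $ i $ i) * (b j * A $ j $ j))) = 1 / (A $ i $ i * A $ j $ j)"
   using b[of i] b[of j] p by (simp add: field_simps)
  ultimately show ?thesis using inverse_minor[OF A B AB that] by simp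
 qed
 have "2 * minors2 B = (\<Sum>i\<in>UNIV. \<Sum>j\<in>UNIV - {i}. B $ i $ i * B $ j $ j - (B $ i $ j)\<^sup>2)"
 proof -
  have "(\<Sum>j\<in>UNIV. B $ i $ i * B $ j $ j - (B $ i $ j)\<^sup>2) = (\<Sum>j\<in>UNIV - {i}. B $ i $ i * B $ j $ j - (B $ i $ j)\<^sup>2)" for i
   by (rule sum.mono_neutral_right) (auto simp: power2_eq_square)
  then show ?thesis by (simp add: minors2_def)
 qed
 also have "... >= (\<Sum>i\<in>UNIV. \<Sum>j\<in>UNIV - {i}. b i * b j * (3 - b i * A $ i $ i - b j * A $ j $ j))"
  by (intro sum_mono pair) auto
 also have "(\<Sum>i\<in>UNIV. \<Sum>j\<in>UNIV - {i}. b i * b j * (3 - b i * A $ i $ i - b j * A $ j $ j)) =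
   3 * (\<Sum>i\<in>UNIV. \<Sum>j\<in>UNIV - {i}. b i * b j) -
   (\<Sum>i\<in>UNIV. \<Sum>j\<in>UNIV - {i}. (b i)\<^sup>2 * b j * A $ i $ i) - (\<Sum>i\<in>UNIV. \<Sum>j\<in>UNIV - {i}. b i * (b j)\<^sup>2 * A $ j $ j)"
  by (simp add: sum_distrib_left sum_subtractf[symmetric] algebra_simps power2_eq_square)
 also have "(\<Sum>i\<in>UNIV. \<Sum>j\<in>UNIV - {i}. b i * (b j)\<^sup>2 * A $ j $ j) = (\<Sum>i\<in>UNIV. \<Sum>j\<in>UNIV - {i}. (b i)\<^sup>2 * b j * A $ i $ i)"
 proof -
  have "(\<Sum>i\<in>UNIV. \<Sum>j\<in>UNIV - {i}. b i * (b j)\<^sup>2 * A $ j $ j) = (\<Sum>i\<in>UNIV. \<Sum>j\<in>{j. j \<in> UNIV & j ~= i}. b i * (b j)\<^sup>2 * A $ j $ j)"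
   by (intro sum.cong) auto
  also have "... = (\<Sum>j\<in>UNIV. \<Sum>i\<in>{i. i \<in> UNIV & j ~= i}. b i * (b j)\<^sup>2 * A $ j $ j)"
   by (rule sum.swap_restrict) auto
  also have "... = (\<Sum>i\<in>UNIV. \<Sum>j\<in>UNIV - {i}. (b i)\<^sup>2 * b j * A $ i $ i)"
   by (intro sum.cong) (auto simp: mult_ac)
  finally show ?thesis .
 qed
 also have "(\<Sum>i\<in>UNIV. \<Sum>j\<in>UNIV - {i}. (b i)\<^sup>2 * b j * A $ i $ i) = (\<Sum>i\<in>UNIV. (b i)\<^sup>2 * (\<Sum>j\<in>UNIV - {i}. b j) * A $ i $ i)"
  by (simp add: sum_distrib_left sum_distrib_right)
 finally show ?thesis by linarith
qed

text \<open>For a small slope p the inverse metric is near the identity, so speed and mean curvature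
  are those of the matrix \<open>B\<close> up to factors 1 - O(|p|^2). Definiteness of
  \<open>B\<close> bounds the correction by \<open>minors2 B\<close>, respectively
  \<open>trace B\<close>, itself.\<close>

lemma graph_speed_lower:
 fixes B :: "real^'n^'n"
 assumes B: "pos_def B"
 shows "graph_speed p B >= (1 - 2 * (norm p)\<^sup>2) * minors2 B / sqrt (1 + (norm p)\<^sup>2)"
  and "graph_mean_curvature p B >= (1 - (norm p)\<^sup>2) * trace B / sqrt (1 + (norm p)\<^sup>2)"
proof -
 define Q where "Q u v = fst u \<bullet> (B *v fst v)" for u v :: "(real^'n) \<times> real"
 have Qb: "bilinear Q"
  unfolding Q_def by (rule bilinearI2)
   (simp_all add: inner_add_left inner_add_right matrix_vector_right_distrib matrix_vector_mult_scaleR)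
 have Qs: "Q u v = Q v u" for u v unfolding Q_def by (rule sym_inner_matrix(2)[OF pos_defD(1)[OF B]])
 have BQ: "B $ i $ j = Q (axis i 1, p $ i) (axis j 1, p $ j)" for i j by (simp add: Q_def axis_inner_matrix)
 note gs = graph_speed_eq_hyp_speed[OF Qb Qs zero_less_one BQ]
 define P where "P = (norm p)\<^sup>2"
 define k where "k = 1 / (1 + P)"
 have P: "P >= 0" by (simp add: P_def)
 have k: "k > 0" "k <= 1" using P by (auto simp: k_def)
 define x where "x = p \<bullet> (B *v p)"
 define y where "y = (norm (B *v p))\<^sup>2"
 have NN: "p \<bullet> p + 1 = 1 + P" by (simp add: P_def power2_norm_eq_inner)
 have QN: "B *v (- v) = - (B *v v)" for v :: "real^'n"
  using matrix_vector_mult_diff_distrib[of B 0 v] by simp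
 have T1: "tangent_trace (- p, 1) Q = trace B - k * x"
  by (simp add: tangent_trace_def sum_Basis_prod Q_def axis_inner_matrix trace_def NN QN x_def k_def)
 have inner_sum: "(\<Sum>i\<in>UNIV. (axis i 1 \<bullet> u) * (axis i 1 \<bullet> v)) = u \<bullet> v" for u v :: "real^'n"
  by (simp add: inner_axis') (simp add: inner_vec_def)
 have T2: "tangent_trace (- p, 1) (%u v. Q u w * Q v z) =
   (B *v fst w) \<bullet> (B *v fst z) - k * ((p \<bullet> (B *v fst w)) * (p \<bullet> (B *v fst z)))" for w z
  by (simp add: tangent_trace_def sum_Basis_prod Q_def inner_sum NN k_def)
 have sq: "(\<Sum>i\<in>UNIV. (B *v axis i 1) \<bullet> (B *v axis i 1)) = (\<Sum>i\<in>UNIV. \<Sum>j\<in>UNIV. (B $ i $ j)\<^sup>2)"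
 proof -
  have "(B *v axis i 1) \<bullet> (B *v axis i 1) = (\<Sum>j\<in>UNIV. (B $ i $ j)\<^sup>2)" for i
   by (simp add: matrix_vector_mult_basis column_def inner_vec_def power2_eq_square pos_defD(1)[OF B, of _ i])
  then show ?thesis by simp
 qed
 have sq2: "(\<Sum>i\<in>UNIV. (p \<bullet> (B *v axis i 1)) * (p \<bullet> (B *v axis i 1))) = y"
 proof -
  have "p \<bullet> (B *v axis i 1) = axis i 1 \<bullet> (B *v p)" for i
   by (rule sym_inner_matrix(2)[OF pos_defD(1)[OF B]])
  then show ?thesis by (simp add: inner_sum y_def power2_norm_eq_inner)
 qed
 have T3: "tangent_trace (- p, 1) (%w z. tangent_trace (- p, 1) (%u v. Q u w * Q v z)) =
   (\<Sum>i\<in>UNIV. \<Sum>j\<in>UNIV. (B $ i $ j)\<^sup>2) - 2 * k * y + k\<^sup>2 * x\<^sup>2"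
 proof -
  define f where "f w z = (B *v fst w) \<bullet> (B *v fst z) - k * ((p \<bullet> (B *v fst w)) * (p \<bullet> (B *v fst z)))" for w z :: "(real^'n) \<times> real"
  have f1: "(\<Sum>i\<in>UNIV. f (axis i 1, 0) (axis i 1, 0)) = (\<Sum>i\<in>UNIV. \<Sum>j\<in>UNIV. (B $ i $ j)\<^sup>2) - k * y"
   by (simp add: f_def sum_subtractf sum_distrib_left[symmetric] sq sq2)
  have f2: "f (0, 1) (0, 1) = 0" by (simp add: f_def)
  have f3: "f (- p, 1) (- p, 1) = y - k * x\<^sup>2"
   by (simp add: f_def QN x_def y_def dot_square_norm power2_eq_square)
  have N: "(- p, 1) \<bullet> (- p, 1::real) = 1 + P" using NN by simp
  have "tangent_trace (- p, 1) f = (\<Sum>i\<in>UNIV. f (axis i 1, 0) (axis i 1, 0)) + f (0, 1) (0, 1) - f (- p, 1) (- p, 1) / ((- p, 1) \<bullet> (- p, 1::real))"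
   unfolding tangent_trace_def sum_Basis_prod ..
  also have "... = (\<Sum>i\<in>UNIV. \<Sum>j\<in>UNIV. (B $ i $ j)\<^sup>2) - k * y - k * (y - k * x\<^sup>2)"
   unfolding f1 f2 f3 N by (simp add: k_def)
  finally show ?thesis unfolding T2 f_def[abs_def] by (simp add: power2_eq_square algebra_simps)
 qed
 have m2: "2 * minors2 B = (trace B)\<^sup>2 - (\<Sum>i\<in>UNIV. \<Sum>j\<in>UNIV. (B $ i $ j)\<^sup>2)"
  by (simp add: minors2_def trace_def power2_eq_square sum_product sum_subtractf)
 have nrm: "norm (1 *\<^sub>R (- p, 1::real)) = sqrt (1 + P)" by (simp add: norm_graph_vec P_def)
 have "graph_speed p B = (2 * minors2 B - 2 * k * (trace B * x - y)) / (2 * sqrt (1 + P))"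
  unfolding gs(1) hyp_speed_def nrm using m2
  by (simp add: T1 T3 power2_eq_square algebra_simps)
 also have "trace B * x - y <= 2 * P * minors2 B"
 proof -
  \<comment> \<open>B_jj times the Schur complement of \<open>B\<close> at j, semidefinite by
    Cauchy-Schwarz. The correction trace B * x - y is the sum of its values at p, and its traces add
    up to twice \<open>minors2 B\<close>.\<close>
  define C where "C j = (\<chi> i l. B $ i $ l * B $ j $ j - B $ i $ j * B $ j $ l)" for j
  have Cs: "C j $ i $ l = C j $ l $ i" for i j l
   by (simp add: C_def pos_defD(1)[OF B, of i l] pos_defD(1)[OF B, of i j] pos_defD(1)[OF B, of l j])
  have Cq: "v \<bullet> (C j *v v) = (v \<bullet> (B *v v)) * B $ j $ j - (v \<bullet> (B *v axis j 1))\<^sup>2" for j v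
  proof -
   have "v \<bullet> (C j *v v) = (\<Sum>i\<in>UNIV. \<Sum>l\<in>UNIV. v $ i * v $ l * B $ i $ l) * B $ j $ j -
    (\<Sum>i\<in>UNIV. v $ i * B $ i $ j) * (\<Sum>l\<in>UNIV. v $ l * B $ j $ l)"
    unfolding inner_matrix_vector sum_product
    by (simp add: C_def sum_distrib_right right_diff_distrib sum_subtractf mult_ac) (simp add: sum_distrib_left mult_ac)
   also have "(\<Sum>l\<in>UNIV. v $ l * B $ j $ l) = v \<bullet> (B *v axis j 1)"
    by (simp add: inner_vec_def matrix_vector_mult_basis column_def pos_defD(1)[OF B, of j])
   also have "(\<Sum>i\<in>UNIV. v $ i * B $ i $ j) = v \<bullet> (B *v axis j 1)"
    by (simp add: inner_vec_def matrix_vector_mult_basis column_def)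
   finally show ?thesis by (simp add: inner_matrix_vector power2_eq_square)
  qed
  have Cp: "v \<bullet> (C j *v v) >= 0" for j v
   unfolding Cq using psd_Cauchy_Schwarz[OF pos_defD(1,2)[OF B], of v "axis j 1"]
   by (simp add: axis_inner_matrix)
  have "trace B * x - y = (\<Sum>j\<in>UNIV. p \<bullet> (C j *v p))"
   unfolding Cq sum_subtractf x_def[symmetric] sq2[symmetric]
   by (simp add: trace_def sum_distrib_left sum_distrib_right mult.commute power2_eq_square)
  also have "... <= (\<Sum>j\<in>UNIV. P * trace (C j))"
   unfolding P_def by (intro sum_mono psd_le_trace Cs Cp)
  also have "... = P * (2 * minors2 B)"
   by (simp add: minors2_def trace_def C_def sum_distrib_left[symmetric] power2_eq_square pos_defD(1)[OF B])
    (subst sum.swap, simp add: pos_defD(1)[OF B] mult.commute)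
  finally show ?thesis by simp
 qed
 then have "k * (trace B * x - y) <= 1 * (2 * P * minors2 B)"
 proof -
  have "0 <= minors2 B"
   unfolding minors2_def using pos_def_minor[OF B] by (auto intro!: sum_nonneg divide_nonneg_pos)
  then have "0 <= 2 * P * minors2 B" using P by simp
  moreover have "k * (trace B * x - y) <= k * (2 * P * minors2 B)"
   using \<open>trace B * x - y <= 2 * P * minors2 B\<close> k by (intro mult_left_mono) auto
  moreover have "k * (2 * P * minors2 B) <= 1 * (2 * P * minors2 B)"
   using k \<open>0 <= 2 * P * minors2 B\<close> by (intro mult_right_mono) auto
  ultimately show ?thesis by linarith
 qed
 ultimately show "graph_speed p B >= (1 - 2 * (norm p)\<^sup>2) * minors2 B / sqrt (1 + (norm p)\<^sup>2)"
  unfolding P_def[symmetric]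
 proof -
  assume g: "graph_speed p B = (2 * minors2 B - 2 * k * (trace B * x - y)) / (2 * sqrt (1 + P))"
   and l: "k * (trace B * x - y) <= 1 * (2 * P * minors2 B)"
  have "graph_speed p B = (minors2 B - k * (trace B * x - y)) / sqrt (1 + P)"
  proof -
   have e: "2 * minors2 B - 2 * k * (trace B * x - y) = 2 * (minors2 B - k * (trace B * x - y))"
    by (simp add: algebra_simps)
   show ?thesis unfolding g e by (rule mult_divide_mult_cancel_left) simp
  qed
  then show "(1 - 2 * P) * minors2 B / sqrt (1 + P) <= graph_speed p B"
   using l P unfolding left_diff_distrib by (auto intro!: divide_right_mono)
 qed
 have x: "x <= P * trace B" unfolding x_def P_def by (intro psd_le_trace pos_defD[OF B])
 have x0: "0 <= x" unfolding x_def by (rule pos_defD(2)[OF B])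
 have "k * x <= P * trace B" using x x0 k mult_right_mono[of k 1 x] by simp
 then show "graph_mean_curvature p B >= (1 - (norm p)\<^sup>2) * trace B / sqrt (1 + (norm p)\<^sup>2)"
  unfolding gs(2) P_def[symmetric] left_diff_distrib scaleR_one T1 using P by (intro divide_right_mono) auto
qed

section \<open>Support functions of the flow\<close>

locale scalar_flow =
 fixes S :: "((real ^ 'n) \<times> real) set" and X and Tc :: real
 assumes flow: "scalar_curvature_flow S X Tc" and compact_S: "compact S" and ne_S: "S ~= {}"
  and dim2: "CARD('n) >= 2"
begin

abbreviation "M \<equiv> evolving_surface X S"

lemma continuous_X: "continuous_on (S \<times> {0..<Tc}) (%(p, t). X p t)"
 and inj_X: "t \<in> {0..<Tc} ==> inj_on (%p. X p t) S"
 and X_0: "p \<in> S ==> X p 0 = p"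
 using flow by (auto simp: scalar_curvature_flow_def)

lemma continuous_X_at:
 assumes "t \<in> {0..<Tc}" shows "continuous_on S (%p. X p t)"
proof -
 have "continuous_on S ((%(p, t). X p t) \<circ> (%p. (p, t)))"
  using assms by (intro continuous_on_compose continuous_on_subset[OF continuous_X] continuous_intros) auto
 then show ?thesis by (simp add: o_def)
qed

lemma compact_M: "t \<in> {0..<Tc} ==> compact (M t)"
 unfolding evolving_surface_def by (rule compact_continuous_image[OF continuous_X_at compact_S])

lemma ne_M: "M t ~= {}" using ne_S by (simp add: evolving_surface_def)

lemma M_0: "M 0 = S" using X_0 by (force simp: evolving_surface_def)

lemma local_touching_exists:
 assumes t0: "0 < t0" "t0 < Tc" and z0: "z0 \<in> M t0"
  and Q: "bilinear Q" "!!u v. Q u v = Q v u" "N ~= 0"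
  and c0: "c0 > 0" "!!zt. N \<bullet> zt = 0 ==> Q zt zt >= c0 * (norm zt)\<^sup>2"
 obtains psi QQ u x0 aa bb C L n1 m where "local_touching M psi QQ u x0 N Q aa bb t0 C c0 L n1 m"
  "z0 = psi (x0, u x0 t0)"
proof -
 have "\<exists>psi QQ a b u x C. local_graph M psi QQ a b u &
     QQ \<subseteq> UNIV \<times> {0<..<Tc} & (x, t0) \<in> QQ & z0 = psi (x, u x t0) &
     (\<forall>y y' s. (y, s) \<in> QQ & (y', s) \<in> QQ --> \<bar>u y s - u y' s\<bar> <= C * norm (y - y'))"
  by (rule flow[unfolded scalar_curvature_flow_def, THEN conjunct2, THEN conjunct2, THEN conjunct2,
     THEN conjunct1, THEN bspec, THEN bspec]) (use t0 z0 in auto)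
 then obtain psi :: "(real^'n) \<times> real => (real^'n) \<times> real" and QQ :: "((real^'n) \<times> real) set" and a b :: real and u x C where lg: "local_graph M psi QQ a b u" and sub: "QQ \<subseteq> UNIV \<times> {0<..<Tc}"
  and x: "(x, t0) \<in> QQ" "z0 = psi (x, u x t0)"
  and lip: "!!y y' s. (y, s) \<in> QQ ==> (y', s) \<in> QQ ==> \<bar>u y s - u y' s\<bar> <= C * norm (y - y')"
  by blast
 have vs: "viscosity_solution QQ u" using flow[unfolded scalar_curvature_flow_def, THEN conjunct2, THEN conjunct2, THEN conjunct2,
     THEN conjunct2, THEN conjunct2] lg sub by blast
 obtain c L where L: "orthogonal_transformation L" "psi = (%z. c + L z)"
  using lg unfolding local_graph_def rigid_motion_def by blast
 have lin: "linear L" using L(1) by (simp add: orthogonal_transformation_def)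
 obtain n1 m where nm: "N = L (n1, m)"
  using orthogonal_transformation_surj[OF L(1)] by (metis surjD surj_pair)
 have "local_touching M psi QQ u x N Q a b t0 C c0 L n1 m"
  by unfold_locales (use lg vs x lip Q c0 L nm in \<open>auto simp: linear_diff[OF lin]\<close>)
 then show thesis using that x(2) by blast
qed

text \<open>The chart-free supersolution test: the enclosed region lies where \<open>hyp_fun\<close>
  >= 0, so the paraboloid touches from outside.\<close>

lemma flow_super:
 assumes t0: "0 < t0" "t0 < Tc" and z0: "z0 \<in> M t0"
  and Q: "bilinear Q" "!!u v. Q u v = Q v u" "N ~= 0"
  and c0: "c0 > 0" "!!zt. N \<bullet> zt = 0 ==> Q zt zt >= c0 * (norm zt)\<^sup>2"
  and adm: "tangent_trace N Q > 0" "hyp_speed N Q > 0" and rho: "rho > 0"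
  and F: "!!z t. t0 - rho < t ==> t <= t0 ==> z \<in> M t \<union> inside (M t) ==> dist z z0 < rho ==>
   hyp_fun N Q \<alpha> (z - z0) (t - t0) >= 0"
 shows "hyp_speed N Q <= \<alpha>"
proof (rule local_touching_exists[OF t0 z0 Q c0])
 fix psi QQ u x0 aa bb C L n1 m
 assume lt: "local_touching M psi QQ u x0 N Q aa bb t0 C c0 L n1 m" and z: "z0 = psi (x0, u x0 t0)"
 note F' = F[unfolded z]
 show "hyp_speed N Q <= \<alpha>"
  by (rule local_touching.touching_super[OF lt rho _ adm]) (rule F')
qed

text \<open>The chart-free subsolution test: the positive side of the paraboloid lies inside, so
  contact is from within. This is the test that the barrier contradicts.\<close>

lemma flow_sub:
 assumes t0: "0 < t0" "t0 < Tc" and z0: "z0 \<in> M t0"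
  and Q: "bilinear Q" "!!u v. Q u v = Q v u" "N ~= 0"
  and c0: "c0 > 0" "!!zt. N \<bullet> zt = 0 ==> Q zt zt >= c0 * (norm zt)\<^sup>2" and rho: "rho > 0"
  and F: "!!z t. t0 - rho < t ==> t < t0 ==> dist z z0 < rho ==>
   hyp_fun N Q \<alpha> (z - z0) (t - t0) > 0 ==> z \<in> inside (M t)"
 shows "\<alpha> <= hyp_speed N Q"
proof (rule local_touching_exists[OF t0 z0 Q c0])
 fix psi QQ u x0 aa bb C L n1 m
 assume lt: "local_touching M psi QQ u x0 N Q aa bb t0 C c0 L n1 m" and z: "z0 = psi (x0, u x0 t0)"
 note F' = F[unfolded z]
 show "\<alpha> <= hyp_speed N Q"
  by (rule local_touching.touching_sub[OF lt rho]) (rule F')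
qed

text \<open>The support function of the convex hull of \<open>M t\<close>, expressed through the
  parametrisation over \<open>S\<close>; this form yields joint continuity in direction and
  time.\<close>

definition supp :: "(real^'n) \<times> real => real => real" where
 "supp nu t = (SUP p\<in>S. X p t \<bullet> nu)"

lemma supp_attained:
 assumes "t \<in> {0..<Tc}" shows "\<exists>p\<in>S. supp nu t = X p t \<bullet> nu & (\<forall>p'\<in>S. X p' t \<bullet> nu <= X p t \<bullet> nu)"
proof -
 have "continuous_on S (%p. X p t \<bullet> nu)" using continuous_X_at[OF assms] by (intro continuous_intros)
 then obtain p where p: "p \<in> S" "!!p'. p' \<in> S ==> X p' t \<bullet> nu <= X p t \<bullet> nu"
  using continuous_attains_sup[OF compact_S ne_S] by blast
 have "supp nu t = X p t \<bullet> nu"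
  unfolding supp_def using p by (intro antisym cSUP_least cSUP_upper ne_S bdd_aboveI2[of _ _ "X p t \<bullet> nu"]) auto
 then show ?thesis using p by blast
qed

lemma X_in_M: "p \<in> S ==> X p t \<in> M t"
 by (auto simp: evolving_surface_def)

lemma supp_attained_M:
 assumes t: "t \<in> {0..<Tc}" shows "\<exists>z\<in>M t. supp nu t = z \<bullet> nu"
 using supp_attained[OF t, of nu] X_in_M by blast

lemma supp_ge:
 assumes t: "t \<in> {0..<Tc}" and z: "z \<in> M t" shows "z \<bullet> nu <= supp nu t"
proof -
 obtain p where p: "p \<in> S" "z = X p t" using z by (auto simp: evolving_surface_def)
 then show ?thesis using supp_attained[OF t, of nu] by force
qed

lemma supp_le:
 assumes t: "t \<in> {0..<Tc}" and z: "!!z. z \<in> M t ==> z \<bullet> nu <= c" shows "supp nu t <= c"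
 using supp_attained_M[OF t, of nu] z by force

text \<open>The complement of a half-space containing \<open>M t\<close> lies in the outside, hence
  contains no inside point.\<close>

lemma inside_halfspace:
 assumes "!!z. z \<in> M t ==> z \<bullet> nu <= c" "z \<in> inside (M t)"
 shows "z \<bullet> nu <= c"
proof -
 have "convex {z. z \<bullet> nu <= c}" using convex_halfspace_le[of nu c] by (simp add: inner_commute)
 moreover have "M t \<subseteq> {z. z \<bullet> nu <= c}" using assms(1) by auto
 ultimately have "outside {z. z \<bullet> nu <= c} \<subseteq> outside (M t)" "outside {z. z \<bullet> nu <= c} = - {z. z \<bullet> nu <= c}"
  by (auto intro: outside_mono[THEN subsetD] simp: outside_convex)
 moreover have "z \<notin> outside (M t)" using assms(2) inside_Int_outside by blast
 ultimately show ?thesis by auto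
qed

lemma supp_ge': "t \<in> {0..<Tc} ==> z \<in> M t \<union> inside (M t) ==> z \<bullet> nu <= supp nu t"
 using inside_halfspace[of t nu "supp nu t" z] supp_ge by blast

lemma supp_add:
 assumes t: "t \<in> {0..<Tc}" shows "supp (mu + nu) t <= supp mu t + supp nu t"
proof (rule supp_le[OF t])
 fix z assume "z \<in> M t"
 then show "z \<bullet> (mu + nu) <= supp mu t + supp nu t"
  unfolding inner_add_right by (intro add_mono supp_ge[OF t])
qed

lemma supp_scale:
 assumes t: "t \<in> {0..<Tc}" and c: "c >= 0" shows "supp (c *\<^sub>R nu) t = c * supp nu t"
proof (rule antisym)
 show "supp (c *\<^sub>R nu) t <= c * supp nu t"
 proof (rule supp_le[OF t])
  fix z assume "z \<in> M t"
  then show "z \<bullet> (c *\<^sub>R nu) <= c * supp nu t"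
   unfolding inner_scaleR_right using c by (intro mult_left_mono supp_ge[OF t])
 qed
 obtain z where "z \<in> M t" "supp nu t = z \<bullet> nu" using supp_attained_M[OF t] by blast
 then show "c * supp nu t <= supp (c *\<^sub>R nu) t" using supp_ge[OF t, of z "c *\<^sub>R nu"] by simp
qed

lemma supp_convex: "t \<in> {0..<Tc} ==> convex_on UNIV (%nu. supp nu t)"
 unfolding convex_on_def
proof (intro conjI allI impI ballI)
 fix mu nu and u v :: real assume "t \<in> {0..<Tc}" "0 <= u" "0 <= v"
 then show "supp (u *\<^sub>R mu + v *\<^sub>R nu) t <= u * supp mu t + v * supp nu t"
  using supp_add[of t "u *\<^sub>R mu" "v *\<^sub>R nu"] by (simp add: supp_scale)
qed auto

lemma continuous_supp: "continuous_on (UNIV \<times> {0..<Tc}) (%(nu, t). supp nu t)"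
 unfolding continuous_on_iff
proof (intro ballI allI impI)
 fix x :: "((real^'n) \<times> real) \<times> real" and e :: real
 assume x: "x \<in> UNIV \<times> {0..<Tc}" and e: "e > 0"
 obtain nu0 t0 where x0: "x = (nu0, t0)" by (cases x)
 have t0: "0 <= t0" "t0 < Tc" using x by (auto simp: x0)
 define T1 where "T1 = (t0 + Tc) / 2"
 have T1: "t0 < T1" "T1 < Tc" using t0 by (auto simp: T1_def)
 let ?K = "S \<times> (cball nu0 1 \<times> {0..T1})"
 have "continuous_on ?K (%(p, nu, t). X p t \<bullet> nu)"
 proof -
  have "continuous_on ?K ((%(p, t). X p t) \<circ> (%x. (fst x, snd (snd x))))"
   using T1 by (intro continuous_on_compose continuous_on_subset[OF continuous_X] continuous_intros) auto
  then have "continuous_on ?K (%x. X (fst x) (snd (snd x)))" by (simp add: o_def)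
  then show ?thesis unfolding split_beta' by (intro continuous_intros)
 qed
 moreover have "compact ?K" by (intro compact_Times compact_S) auto
 ultimately have "uniformly_continuous_on ?K (%(p, nu, t). X p t \<bullet> nu)" by (rule compact_uniformly_continuous)
 then obtain d where d: "d > 0" "!!x x'. x \<in> ?K ==> x' \<in> ?K ==> dist x' x < d ==>
   dist ((%(p, nu, t). X p t \<bullet> nu) x') ((%(p, nu, t). X p t \<bullet> nu) x) < e / 2"
  unfolding uniformly_continuous_on_def using e by (metis half_gt_zero)
 define r where "r = min d (min 1 (T1 - t0))"
 have r: "r > 0" using d T1 by (simp add: r_def)
 have main: "\<bar>supp nu t - supp nu0 t0\<bar> < e" if nu: "0 <= t" "t < Tc" "dist (nu, t) (nu0, t0) < r" for nu t
 proof -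
  have "dist nu nu0 < r" using nu(3) dist_fst_le[of "(nu, t)" "(nu0, t0)"] by simp
  moreover have "\<bar>t - t0\<bar> < r" using nu(3) dist_snd_le[of "(nu, t)" "(nu0, t0)"] by (simp add: dist_real_def)
  ultimately have K: "nu \<in> cball nu0 1" "t \<in> {0..T1}" "t0 \<in> {0..T1}"
   using nu t0 T1 by (auto simp: r_def dist_commute)
  have close: "\<bar>X p t \<bullet> nu - X p t0 \<bullet> nu0\<bar> < e / 2" if p: "p \<in> S" for p
  proof -
   have "dist (p, nu, t) (p, nu0, t0) < d" using nu(3) by (simp add: dist_Pair_Pair r_def)
   then show ?thesis using d(2)[of "(p, nu0, t0)" "(p, nu, t)"] p K by (simp add: dist_real_def)
  qed
  have "supp nu t <= supp nu0 t0 + e / 2"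
  proof -
   obtain p where p: "p \<in> S" "supp nu t = X p t \<bullet> nu" using supp_attained[of t nu] nu by auto
   have "X p t0 \<bullet> nu0 <= supp nu0 t0" using p t0 by (intro supp_ge) (auto simp: evolving_surface_def)
   then show ?thesis using close[OF p(1)] p(2) by linarith
  qed
  moreover have "supp nu0 t0 <= supp nu t + e / 2"
  proof -
   obtain p where p: "p \<in> S" "supp nu0 t0 = X p t0 \<bullet> nu0" using supp_attained[of t0 nu0] t0 by auto
   have "X p t \<bullet> nu <= supp nu t" using p nu by (intro supp_ge) (auto simp: evolving_surface_def)
   then show ?thesis using close[OF p(1)] p(2) by linarith
  qed
  ultimately show ?thesis using e by linarith
 qed
 show "\<exists>d>0. \<forall>x'\<in>UNIV \<times> {0..<Tc}. dist x' x < d -->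
   dist ((%(nu, t). supp nu t) x') ((%(nu, t). supp nu t) x) < e"
 proof (rule exI[of _ r], intro conjI ballI impI)
  fix x' assume "x' \<in> UNIV \<times> {0..<Tc}" "dist x' x < r"
  moreover obtain nu t where "x' = (nu, t)" by (cases x')
  ultimately show "dist ((%(nu, t). supp nu t) x') ((%(nu, t). supp nu t) x) < e"
   using main[of t nu] by (simp add: x0 dist_real_def)
 qed fact
qed

end

section \<open>Legendre duality between the support function and the surface\<close>

definition diag_scale :: "('n => real) => real^'n => real^'n" where
 "diag_scale d x = (\<chi> i. d i * x $ i)"

lemma diag_scale_simps:
 "diag_scale d (x + y) = diag_scale d x + diag_scale d y" "diag_scale d (c *\<^sub>R x) = c *\<^sub>R diag_scale d x"
 "diag_scale d (x - y) = diag_scale d x - diag_scale d y" "diag_scale d 0 = 0"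
 "x \<bullet> diag_scale d y = diag_scale d x \<bullet> y" "diag_scale d (- x) = - diag_scale d x"
 by (simp_all add: diag_scale_def vec_eq_iff inner_vec_def algebra_simps)

lemma linear_diag_scale: "linear (diag_scale d)"
 by (rule linearI) (simp_all add: diag_scale_simps)

context scalar_flow
begin

text \<open>A quadratic in the normal that touches \<open>supp\<close> from above confines the
  region to a family of half-spaces. Optimising over xi gives a paraboloid that touches from outside
  at the support point, with second-order form inverse to V. Normals are written L (diag_scale d q,
  - lam), so the inverse \<open>W\<close> of that form is V rescaled by \<open>d\<close>. The
  supersolution test becomes an upper bound for the growth rate a of \<open>supp\<close>.\<close>

lemma dual_touch:
 fixes V :: "real^'n^'n"
 assumes L: "orthogonal_transformation L" and lam: "lam > 0" and d: "!!i. d i > 0"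
  and sg1: "0 < sg1" "sg1 < Tc" and V: "pos_def V" and rho: "rho > 0"
  and touch: "!!xi th. norm xi < rho ==> - rho < th ==> th <= 0 ==>
   supp (L (diag_scale d (q1 + xi), - lam)) (sg1 + th) <= supp (L (diag_scale d q1, - lam)) sg1 + quadratic_test b V a xi th"
  and small: "norm (diag_scale d q1) <= lam / 4"
 shows "\<exists>B W. pos_def B & pos_def W & W ** B = mat 1 & (\<forall>i. W $ i $ i = V $ i $ i / (d i)\<^sup>2) &
  graph_speed ((1 / lam) *\<^sub>R diag_scale d q1) B / lam <= - a"
proof -
 interpret L: linear L using L by (simp add: orthogonal_transformation_def)
 have Li: "L u \<bullet> L v = u \<bullet> v" for u v using L unfolding orthogonal_transformation_def by blast
 have Ln: "norm (L u) = norm u" for u using L by (rule orthogonal_transformation_norm)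
 obtain U where U: "pos_def U" "V ** U = mat 1" "U ** V = mat 1" using pos_def_inverse[OF V] by blast
 let ?D = "diag_scale d"
 define B where "B = (\<chi> i j. d i * d j * U $ i $ j)"
 define W where "W = (\<chi> i j. V $ i $ j / (d i * d j))"
 have WB: "W ** B = mat 1"
 proof -
  have "(W ** B) $ i $ j = (d j / d i) * (V ** U) $ i $ j" for i j
   using d by (simp add: matrix_matrix_mult_def W_def B_def sum_distrib_left less_imp_neq[OF d, symmetric] field_simps)
  then show ?thesis using d by (simp add: U(2) vec_eq_iff mat_def less_imp_neq[OF d, symmetric])
 qed
 have Bq: "x \<bullet> (B *v y) = ?D x \<bullet> (U *v ?D y)" for x y
  by (simp add: inner_vec_def matrix_vector_mult_def B_def diag_scale_def sum_distrib_left mult_ac)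
 have D0: "?D x ~= 0" if "x ~= 0" for x
  using that d by (auto simp: diag_scale_def vec_eq_iff less_imp_neq[OF d, symmetric])
 have B: "pos_def B"
  unfolding pos_def_def
 proof (intro conjI allI impI)
  show "B $ i $ j = B $ j $ i" for i j by (simp add: B_def pos_defD(1)[OF U(1), of i j] mult_ac)
  show "x \<bullet> (B *v x) > 0" if "x ~= 0" for x unfolding Bq by (rule pos_defD(3)[OF U(1) D0[OF that]])
 qed
 define D' where "D' = diag_scale (%i. 1 / d i)"
 have Wq: "x \<bullet> (W *v x) = D' x \<bullet> (V *v D' x)" for x
  by (simp add: inner_vec_def matrix_vector_mult_def W_def D'_def diag_scale_def sum_distrib_left mult_ac)
 have W: "pos_def W"
  unfolding pos_def_def
 proof (intro conjI allI impI)
  show "W $ i $ j = W $ j $ i" for i j by (simp add: W_def pos_defD(1)[OF V, of i j] mult_ac)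
  show "x \<bullet> (W *v x) > 0" if "x ~= 0" for x
  proof -
   have "D' x ~= 0" using that d by (auto simp: D'_def diag_scale_def vec_eq_iff less_imp_neq[OF d, symmetric])
   then show ?thesis unfolding Wq by (rule pos_defD(3)[OF V])
  qed
 qed
 have sg1': "sg1 \<in> {0..<Tc}" using sg1 by auto
 define nu where "nu xi = L (?D (q1 + xi), - lam)" for xi
 obtain z1 where z1: "z1 \<in> M sg1" "supp (nu 0) sg1 = z1 \<bullet> nu 0" using supp_attained_M[OF sg1'] by blast
 obtain x1 y1 where xy: "z1 = L (x1, y1)"
  using orthogonal_transformation_surj[OF L] by (metis surjD surj_pair)
 have zn: "L (x, y) \<bullet> nu xi = ?D x \<bullet> q1 + ?D x \<bullet> xi - lam * y" for x y xi
  unfolding nu_def Li by (simp add: diag_scale_simps inner_add_right)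
 have g1: "supp (nu 0) sg1 = ?D x1 \<bullet> q1 - lam * y1" using z1(2) unfolding xy zn by simp
 have main: "?D x \<bullet> q1 + ?D x \<bullet> xi - lam * y <= ?D x1 \<bullet> q1 - lam * y1 + quadratic_test b V a xi th"
  if "L (x, y) \<in> M (sg1 + th) \<union> inside (M (sg1 + th))" "norm xi < rho" "- rho < th" "- sg1 < th" "th <= 0" for x y xi th
 proof -
  have "L (x, y) \<bullet> nu xi <= supp (nu xi) (sg1 + th)"
   using that sg1 by (intro supp_ge') auto
  also have "... <= supp (nu 0) sg1 + quadratic_test b V a xi th"
   using touch[of xi th] that by (simp add: nu_def)
  finally show ?thesis unfolding zn g1 .
 qed
 \<comment> \<open>Envelope argument: the support point z1 attains the bound at xi = 0 and obeys all
   nearby bounds, so the linear term of the quadratic is the one given by z1. Otherwise a small step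
   along the difference eta violates a bound.\<close>
 have b: "?D x1 = b"
 proof (rule ccontr)
  assume ne: "?D x1 ~= b"
  define eta where "eta = ?D x1 - b"
  have eta: "eta ~= 0" using ne by (simp add: eta_def)
  define v where "v = eta \<bullet> (V *v eta)"
  have v: "v > 0" unfolding v_def by (rule pos_defD(3)[OF V eta])
  define s where "s = min (rho / (2 * norm eta)) ((norm eta)\<^sup>2 / v)"
  have s: "s > 0" "s * norm eta < rho" "s * v <= (norm eta)\<^sup>2"
  proof -
   show "s > 0" using rho eta v by (simp add: s_def)
   have "s * norm eta <= rho / (2 * norm eta) * norm eta" by (intro mult_right_mono) (auto simp: s_def)
   then show "s * norm eta < rho" using rho eta by simp
   have "s * v <= (norm eta)\<^sup>2 / v * v" using v by (intro mult_right_mono) (auto simp: s_def)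
   then show "s * v <= (norm eta)\<^sup>2" using v by simp
  qed
  have "?D x1 \<bullet> (s *\<^sub>R eta) <= quadratic_test b V a (s *\<^sub>R eta) 0"
   using main[of x1 y1 0 "s *\<^sub>R eta"] z1(1) s rho sg1 by (simp add: xy)
  moreover have "?D x1 \<bullet> (s *\<^sub>R eta) = s * (eta \<bullet> eta) + s * (b \<bullet> eta)"
   by (simp add: eta_def inner_diff_left algebra_simps)
  moreover have "quadratic_test b V a (s *\<^sub>R eta) 0 = s * (b \<bullet> eta) + s * (s * v) / 2"
   by (simp add: quadratic_test_def matrix_vector_mult_scaleR v_def)
  ultimately have "s * (eta \<bullet> eta) <= s * (s * v) / 2" by linarith
  then have "eta \<bullet> eta <= s * v / 2" using s(1) by simp
  also have "... <= (eta \<bullet> eta) / 2" using s(3) by (simp add: power2_norm_eq_inner)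
  finally show False using eta by simp
 qed
 define p where "p = (1 / lam) *\<^sub>R ?D q1"
 have lp: "lam *\<^sub>R (- p, 1) = (- ?D q1, lam)" using lam by (simp add: p_def)
 \<comment> \<open>At slope 1 / 4 the estimates of \<open>graph_speed_lower\<close> make speed and
   mean curvature positive, as the supersolution test demands.\<close>
 have np: "norm p <= 1 / 4" using small lam by (simp add: p_def field_simps)
 define N where "N = L (- ?D q1, lam)"
 define Li' where "Li' = inv L"
 have Li': "Li' (L u) = u" "L (Li' u) = u" for u
  using orthogonal_transformation_bij[OF L] by (auto simp: Li'_def bij_is_inj bij_is_surj surj_f_inv_f)
 have Li'_lin: "linear Li'"
  using orthogonal_transformation_inv[OF L] by (simp add: Li'_def orthogonal_transformation_def)
 define Q where "Q u v = fst (Li' u) \<bullet> (B *v fst (Li' v))" for u v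
 have Qb: "bilinear Q"
  unfolding Q_def by (rule bilinearI2)
   (simp_all add: linear_add[OF Li'_lin] linear_cmul[OF Li'_lin] inner_add_left inner_add_right matrix_vector_right_distrib matrix_vector_mult_scaleR)
 have Qs: "Q u v = Q v u" for u v unfolding Q_def by (rule sym_inner_matrix(2)[OF pos_defD(1)[OF B]])
 define Q' where "Q' u v = fst u \<bullet> (B *v fst v)" for u v :: "(real^'n) \<times> real"
 have Q'Q: "(%u v. Q (L u) (L v)) = Q'" by (simp add: Q_def Q'_def Li' fun_eq_iff)
 have Q'b: "bilinear Q'"
  unfolding Q'_def by (rule bilinearI2)
   (simp_all add: inner_add_left inner_add_right matrix_vector_right_distrib matrix_vector_mult_scaleR)
 have Q's: "Q' u v = Q' v u" for u v unfolding Q'_def by (rule sym_inner_matrix(2)[OF pos_defD(1)[OF B]])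
 have BQ': "B $ i $ j = Q' (axis i 1, p $ i) (axis j 1, p $ j)" for i j by (simp add: Q'_def axis_inner_matrix)
 note gs = graph_speed_eq_hyp_speed[OF Q'b Q's lam BQ', unfolded lp]
 have hN: "hyp_speed N Q = graph_speed p B / lam"
  using gs(1) hyp_speed_orthogonal[OF Qb L, of "(- ?D q1, lam)"] lam unfolding Q'Q N_def by simp
 have tN: "graph_mean_curvature p B = tangent_trace N Q / sqrt (1 + (norm p)\<^sup>2)"
  using gs(2) tangent_trace_orthogonal[OF Qb L, of "(- ?D q1, lam)"] unfolding Q'Q N_def by simp
 have np2: "(norm p)\<^sup>2 <= 1 / 16" using power_mono[OF np, of 2] by (simp add: power2_eq_square)
 have sq: "sqrt (1 + (norm p)\<^sup>2) > 0" by (simp add: add_pos_nonneg)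
 have "graph_speed p B > 0"
 proof -
  have "(1 - 2 * (norm p)\<^sup>2) * minors2 B / sqrt (1 + (norm p)\<^sup>2) > 0"
   using np2 minors2_pos[OF B dim2] sq by (intro divide_pos_pos mult_pos_pos) auto
  then show ?thesis using graph_speed_lower(1)[OF B, of p] by linarith
 qed
 then have pos1: "hyp_speed N Q > 0" using lam by (simp add: hN)
 have "trace B > 0" unfolding trace_def using pos_defD(4)[OF B] by (intro sum_pos) auto
 then have "(1 - (norm p)\<^sup>2) * trace B / sqrt (1 + (norm p)\<^sup>2) > 0"
  using np2 sq by (intro divide_pos_pos mult_pos_pos) auto
 then have "graph_mean_curvature p B > 0" using graph_speed_lower(2)[OF B, of p] by linarith
 then have pos2: "tangent_trace N Q > 0" using sq unfolding tN by (simp add: zero_less_divide_iff)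
 obtain c where c: "c > 0" "!!x. x \<bullet> (B *v x) >= c * (norm x)\<^sup>2" using pos_def_lower[OF B] by blast
  obtain K where K: "K > 0" "!!v. norm (U *v ?D v) <= norm v * K"
  proof -
   have "bounded_linear (%v. U *v ?D v)"
    using linear_compose[OF linear_diag_scale[of d] matrix_vector_mul_linear[of U]]
    by (simp add: linear_conv_bounded_linear o_def)
   then show thesis using that bounded_linear.pos_bounded by blast
  qed
  define r where "r = min (min rho sg1) (rho / K)"
 have "graph_speed p B / lam <= - a"
  unfolding hN[symmetric]
 proof (rule flow_super[where ?t0.0=sg1 and ?z0.0=z1 and ?c0.0="c / 2" and rho=r])
  show "0 < sg1" "sg1 < Tc" "z1 \<in> M sg1" by (fact sg1 z1(1))+
  show "N ~= 0"
  proof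
   assume "N = 0"
   then have "Li' N = 0" by (simp add: linear_0[OF Li'_lin])
   then show False using lam by (simp add: N_def Li' zero_prod_def)
  qed
  show "c / 2 > 0" using c by simp
  show "Q zt zt >= c / 2 * (norm zt)\<^sup>2" if "N \<bullet> zt = 0" for zt
  proof -
   obtain x y where xy': "Li' zt = (x, y)" by force
   then have zt: "zt = L (x, y)" using Li'(2) by metis
   have "lam * y = ?D q1 \<bullet> x" using that unfolding zt N_def Li by (simp add: algebra_simps)
   then have y: "y = p \<bullet> x" using lam by (simp add: p_def field_simps)
   have "\<bar>y\<bar> <= norm p * norm x" unfolding y by (rule Cauchy_Schwarz_ineq2)
   also have "... <= 1 * norm x" using np by (intro mult_right_mono) auto
   finally have "\<bar>y\<bar> <= norm x" by simp
   then have "y\<^sup>2 <= (norm x)\<^sup>2" using power_mono[of "\<bar>y\<bar>" "norm x" 2] by simp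
   then have "(norm zt)\<^sup>2 <= 2 * (norm x)\<^sup>2" unfolding zt Ln by (simp add: norm_Pair)
   then have "c / 2 * (norm zt)\<^sup>2 <= c / 2 * (2 * (norm x)\<^sup>2)" using c by (intro mult_left_mono) auto
   also have "... <= Q zt zt" using c(2)[of x] by (simp add: Q_def xy')
   finally show ?thesis .
  qed
  show "r > 0" using rho sg1 K by (simp add: r_def)
  fix z t assume t: "sg1 - r < t" "t <= sg1" and z: "z \<in> M t \<union> inside (M t)" "dist z z1 < r"
  obtain x y where zxy: "z = L (x, y)" using orthogonal_transformation_surj[OF L] by (metis surjD surj_pair)
  define eta where "eta = ?D (x - x1)"
  \<comment> \<open>The maximiser of xi . eta - xi . V xi / 2, that is, the tilt of the normal whose
    half-space is the sharpest for this point. The choice of \<open>r\<close> keeps it shorter than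
    rho.\<close>
  define xi where "xi = U *v eta"
  have zz: "z - z1 = L (x - x1, y - y1)" by (simp add: zxy xy L.diff[symmetric])
  have "norm (x - x1) < r" using z(2) norm_fst_le[of "x - x1" "y - y1"] by (simp add: dist_norm zz Ln)
  then have "norm (x - x1) * K < r * K" using K by simp
  also have "r * K <= rho"
  proof -
   have "r * K <= rho / K * K" using K by (intro mult_right_mono) (auto simp: r_def)
   then show ?thesis using K by simp
  qed
  finally have "norm xi < rho" using K(2)[of "x - x1"] by (simp add: xi_def eta_def)
  then have m: "?D x \<bullet> q1 + ?D x \<bullet> xi - lam * y <= ?D x1 \<bullet> q1 - lam * y1 + quadratic_test b V a xi (t - sg1)"
   using z(1) t by (intro main) (auto simp: zxy r_def)
  have Vxi: "V *v xi = eta" by (simp add: xi_def matrix_vector_mul_assoc U)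
  have "quadratic_test b V a xi (t - sg1) = ?D x1 \<bullet> xi + xi \<bullet> eta / 2 + a * (t - sg1)"
   by (simp add: quadratic_test_def Vxi b)
  moreover have "?D x \<bullet> xi = ?D x1 \<bullet> xi + xi \<bullet> eta" by (simp add: eta_def diag_scale_simps(3) inner_diff_right inner_commute)
  ultimately have "?D x \<bullet> q1 - ?D x1 \<bullet> q1 + xi \<bullet> eta / 2 - a * (t - sg1) <= lam * (y - y1)"
   using m by (simp add: algebra_simps)
  moreover have "N \<bullet> (z - z1) = lam * (y - y1) - (?D x \<bullet> q1 - ?D x1 \<bullet> q1)"
   unfolding zz N_def Li using diag_scale_simps(5)[of q1 d x] diag_scale_simps(5)[of q1 d x1]
   by (simp add: inner_diff_right inner_commute algebra_simps)
  moreover have "Q (z - z1) (z - z1) = xi \<bullet> eta"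
   by (simp add: Q_def zz Li' Bq eta_def[symmetric] xi_def inner_commute)
  ultimately show "0 <= hyp_fun N Q (- a) (z - z1) (t - sg1)" by (simp add: hyp_fun_def)
 qed (fact Qb Qs pos1 pos2)+
 then show ?thesis
  using B W WB unfolding p_def by (intro exI[of _ B] exI[of _ W]) (simp add: W_def power2_eq_square)
qed

end

text \<open>Spectral theorem by induction on the dimension: a maximiser of Q on the unit sphere of
  the subspace is Q-orthogonal to its orthogonal complement, in which the induction
  continues.\<close>

lemma orthogonal_diagonalization:
 fixes Q :: "'a::euclidean_space => 'a => real"
 assumes Q: "bilinear Q" and sym: "!!u v. Q u v = Q v u" and V: "subspace V"
 shows "\<exists>B. B \<subseteq> V & finite B & card B = dim V & (\<forall>b\<in>B. norm b = 1) &
  (\<forall>b\<in>B. \<forall>c\<in>B. b ~= c --> b \<bullet> c = 0 & Q b c = 0)"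
 using V
proof (induction "dim V" arbitrary: V)
 case 0
 then show ?case by (intro exI[of _ "{}"]) auto
next
 case (Suc n V)
 note q = bilinear_simps[OF Q]
 have "\<not> V \<subseteq> {0}"
 proof
  assume "V \<subseteq> {0}"
  then have "dim V = 0" by (simp add: dim_eq_0)
  then show False using Suc(2) by linarith
 qed
 then obtain v where v: "v \<in> V" "v ~= 0" by auto
 have "sgn v \<in> sphere 0 1 \<inter> V" using v Suc.prems by (simp add: sgn_div_norm subspace_scale)
 moreover have "compact (sphere 0 1 \<inter> V)" using closed_subspace[OF Suc.prems] by (intro compact_Int_closed) auto
 moreover have "continuous_on (sphere 0 1 \<inter> V) (%x. Q x x)"
  using bilinear_continuous_on_compose[OF continuous_on_id continuous_on_id Q] by simp
 ultimately obtain e where e: "e \<in> sphere 0 1 \<inter> V" "!!x. x \<in> sphere 0 1 \<inter> V ==> Q x x <= Q e e"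
  using continuous_attains_sup[of "sphere 0 1 \<inter> V" "%x. Q x x"] by blast
 define m where "m = Q e e"
 have ne: "norm e = 1" "e \<in> V" using e by auto
 have le: "Q x x <= m * (x \<bullet> x)" if x: "x \<in> V" for x
 proof (cases "x = 0")
  case False
  have "sgn x \<in> sphere 0 1 \<inter> V" using x False Suc.prems by (simp add: sgn_div_norm subspace_scale)
  then have "Q (sgn x) (sgn x) <= m" using e(2) by (simp add: m_def)
  then have "Q x x / (norm x)\<^sup>2 <= m" by (simp add: sgn_div_norm q power2_eq_square field_simps)
  then show ?thesis using False by (simp add: dot_square_norm field_simps)
 qed (simp add: q)
 have e0: "Q e x = 0" if x: "x \<in> V" "e \<bullet> x = 0" for x
 proof -
  have "2 * t * Q e x <= m * (x \<bullet> x) * t\<^sup>2 - Q x x * t\<^sup>2" for t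
  proof -
   have "Q (e + t *\<^sub>R x) (e + t *\<^sub>R x) <= m * ((e + t *\<^sub>R x) \<bullet> (e + t *\<^sub>R x))"
    using x ne Suc.prems by (intro le subspace_add subspace_scale)
   also have "(e + t *\<^sub>R x) \<bullet> (e + t *\<^sub>R x) = 1 + t\<^sup>2 * (x \<bullet> x)"
   proof -
    have "e \<bullet> e = 1" "x \<bullet> e = 0" using x ne by (simp_all add: dot_square_norm inner_commute)
    then show ?thesis using x by (simp add: inner_add_left inner_add_right power2_eq_square)
   qed
   finally show ?thesis by (simp add: q m_def sym[of x e] power2_eq_square algebra_simps)
  qed
  \<comment> \<open>Maximality is tested at e + t x with t = Q e x / K; the linear gain beats the
    quadratic loss unless Q e x = 0.\<close>
  define K where "K = \<bar>m * (x \<bullet> x) - Q x x\<bar> + 1"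
  have "K > 0" by (simp add: K_def)
  have "2 * (Q e x / K) * Q e x <= (m * (x \<bullet> x) - Q x x) * (Q e x / K)\<^sup>2"
   using \<open>!!t. 2 * t * Q e x <= m * (x \<bullet> x) * t\<^sup>2 - Q x x * t\<^sup>2\<close>[of "Q e x / K"] by (simp add: algebra_simps)
  also have "... <= K * (Q e x / K)\<^sup>2" by (intro mult_right_mono) (auto simp: K_def)
  finally have "2 * (Q e x)\<^sup>2 / K <= (Q e x)\<^sup>2 / K" using \<open>K > 0\<close> by (simp add: power2_eq_square)
  then have "(Q e x)\<^sup>2 <= 0" using \<open>K > 0\<close> by (simp add: field_simps)
  then show ?thesis by simp
 qed
 define V' where "V' = {y \<in> V. \<forall>x\<in>span {e}. orthogonal x y}"
 have V'e: "e \<bullet> x = 0" "x \<in> V" if "x \<in> V'" for x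
  using that by (auto simp: V'_def orthogonal_def span_base)
 have "dim V' + dim (span {e}) = dim V"
  unfolding V'_def using ne Suc.prems by (intro dim_subspace_orthogonal_to_vectors) (auto simp: span_minimal)
 moreover have "dim (span {e}) = 1"
 proof -
  have "dim {e} = 1" using ne by (intro dim_eq_card_independent[THEN trans]) (auto simp: dependent_single)
  then show ?thesis by simp
 qed
 ultimately have nV': "n = dim V'" using Suc(2) by simp
 have sV': "subspace V'"
  unfolding subspace_def V'_def
  using subspace_0[OF Suc.prems] subspace_add[OF Suc.prems] subspace_scale[OF Suc.prems]
  by (simp add: orthogonal_clauses)
 obtain B where B: "B \<subseteq> V'" "finite B" "card B = dim V'" "\<forall>b\<in>B. norm b = 1"
  "\<forall>b\<in>B. \<forall>c\<in>B. b ~= c --> b \<bullet> c = 0 & Q b c = 0" using Suc(1)[OF nV' sV'] by blast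
 have "e \<notin> B"
 proof
  assume "e \<in> B"
  then have "e \<bullet> e = 0" using B(1) V'e by blast
  then show False using ne by simp
 qed
 have eB: "e \<bullet> b = 0" "b \<bullet> e = 0" "Q e b = 0" "Q b e = 0" if "b \<in> B" for b
  using V'e[of b] B(1) that e0[of b] sym[of b e] by (auto simp: inner_commute)
 show ?case
 proof (intro exI[of _ "insert e B"] conjI ballI impI)
  show "insert e B \<subseteq> V" using B(1) ne V'e by blast
  show "finite (insert e B)" using B(2) by simp
  show "card (insert e B) = dim V" using B(2,3) \<open>e \<notin> B\<close> nV' Suc(2) by simp
  fix b assume b: "b \<in> insert e B"
  then show "norm b = 1" using B(4) ne by blast
  fix c assume c: "c \<in> insert e B" "b ~= c"
  show "b \<bullet> c = 0" "Q b c = 0" using b c eB B(5) by blast+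
 qed
qed

text \<open>The outer normal nu becomes the downward vector (0, -1), matching the orientation of
  local graphs; only the tangential block of Q is diagonalised.\<close>

lemma diagonalizing_frame:
 fixes Q :: "(real^'n) \<times> real => (real^'n) \<times> real => real"
 assumes Q: "bilinear Q" and sym: "!!u v. Q u v = Q v u" and nu: "norm nu = 1"
 obtains L :: "(real^'n) \<times> real => (real^'n) \<times> real" where "orthogonal_transformation L" "L (0, -1) = nu"
  "!!i j. i ~= j ==> Q (L (axis i 1, 0)) (L (axis j 1, 0)) = 0"
proof -
 let ?V = "{x. nu \<bullet> x = 0}"
 obtain B where B: "B \<subseteq> ?V" "finite B" "card B = dim ?V" "\<forall>b\<in>B. norm b = 1"
  "\<forall>b\<in>B. \<forall>c\<in>B. b ~= c --> b \<bullet> c = 0 & Q b c = 0"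
  using orthogonal_diagonalization[OF Q sym subspace_hyperplane[of nu]] by metis
 have "nu ~= 0" using nu by auto
 then have "card B = CARD('n)" using B(3) by (simp add: dim_hyperplane)
 then obtain e where e: "bij_betw e (UNIV :: 'n set) B"
  using B(2) by (metis finite finite_same_card_bij)
 have eB: "e i \<in> B" for i using e by (auto simp: bij_betw_def)
 have inj: "e i = e j ==> i = j" for i j using e by (auto simp: bij_betw_def inj_def)
 have e1: "e i \<bullet> e i = 1" for i using B(4) eB[of i] by (simp add: dot_square_norm)
 have e2: "e i \<bullet> e j = 0 & Q (e i) (e j) = 0" if "i ~= j" for i j using B(5) eB[of i] eB[of j] inj[of i j] that by blast
 have ee: "e i \<bullet> e j = (if i = j then 1 else 0)" "i ~= j ==> Q (e i) (e j) = 0" for i j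
  using e1[of i] e2[of i j] by auto
 have enu: "e i \<bullet> nu = 0" "nu \<bullet> e i = 0" for i using B(1) eB[of i] by (auto simp: inner_commute)
 define L where "L z = (\<Sum>i\<in>UNIV. (fst z $ i) *\<^sub>R e i) - snd z *\<^sub>R nu" for z :: "(real^'n) \<times> real"
 have lin: "linear L"
  by (rule linearI) (simp_all add: L_def sum.distrib scaleR_add_left algebra_simps scaleR_sum_right)
 have "L v \<bullet> L w = v \<bullet> w" for v w
 proof -
  have "(\<Sum>i\<in>UNIV. fst v $ i *\<^sub>R e i) \<bullet> (\<Sum>i\<in>UNIV. fst w $ i *\<^sub>R e i) = fst v \<bullet> fst w"
   by (simp add: inner_sum_left inner_sum_right ee inner_vec_def if_distrib[of "%x. _ * x"] sum.delta mult.commute cong: if_cong)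
  then show ?thesis
   using nu by (cases v, cases w)
    (simp add: L_def inner_diff_left inner_diff_right inner_sum_left inner_sum_right enu dot_square_norm)
 qed
 with lin have 1: "orthogonal_transformation L" by (simp add: orthogonal_transformation_def)
 have La: "L (axis i 1, 0) = e i" for i
  by (simp add: L_def axis_def if_distrib[of "%x. x *\<^sub>R _"] sum.delta cong: if_cong)
 have 2: "L (0, -1) = nu" by (simp add: L_def)
 show thesis by (rule that[OF 1 2]) (simp add: La ee)
qed

lemma diag_scale_1: "diag_scale (%_. 1) x = x"
 by (simp add: diag_scale_def vec_eq_iff)

lemma scaled_mat_vector: "(c *\<^sub>R mat 1) *v x = c *\<^sub>R (x :: real^'n)"
 by (metis matrix_vector_mul_lid scaleR_matrix_vector_assoc)

lemma pos_def_scaled_mat: "c > 0 ==> pos_def (c *\<^sub>R mat 1 :: real^'n^'n)"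
 unfolding pos_def_def scaled_mat_vector by (simp add: mat_def)

section \<open>Monotonicity of the support function in time\<close>

context scalar_flow
begin

lemma X_bounded:
 assumes T: "T1 < Tc"
 obtains R where "R > 0" "!!z t. 0 <= t ==> t <= T1 ==> z \<in> M t ==> norm z <= R"
proof -
 have "compact ((%(p, t). X p t) ` (S \<times> {0..T1}))"
  using T by (intro compact_continuous_image continuous_on_subset[OF continuous_X] compact_Times compact_S) auto
 from compact_imp_bounded[OF this] obtain R where R: "R > 0" "\<forall>z\<in>(%(p, t). X p t) ` (S \<times> {0..T1}). norm z <= R"
  unfolding bounded_pos by blast
 show thesis
 proof (rule that[OF R(1)])
  fix z t assume "0 <= t" "t <= T1" "z \<in> M t"
  then obtain p where "p \<in> S" "z = X p t" by (auto simp: evolving_surface_def)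
  with \<open>0 <= t\<close> \<open>t <= T1\<close> show "norm z <= R" by (intro bspec[OF R(2)] image_eqI[of _ _ "(p, t)"]) auto
 qed
qed

lemma supp_le_norm:
 assumes "t \<in> {0..<Tc}" and "!!z. z \<in> M t ==> norm z <= R"
 shows "\<bar>supp nu t\<bar> <= R * norm nu"
proof -
 obtain z where z: "z \<in> M t" "supp nu t = z \<bullet> nu" using supp_attained_M[OF assms(1)] by blast
 have "\<bar>z \<bullet> nu\<bar> <= norm z * norm nu" by (rule Cauchy_Schwarz_ineq2)
 also have "... <= R * norm nu" using assms(2)[OF z(1)] by (intro mult_right_mono) auto
 finally show ?thesis using z by simp
qed

lemma supp_lipschitz:
 assumes t: "t \<in> {0..<Tc}" and "!!z. z \<in> M t ==> norm z <= R"
 shows "supp mu t <= supp nu t + R * norm (mu - nu)"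
proof -
 have "nu + (mu - nu) = mu" by simp
 with supp_add[OF t, of nu "mu - nu"] have "supp mu t <= supp nu t + supp (mu - nu) t" by (simp only:)
 moreover have "\<bar>supp (mu - nu) t\<bar> <= R * norm (mu - nu)" by (rule supp_le_norm[OF assms])
 ultimately show ?thesis by linarith
qed

text \<open>A maximum principle, since \<open>supp\<close> need not be differentiable. If it grew,
  then \<open>w\<close>, from which a paraboloid and half the mean growth rate are subtracted, would
  have an interior maximum; \<open>dual_touch\<close> would give a speed of at most - gm there,
  although definite Hessians with small slope have nonnegative speed.\<close>

lemma supp_antimono:
 assumes t12: "0 <= t1" "t1 <= t2" "t2 < Tc"
 shows "supp nu t2 <= supp nu t1"
proof -
 have unit: "supp nu t2 <= supp nu t1" if nu: "norm nu = 1" for nu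
 proof (rule ccontr)
  assume "\<not> ?thesis"
  then have gt: "supp nu t1 < supp nu t2" by simp
  then have lt: "t1 < t2" using t12 by (cases "t1 = t2") auto
  define \<Delta> where "\<Delta> = supp nu t2 - supp nu t1"
  have \<Delta>: "\<Delta> > 0" using gt by (simp add: \<Delta>_def)
  define gm where "gm = \<Delta> / (2 * (t2 - t1))"
  have gm: "gm > 0" using \<Delta> lt by (simp add: gm_def)
  obtain R where R: "R > 0" "!!z t. 0 <= t ==> t <= t2 ==> z \<in> M t ==> norm z <= R" using X_bounded[OF t12(3)] by blast
  obtain L :: "(real^'n) \<times> real => (real^'n) \<times> real" where L: "orthogonal_transformation L" "L (0, -1) = nu"
  proof -
   have "bilinear (inner :: (real^'n) \<times> real => _)"
    using bounded_bilinear_inner bilinear_conv_bounded_bilinear by blast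
   from diagonalizing_frame[OF this inner_commute nu] that show thesis by blast
  qed
  interpret L: linear L using L by (simp add: orthogonal_transformation_def)
  define g where "g q t = supp (L (q, -1)) t" for q t
  \<comment> \<open>The first term excludes a maximum at time t1, where K |q|^2 + \<Delta> / 2
    exceeds the Lipschitz bound R |q|; the second excludes |q| = 1 / 4.\<close>
  define K where "K = R\<^sup>2 / \<Delta> + 64 * R + 1"
  have K: "K > 0" "R\<^sup>2 / \<Delta> < K" "64 * R < K" using R \<Delta> by (auto simp: K_def intro!: add_nonneg_pos)
  define w where "w q t = g q t - K * (norm q)\<^sup>2 - gm * (t - t1)" for q t
  let ?D = "cball (0::real^'n) (1/4) \<times> {t1..t2}"
  have cont: "continuous_on ?D (%(q, t). w q t)"
  proof -
   have "continuous_on ?D ((%(nu, t). supp nu t) \<circ> (%x. (L (fst x, -1), snd x)))"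
    using t12 by (intro continuous_on_compose continuous_on_subset[OF continuous_supp] continuous_intros
      linear_continuous_on_compose[OF _ L.linear_axioms]) auto
   then have "continuous_on ?D (%x. g (fst x) (snd x))" by (simp add: o_def g_def)
   then show ?thesis unfolding w_def split_beta' by (intro continuous_intros)
  qed
  have "compact ?D" "?D ~= {}" using lt by (auto intro!: compact_Times)
  then obtain x where x: "x \<in> ?D" "!!y. y \<in> ?D ==> (%(q, t). w q t) y <= (%(q, t). w q t) x"
   using continuous_attains_sup[OF _ _ cont] by blast
  obtain q1 s where xs: "x = (q1, s)" by (cases x)
  have s: "norm q1 <= 1/4" "t1 <= s" "s <= t2" using x(1) by (auto simp: xs)
  have max: "w q t <= w q1 s" if "norm q <= 1/4" "t1 <= t" "t <= t2" for q t
   using x(2)[of "(q, t)"] that by (simp add: xs)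
  have "gm * (t2 - t1) = \<Delta> / 2" using lt by (simp add: gm_def field_simps)
  moreover have "w 0 t2 = supp nu t2 - gm * (t2 - t1)" unfolding w_def g_def L(2) by simp
  ultimately have w0: "w 0 t2 = supp nu t1 + \<Delta> / 2" using \<Delta>_def by linarith
  have "w 0 t2 <= w q1 s" using lt by (intro max) auto
  with w0 have ge: "supp nu t1 + \<Delta> / 2 <= w q1 s" by simp
  have gl: "g q t <= supp nu t + R * norm q" if "t1 <= t" "t <= t2" for q t
  proof -
   have "g q t <= supp nu t + R * norm (L (q, -1) - nu)"
    unfolding g_def using that t12 by (intro supp_lipschitz R(2)) auto
   also have "L (q, -1) - nu = L (q, 0)" unfolding L(2)[symmetric] by (simp add: L.diff[symmetric])
   also have "norm (L (q, 0)) = norm q" by (simp add: orthogonal_transformation_norm[OF L(1)])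
   finally show ?thesis .
  qed
  have "s ~= t1"
  proof
   assume "s = t1"
   then have "w q1 s = g q1 t1 - K * (norm q1)\<^sup>2" by (simp add: w_def)
   also have "... <= supp nu t1 + R * norm q1 - K * (norm q1)\<^sup>2" using gl[of t1 q1] lt by simp
   finally have 1: "\<Delta> / 2 + K * (norm q1)\<^sup>2 <= R * norm q1" using ge by simp
   define y where "y = norm q1"
   have "R\<^sup>2 < K * \<Delta>" using K(2) \<Delta> by (simp add: field_simps)
   have "0 <= (K * y - R / 2)\<^sup>2" by simp
   also have "... = K * (K * y\<^sup>2 - R * y) + R\<^sup>2 / 4" by (simp add: power2_eq_square algebra_simps)
   also have "... <= K * (- \<Delta> / 2) + R\<^sup>2 / 4" using 1 K(1) by (intro add_right_mono mult_left_mono) (auto simp: y_def)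
   also have "... < 0" using \<open>R\<^sup>2 < K * \<Delta>\<close> zero_le_power2[of R] by (simp; argo)
   finally show False by simp
  qed
  then have st: "t1 < s" using s by simp
  have "norm q1 ~= 1/4"
  proof
   assume n: "norm q1 = 1/4"
   have "w q1 s <= g q1 s - K / 16"
   proof -
    have "K * (norm q1)\<^sup>2 = K / 16" unfolding n by (simp add: power2_eq_square)
    moreover have "gm * (s - t1) >= 0" using gm s by (intro mult_nonneg_nonneg) auto
    ultimately show ?thesis unfolding w_def by linarith
   qed
   also have "... <= supp nu s + R / 4 - K / 16" using gl[of s q1] s n by simp
   also have "... < supp nu s - 2 * R" using K R by (simp add: field_simps)
   finally have "supp nu t1 < supp nu s - 2 * R" using ge \<Delta> by linarith
   moreover have "\<bar>supp nu t1\<bar> <= R" "\<bar>supp nu s\<bar> <= R"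
    using supp_le_norm[of t1 R nu] supp_le_norm[of s R nu] R(2)[of t1] R(2)[of s] s t12 lt nu by simp_all
   ultimately show False by linarith
  qed
  then have q1: "norm q1 < 1/4" using s by simp
  have "\<exists>B W. pos_def B & pos_def W & W ** B = mat 1 & (\<forall>i. W $ i $ i = ((2 * K) *\<^sub>R mat 1 :: real^'n^'n) $ i $ i / (1::real)\<^sup>2) &
   graph_speed ((1 / 1) *\<^sub>R diag_scale (%_. 1) q1) B / 1 <= - (gm)"
  proof (rule dual_touch[where rho = "min (1/4 - norm q1) (s - t1)" and b = "(2 * K) *\<^sub>R q1" and ?sg1.0 = s and d = "%_. 1" and lam = 1, OF L(1)])
   fix xi :: "real^'n" and th :: real assume xi: "norm xi < min (1/4 - norm q1) (s - t1)" "- min (1/4 - norm q1) (s - t1) < th" "th <= 0"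
   have "norm (q1 + xi) <= 1/4" using norm_triangle_ineq[of q1 xi] xi by simp
   then have "w (q1 + xi) (s + th) <= w q1 s" using xi s by (intro max) auto
   moreover have "(norm (q1 + xi))\<^sup>2 = (norm q1)\<^sup>2 + 2 * (q1 \<bullet> xi) + (norm xi)\<^sup>2"
    by (simp add: power2_norm_eq_inner inner_add_left inner_add_right inner_commute)
   ultimately show "supp (L (diag_scale (%_. 1) (q1 + xi), - 1)) (s + th) <= supp (L (diag_scale (%_. 1) q1, - 1)) s +
     quadratic_test ((2 * K) *\<^sub>R q1) ((2 * K) *\<^sub>R mat 1) (gm) xi th"
    by (simp add: w_def g_def diag_scale_1 quadratic_test_def scaled_mat_vector power2_norm_eq_inner algebra_simps)
  qed (use st s t12 q1 K in \<open>auto simp: diag_scale_1 pos_def_scaled_mat\<close>)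
  then obtain B :: "real^'n^'n" where B: "pos_def B" "graph_speed q1 B <= - (gm)"
   by (auto simp: diag_scale_1)
  have "(norm q1)\<^sup>2 <= (1/4)\<^sup>2" using q1 by (intro power_mono) auto
  then have "(1 - 2 * (norm q1)\<^sup>2) * minors2 B / sqrt (1 + (norm q1)\<^sup>2) >= 0"
   using minors2_pos[OF B(1) dim2] by (intro divide_nonneg_nonneg mult_nonneg_nonneg) (auto simp: power2_eq_square)
  then have "graph_speed q1 B >= 0" using graph_speed_lower(1)[OF B(1), of q1] by linarith
  then show False using B(2) gm by linarith
 qed
 have eq: "norm nu *\<^sub>R sgn nu = nu" by (cases "nu = 0") (simp_all add: sgn_div_norm)
 have "supp nu t2 = norm nu * supp (sgn nu) t2" "supp nu t1 = norm nu * supp (sgn nu) t1"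
  using t12 supp_scale[of t2 "norm nu" "sgn nu"] supp_scale[of t1 "norm nu" "sgn nu"] unfolding eq by auto
 moreover have "supp (sgn nu) t2 <= supp (sgn nu) t1" if "nu ~= 0"
  using that by (intro unit) (simp add: norm_sgn)
 ultimately show ?thesis by (cases "nu = 0") (auto intro: mult_left_mono)
qed

end

section \<open>Mollification of sublinear functions\<close>

text \<open>The cube of the positive part has second derivative 6 max 0 s, with Lipschitz constant
  6; hence a cubic remainder with constant 1. This regularity is the reason for the cube in the
  mollifier.\<close>

lemma cube_taylor:
 fixes s h :: real
 shows "\<bar>max 0 (s + h) ^ 3 - max 0 s ^ 3 - 3 * (max 0 s)\<^sup>2 * h - 3 * max 0 s * h\<^sup>2\<bar> <= \<bar>h\<bar> ^ 3"
proof (cases "0 <= s")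
 case s: True
 show ?thesis
 proof (cases "0 <= s + h")
  case True
  then have "max 0 (s + h) ^ 3 - max 0 s ^ 3 - 3 * (max 0 s)\<^sup>2 * h - 3 * max 0 s * h\<^sup>2 = h ^ 3"
   using s by (simp add: power2_eq_square power3_eq_cube algebra_simps)
  then show ?thesis by (simp add: power_abs)
 next
  case False
  define x y where "x = - (s + h)" and "y = - h"
  have xy: "0 <= x" "x <= y" "s = y - x" "h = - y" using s False by (auto simp: x_def y_def)
  have m: "max 0 (s + h) = 0" "max 0 s = y - x" using xy by auto
  have 1: "max 0 (s + h) ^ 3 - max 0 s ^ 3 - 3 * (max 0 s)\<^sup>2 * h - 3 * max 0 s * h\<^sup>2 = x ^ 3 - y ^ 3"
   unfolding m unfolding xy(4) by (simp add: power2_eq_square power3_eq_cube algebra_simps)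
  have "0 <= x ^ 3" using xy(1) by (rule zero_le_power)
  moreover have "x ^ 3 <= y ^ 3" using xy(2,1) by (rule power_mono)
  moreover have "\<bar>h\<bar> = y" using xy by simp
  ultimately show ?thesis unfolding 1 by simp
 qed
next
 case False
 have "0 <= max 0 (s + h) ^ 3" "max 0 (s + h) ^ 3 <= \<bar>h\<bar> ^ 3" using False by (auto intro!: power_mono)
 then show ?thesis using False by simp
qed

locale mollified =
 fixes h :: "'a::euclidean_space => real => real" and I :: "real set" and r :: real
 assumes h_add: "!!mu nu t. t \<in> I ==> h (mu + nu) t <= h mu t + h nu t"
  and h_scale: "!!c nu t. t \<in> I ==> 0 <= c ==> h (c *\<^sub>R nu) t = c * h nu t"
  and h_cont: "continuous_on (UNIV \<times> I) (%(nu, t). h nu t)"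
  and r: "0 < r" "r <= 1"
begin

definition s0 :: "'a => real" where "s0 y = max 0 (r\<^sup>2 - (norm y)\<^sup>2)"
definition box0 :: "'a set" where "box0 = cbox (- (r *\<^sub>R One)) (r *\<^sub>R One)"
definition box3 :: "'a set" where "box3 = cbox (- (3 *\<^sub>R One)) (3 *\<^sub>R One)"
definition mass :: real where "mass = integral box0 (%y. s0 y ^ 3)"
definition kap :: "'a => real" where "kap y = s0 y ^ 3 / mass"
text \<open>Mollification at scale \<open>N\<close>, jointly sublinear in (nu, N). Taking N = norm
  nu keeps positive homogeneity and subadditivity, so the result is still of support type; N = 1
  gives the ordinary mollification \<open>G\<close>.\<close>

definition Phi :: "'a => real => real => real" where "Phi nu N t = integral box0 (%y. h (nu + N *\<^sub>R y) t * kap y)"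

lemma continuous_s0: "continuous_on A f ==> continuous_on A (%x. s0 (f x))"
 unfolding s0_def by (intro continuous_intros)

lemma s0_bounds: "0 <= s0 y" "s0 y <= 1"
proof -
 have "r\<^sup>2 <= 1" using r by (simp add: power_le_one)
 then show "s0 y <= 1" using zero_le_power2[of "norm y"] unfolding s0_def by (intro max.boundedI) linarith+
qed (simp add: s0_def)

lemma s0_minus: "s0 (- y) = s0 y" by (simp add: s0_def)

lemma mass_pos: "mass > 0"
proof -
 define D where "D = real DIM('a)"
 have D: "D >= 1" using DIM_positive[where 'a='a] by (simp add: D_def)
 define c where "c = r / (2 * D)"
 have c: "c > 0" "D * c = r / 2" "c <= r" using r D by (auto simp: c_def field_simps)
 let ?b = "cbox (- (c *\<^sub>R One)) (c *\<^sub>R One :: 'a)"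
 have cont: "continuous_on A (%y. s0 y ^ 3)" for A by (intro continuous_intros continuous_s0)
 have "(3 / 4 * r\<^sup>2) ^ 3 * measure lborel ?b = integral ?b (%y. (3 / 4 * r\<^sup>2) ^ 3)" by simp
 also have "... <= integral ?b (%y. s0 y ^ 3)"
 proof (intro integral_le integrable_continuous cont continuous_intros power_mono)
  fix y :: 'a assume y: "y \<in> ?b"
  have "norm y <= (\<Sum>b\<in>Basis. \<bar>y \<bullet> b\<bar>)" by (rule norm_le_l1)
  also have "... <= (\<Sum>b\<in>(Basis::'a set). c)"
  proof (intro sum_mono)
   fix b :: 'a assume "b \<in> Basis"
   then show "\<bar>y \<bullet> b\<bar> <= c" using y unfolding mem_box by force
  qed
  also have "... = r / 2" using c(2) by (simp add: D_def)
  finally have "(norm y)\<^sup>2 <= (r / 2)\<^sup>2" by (intro power_mono) auto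
  moreover have "(r / 2)\<^sup>2 = r\<^sup>2 / 4" by (simp add: power_divide)
  ultimately show "3 / 4 * r\<^sup>2 <= s0 y" unfolding s0_def by (intro max.coboundedI2) linarith
 qed simp
 also have "... <= integral box0 (%y. s0 y ^ 3)"
  unfolding box0_def
 proof (intro integral_subset_le integrable_continuous cont)
  show "?b \<subseteq> cbox (- (r *\<^sub>R One)) (r *\<^sub>R One)"
   using c(3) unfolding subset_box by simp
 qed (simp add: s0_bounds)
 finally have "(3 / 4 * r\<^sup>2) ^ 3 * measure lborel ?b <= mass" by (simp add: mass_def)
 moreover have "measure lborel ?b > 0" using c by (intro content_pos_lt) simp
 then have "(3 / 4 * r\<^sup>2) ^ 3 * measure lborel ?b > 0" using r by (intro mult_pos_pos) auto
 ultimately show ?thesis by linarith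
qed

lemma continuous_kap: "continuous_on A f ==> continuous_on A (%x. kap (f x))"
 unfolding kap_def using mass_pos by (intro continuous_intros continuous_s0) auto

lemma kap_nonneg: "0 <= kap y" using s0_bounds mass_pos by (simp add: kap_def)

lemma kap_minus: "kap (- y) = kap y" by (simp add: kap_def s0_minus)

lemma integral_kap: "integral box0 kap = 1"
 using mass_pos by (simp add: kap_def[abs_def] mass_def)

lemma kap_outside: "norm y >= r ==> kap y = 0"
 using r power_mono[of r "norm y" 2] by (simp add: kap_def s0_def)

lemma kap_outside_box: "y \<notin> box0 ==> kap y = 0"
proof -
 assume "y \<notin> box0"
 then obtain b where b: "b \<in> Basis" "r < \<bar>y \<bullet> b\<bar>" by (force simp: box0_def mem_box)
 then have "r < norm y" using Basis_le_norm[OF b(1), of y] by simp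
 then show "kap y = 0" by (intro kap_outside) simp
qed

lemma integrable_box0: "continuous_on box0 f ==> (f :: 'a => real) integrable_on box0"
 unfolding box0_def by (rule integrable_continuous)

lemma integrable_box3: "continuous_on box3 f ==> (f :: 'a => real) integrable_on box3"
 unfolding box3_def by (rule integrable_continuous)

lemma continuous_h: "t \<in> I ==> continuous_on A f ==> continuous_on A (%x. h (f x) t)"
proof -
 assume "t \<in> I" "continuous_on A f"
 then have "continuous_on A ((%(nu, t). h nu t) \<circ> (%x. (f x, t)))"
  by (intro continuous_on_compose continuous_on_subset[OF h_cont] continuous_intros) auto
 then show ?thesis by (simp add: o_def)
qed

lemma Phi_integrable: "t \<in> I ==> (%y. h (nu + N *\<^sub>R y) t * kap y) integrable_on box0"
 by (intro integrable_box0 continuous_intros continuous_h continuous_kap) auto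

lemma integral_even: "integral box0 (%y. f (- y)) = integral box0 (f :: 'a => real)"
 unfolding box0_def using integral_reflect[of "r *\<^sub>R One" "- (r *\<^sub>R One)" f] by simp

lemma Phi_even: "Phi nu (- N) t = Phi nu N t"
 using integral_even[of "%y. h (nu + N *\<^sub>R y) t * kap y"] by (simp add: Phi_def kap_minus)

lemma Phi_0: "Phi nu 0 t = h nu t"
 by (simp add: Phi_def integral_kap)

lemma Phi_add: "t \<in> I ==> Phi (mu + nu) (K + N) t <= Phi mu K t + Phi nu N t"
proof -
 assume t: "t \<in> I"
 have "Phi (mu + nu) (K + N) t <= integral box0 (%y. h (mu + K *\<^sub>R y) t * kap y + h (nu + N *\<^sub>R y) t * kap y)"
  unfolding Phi_def
 proof (intro integral_le Phi_integrable t integrable_add)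
  fix y :: 'a
  have "h ((mu + K *\<^sub>R y) + (nu + N *\<^sub>R y)) t * kap y <= (h (mu + K *\<^sub>R y) t + h (nu + N *\<^sub>R y) t) * kap y"
   by (intro mult_right_mono h_add t kap_nonneg)
  then show "h (mu + nu + (K + N) *\<^sub>R y) t * kap y <= h (mu + K *\<^sub>R y) t * kap y + h (nu + N *\<^sub>R y) t * kap y"
   by (simp add: algebra_simps)
 qed
 also have "... = Phi mu K t + Phi nu N t" unfolding Phi_def by (intro integral_add Phi_integrable t)
 finally show ?thesis .
qed

lemma Phi_scale: "t \<in> I ==> c >= 0 ==> Phi (c *\<^sub>R nu) (c * N) t = c * Phi nu N t"
proof -
 assume t: "t \<in> I" "c >= 0"
 have "h (c *\<^sub>R nu + (c * N) *\<^sub>R y) t = c * h (nu + N *\<^sub>R y) t" for y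
  using h_scale[OF t, of "nu + N *\<^sub>R y"] by (simp add: scaleR_add_right)
 then show ?thesis by (simp add: Phi_def mult.assoc)
qed

text \<open>\<open>Phi\<close> is convex in N, and even because the kernel is even; so it increases
  for N >= 0. The weight \<open>a\<close> writes K as a convex combination of N and - N.\<close>

lemma Phi_mono:
 assumes t: "t \<in> I" and N: "0 <= K" "K <= N"
 shows "Phi nu K t <= Phi nu N t"
proof (cases "N = 0")
 case False
 then have N0: "N > 0" using N by simp
 define a where "a = (1 + K / N) / 2"
 have a: "0 <= a" "0 <= 1 - a" using N N0 by (auto simp: a_def field_simps)
 have "Phi (a *\<^sub>R nu + (1 - a) *\<^sub>R nu) (a * N + (1 - a) * - N) t <= a * Phi nu N t + (1 - a) * Phi nu (- N) t"
  using Phi_add[OF t, of "a *\<^sub>R nu" "(1 - a) *\<^sub>R nu" "a * N" "(1 - a) * - N"]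
  unfolding Phi_scale[OF t a(1)] Phi_scale[OF t a(2)] .
 moreover have "a * N + (1 - a) * - N = K" using N0 by (simp add: a_def field_simps)
 moreover have "a *\<^sub>R nu + (1 - a) *\<^sub>R nu = nu" by (simp add: scaleR_add_left[symmetric])
 ultimately show ?thesis by (simp add: Phi_even algebra_simps)
qed (use N in simp)

lemma Phi_ge: "t \<in> I ==> 0 <= N ==> h nu t <= Phi nu N t"
 using Phi_mono[of t 0 N nu] by (simp add: Phi_0)

lemma Phi_le:
 assumes t: "t \<in> I" and N: "0 <= N" and C: "!!y. h y t <= C * norm y"
 shows "Phi nu N t <= h nu t + N * (\<bar>C\<bar> * r)"
proof -
 have "Phi nu N t <= integral box0 (%y. (h nu t + N * (\<bar>C\<bar> * r)) * kap y)"
  unfolding Phi_def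
 proof (intro integral_le Phi_integrable t integrable_box0 continuous_intros continuous_kap)
  fix y :: 'a
  show "h (nu + N *\<^sub>R y) t * kap y <= (h nu t + N * (\<bar>C\<bar> * r)) * kap y"
  proof (cases "norm y >= r")
   case False
   have "h (nu + N *\<^sub>R y) t <= h nu t + N * h y t" using h_add[OF t, of nu "N *\<^sub>R y"] h_scale[OF t N] by simp
   moreover have "C * norm y <= \<bar>C\<bar> * r" using False by (intro mult_mono) auto
   then have "N * h y t <= N * (\<bar>C\<bar> * r)" using C[of y] N by (intro mult_left_mono) auto
   ultimately show ?thesis by (intro mult_right_mono kap_nonneg) simp
  qed (simp add: kap_outside)
 qed
 then show ?thesis by (simp add: integral_kap)
qed

lemma continuous_Phi: "continuous_on (UNIV \<times> UNIV \<times> I) (%(nu, N, t). Phi nu N t)"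
proof -
 have "continuous_on ((UNIV \<times> UNIV \<times> I) \<times> box0) ((%(nu, t). h nu t) \<circ> (%x. (fst (fst x) + fst (snd (fst x)) *\<^sub>R snd x, snd (snd (fst x)))))"
  by (intro continuous_on_compose continuous_on_subset[OF h_cont] continuous_intros) auto
 then have "continuous_on ((UNIV \<times> UNIV \<times> I) \<times> box0) (%x. h (fst (fst x) + fst (snd (fst x)) *\<^sub>R snd x) (snd (snd (fst x))) * kap (snd x))"
  by (intro continuous_intros continuous_kap) (simp_all add: o_def)
 then have "continuous_on (UNIV \<times> UNIV \<times> I) (%x. integral box0 (%y. h (fst x + fst (snd x) *\<^sub>R y) (snd (snd x)) * kap y))"
  unfolding box0_def by (intro integral_continuous_on_param) (simp add: split_beta')
 then show ?thesis by (simp add: Phi_def split_beta')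
qed

definition G :: "'a => real => real" where "G nu t = Phi nu 1 t"
text \<open>\<open>dG\<close> and \<open>d2G\<close> are the derivatives of \<open>G\<close>, moved
  onto the kernel by the substitution w = nu + y. The fixed box \<open>box3\<close> contains the
  support of the shifted kernel whenever |nu| <= 2.\<close>

definition dG :: "'a => real => 'a => real" where
 "dG nu t xi = integral box3 (%w. h w t * (6 * (s0 (w - nu))\<^sup>2 * ((w - nu) \<bullet> xi))) / mass"
definition d2G :: "'a => real => 'a => 'a => real" where
 "d2G nu t xi eta = integral box3 (%w. h w t * (24 * s0 (w - nu) * ((w - nu) \<bullet> xi) * ((w - nu) \<bullet> eta) - 6 * (s0 (w - nu))\<^sup>2 * (xi \<bullet> eta))) / mass"

lemma G_alt:
 assumes t: "t \<in> I" and nu: "norm nu <= 2"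
 shows "G nu t = integral box3 (%w. h w t * kap (w - nu))"
proof -
 let ?f = "%w. h w t * kap (w - nu)"
 let ?b = "cbox (- (r *\<^sub>R One) + nu) (r *\<^sub>R One + nu)"
 have "G nu t = integral (cbox (- (r *\<^sub>R One)) (r *\<^sub>R One)) (?f \<circ> (%x. nu + x))"
  by (simp add: G_def Phi_def box0_def o_def)
 also have "... = integral ?b ?f"
  using integral_shift_cbox_plus[of "- (r *\<^sub>R One)" "r *\<^sub>R One" ?f nu] by (simp add: o_def add.commute)
 also have "... = integral box3 ?f"
 proof -
  have i: "?f integrable_on ?b"
   by (intro integrable_continuous continuous_intros continuous_h continuous_kap t)
  have z: "?f w = 0" if "w \<notin> ?b" for w
  proof -
   have "w - nu \<notin> box0"
    using that by (auto simp: box0_def mem_box inner_diff_left inner_add_left algebra_simps)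
   then show ?thesis by (simp add: kap_outside_box)
  qed
  have sub: "?b \<subseteq> box3"
  proof -
   have "\<bar>nu \<bullet> b\<bar> <= 2" if "b \<in> Basis" for b using Basis_le_norm[OF that, of nu] nu by simp
   then have *: "- 2 <= nu \<bullet> b" "nu \<bullet> b <= 2" if "b \<in> Basis" for b using that by (force simp: abs_le_iff)+
   show ?thesis
   proof
    fix w assume w: "w \<in> ?b"
    show "w \<in> box3" unfolding box3_def mem_box
    proof (intro ballI conjI)
     fix b :: 'a assume b: "b \<in> Basis"
     have "(- (r *\<^sub>R One) + nu) \<bullet> b <= w \<bullet> b" "w \<bullet> b <= (r *\<^sub>R One + nu) \<bullet> b"
      using w b unfolding mem_box by auto
     then have "- r + nu \<bullet> b <= w \<bullet> b" "w \<bullet> b <= r + nu \<bullet> b" using b by (simp_all add: inner_add_left inner_diff_left)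
     then show "- (3 *\<^sub>R One) \<bullet> b <= w \<bullet> b" "w \<bullet> b <= (3 *\<^sub>R One) \<bullet> b"
      using b *[OF b] r by auto
    qed
   qed
  qed
  show ?thesis
   using has_integral_on_superset[OF integrable_integral[OF i] z sub] by (simp add: integral_unique)
 qed
 finally show ?thesis .
qed

text \<open>By \<open>cube_taylor\<close> the kernel has a cubic remainder uniformly in w, and
  \<open>h\<close> is bounded on the compact set of integration.\<close>

lemma G_expansion:
 assumes J: "compact J" "J \<subseteq> I"
 shows "\<exists>K>0. \<forall>nu t xi. norm nu <= 3/2 --> norm xi <= 1/2 --> t \<in> J -->
  \<bar>G (nu + xi) t - G nu t - dG nu t xi - d2G nu t xi xi / 2\<bar> <= K * norm xi ^ 3"
proof -
 have "compact ((%(nu, t). h nu t) ` (box3 \<times> J))"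
  using J by (intro compact_continuous_image continuous_on_subset[OF h_cont] compact_Times) (auto simp: box3_def)
 from compact_imp_bounded[OF this] obtain H where H: "H > 0" "\<forall>x\<in>(%(nu, t). h nu t) ` (box3 \<times> J). norm x <= H"
  unfolding bounded_pos by blast
 have Hb: "\<bar>h w t\<bar> <= H" if "w \<in> box3" "t \<in> J" for w t using bspec[OF H(2), of "h w t"] that by force
 obtain Y0 where Y0: "Y0 > 0" "\<forall>w\<in>box3. norm w <= Y0" using bounded_cbox[of "- (3 *\<^sub>R One)" "3 *\<^sub>R One :: 'a"] unfolding bounded_pos box3_def by blast
 define Y where "Y = 2 * (Y0 + 2) + 1"
 define C where "C = (Y ^ 3 + 15) * H / mass"
 have Y: "Y > 0" using Y0 by (simp add: Y_def)
 have C: "C > 0" using H(1) mass_pos Y unfolding C_def by (intro divide_pos_pos mult_pos_pos add_pos_pos) auto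
 have "measure lborel (box3 :: 'a set) > 0" unfolding box3_def by (intro content_pos_lt) simp
 define K where "K = C * measure lborel (box3 :: 'a set)"
 have main: "\<bar>G (nu + xi) t - G nu t - dG nu t xi - d2G nu t xi xi / 2\<bar> <= K * norm xi ^ 3"
  if nu: "norm nu <= 3/2" and xi: "norm xi <= 1/2" and tJ: "t \<in> J" for nu t xi
 proof -
  have t: "t \<in> I" using tJ J by auto
  have n2: "norm (nu + xi) <= 2" using norm_triangle_ineq[of nu xi] nu xi by simp
  let ?k1 = "%w. h w t * kap (w - (nu + xi))" and ?k2 = "%w. h w t * kap (w - nu)"
  let ?k3 = "%w. h w t * (6 * (s0 (w - nu))\<^sup>2 * ((w - nu) \<bullet> xi))"
  let ?k4 = "%w. h w t * (24 * s0 (w - nu) * ((w - nu) \<bullet> xi) * ((w - nu) \<bullet> xi) - 6 * (s0 (w - nu))\<^sup>2 * (xi \<bullet> xi))"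
  define k where "k w = ?k1 w - ?k2 w - ?k3 w / mass - ?k4 w / mass / 2" for w
  have i: "?k1 integrable_on box3" "?k2 integrable_on box3" "(%w. ?k3 w / mass) integrable_on box3" "(%w. ?k4 w / mass / 2) integrable_on box3"
   using mass_pos by (intro integrable_box3 continuous_intros continuous_h continuous_kap continuous_s0 t; simp)+
  have "integral box3 k = integral box3 ?k1 - integral box3 ?k2 - integral box3 (%w. ?k3 w / mass) - integral box3 (%w. ?k4 w / mass / 2)"
   unfolding k_def using i by (simp only: integral_diff integrable_diff)
  also have "... = G (nu + xi) t - G nu t - dG nu t xi - d2G nu t xi xi / 2"
   using nu n2 t by (simp add: G_alt dG_def d2G_def)
  finally have eq: "integral box3 k = G (nu + xi) t - G nu t - dG nu t xi - d2G nu t xi xi / 2" .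
  have bound: "\<bar>k w\<bar> <= C * norm xi ^ 3" if w: "w \<in> box3" for w
  proof -
   define y where "y = w - nu"
   define s where "s = r\<^sup>2 - (norm y)\<^sup>2"
   define d where "d = 2 * (y \<bullet> xi) - (norm xi)\<^sup>2"
   have s0y: "s0 y = max 0 s" by (simp add: s0_def s_def)
   have s0x: "s0 (w - (nu + xi)) = max 0 (s + d)"
    by (simp add: s0_def s_def d_def y_def power2_norm_eq_inner inner_diff_left inner_diff_right inner_add_left inner_add_right inner_commute)
   have yY: "norm y <= Y0 + 2" using Y0(2) w nu norm_triangle_ineq4[of w nu] unfolding y_def by fastforce
   have "\<bar>d\<bar> <= 2 * \<bar>y \<bullet> xi\<bar> + (norm xi)\<^sup>2" unfolding d_def by (rule order_trans[OF abs_triangle_ineq4]) simp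
   also have "... <= 2 * (norm y * norm xi) + 1 * norm xi"
    using Cauchy_Schwarz_ineq2[of y xi] xi unfolding power2_eq_square by (intro add_mono mult_left_mono mult_right_mono) auto
   also have "... <= 2 * ((Y0 + 2) * norm xi) + 1 * norm xi"
    using yY by (intro add_mono mult_left_mono mult_right_mono) auto
   also have "... = Y * norm xi" by (simp add: Y_def algebra_simps)
   finally have d: "\<bar>d\<bar> ^ 3 <= Y ^ 3 * norm xi ^ 3" using power_mono[of "\<bar>d\<bar>" "Y * norm xi" 3] by (simp add: power_mult_distrib)
   \<comment> \<open>\<open>cube_taylor\<close> expands in d = 2 y . xi - |xi|^2; this is the part
     of its quadratic terms that is of order three or more in xi. It differs from 0 only where s0 y
     > 0, hence |y| <= 1.\<close>
   have extra: "\<bar>3 * s0 y * ((norm xi)\<^sup>2 * ((norm xi)\<^sup>2 - 4 * (y \<bullet> xi)))\<bar> <= 15 * norm xi ^ 3"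
   proof (cases "s > 0")
    case True
    then have "(norm y)\<^sup>2 < 1\<^sup>2" using r power_mono[of r 1 2] by (simp add: s_def)
    then have y1: "norm y <= 1" using power2_less_imp_less[of "norm y" 1] by simp
    have s1: "s0 y <= 1" by (rule s0_bounds(2))
    have "\<bar>(norm xi)\<^sup>2 - 4 * (y \<bullet> xi)\<bar> <= (norm xi)\<^sup>2 + 4 * \<bar>y \<bullet> xi\<bar>" by (rule order_trans[OF abs_triangle_ineq4]) simp
    also have "... <= 1 * norm xi + 4 * (1 * norm xi)"
     using Cauchy_Schwarz_ineq2[of y xi] xi mult_right_mono[OF y1, of "norm xi"] unfolding power2_eq_square
     by (intro add_mono mult_left_mono mult_right_mono) auto
    finally have 1: "\<bar>(norm xi)\<^sup>2 - 4 * (y \<bullet> xi)\<bar> <= 5 * norm xi" by simp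
    have "\<bar>3 * s0 y * ((norm xi)\<^sup>2 * ((norm xi)\<^sup>2 - 4 * (y \<bullet> xi)))\<bar> = 3 * s0 y * ((norm xi)\<^sup>2 * \<bar>(norm xi)\<^sup>2 - 4 * (y \<bullet> xi)\<bar>)"
     using s0_bounds(1)[of y] by (simp only: abs_mult abs_of_nonneg abs_numeral abs_power2)
    also have "... <= 3 * 1 * ((norm xi)\<^sup>2 * (5 * norm xi))"
     using 1 s1 s0_bounds(1)[of y] by (intro mult_mono) auto
    finally show ?thesis by (simp add: power2_eq_square power3_eq_cube)
   next
    case False
    then have "s0 y = 0" by (simp add: s0y)
    then show ?thesis by simp
   qed
   have "k w = h w t / mass * ((max 0 (s + d) ^ 3 - max 0 s ^ 3 - 3 * (max 0 s)\<^sup>2 * d - 3 * max 0 s * d\<^sup>2)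
     + 3 * max 0 s * ((norm xi)\<^sup>2 * ((norm xi)\<^sup>2 - 4 * (y \<bullet> xi))))"
   proof -
    have *: "a * (A / m) - a * (B / m) - a * C / m - a * D / m / 2 = a / m * (A - B - C - D / 2)" for a A B C D m :: real
     by (simp add: diff_divide_distrib algebra_simps)
    have **: "A - B - 6 * p\<^sup>2 * e - (24 * p * e * e - 6 * p\<^sup>2 * n) / 2 =
     (A - B - 3 * p\<^sup>2 * (2 * e - n) - 3 * p * (2 * e - n)\<^sup>2) + 3 * p * (n * (n - 4 * e))" for A B p e n :: real
     by (simp add: power2_eq_square field_simps)
    show ?thesis
     unfolding k_def kap_def s0x y_def[symmetric] s0y d_def power2_norm_eq_inner * ** ..
   qed
   then have "\<bar>k w\<bar> = \<bar>h w t\<bar> / mass * \<bar>(max 0 (s + d) ^ 3 - max 0 s ^ 3 - 3 * (max 0 s)\<^sup>2 * d - 3 * max 0 s * d\<^sup>2)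
     + 3 * max 0 s * ((norm xi)\<^sup>2 * ((norm xi)\<^sup>2 - 4 * (y \<bullet> xi)))\<bar>"
    by (simp only: abs_mult abs_divide abs_of_pos[OF mass_pos])
   also have "... <= H / mass * (Y ^ 3 * norm xi ^ 3 + 15 * norm xi ^ 3)"
   proof (intro mult_mono)
    show "\<bar>h w t\<bar> / mass <= H / mass" using Hb[OF w tJ] mass_pos by (simp add: divide_right_mono)
    show "\<bar>(max 0 (s + d) ^ 3 - max 0 s ^ 3 - 3 * (max 0 s)\<^sup>2 * d - 3 * max 0 s * d\<^sup>2)
     + 3 * max 0 s * ((norm xi)\<^sup>2 * ((norm xi)\<^sup>2 - 4 * (y \<bullet> xi)))\<bar> <= Y ^ 3 * norm xi ^ 3 + 15 * norm xi ^ 3"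
     by (rule order_trans[OF abs_triangle_ineq add_mono[OF order_trans[OF cube_taylor d] extra[unfolded s0y]]])
   qed (use H(1) mass_pos in simp_all)
   also have "... = C * norm xi ^ 3" by (simp add: C_def field_simps)
   finally show ?thesis .
  qed
  have ki: "k integrable_on box3" unfolding k_def using i by (intro integrable_diff)
  have "norm (integral box3 k) <= integral box3 (%w. C * norm xi ^ 3)"
   using bound by (intro integral_norm_bound_integral ki) (auto simp: box3_def)
  also have "... = K * norm xi ^ 3" by (simp add: K_def box3_def)
  finally show ?thesis unfolding eq[symmetric] by simp
 qed
 have "K > 0" using C \<open>measure lborel (box3 :: 'a set) > 0\<close> by (simp add: K_def)
 then show ?thesis using main by blast
qed

lemma d2G_sym: "d2G nu t xi eta = d2G nu t eta xi"
proof -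
 have "24 * a * b * c - 6 * d * (xi \<bullet> eta) = 24 * a * c * b - 6 * d * (eta \<bullet> xi)" for a b c d
  by (simp add: inner_commute)
 then show ?thesis unfolding d2G_def by (simp only:)
qed

lemma d2G_continuous: "continuous_on (UNIV \<times> I) (%(nu, t). d2G nu t xi eta)"
proof -
 have "continuous_on ((UNIV \<times> I) \<times> box3) ((%(nu, t). h nu t) \<circ> (%x. (snd x, snd (fst x))))"
  by (intro continuous_on_compose continuous_on_subset[OF h_cont] continuous_intros) auto
 then have 1: "continuous_on ((UNIV \<times> I) \<times> box3) (%x. h (snd x) (snd (fst x)))" by (simp add: o_def)
 have "continuous_on ((UNIV \<times> I) \<times> box3) (%x. h (snd x) (snd (fst x)) * (24 * s0 (snd x - fst (fst x)) * ((snd x - fst (fst x)) \<bullet> xi) *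
   ((snd x - fst (fst x)) \<bullet> eta) - 6 * (s0 (snd x - fst (fst x)))\<^sup>2 * (xi \<bullet> eta)))"
  by (intro continuous_on_mult[OF 1] continuous_intros continuous_s0)
 then have "continuous_on (UNIV \<times> I) (%x. integral box3 (%w. h w (snd x) * (24 * s0 (w - fst x) * ((w - fst x) \<bullet> xi) *
   ((w - fst x) \<bullet> eta) - 6 * (s0 (w - fst x))\<^sup>2 * (xi \<bullet> eta))))"
  unfolding box3_def by (intro integral_continuous_on_param) (simp add: split_beta')
 then show ?thesis unfolding d2G_def split_beta' using mass_pos by (intro continuous_intros) auto
qed

lemma dG_linear: "t \<in> I ==> linear (dG nu t)"
proof (rule linearI)
 assume t: "t \<in> I"
 have i: "(%w. h w t * (6 * (s0 (w - nu))\<^sup>2 * ((w - nu) \<bullet> xi))) integrable_on box3" for xi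
  by (intro integrable_box3 continuous_intros continuous_h continuous_s0 t)
 fix a b and c :: real
 show "dG nu t (a + b) = dG nu t a + dG nu t b"
  unfolding dG_def add_divide_distrib[symmetric] integral_add[OF i i, symmetric]
  by (simp add: inner_add_right algebra_simps)
 show "dG nu t (c *\<^sub>R a) = c *\<^sub>R dG nu t a"
 proof -
  have "(%w. h w t * (6 * (s0 (w - nu))\<^sup>2 * ((w - nu) \<bullet> (c *\<^sub>R a)))) = (%w. c * (h w t * (6 * (s0 (w - nu))\<^sup>2 * ((w - nu) \<bullet> a))))"
   by (simp add: fun_eq_iff algebra_simps)
  then show ?thesis by (simp only: dG_def integral_mult_right) simp
 qed
qed

lemma d2G_bilinear: "t \<in> I ==> bilinear (d2G nu t)"
proof -
 assume t: "t \<in> I"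
 have i: "(%w. h w t * (24 * s0 (w - nu) * ((w - nu) \<bullet> xi) * ((w - nu) \<bullet> eta) - 6 * (s0 (w - nu))\<^sup>2 * (xi \<bullet> eta))) integrable_on box3" for xi eta
  by (intro integrable_box3 continuous_intros continuous_h continuous_s0 t)
 have 1: "d2G nu t (a + b) z = d2G nu t a z + d2G nu t b z" for a b z
  unfolding d2G_def add_divide_distrib[symmetric] integral_add[OF i i, symmetric]
  by (simp add: inner_add_left inner_add_right algebra_simps)
 have 2: "d2G nu t (c *\<^sub>R a) z = c *\<^sub>R d2G nu t a z" for c a z
 proof -
  have "(%w. h w t * (24 * s0 (w - nu) * ((w - nu) \<bullet> (c *\<^sub>R a)) * ((w - nu) \<bullet> z) - 6 * (s0 (w - nu))\<^sup>2 * ((c *\<^sub>R a) \<bullet> z))) =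
   (%w. c * (h w t * (24 * s0 (w - nu) * ((w - nu) \<bullet> a) * ((w - nu) \<bullet> z) - 6 * (s0 (w - nu))\<^sup>2 * (a \<bullet> z))))"
   by (simp add: fun_eq_iff algebra_simps)
  then show ?thesis by (simp only: d2G_def integral_mult_right) simp
 qed
 have 3: "d2G nu t z (a + b) = d2G nu t z a + d2G nu t z b" for a b z
  using 1[of a b z] unfolding d2G_sym[of nu t z "a + b"] d2G_sym[of nu t z a] d2G_sym[of nu t z b] .
 have 4: "d2G nu t z (c *\<^sub>R a) = c *\<^sub>R d2G nu t z a" for c a z
  using 2[of c a z] unfolding d2G_sym[of nu t z "c *\<^sub>R a"] d2G_sym[of nu t z a] .
 show ?thesis by (rule bilinearI2[OF 1 3 2 4])
qed

text \<open>Convexity makes the second differences of \<open>G\<close> nonnegative, and at scale u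
  the cubic remainder is smaller than the quadratic term by a factor u.\<close>

lemma d2G_nonneg:
 assumes t: "t \<in> I" and nu: "norm nu <= 3/2"
 shows "d2G nu t xi xi >= 0"
proof -
 have "\<exists>K>0. \<forall>nu' t' xi. norm nu' <= 3/2 --> norm xi <= 1/2 --> t' \<in> {t} -->
  \<bar>G (nu' + xi) t' - G nu' t' - dG nu' t' xi - d2G nu' t' xi xi / 2\<bar> <= K * norm xi ^ 3"
  using t by (intro G_expansion) auto
 then obtain K where K: "K > 0" "!!xi. norm xi <= 1/2 ==> \<bar>G (nu + xi) t - G nu t - dG nu t xi - d2G nu t xi xi / 2\<bar> <= K * norm xi ^ 3"
  using nu by blast
 interpret D: linear "dG nu t" by (rule dG_linear[OF t])
 note b = bilinear_simps[OF d2G_bilinear[OF t]]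
 have conv: "2 * G nu t <= G (nu + zt) t + G (nu - zt) t" for zt
 proof -
  have "0 <= (1 / 2 :: real)" by simp
  note half = Phi_scale[OF t this]
  have "Phi ((1/2) *\<^sub>R (nu + zt) + (1/2) *\<^sub>R (nu - zt)) (1/2 * 1 + 1/2 * 1) t <= 1/2 * Phi (nu + zt) 1 t + 1/2 * Phi (nu - zt) 1 t"
   using Phi_add[OF t, of "(1/2) *\<^sub>R (nu + zt)" "(1/2) *\<^sub>R (nu - zt)" "1/2 * 1" "1/2 * 1"] unfolding half .
  moreover have "(1/2) *\<^sub>R (nu + zt) + (1/2) *\<^sub>R (nu - zt) = nu"
   by (simp add: scaleR_add_right scaleR_diff_right scaleR_add_left[symmetric])
  ultimately show ?thesis by (simp add: G_def)
 qed
 have "0 <= d2G nu t xi xi + 2 * K * norm xi ^ 3 * u" if u: "0 < u" "u * norm xi <= 1/2" for u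
 proof -
  define x where "x = u *\<^sub>R xi"
  have nx: "norm x = u * norm xi" using u by (simp add: x_def)
  have "\<bar>G (nu + x) t - G nu t - dG nu t x - d2G nu t x x / 2\<bar> <= K * norm x ^ 3"
   using u by (intro K(2)) (simp add: nx)
  moreover have "\<bar>G (nu - x) t - G nu t + dG nu t x - d2G nu t x x / 2\<bar> <= K * norm x ^ 3"
   using K(2)[of "- x"] u by (simp add: nx D.neg b)
  ultimately have "0 <= d2G nu t x x + 2 * (K * norm x ^ 3)" using conv[of x] by linarith
  then have "0 <= u * (u * d2G nu t xi xi) + 2 * (K * (u * norm xi) ^ 3)" unfolding nx unfolding x_def b .
  then have "0 <= u * u * (d2G nu t xi xi + 2 * K * norm xi ^ 3 * u)"
   by (simp add: power3_eq_cube algebra_simps)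
  moreover have "u * u > 0" using u by simp
  ultimately show ?thesis using zero_le_mult_iff[of "u * u"] by auto
 qed
 note * = this
 show ?thesis
 proof (rule ccontr)
  assume neg: "\<not> ?thesis"
  define k where "k = 2 * K * norm xi ^ 3"
  have k: "k >= 0" using K by (simp add: k_def)
  define u where "u = min (1 / (2 * norm xi + 1)) (- d2G nu t xi xi / (2 * (k + 1)))"
  have n1: "2 * norm xi + 1 > 0" by (simp add: add_nonneg_pos)
  have u: "0 < u" "u <= 1 / (2 * norm xi + 1)" "u <= - d2G nu t xi xi / (2 * (k + 1))"
  proof -
   have "0 < - d2G nu t xi xi / (2 * (k + 1))" using neg k by (intro divide_pos_pos) auto
   then show "0 < u" using n1 by (simp add: u_def)
  qed (simp_all add: u_def)
  have "u * norm xi <= 1 / (2 * norm xi + 1) * norm xi" using u by (intro mult_right_mono) auto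
  also have "... <= 1/2" using n1 by (simp add: field_simps)
  finally have "0 <= d2G nu t xi xi + k * u" using *[of u] u by (simp add: k_def)
  also have "k * u <= (k + 1) * (- d2G nu t xi xi / (2 * (k + 1)))" using u k by (intro mult_mono) auto
  also have "... = - d2G nu t xi xi / 2" using k by (simp add: field_simps)
  finally show False using neg by simp
 qed
qed

end

section \<open>The averaged heat inequality\<close>

text \<open>The Gaussian has covariance 2 tau times the identity; linear and mixed terms integrate
  to 0 on the symmetric cube. Truncation only lowers the mass and the diagonal moments, whence the
  sign conditions on c0 and m i i.\<close>

lemma gauss_quadratic_le:
 fixes l :: "real^'n => real" and m :: "'n => 'n => real"
 assumes tau: "tau > 0" and l: "linear l" and c0: "c0 >= 0" and m: "!!i. m i i >= 0"
 shows "(%z. gauss tau z * (c0 + l z + (\<Sum>i\<in>UNIV. \<Sum>j\<in>UNIV. z $ i * z $ j * m i j))) integrable_on cube d"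
  and "integral (cube d) (%z. gauss tau z * (c0 + l z + (\<Sum>i\<in>UNIV. \<Sum>j\<in>UNIV. z $ i * z $ j * m i j)))
   <= c0 + 2 * tau * (\<Sum>i\<in>UNIV. m i i)"
proof -
 have lc: "continuous_on A l" for A using l by (simp add: linear_continuous_on linear_conv_bounded_linear)
 have gl: "(%z. gauss tau z * l z) integrable_on cube d" unfolding cube_def
  by (intro integrable_continuous continuous_intros continuous_on_gauss lc tau)
 note g = gauss_mass(1,2)[OF tau] and g2 = gauss_second_moment[OF tau]
 have q: "(%z::real^'n. \<Sum>i\<in>UNIV. \<Sum>j\<in>UNIV. gauss tau z * (z $ i * z $ j) * m i j) integrable_on cube d"
  by (intro integrable_sum integrable_on_mult_left g2(1)) auto
 have eq: "gauss tau z * (c0 + l z + (\<Sum>i\<in>UNIV. \<Sum>j\<in>UNIV. z $ i * z $ j * m i j)) =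
  gauss tau z * c0 + gauss tau z * l z + (\<Sum>i\<in>UNIV. \<Sum>j\<in>UNIV. gauss tau z * (z $ i * z $ j) * m i j)" for z
  by (simp add: distrib_left sum_distrib_left mult.assoc)
 show "(%z. gauss tau z * (c0 + l z + (\<Sum>i\<in>UNIV. \<Sum>j\<in>UNIV. z $ i * z $ j * m i j))) integrable_on cube d"
  unfolding eq by (intro integrable_add q gl integrable_on_mult_left g)
 have "integral (cube d) (%z. gauss tau z * (c0 + l z + (\<Sum>i\<in>UNIV. \<Sum>j\<in>UNIV. z $ i * z $ j * m i j))) =
  integral (cube d) (%z::real^'n. gauss tau z * c0) + integral (cube d) (%z. gauss tau z * l z) +
  integral (cube d) (%z. \<Sum>i\<in>UNIV. \<Sum>j\<in>UNIV. gauss tau z * (z $ i * z $ j) * m i j)"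
  unfolding eq integral_add[OF integrable_add[OF integrable_on_mult_left[OF g(1)] gl] q]
   integral_add[OF integrable_on_mult_left[OF g(1)] gl] by (rule refl)
 also have "integral (cube d) (%z. gauss tau z * l z) = 0"
 proof -
  have "integral (cube d) (%z. gauss tau z * l z) = integral (cube d) (%z. gauss tau (- z) * l (- z))"
   unfolding cube_def using integral_reflect[of "\<chi> i. d" "- (\<chi> i. d)" "%z. gauss tau z * l z"] by simp
  also have "... = - integral (cube d) (%z. gauss tau z * l z)" by (simp add: gauss_minus linear_neg[OF l])
  finally show ?thesis by simp
 qed
 also have "integral (cube d) (%z::real^'n. gauss tau z * c0) <= c0"
  using mult_right_mono[OF g(2) c0] by simp
 also have "integral (cube d) (%z::real^'n. \<Sum>i\<in>UNIV. \<Sum>j\<in>UNIV. gauss tau z * (z $ i * z $ j) * m i j) =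
  (\<Sum>i\<in>UNIV. \<Sum>j\<in>UNIV. integral (cube d) (%z::real^'n. gauss tau z * (z $ i * z $ j)) * m i j)"
 proof -
  have i1: "(%z::real^'n. gauss tau z * (z $ i * z $ j) * m i j) integrable_on cube d" for i j
   by (intro integrable_on_mult_left g2(1))
  show ?thesis
   by (subst integral_sum; (intro finite integrable_sum i1)?) (subst integral_sum; (intro finite i1)?; simp)
 qed
 also have "... <= (\<Sum>i\<in>UNIV. \<Sum>j\<in>UNIV. (if i = j then 2 * tau * m i i else 0))"
 proof (intro sum_mono)
  fix i j :: 'n
  show "integral (cube d) (%z::real^'n. gauss tau z * (z $ i * z $ j)) * m i j <= (if i = j then 2 * tau * m i i else 0)"
   using mult_right_mono[OF g2(2)[of d j] m[of j]] g2(3)[of i j d] by simp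
 qed
 also have "... = 2 * tau * (\<Sum>i\<in>UNIV. m i i)" by (simp add: sum_distrib_left)
 finally show "integral (cube d) (%z. gauss tau z * (c0 + l z + (\<Sum>i\<in>UNIV. \<Sum>j\<in>UNIV. z $ i * z $ j * m i j)))
   <= c0 + 2 * tau * (\<Sum>i\<in>UNIV. m i i)" by simp
qed

text \<open>Minus the partial derivatives of A -> \<open>minors2\<close> of the inverse of A, at the
  diagonal matrix with entries 1 / b i; \<open>pair_sum b\<close> is the value there. By homogeneity
  of degree -2 the tangent plane is 3 \<open>pair_sum b\<close> minus the weighted trace.\<close>

definition pair_weight :: "('n::finite => real) => 'n => real" where
 "pair_weight b i = (b i)\<^sup>2 * (\<Sum>j\<in>UNIV - {i}. b j)"

definition pair_sum :: "('n::finite => real) => real" where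
 "pair_sum b = (\<Sum>i\<in>UNIV. \<Sum>j\<in>UNIV - {i}. b i * b j) / 2"

lemma pair_pos:
 assumes b: "!!i. b i > 0" and n: "CARD('n) >= 2"
 shows "pair_weight b (i::'n::finite) > 0" "pair_sum (b :: 'n => real) > 0"
proof -
 have s: "(\<Sum>j\<in>UNIV - {i}. b j) > 0" for i
 proof (intro sum_pos)
  show "UNIV - {i} ~= {}"
  proof
   assume "UNIV - {i} = {}"
   then have "UNIV = {i}" by auto
   then have "CARD('n) = 1" by (metis card_1_singleton_iff One_nat_def)
   then show False using n by simp
  qed
 qed (use b in auto)
 show "pair_weight b i > 0" using s[of i] b[of i] by (simp add: pair_weight_def)
 have "(\<Sum>j\<in>UNIV - {i}. b i * b j) > 0" for i
  using s[of i] b[of i] by (simp add: sum_distrib_left[symmetric])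
 then have "(\<Sum>i\<in>UNIV. \<Sum>j\<in>UNIV - {i}. b i * b j) > 0" by (rule sum_pos[OF finite UNIV_not_empty])
 then show "pair_sum b > 0" by (simp add: pair_sum_def)
qed

text \<open>The factor 1 - om pays for normals that deviate from the frame: a vertical component
  within om / 4 of 1 and a slope of at most om / 3 cost less than om.\<close>

lemma slope_factor:
 fixes om lam s :: real
 assumes om: "0 < om" "om < 1" and lam: "\<bar>lam - 1\<bar> <= om / 4" and s: "0 <= s" "s <= om / 3"
 shows "(1 - om) * lam * sqrt (1 + s\<^sup>2) <= 1 - 2 * s\<^sup>2"
proof -
 have "s\<^sup>2 <= (om / 3)\<^sup>2" using s by (intro power_mono) auto
 also have "... = om * om / 9" by (simp add: power2_eq_square)
 also have "... <= om * 1 / 9" using om by (intro divide_right_mono mult_left_mono) auto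
 finally have s2: "s\<^sup>2 <= om / 9" by simp
 have "sqrt (1 + s\<^sup>2) <= 1 + s\<^sup>2"
  using zero_le_power2[of s] by (intro real_le_lsqrt) (auto simp: power2_sum)
 then have sq: "sqrt (1 + s\<^sup>2) <= 1 + om / 9" using s2 by linarith
 have l: "lam <= 1 + om / 4" "lam >= 0" using lam om by linarith+
 have "(1 - om) * (lam * sqrt (1 + s\<^sup>2)) <= (1 - om) * ((1 + om / 4) * (1 + om / 9))"
  using l sq om by (intro mult_left_mono mult_mono) auto
 also have "... = 1 - om + (1 - om) * (om * (13 / 36 + om / 36))" by (simp add: field_simps)
 also have "(1 - om) * (om * (13 / 36 + om / 36)) <= 1 * (om * (14 / 36))"
  using om by (intro mult_mono mult_left_mono) auto
 finally show ?thesis using s2 om by (simp add: mult.assoc)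
qed

context scalar_flow
begin

text \<open>In coordinates scaled by \<open>d\<close> the linearised operator becomes the Laplacian:
  \<open>dual_touch\<close> gives W_ii = V_ii / d_i^2, and the weights in
  \<open>minors2_inverse_ge\<close> cancel this scaling. The parameters p0 and lam move the slice,
  so one frozen \<open>b\<close> serves for all nearby normals.\<close>

lemma slice_touch:
 fixes V :: "real^'n^'n" and b :: "'n => real" and p0 q1 bb :: "real^'n"
 assumes L: "orthogonal_transformation L" and b: "!!i. b i > 0" and om: "0 < om" "om < 1"
  and lam: "\<bar>lam - 1\<bar> <= om / 4" and sg1: "0 < sg1" "sg1 < Tc" and V: "pos_def V" and rho: "rho > 0"
 defines "d \<equiv> %i. sqrt ((1 - om) * pair_weight b i)"
 assumes small: "norm (p0 + diag_scale d q1) <= om / 4 * (3 / 4)"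
  and touch: "!!xi th. norm xi < rho ==> - rho < th ==> th <= 0 ==>
   supp (L (p0 + diag_scale d (q1 + xi), - lam)) (sg1 + th) <= supp (L (p0 + diag_scale d q1, - lam)) sg1 + quadratic_test bb V a xi th"
 shows "a <= trace V - 3 * (1 - om) * pair_sum b"
proof -
 have a0: "(1 - om) * pair_weight b i > 0" for i using pair_pos(1)[where b = b, OF b dim2] om by simp
 have d: "d i > 0" "(d i)\<^sup>2 = (1 - om) * pair_weight b i" for i using a0[of i] by (simp_all add: d_def)
 have lp: "lam >= 3/4" using lam om by linarith
 define q0 where "q0 = diag_scale (%i. 1 / d i) p0"
 have q0: "diag_scale d (q0 + q) = p0 + diag_scale d q" for q
  using d(1) by (simp add: diag_scale_simps q0_def) (simp add: diag_scale_def vec_eq_iff less_imp_neq[symmetric])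
 define p where "p = (1 / lam) *\<^sub>R (p0 + diag_scale d q1)"
 have "\<exists>B W. pos_def B & pos_def W & W ** B = mat 1 & (\<forall>i. W $ i $ i = V $ i $ i / (d i)\<^sup>2) &
  graph_speed ((1 / lam) *\<^sub>R diag_scale d (q0 + q1)) B / lam <= - a"
 proof (rule dual_touch[OF L _ d(1) sg1 V rho])
  show "supp (L (diag_scale d (q0 + q1 + xi), - lam)) (sg1 + th)
      <= supp (L (diag_scale d (q0 + q1), - lam)) sg1 + quadratic_test bb V a xi th"
   if "norm xi < rho" "- rho < th" "th <= 0" for xi th
   using touch[OF that] unfolding add.assoc q0 .
  have "om / 4 * (3 / 4) <= lam / 4" using lp om by linarith
  then show "norm (diag_scale d (q0 + q1)) <= lam / 4" unfolding q0 using small by linarith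
 qed (use lp in simp)
 then obtain B W where BW: "pos_def B" "pos_def W" "W ** B = mat 1" "!!i. W $ i $ i = V $ i $ i / (d i)\<^sup>2"
  "graph_speed p B / lam <= - a" unfolding q0 p_def by blast
 have np: "norm p <= om / 3"
 proof -
  have "norm p = norm (p0 + diag_scale d q1) / lam" using lp by (simp add: p_def)
  also have "... <= (om / 4 * (3 / 4)) / (3 / 4)" using small lp om by (intro frac_le) auto
  finally show ?thesis using om by simp
 qed
 define w where "w = sqrt (1 + (norm p)\<^sup>2)"
 have w: "w > 0" unfolding w_def by (simp add: add_pos_nonneg)
 have f: "(1 - om) * lam * w <= 1 - 2 * (norm p)\<^sup>2"
  unfolding w_def using om lam np by (intro slope_factor) auto
 have m: "minors2 B > 0" by (rule minors2_pos[OF BW(1) dim2])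
 have "(1 - om) * minors2 B * (lam * w) <= (1 - 2 * (norm p)\<^sup>2) * minors2 B"
  using mult_right_mono[OF f, of "minors2 B"] m by (simp add: mult_ac)
 also have "... <= graph_speed p B * w"
  using graph_speed_lower(1)[OF BW(1), of p] w unfolding w_def[symmetric] by (simp add: pos_divide_le_eq)
 also have "... <= (- a) * lam * w"
  using BW(5) lp w by (intro mult_right_mono) (auto simp: pos_divide_le_eq)
 finally have "(1 - om) * minors2 B <= - a" using lp w mult_le_cancel_right_pos[of "lam * w" "(1 - om) * minors2 B" "- a"] by (simp add: mult.assoc)
 moreover have "minors2 B >= 3 * pair_sum b - (\<Sum>i\<in>UNIV. pair_weight b i * W $ i $ i)"
  using minors2_inverse_ge[OF BW(2,1,3) b] unfolding pair_sum_def pair_weight_def .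
 then have "(1 - om) * (3 * pair_sum b - (\<Sum>i\<in>UNIV. pair_weight b i * W $ i $ i)) <= (1 - om) * minors2 B"
  using om by (intro mult_left_mono) auto
 moreover have "(1 - om) * (\<Sum>i\<in>UNIV. pair_weight b i * W $ i $ i) = trace V"
  unfolding sum_distrib_left trace_def
 proof (intro sum.cong refl)
  fix i
  have "(1 - om) * (pair_weight b i * W $ i $ i) = (d i)\<^sup>2 * (V $ i $ i / (d i)\<^sup>2)" unfolding d(2) BW(4) by simp
  then show "(1 - om) * (pair_weight b i * W $ i $ i) = V $ i $ i" using d(1)[of i] by simp
 qed
 moreover have "(1 - om) * (3 * pair_sum b - (\<Sum>i\<in>UNIV. pair_weight b i * W $ i $ i)) =
   3 * (1 - om) * pair_sum b - (1 - om) * (\<Sum>i\<in>UNIV. pair_weight b i * W $ i $ i)"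
  by (simp add: algebra_simps)
 ultimately show ?thesis by linarith
qed

end

locale smoothed_flow = scalar_flow S X Tc
 for S :: "((real ^ 'n) \<times> real) set" and X and Tc :: real +
 fixes r :: real assumes r01: "0 < r" "r <= 1"

sublocale smoothed_flow \<subseteq> mollified supp "{0..<Tc}" r
 by unfold_locales (use supp_add supp_scale continuous_supp r01 in auto)

context smoothed_flow
begin

text \<open>On each slice \<open>supp\<close> obeys the linear inequality only in the viscosity
  sense. \<open>heat_comparison\<close> turns it into an integral inequality over a time step tau,
  which is averaged over the shifts y of the mollifier; after Fubini the Gaussian acts on
  \<open>G\<close>, whose expansion yields the weighted second derivatives. The result is a
  difference inequality, as \<open>G\<close> need not be differentiable in time.\<close>

lemma averaged_heat:
 fixes L :: "(real^'n) \<times> real => (real^'n) \<times> real" and b :: "'n => real"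
 assumes L: "orthogonal_transformation L" and b: "!!i. b i > 0" and om: "0 < om" "om < 1" and rom: "r <= om / 16"
  and sg0: "0 < sg0" "sg0 < Tc" and dl: "dl > 0"
 shows "\<exists>rho>0. \<forall>p tau. norm p < rho --> 0 < tau --> tau < rho -->
  G (L (p, -1)) sg0 <= G (L (p, -1)) (sg0 - tau) + tau * ((1 - om) *
   ((\<Sum>i\<in>UNIV. pair_weight b i * d2G (L (0, -1)) sg0 (L (axis i 1, 0)) (L (axis i 1, 0))) - 3 * pair_sum b) + dl)"
proof -
 interpret L: linear L using L by (simp add: orthogonal_transformation_def)
 have Ln: "norm (L u) = norm u" for u using L by (rule orthogonal_transformation_norm)
 define d where "d i = sqrt ((1 - om) * pair_weight b i)" for i
 have d2: "(d i)\<^sup>2 = (1 - om) * pair_weight b i" for i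
  using pair_pos(1)[where b = b, OF b dim2] om by (simp add: d_def less_imp_le)
 let ?D = "diag_scale d"
 obtain dm where dm: "dm > 0" "!!z. norm (?D z) <= dm * norm z"
  using linear_bounded_pos[OF linear_diag_scale[of d]] by blast
 define f where "f i = L (axis i 1, 0)" for i :: 'n
 define n where "n = real CARD('n)"
 have n: "n >= 1" using dim2 by (simp add: n_def)
 obtain K where K: "K > 0" "!!nu t xi. norm nu <= 3/2 ==> norm xi <= 1/2 ==> t \<in> {0..sg0} ==>
  \<bar>G (nu + xi) t - G nu t - dG nu t xi - d2G nu t xi xi / 2\<bar> <= K * norm xi ^ 3"
  using G_expansion[of "{0..sg0}"] sg0 by force
 \<comment> \<open>The half-width of the Gaussian cube: the cubic remainder of \<open>G\<close> then
   costs at most dl / 3, slopes change by at most om / 16, and the expansion of \<open>G\<close>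
   applies.\<close>
 define d0 where "d0 = min (dl / (6 * n * (K * dm ^ 3 * n))) (min (om / (16 * dm * n)) (1 / (2 * dm * n)))"
 have d0: "d0 > 0" "d0 <= dl / (6 * n * (K * dm ^ 3 * n))" "d0 <= om / (16 * dm * n)" "d0 <= 1 / (2 * dm * n)"
  using dl om n dm K by (auto simp: d0_def)
 define kp where "kp = K * dm ^ 3 * (n * d0)"
 have kp: "kp >= 0" using K dm n d0 by (simp add: kp_def)
 have kp2: "2 * n * kp <= dl / 3"
 proof -
  have "d0 * (6 * n * (K * dm ^ 3 * n)) <= dl" using d0(2) n K dm by (simp add: pos_le_divide_eq)
  then show ?thesis by (simp add: kp_def mult_ac)
 qed
 have cubeD: "norm (?D z) <= dm * (n * d0)" if "z \<in> cube d0" for z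
 proof -
  have "norm (?D z) <= dm * norm z" by (rule dm)
  also have "... <= dm * (n * d0)" using norm_cube[OF that] dm by (intro mult_left_mono) (auto simp: n_def)
  finally show ?thesis .
 qed
 have dmd: "dm * (n * d0) <= om / 16" "dm * (n * d0) <= 1 / 2"
  using d0(3,4) dm n by (simp_all add: pos_le_divide_eq mult_ac)
 obtain R0 where R0: "R0 > 0" "!!z t. 0 <= t ==> t <= sg0 ==> z \<in> M t ==> norm z <= R0" using X_bounded[OF sg0(2)] by blast
 have sb: "\<bar>supp nu t\<bar> <= 4 * R0" if "norm nu <= 4" "0 <= t" "t <= sg0" for nu t
 proof -
  have "\<bar>supp nu t\<bar> <= R0 * norm nu" using that sg0 by (intro supp_le_norm R0(2)) auto
  also have "... <= R0 * 4" using that R0 by (intro mult_left_mono) auto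
  finally show ?thesis by simp
 qed
 \<comment> \<open>Added to \<open>supp\<close> so that the sum is nonnegative, as
   \<open>heat_comparison\<close> requires.\<close>
 define M0 where "M0 = 4 * R0"
 define c where "c = 3 * (1 - om) * pair_sum b"
 have c: "c >= 0" using om pair_pos(2)[where b = b, OF b dim2] by (simp add: c_def)
 define K2 where "K2 = (2 * M0 + c) / (d0 / 2) ^ 4 * (real CARD('n) * (4 * real CARD('n) + 8))"
 have K2: "K2 > 0" unfolding K2_def using R0 c d0 by (intro mult_pos_pos divide_pos_pos) (auto simp: M0_def intro: add_pos_nonneg)
 define nu0 where "nu0 = L (0, -1)"
 define q where "q nu t = (\<Sum>i\<in>UNIV. (d i)\<^sup>2 * d2G nu t (f i) (f i))" for nu t
 have "\<exists>rho1>0. \<forall>p tau. norm p < rho1 --> 0 <= tau --> tau < rho1 --> q (L (p, -1)) (sg0 - tau) <= q nu0 sg0 + dl / 3"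
 proof -
  have "continuous_on (UNIV \<times> {0..<Tc}) (%x. d2G (fst x) (snd x) (f i) (f i))" for i
   using d2G_continuous[of "f i" "f i"] by (simp add: split_beta')
  then have "continuous_on (UNIV \<times> {0..<Tc}) (%x. q (fst x) (snd x))"
   unfolding q_def by (intro continuous_intros)
  then obtain e where e: "e > 0" "!!x. x \<in> UNIV \<times> {0..<Tc} ==> dist x (nu0, sg0) < e ==> dist (q (fst x) (snd x)) (q nu0 sg0) < dl / 3"
   using dl sg0 unfolding continuous_on_iff by (metis (no_types, lifting) UNIV_I atLeastLessThan_iff divide_pos_pos fst_conv less_eq_real_def mem_Sigma_iff snd_conv zero_less_numeral)
  show ?thesis
  proof (rule exI[of _ "min (e / 2) sg0"], intro conjI allI impI)
   show "min (e / 2) sg0 > 0" using e sg0 by simp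
   fix p :: "real^'n" and tau :: real assume p: "norm p < min (e / 2) sg0" "0 <= tau" "tau < min (e / 2) sg0"
   have "L (p, -1) - nu0 = L (p, 0)" unfolding nu0_def by (simp add: L.diff[symmetric])
   then have "dist (L (p, -1)) nu0 < e / 2" using p by (simp add: dist_norm Ln)
   moreover have "dist (sg0 - tau) sg0 < e / 2" using p by (simp add: dist_real_def)
   moreover have "dist (L (p, -1), sg0 - tau) (nu0, sg0) <= dist (L (p, -1)) nu0 + dist (sg0 - tau) sg0"
    unfolding dist_Pair_Pair by (rule sqrt_sum_squares_le_sum) auto
   ultimately have "dist (L (p, -1), sg0 - tau) (nu0, sg0) < e" by linarith
   then have "dist (q (L (p, -1)) (sg0 - tau)) (q nu0 sg0) < dl / 3"
    using e(2)[of "(L (p, -1), sg0 - tau)"] p sg0 by simp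
   then show "q (L (p, -1)) (sg0 - tau) <= q nu0 sg0 + dl / 3" unfolding dist_real_def abs_less_iff by linarith
  qed
 qed
 then obtain rho1 where rho1: "rho1 > 0" "!!p tau. norm p < rho1 ==> 0 <= tau ==> tau < rho1 ==> q (L (p, -1)) (sg0 - tau) <= q nu0 sg0 + dl / 3" by blast
 \<comment> \<open>The error dl is split in three: continuity of the second derivatives
   (\<open>rho1\<close>), the cubic remainder of \<open>G\<close>, and the term K2 tau^2 left by the
   quartic penalty.\<close>
 define rho where "rho = min (min rho1 (om / 16)) (min (min sg0 1) (dl / (3 * K2)))"
 have rho: "rho > 0" using rho1 om sg0 dl K2 by (simp add: rho_def)
 have main: "G (L (p, -1)) sg0 <= G (L (p, -1)) (sg0 - tau) + tau * ((1 - om) *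
   ((\<Sum>i\<in>UNIV. pair_weight b i * d2G (L (0, -1)) sg0 (L (axis i 1, 0)) (L (axis i 1, 0))) - 3 * pair_sum b) + dl)"
  if p: "norm p < rho" and tau: "0 < tau" "tau < rho" for p tau
 proof -
  have tau': "tau < sg0" "tau <= 1" "K2 * tau\<^sup>2 <= tau * (dl / 3)" and p': "norm p <= om / 16" "norm p < rho1" "tau < rho1"
  proof -
   show "tau < sg0" "tau <= 1" "norm p <= om / 16" "norm p < rho1" "tau < rho1" using p tau by (simp_all add: rho_def)
   have "tau <= dl / (3 * K2)" using tau by (simp add: rho_def)
   then have "K2 * tau <= dl / 3" using K2 by (simp add: pos_le_divide_eq mult_ac)
   from mult_left_mono[OF this, of tau] show "K2 * tau\<^sup>2 <= tau * (dl / 3)" using tau by (simp add: power2_eq_square mult_ac)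
  qed
  define s1 where "s1 = sg0 - tau"
  have s1: "0 < s1" "s1 < sg0" "s1 \<in> {0..<Tc}" using tau tau' sg0 by (auto simp: s1_def)
  define nup where "nup = L (p, -1)"
  have nup: "norm nup <= 3 / 2"
  proof -
   have "norm nup <= norm p + 1" unfolding nup_def Ln using norm_Pair_le[of p "-1::real"] by simp
   then show ?thesis using p'(1) om by linarith
  qed
  let ?Z = "%z. L (?D z, 0)"
  have linZ: "linear ?Z"
   by (rule linearI) (simp_all add: diag_scale_simps L.add[symmetric] L.scale[symmetric])
  have nZ: "norm (?Z z) <= dm * norm z" for z unfolding Ln using dm(2)[of z] by (simp add: norm_Pair)
  note contZ = bounded_linear.continuous_on[OF linZ[unfolded linear_conv_bounded_linear]]
  define U where "U y z = supp (nup + y + ?Z z) s1 + M0" for y z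
  \<comment> \<open>One shift y = L (y1, y2) of the mollifier: y1 is added to the base point p, and
    y2 changes the vertical component from - 1 to - (1 - y2).\<close>
  have slice: "supp (nup + y) sg0 + M0 <= integral (cube d0) (%z. gauss tau z * U y z) - c * tau + K2 * tau\<^sup>2"
   if y: "norm y < r" for y
  proof -
   obtain y1 y2 where yy: "y = L (y1, y2)" using orthogonal_transformation_surj[OF L] by (metis surjD surj_pair)
   have yn: "norm y1 <= om / 16" "\<bar>y2\<bar> <= om / 16"
    using y rom norm_fst_le[of y1 y2] norm_snd_le[of y2 y1] unfolding yy Ln by simp_all
   define lam where "lam = 1 - y2"
   define p0 where "p0 = p + y1"
   have vec: "L (p0 + ?D z, - lam) = nup + y + ?Z z" for z
    unfolding nup_def yy p0_def lam_def by (simp add: L.add[symmetric])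
   define g where "g z t = supp (L (p0 + ?D z, - lam)) t + M0" for z t
   have p0n: "norm (p0 + ?D z) <= om / 4 * (3 / 4)" if "z \<in> cube d0" for z
   proof -
    have "norm (p0 + ?D z) <= norm p + norm y1 + norm (?D z)" unfolding p0_def by (intro norm_triangle_le add_mono norm_triangle_ineq order_refl)
    then show ?thesis using p'(1) yn(1) cubeD[OF that] dmd(1) by linarith
   qed
   have lamn: "\<bar>lam - 1\<bar> <= om / 4" using yn(2) om unfolding lam_def by linarith
   have gb: "0 <= g z t & g z t <= 2 * M0" if z: "z \<in> cube d0" "t \<in> {s1..sg0}" for z t
   proof -
    have "norm (L (p0 + ?D z, - lam)) <= norm (p0 + ?D z) + \<bar>lam\<bar>" unfolding Ln using norm_Pair_le[of "p0 + ?D z" "- lam"] by simp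
    then have "norm (L (p0 + ?D z, - lam)) <= 4" using p0n[OF z(1)] lamn om by linarith
    then have "\<bar>supp (L (p0 + ?D z, - lam)) t\<bar> <= 4 * R0" using z s1 by (intro sb) auto
    then show ?thesis unfolding g_def M0_def by linarith
   qed
   have "g 0 sg0 <= heat d0 (%z. g z s1) 0 (sg0 - s1) - c * (sg0 - s1) +
    (2 * M0 + c * (sg0 - s1)) / (d0 / 2) ^ 4 * (real CARD('n) * (4 * real CARD('n) + 8)) * (sg0 - s1)\<^sup>2"
   proof (rule heat_comparison[where B = "2 * M0" and c = c])
    show "continuous_on (cube d0 \<times> {s1..sg0}) (%(z, t). g z t)"
    proof -
     have "continuous_on (cube d0 \<times> {s1..sg0}) ((%(nu, t). supp nu t) \<circ> (%x. (nup + y + ?Z (fst x), snd x)))"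
      using s1 sg0 by (intro continuous_on_compose continuous_on_subset[OF continuous_supp] continuous_intros contZ) auto
     then have "continuous_on (cube d0 \<times> {s1..sg0}) (%x. supp (nup + y + ?Z (fst x)) (snd x))" by (simp add: o_def)
     then show ?thesis unfolding g_def vec split_beta' by (intro continuous_intros)
    qed
    show "convex_on UNIV (%z. g z t)" if t: "t \<in> {s1..sg0}" for t
    proof (rule convex_onI)
     fix u :: real and x x' :: "real^'n" assume u: "0 < u" "u < 1"
     have tI: "t \<in> {0..<Tc}" using t s1 sg0 by auto
     have "nup + y + ?Z ((1 - u) *\<^sub>R x + u *\<^sub>R x') = (1 - u) *\<^sub>R (nup + y + ?Z x) + u *\<^sub>R (nup + y + ?Z x')"
      by (simp only: linear_add[OF linZ] linear_scale[OF linZ]) (simp add: algebra_simps)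
     then have "supp (nup + y + ?Z ((1 - u) *\<^sub>R x + u *\<^sub>R x')) t <= (1 - u) * supp (nup + y + ?Z x) t + u * supp (nup + y + ?Z x') t"
      using convex_onD[OF supp_convex[OF tI], of u] u by simp
     then show "g ((1 - u) *\<^sub>R x + u *\<^sub>R x') t <= (1 - u) * g x t + u * g x' t"
      unfolding g_def vec by (simp add: algebra_simps)
    qed simp
    show "a <= trace V - c"
     if x1: "norm x1 < d0 / 2" "s1 < t1" "t1 <= sg0" "!!i j. V $ i $ j = V $ j $ i" "!!xi. xi ~= 0 ==> 0 < xi \<bullet> (V *v xi)" "0 < rho'"
      and to: "!!xi th. norm xi < rho' ==> - rho' < th ==> th <= 0 ==> g (x1 + xi) (t1 + th) <= g x1 t1 + quadratic_test bb V a xi th"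
     for x1 t1 bb V a rho'
     unfolding c_def
    proof (rule slice_touch[OF L b om lamn])
     show "0 < t1" "t1 < Tc" using x1 s1 sg0 by auto
     show "pos_def V" using x1(4,5) unfolding pos_def_def by blast
     show "0 < rho'" by fact
     have "\<bar>x1 $ i\<bar> <= d0" for i using component_le_norm_cart[of x1 i] x1(1) d0(1) by linarith
     then have "x1 \<in> cube d0" by (simp add: mem_cube)
     then show "norm (p0 + diag_scale (%i. sqrt ((1 - om) * pair_weight b i)) x1) <= om / 4 * (3 / 4)"
      using p0n unfolding d_def by blast
     show "supp (L (p0 + diag_scale (%i. sqrt ((1 - om) * pair_weight b i)) (x1 + xi), - lam)) (t1 + th)
       <= supp (L (p0 + diag_scale (%i. sqrt ((1 - om) * pair_weight b i)) x1, - lam)) t1 + quadratic_test bb V a xi th"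
      if "norm xi < rho'" "- rho' < th" "th <= 0" for xi th
      using to[OF that] unfolding g_def d_def[abs_def] by simp
    qed
   qed (use gb d0 c R0 s1 in \<open>auto simp: M0_def\<close>)
   moreover have "sg0 - s1 = tau" by (simp add: s1_def)
   moreover have "heat d0 (%z. g z s1) 0 tau = integral (cube d0) (%z. gauss tau z * U y z)"
    unfolding heat_def g_def U_def vec by (simp add: gauss_minus)
   moreover have "(2 * M0 + c * tau) / (d0 / 2) ^ 4 * (real CARD('n) * (4 * real CARD('n) + 8)) * tau\<^sup>2 <= K2 * tau\<^sup>2"
    unfolding K2_def using c tau' tau d0 mult_left_mono[OF tau'(2) c]
    by (intro mult_right_mono divide_right_mono) auto
   moreover have "g 0 sg0 = supp (nup + y) sg0 + M0"
    unfolding g_def vec linear_0[OF linZ] by simp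
   ultimately show ?thesis by simp
  qed
  have cU: "continuous_on (box0 \<times> cube d0) (%x. kap (fst x) * (gauss tau (snd x) * U (fst x) (snd x)))"
   unfolding U_def using s1 tau by (intro continuous_intros continuous_kap continuous_on_gauss continuous_h contZ) auto
  have i1: "(%y. kap y * (supp (nup + y) sg0 + M0)) integrable_on box0"
   using sg0 by (intro integrable_box0 continuous_intros continuous_kap continuous_h) auto
  have cB: "continuous_on box0 (%y. integral (cube d0) (%z. kap y * (gauss tau z * U y z)))"
   unfolding cube_def by (intro integral_continuous_on_param) (use cU in \<open>simp add: split_beta' cube_def\<close>)
  have "G nup sg0 + M0 = integral box0 (%y. kap y * (supp (nup + y) sg0 + M0))"
  proof -
   have "integral box0 (%y. supp (nup + 1 *\<^sub>R y) sg0 * kap y + M0 * kap y) = G nup sg0 + M0 * 1"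
    unfolding G_def Phi_def integral_kap[symmetric] integral_mult_right[symmetric]
    using sg0 by (intro integral_add Phi_integrable integrable_box0 continuous_intros continuous_kap) auto
   moreover have "(%y. supp (nup + 1 *\<^sub>R y) sg0 * kap y + M0 * kap y) = (%y. kap y * (supp (nup + y) sg0 + M0))"
    by (simp add: fun_eq_iff algebra_simps)
   ultimately show ?thesis by simp
  qed
  also have "... <= integral box0 (%y. integral (cube d0) (%z. kap y * (gauss tau z * U y z)) + (K2 * tau\<^sup>2 - c * tau) * kap y)"
  proof (intro integral_le i1 integrable_box0 continuous_intros cB continuous_kap)
   fix y
   show "kap y * (supp (nup + y) sg0 + M0) <= integral (cube d0) (%z. kap y * (gauss tau z * U y z)) + (K2 * tau\<^sup>2 - c * tau) * kap y"
   proof (cases "norm y < r")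
    case True
    have alg: "k * (v - u + w) = k * v + (w - u) * k" for k v u w :: real by (simp add: algebra_simps)
    show ?thesis using mult_left_mono[OF slice[OF True] kap_nonneg[of y]] unfolding alg integral_mult_right .
   qed (simp add: kap_outside)
  qed
  also have "... = integral box0 (%y. integral (cube d0) (%z. kap y * (gauss tau z * U y z))) + (K2 * tau\<^sup>2 - c * tau)"
  proof -
   have "(%y. (K2 * tau\<^sup>2 - c * tau) * kap y) integrable_on box0" by (intro integrable_box0 continuous_intros continuous_kap)
   from integral_add[OF integrable_box0[OF cB] this] show ?thesis by (simp add: integral_kap)
  qed
  also have "integral box0 (%y. integral (cube d0) (%z. kap y * (gauss tau z * U y z))) =
   integral (cube d0) (%z. integral box0 (%y. kap y * (gauss tau z * U y z)))"
   unfolding cube_def box0_def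
   by (rule integral_swap_continuous) (use cU in \<open>simp add: split_beta' cube_def box0_def cbox_Pair_eq\<close>)
  also have "... = integral (cube d0) (%z. gauss tau z * (G (nup + ?Z z) s1 + M0))"
  proof -
   have "integral box0 (%y. kap y * (gauss tau z * U y z)) = gauss tau z * (G (nup + ?Z z) s1 + M0)" for z
   proof -
    have "(%y. kap y * (gauss tau z * U y z)) = (%y. gauss tau z * (supp (nup + ?Z z + 1 *\<^sub>R y) s1 * kap y + M0 * kap y))"
     by (simp add: fun_eq_iff U_def algebra_simps)
    moreover have "integral box0 (%y. supp (nup + ?Z z + 1 *\<^sub>R y) s1 * kap y + M0 * kap y) = G (nup + ?Z z) s1 + M0 * 1"
     unfolding G_def Phi_def integral_kap[symmetric] integral_mult_right[symmetric]
     using s1 by (intro integral_add Phi_integrable integrable_box0 continuous_intros continuous_kap)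
    ultimately show ?thesis by simp
   qed
   then show ?thesis by simp
  qed
  also have "... <= (G nup s1 + M0) + 2 * tau * (\<Sum>i\<in>UNIV. d i * d i * d2G nup s1 (f i) (f i) / 2 + (if i = i then kp else 0))"
  proof -
   have Zf: "?Z z = (\<Sum>i\<in>UNIV. (z $ i * d i) *\<^sub>R f i)" for z
   proof -
    have "(?D z, 0) = (\<Sum>i\<in>UNIV. (z $ i * d i) *\<^sub>R (axis i 1, 0 :: real))"
     by (simp add: prod_eq_iff fst_sum snd_sum vec_eq_iff diag_scale_def axis_def if_distrib[of "%x. _ * x"] mult.commute cong: if_cong)
    then show ?thesis by (simp only: L.sum L.scale f_def)
   qed
   let ?m = "%i j. d i * d j * d2G nup s1 (f i) (f j) / 2 + (if i = j then kp else 0)"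
   have bil: "bilinear (d2G nup s1)" by (rule d2G_bilinear[OF s1(3)])
   have linl: "linear (%z. dG nup s1 (?Z z))" using linear_compose[OF linZ dG_linear[OF s1(3)]] by (simp add: o_def)
   have G0: "G nup s1 + M0 >= 0"
   proof -
    have "supp nup s1 <= G nup s1" unfolding G_def by (rule Phi_ge[OF s1(3)]) simp
    moreover have "\<bar>supp nup s1\<bar> <= 4 * R0" using nup s1 by (intro sb) auto
    ultimately show ?thesis unfolding M0_def by linarith
   qed
   have m0: "?m i i >= 0" for i
    using d2G_nonneg[OF s1(3) nup, of "f i"] kp by (simp add: add_nonneg_nonneg)
   note gq = gauss_quadratic_le[where m = "?m" and d = d0, OF tau(1) linl G0 m0]
   have contG: "continuous_on (cube d0) (%z. G (nup + ?Z z) s1)"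
   proof -
    have "continuous_on (cube d0) ((%(nu, N, t). Phi nu N t) \<circ> (%z. (nup + ?Z z, 1, s1)))"
     using s1 by (intro continuous_on_compose continuous_on_subset[OF continuous_Phi] continuous_intros contZ) auto
    then show ?thesis by (simp add: o_def G_def)
   qed
   have "integral (cube d0) (%z. gauss tau z * (G (nup + ?Z z) s1 + M0)) <=
    integral (cube d0) (%z. gauss tau z * ((G nup s1 + M0) + dG nup s1 (?Z z) + (\<Sum>i\<in>UNIV. \<Sum>j\<in>UNIV. z $ i * z $ j * ?m i j)))"
   proof (intro integral_le gq(1) mult_left_mono less_imp_le[OF gauss_pos])
    show "(%z. gauss tau z * (G (nup + ?Z z) s1 + M0)) integrable_on cube d0"
     using contG tau unfolding cube_def by (intro integrable_continuous continuous_intros continuous_on_gauss) auto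
    fix z :: "real^'n" assume z: "z \<in> cube d0"
    have nz: "norm (?Z z) <= 1 / 2" using cubeD[OF z] dmd(2) by (simp add: Ln norm_Pair)
    have "\<bar>G (nup + ?Z z) s1 - G nup s1 - dG nup s1 (?Z z) - d2G nup s1 (?Z z) (?Z z) / 2\<bar> <= K * norm (?Z z) ^ 3"
     using nup nz s1 by (intro K(2)) auto
    also have "K * norm (?Z z) ^ 3 <= kp * (norm z)\<^sup>2"
    proof -
     have "norm (?Z z) ^ 3 <= (dm * norm z) ^ 3" using nZ by (intro power_mono) auto
     also have "... = dm ^ 3 * (norm z * (norm z)\<^sup>2)" by (simp add: power2_eq_square power3_eq_cube)
     also have "... <= dm ^ 3 * (n * d0 * (norm z)\<^sup>2)"
      using norm_cube[OF z] dm unfolding n_def by (intro mult_left_mono mult_right_mono) auto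
     finally have "K * norm (?Z z) ^ 3 <= K * (dm ^ 3 * (n * d0 * (norm z)\<^sup>2))" using K by (intro mult_left_mono) auto
     then show ?thesis by (simp add: kp_def mult.assoc)
    qed
    finally have 1: "G (nup + ?Z z) s1 <= G nup s1 + dG nup s1 (?Z z) + d2G nup s1 (?Z z) (?Z z) / 2 + kp * (norm z)\<^sup>2"
     unfolding abs_le_iff by linarith
    have 2: "d2G nup s1 (?Z z) (?Z z) / 2 + kp * (norm z)\<^sup>2 = (\<Sum>i\<in>UNIV. \<Sum>j\<in>UNIV. z $ i * z $ j * ?m i j)"
    proof -
     have "d2G nup s1 (?Z z) (?Z z) = (\<Sum>i\<in>UNIV. \<Sum>j\<in>UNIV. (z $ i * d i) * ((z $ j * d j) * d2G nup s1 (f i) (f j)))"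
      unfolding Zf bilinear_sum_left[OF bil] bilinear_sum_right[OF bil] bilinear_simps[OF bil] by (simp add: sum_distrib_left d2G_sym)
     moreover have "kp * (norm z)\<^sup>2 = (\<Sum>i\<in>UNIV. \<Sum>j\<in>UNIV. z $ i * z $ j * (if i = j then kp else 0))"
      unfolding norm2_cart by (simp add: sum_distrib_left power2_eq_square if_distrib[of "%x. _ * x"] mult_ac cong: if_cong)
     ultimately show ?thesis
      by (simp add: sum_divide_distrib distrib_left sum.distrib mult_ac)
    qed
    show "G (nup + ?Z z) s1 + M0 <= (G nup s1 + M0) + dG nup s1 (?Z z) + (\<Sum>i\<in>UNIV. \<Sum>j\<in>UNIV. z $ i * z $ j * ?m i j)"
     using 1 unfolding 2[symmetric] by linarith
   qed
   also note gq(2)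
   finally show ?thesis .
  qed
  also have "(\<Sum>i\<in>UNIV. d i * d i * d2G nup s1 (f i) (f i) / 2 + (if i = i then kp else 0)) = q nup s1 / 2 + n * kp"
   by (simp add: sum.distrib q_def n_def sum_divide_distrib power2_eq_square)
  finally have "G nup sg0 <= G nup s1 + 2 * tau * (q nup s1 / 2 + n * kp) + (K2 * tau\<^sup>2 - c * tau)" by simp
  also have "... = G nup s1 + tau * (q nup s1 + 2 * n * kp) + (K2 * tau\<^sup>2 - c * tau)" by (simp add: algebra_simps)
  also have "... <= G nup s1 + tau * (q nu0 sg0 + dl / 3 + dl / 3) + (tau * (dl / 3) - c * tau)"
  proof -
   have "q nup s1 <= q nu0 sg0 + dl / 3" unfolding nup_def s1_def using rho1(2)[OF p'(2) _ p'(3)] tau by simp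
   then have "tau * (q nup s1 + 2 * n * kp) <= tau * (q nu0 sg0 + dl / 3 + dl / 3)"
    using kp2 tau by (intro mult_left_mono) auto
   then show ?thesis using tau'(3) by linarith
  qed
  also have "... = G nup s1 + tau * (q nu0 sg0 - c + dl)" by (simp add: field_simps)
  also have "q nu0 sg0 - c = (1 - om) * ((\<Sum>i\<in>UNIV. pair_weight b i * d2G nu0 sg0 (f i) (f i)) - 3 * pair_sum b)"
   by (simp add: q_def d2 c_def right_diff_distrib sum_distrib_left mult.assoc)
  finally show ?thesis by (simp add: nup_def s1_def nu0_def f_def)
 qed
 show ?thesis using rho main by blast
qed

end

section \<open>A cap touching the hyperplane\<close>

text \<open>After scaling |a| to 1 the squares of both sides are compared; the slack e w absorbs the
  terms of order three and four once |v| <= e / 2.\<close>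

lemma norm_lower_expansion:
 fixes a :: "'a::real_inner"
 assumes a: "a ~= 0" and ez: "ez > 0"
 shows "\<exists>rho>0. \<forall>v. norm v < rho -->
  norm a + a \<bullet> v / norm a + ((norm v)\<^sup>2 - (a \<bullet> v)\<^sup>2 / (norm a)\<^sup>2) / (2 * norm a) - ez * (norm v)\<^sup>2 <= norm (a + v)"
proof -
 define m where "m = norm a"
 have m: "m > 0" using a by (simp add: m_def)
 have unit: "1 + t + (w - t\<^sup>2) / 2 - e * w <= X"
  if X: "0 <= X" "X\<^sup>2 = 1 + 2 * t + w" and w: "t\<^sup>2 <= w" and e: "0 < e" "e <= 1/2" and s: "w = s\<^sup>2" "0 <= s" "s <= e / 2" for t w X e s :: real
 proof -
  define u where "u = (w - t\<^sup>2) / 2 - e * w"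
  have w0: "0 <= w" using s by simp
  have ew: "e * w <= 1/2 * w" "0 <= e * w" using e w0 mult_right_mono[of e "1/2" w] by simp_all
  have u: "\<bar>u\<bar> <= w" using ew w zero_le_power2[of t] w0 unfolding u_def abs_le_iff by (auto simp: field_simps)
  have ts: "\<bar>t\<bar> <= s" using w s abs_le_square_iff[of t s] by simp
  have "t * u <= s * w" using mult_mono[OF ts u] s by (simp add: abs_mult[symmetric] abs_le_iff)
  moreover have "u\<^sup>2 <= w\<^sup>2" using power_mono[OF u, of 2] by simp
  moreover have "w\<^sup>2 = s\<^sup>2 * w" using s by (simp add: power2_eq_square)
  moreover have "s\<^sup>2 * w <= s * w"
  proof -
   have "s\<^sup>2 <= s * 1" unfolding power2_eq_square using s e by (intro mult_left_mono) auto
   then show ?thesis using w0 by (simp add: mult_right_mono)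
  qed
  moreover have "3 * (s * w) <= 2 * (e * w)"
  proof -
   have "s * w <= e / 2 * w" using s w0 by (intro mult_right_mono) auto
   then show ?thesis using ew by simp
  qed
  ultimately have "- 2 * (e * w) + 2 * (t * u) + u\<^sup>2 <= 0" by linarith
  moreover have "(1 + t + u)\<^sup>2 = 1 + 2 * t + w + (- 2 * (e * w) + 2 * (t * u) + u\<^sup>2)"
   by (simp add: u_def power2_eq_square field_simps)
  ultimately have "(1 + t + u)\<^sup>2 <= X\<^sup>2" using X by linarith
  then have "1 + t + u <= X" using X(1) by (rule power2_le_imp_le)
  then show ?thesis by (simp add: u_def)
 qed
 define e where "e = min (ez * m) (1/2)"
 have e: "0 < e" "e <= 1/2" "e <= ez * m" using ez m by (auto simp: e_def)
 show ?thesis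
 proof (rule exI[of _ "m * (e / 2)"], intro conjI allI impI)
  show "m * (e / 2) > 0" using m e by simp
  fix v :: 'a assume v: "norm v < m * (e / 2)"
  define t where "t = a \<bullet> v / m\<^sup>2"
  define w where "w = (norm v)\<^sup>2 / m\<^sup>2"
  have "1 + t + (w - t\<^sup>2) / 2 - e * w <= norm (a + v) / m"
  proof (rule unit[where s = "norm v / m"])
   have "(norm (a + v))\<^sup>2 = m\<^sup>2 + 2 * (a \<bullet> v) + (norm v)\<^sup>2"
    by (simp add: m_def power2_norm_eq_inner inner_add_left inner_add_right inner_commute)
   then show "(norm (a + v) / m)\<^sup>2 = 1 + 2 * t + w"
    using m by (simp add: power_divide t_def w_def add_divide_distrib)
   have "(a \<bullet> v)\<^sup>2 <= m\<^sup>2 * (norm v)\<^sup>2"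
    using Cauchy_Schwarz_ineq[of a v] by (simp add: m_def power2_norm_eq_inner)
   then have "(a \<bullet> v)\<^sup>2 / (m\<^sup>2 * m\<^sup>2) <= m\<^sup>2 * (norm v)\<^sup>2 / (m\<^sup>2 * m\<^sup>2)" by (intro divide_right_mono) auto
   then show "t\<^sup>2 <= w" using m unfolding t_def w_def power_divide by (simp add: power2_eq_square)
   show "norm v / m <= e / 2" using v m by (simp add: pos_divide_le_eq mult.commute)
  qed (use m e in \<open>auto simp: w_def power_divide\<close>)
  then have "m * (1 + t + (w - t\<^sup>2) / 2 - e * w) <= norm (a + v)" using m by (simp add: pos_le_divide_eq mult.commute)
  moreover have "m * (1 + t + (w - t\<^sup>2) / 2 - e * w) = m + a \<bullet> v / m + ((norm v)\<^sup>2 - (a \<bullet> v)\<^sup>2 / m\<^sup>2) / (2 * m) - e / m * (norm v)\<^sup>2"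
   using m by (simp add: t_def w_def power_divide field_simps power2_eq_square)
  moreover have "e / m * (norm v)\<^sup>2 <= ez * (norm v)\<^sup>2"
   using e m by (intro mult_right_mono) (auto simp: pos_divide_le_eq)
  ultimately show "norm a + a \<bullet> v / norm a + ((norm v)\<^sup>2 - (a \<bullet> v)\<^sup>2 / (norm a)\<^sup>2) / (2 * norm a) - ez * (norm v)\<^sup>2 <= norm (a + v)"
   unfolding m_def[symmetric] by linarith
 qed
qed

text \<open>Either S = x v + y w is at least 8, or 4 x y Y <= S^2 <= 64 bounds x y by 16 / Y. The
  threshold 8 = 3 + 5 leaves the barrier a gain of 5 beyond the 3 of the tangent plane.\<close>

lemma pair_amgm:
 fixes x y v w Y :: real
 assumes "x > 0" "y > 0" "v > 0" "w > 0" "Y > 0" "v * w >= Y"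
 shows "x * y * (x * v + y * w) >= 8 * (x * y) - 128 / Y"
proof -
 define S where "S = x * v + y * w"
 have S: "S > 0" using assms by (simp add: S_def add_pos_pos)
 have xy: "x * y > 0" using assms by simp
 show ?thesis
 proof (cases "S >= 8")
  case True
  then have "x * y * 8 <= x * y * S" using xy by (intro mult_left_mono) auto
  moreover have "128 / Y >= 0" using assms by simp
  ultimately show ?thesis unfolding S_def[symmetric] by linarith
 next
  case False
  have "0 <= (x * v - y * w)\<^sup>2" by simp
  then have "4 * (x * y) * (v * w) <= S\<^sup>2" by (simp add: S_def power2_eq_square algebra_simps)
  moreover have "4 * (x * y) * Y <= 4 * (x * y) * (v * w)" using assms xy by (intro mult_left_mono) auto
  moreover have "S\<^sup>2 <= 8\<^sup>2" using False S by (intro power_mono) auto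
  ultimately have "4 * (x * y) * Y <= 8\<^sup>2" by linarith
  then have "8 * (x * y) * Y <= 128" by simp
  then have "8 * (x * y) <= 128 / Y" using assms by (simp add: pos_le_divide_eq)
  moreover have "x * y * S >= 0" using xy S by simp
  ultimately show ?thesis unfolding S_def[symmetric] by linarith
 qed
qed

text \<open>Exchanging i and j writes the weighted sum as half a sum over ordered pairs, each
  subject to the pair estimate; at most n^2 pairs carry the error k.\<close>

lemma pair_weight_sum:
 fixes b w :: "'n::finite => real"
 assumes pair: "!!i j. i ~= j ==> b i * b j * (b i * w i + b j * w j) >= 8 * (b i * b j) - k" and k: "k >= 0"
 shows "(\<Sum>i\<in>UNIV. pair_weight b i * w i) >= 8 * pair_sum b - (real CARD('n))\<^sup>2 / 2 * k"
proof -
 define N where "N = (real CARD('n))\<^sup>2"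
 let ?A = "SIGMA i:UNIV. UNIV - {i::'n}"
 have ss: "(\<Sum>i\<in>UNIV. \<Sum>j\<in>UNIV - {i}. g i j) = (\<Sum>x\<in>?A. g (fst x) (snd x))" for g :: "'n => 'n => real"
  by (subst sum.Sigma) (auto simp: split_beta')
 have 1: "(\<Sum>i\<in>UNIV. pair_weight b i * w i) = (\<Sum>i\<in>UNIV. \<Sum>j\<in>UNIV - {i}. b i * b j * (b i * w i))"
  unfolding pair_weight_def by (intro sum.cong refl) (simp add: sum_distrib_left sum_distrib_right power2_eq_square mult_ac)
 have "(\<Sum>i\<in>UNIV. \<Sum>j\<in>UNIV - {i}. b i * b j * (b i * w i)) = (\<Sum>x\<in>?A. b (fst x) * b (snd x) * (b (fst x) * w (fst x)))"
  by (rule ss)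
 also have "... = (\<Sum>x\<in>?A. b (fst x) * b (snd x) * (b (snd x) * w (snd x)))"
  by (rule sum.reindex_bij_witness[of _ prod.swap prod.swap]) (auto simp: mult_ac)
 also have "... = (\<Sum>i\<in>UNIV. \<Sum>j\<in>UNIV - {i}. b i * b j * (b j * w j))" by (rule ss[symmetric])
 finally have 2: "2 * (\<Sum>i\<in>UNIV. pair_weight b i * w i) = (\<Sum>i\<in>UNIV. \<Sum>j\<in>UNIV - {i}. b i * b j * (b i * w i + b j * w j))"
  unfolding 1 by (simp add: distrib_left sum.distrib)
 have 3: "(\<Sum>i\<in>UNIV. \<Sum>j\<in>UNIV - {i}. 8 * (b i * b j) - k) <= (\<Sum>i\<in>UNIV. \<Sum>j\<in>UNIV - {i}. b i * b j * (b i * w i + b j * w j))"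
  using pair by (intro sum_mono) auto
 have 4: "(\<Sum>i\<in>UNIV. \<Sum>j\<in>UNIV - {i}. 8 * (b i * b j) - k) = 16 * pair_sum b - (\<Sum>i\<in>(UNIV::'n set). \<Sum>j\<in>UNIV - {i}. k)"
  by (simp add: pair_sum_def sum_subtractf sum_distrib_left[symmetric])
 have "(\<Sum>i\<in>(UNIV::'n set). \<Sum>j\<in>UNIV - {i}. k) <= (\<Sum>i\<in>(UNIV::'n set). \<Sum>j\<in>(UNIV::'n set). k)"
  using k by (intro sum_mono sum_mono2) auto
 also have "... = N * k" by (simp add: N_def power2_eq_square)
 finally show ?thesis using 2 3 4 unfolding N_def[symmetric] by linarith
qed

text \<open>The cap is the sum of an ellipsoid with semi-axes rho1 (horizontal) and rho1 kp = dl / 2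
  (vertical) and a ball of radius rE, centred at height rE + dl. Its lowest height is dl / 2 and it
  contains (0, dl). The parameters stand for a disc of radius rho0 in the flat side and a surface
  point (xs, H0) at positive height; \<open>hE\<close> is the support function.\<close>

locale cap =
 fixes rho0 H0 :: real and xs :: "real^'n" and dl :: real
 assumes rho0: "rho0 > 0" and H0: "H0 > 0" and dl0: "dl > 0"
begin

definition "th = min (1 / 4) (rho0 / (4 * (rho0 + norm xs)))"
definition "rE = min (rho0 / 4) (th * H0 / 8)"
definition "rho1 = rho0 / 4"
definition "kp = dl / (2 * rho1)"
definition "T nu = (fst nu, kp * snd nu)" for nu :: "(real^'n) \<times> real"
definition "hE nu = rho1 * norm (T nu) + rE * norm nu + (rE + dl) * snd nu"
text \<open>\<open>WE\<close> and \<open>dE\<close> are the Hessian and gradient of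
  \<open>hE\<close> at a unit vector nu, restricted to directions orthogonal to nu. Hence the ball
  contributes rE (xi . eta) to the former and nothing to the latter.\<close>

definition "WE nu xi eta = rE * (xi \<bullet> eta) + rho1 / norm (T nu) * (T xi \<bullet> T eta - (T nu \<bullet> T xi) * (T nu \<bullet> T eta) / (norm (T nu))\<^sup>2)"
definition "dE nu xi = rho1 * (T nu \<bullet> T xi / norm (T nu)) + (rE + dl) * snd xi"
definition "c1 = min (rho0 / 8) (th * H0 / 4)"
text \<open>No ingredient depends on \<open>dl\<close>; this allows \<open>dl\<close> to tend to 0
  at a fixed growth rate of \<eta>. The two summands belong to normals away from and near the south
  pole.\<close>

definition "CE = 64 * (real CARD('n))\<^sup>2 * (1 / (rE\<^sup>2 * c1) + 16 / (rho0 * rE * rho1))"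

lemma pos: "th > 0" "th <= 1/4" "rE > 0" "rho1 > 0" "kp > 0" "c1 > 0" "CE > 0"
proof -
 have s: "rho0 + norm xs > 0" using rho0 by (simp add: add_pos_nonneg)
 show th: "th > 0" "th <= 1/4" using s rho0 by (auto simp: th_def)
 show r: "rE > 0" "rho1 > 0" "c1 > 0" using th rho0 H0 by (auto simp: rE_def rho1_def c1_def)
 show "kp > 0" using r dl0 by (simp add: kp_def)
 show "CE > 0" unfolding CE_def using r rho0 by (intro mult_pos_pos add_pos_pos) auto
qed

lemma linear_T: "linear T" by (rule linearI) (simp_all add: T_def algebra_simps)

lemma T_nonzero: "nu ~= 0 ==> norm (T nu) > 0"
 using pos(5) by (cases nu) (auto simp: T_def zero_prod_def)

lemma norm_T_le: "norm (T nu) <= norm (fst nu) + kp * \<bar>snd nu\<bar>"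
 unfolding T_def using norm_Pair_le[of "fst nu" "kp * snd nu"] pos(5) by (simp add: abs_mult)

lemma norm_le_parts: "norm nu <= norm (fst nu) + \<bar>snd nu\<bar>" for nu :: "(real^'n) \<times> real"
 using norm_Pair_le[of "fst nu" "snd nu"] by simp

lemma hE_scale: "c >= 0 ==> hE (c *\<^sub>R nu) = c * hE nu"
 using linear_scale[OF linear_T, of c nu] by (simp add: hE_def algebra_simps)

lemma continuous_hE: "continuous_on A f ==> continuous_on A (%x. hE (f x))"
 unfolding hE_def T_def by (intro continuous_intros)

text \<open>The ball of radius rE supplies the excess in the triangle inequality; it makes the
  contact normal of the barrier unique.\<close>

lemma hE_strict:
 "hE (mu + nu) + rE * (norm mu + norm nu - norm (mu + nu)) <= hE mu + hE nu"
proof -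
 have "rho1 * norm (T (mu + nu)) <= rho1 * (norm (T mu) + norm (T nu))"
  unfolding linear_add[OF linear_T] using pos(4) by (intro mult_left_mono norm_triangle_ineq) auto
 then show ?thesis by (simp add: hE_def algebra_simps)
qed

lemma hE_ge: "rE * norm nu + (rE + dl) * snd nu <= hE nu" "dl * snd nu <= hE nu"
proof -
 have "rho1 * norm (T nu) >= 0" using pos(4) by simp
 then show 1: "rE * norm nu + (rE + dl) * snd nu <= hE nu" by (simp add: hE_def)
 have "\<bar>snd nu\<bar> <= norm nu" using norm_snd_le[of "snd nu" "fst nu"] by simp
 then have "rE * (norm nu + snd nu) >= 0" using pos(3) by simp
 then show "dl * snd nu <= hE nu" using 1 by (simp add: algebra_simps)
qed

lemma WE_bilinear: "bilinear (WE nu)"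
 using linear_add[OF linear_T] linear_scale[OF linear_T]
 by (intro bilinearI2) (simp_all add: WE_def inner_add_left inner_add_right algebra_simps add_divide_distrib)

lemma WE_sym: "WE nu xi eta = WE nu eta xi"
 unfolding WE_def by (simp only: inner_commute[of xi] inner_commute[of "T xi" "T eta"] mult.commute)

lemma T_part: "(T nu \<bullet> T xi)\<^sup>2 / (norm (T nu))\<^sup>2 <= (norm (T xi))\<^sup>2"
proof (cases "T nu = 0")
 case False
 then show ?thesis using Cauchy_Schwarz_ineq[of "T nu" "T xi"]
  by (simp add: pos_divide_le_eq power2_norm_eq_inner mult.commute)
qed simp

lemma WE_diag: "WE nu xi xi = rE * (norm xi)\<^sup>2 + rho1 / norm (T nu) * ((norm (T xi))\<^sup>2 - (T nu \<bullet> T xi)\<^sup>2 / (norm (T nu))\<^sup>2)"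
 unfolding WE_def dot_square_norm power2_eq_square[of "T nu \<bullet> T xi"] by (rule refl)

lemma WE_ge: "WE nu xi xi >= rE * (norm xi)\<^sup>2"
 unfolding WE_diag using T_part[of nu xi] pos(4) by simp

lemma dE_linear: "linear (dE nu)"
 using linear_add[OF linear_T] linear_scale[OF linear_T]
 by (intro linearI) (simp_all add: dE_def inner_add_right add_divide_distrib algebra_simps)

lemma hE_lower:
 assumes nu: "norm nu = 1" and ez: "ez > 0"
 shows "\<exists>rho>0. \<forall>xi. norm xi < rho --> nu \<bullet> xi = 0 --> hE nu + dE nu xi + WE nu xi xi / 2 - ez * (norm xi)\<^sup>2 <= hE (nu + xi)"
proof -
 define m where "m = 1 + kp"
 have m: "m > 0" using pos(5) by (simp add: m_def)
 have Tm: "norm (T xi) <= m * norm xi" for xi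
 proof -
  have "norm (T xi) <= norm (fst xi) + kp * \<bar>snd xi\<bar>" by (rule norm_T_le)
  also have "... <= norm xi + kp * norm xi"
   using norm_fst_le[of "fst xi" "snd xi"] norm_snd_le[of "snd xi" "fst xi"] pos(5) by (intro add_mono mult_left_mono) auto
  finally show ?thesis by (simp add: m_def algebra_simps)
 qed
 define e where "e = ez / (2 * rho1 * m\<^sup>2)"
 have e: "e > 0" using ez pos(4) m by (simp add: e_def)
 have "nu ~= 0" using nu by auto
 then have T0: "norm (T nu) > 0" "T nu ~= 0" using T_nonzero[OF \<open>nu ~= 0\<close>] by auto
 obtain r1 where r1: "r1 > 0" "!!v. norm v < r1 ==> norm (T nu) + T nu \<bullet> v / norm (T nu) + ((norm v)\<^sup>2 - (T nu \<bullet> v)\<^sup>2 / (norm (T nu))\<^sup>2) / (2 * norm (T nu)) - e * (norm v)\<^sup>2 <= norm (T nu + v)"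
  using norm_lower_expansion[OF T0(2) e] by blast
 have e2: "ez / (2 * rE) > 0" using ez pos(3) by simp
 obtain r2 where r2: "r2 > 0" "!!v. norm v < r2 ==> norm nu + nu \<bullet> v / norm nu + ((norm v)\<^sup>2 - (nu \<bullet> v)\<^sup>2 / (norm nu)\<^sup>2) / (2 * norm nu) - ez / (2 * rE) * (norm v)\<^sup>2 <= norm (nu + v)"
  using norm_lower_expansion[OF \<open>nu ~= 0\<close> e2] by blast
 show ?thesis
 proof (rule exI[of _ "min (r1 / m) r2"], intro conjI allI impI)
  show "min (r1 / m) r2 > 0" using r1 r2 m by simp
  fix xi assume xi: "norm xi < min (r1 / m) r2" "nu \<bullet> xi = 0"
  have "m * norm xi < r1" using xi m by (simp add: pos_less_divide_eq mult.commute)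
  then have "norm (T xi) < r1" using Tm[of xi] by linarith
  define Y where "Y = ((norm (T xi))\<^sup>2 - (T nu \<bullet> T xi)\<^sup>2 / (norm (T nu))\<^sup>2) / norm (T nu)"
  have "norm (T nu) + T nu \<bullet> T xi / norm (T nu) + Y / 2 - e * (norm (T xi))\<^sup>2 <= norm (T (nu + xi))"
   using r1(2)[OF \<open>norm (T xi) < r1\<close>] unfolding Y_def linear_add[OF linear_T] by (simp add: mult.commute)
  then have "rho1 * (norm (T nu) + T nu \<bullet> T xi / norm (T nu) + Y / 2 - e * (norm (T xi))\<^sup>2) <= rho1 * norm (T (nu + xi))"
   using pos(4) by (intro mult_left_mono) auto
  moreover have "rho1 * (e * (norm (T xi))\<^sup>2) <= ez / 2 * (norm xi)\<^sup>2"
  proof -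
   have "(norm (T xi))\<^sup>2 <= m\<^sup>2 * (norm xi)\<^sup>2" using power_mono[OF Tm[of xi], of 2] by (simp add: power_mult_distrib)
   then have "rho1 * (e * (norm (T xi))\<^sup>2) <= rho1 * (e * (m\<^sup>2 * (norm xi)\<^sup>2))" using pos(4) e by (intro mult_left_mono) auto
   then show ?thesis using pos(4) m by (simp add: e_def)
  qed
  moreover have "rE * (1 + (norm xi)\<^sup>2 / 2 - ez / (2 * rE) * (norm xi)\<^sup>2) <= rE * norm (nu + xi)"
   using r2(2)[of xi] xi nu pos(3) by (intro mult_left_mono) auto
  moreover have "rE * (ez / (2 * rE) * (norm xi)\<^sup>2) = ez / 2 * (norm xi)\<^sup>2" using pos(3) by simp
  moreover have "WE nu xi xi = rE * (norm xi)\<^sup>2 + rho1 * Y" unfolding WE_diag Y_def by simp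
  moreover have "rho1 * (norm (T nu) + T nu \<bullet> T xi / norm (T nu) + Y / 2 - e * (norm (T xi))\<^sup>2) =
   rho1 * norm (T nu) + rho1 * (T nu \<bullet> T xi / norm (T nu)) + rho1 * Y / 2 - rho1 * (e * (norm (T xi))\<^sup>2)"
   by (simp add: distrib_left right_diff_distrib)
  moreover have "rE * (1 + (norm xi)\<^sup>2 / 2 - ez / (2 * rE) * (norm xi)\<^sup>2) = rE + rE * (norm xi)\<^sup>2 / 2 - rE * (ez / (2 * rE) * (norm xi)\<^sup>2)"
   unfolding distrib_left right_diff_distrib by simp
  moreover have "(rE + dl) * snd (nu + xi) = (rE + dl) * snd nu + (rE + dl) * snd xi" by (simp add: distrib_left)
  moreover have "rE * norm nu = rE" using nu by simp
  ultimately show "hE nu + dE nu xi + WE nu xi xi / 2 - ez * (norm xi)\<^sup>2 <= hE (nu + xi)"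
   unfolding hE_def dE_def by linarith
 qed
qed

text \<open>A lower bound for \<open>supp\<close> minus \<open>hE\<close>. In the lower half it
  equals rho0 / 4 (|fst nu| + kp |snd nu|), comparable to |T nu|, and thus degenerates at the south
  pole as \<open>dl\<close> tends to 0.\<close>

definition "gap nu = (if snd nu >= 0 then rho0 / 4 * norm (fst nu) + th * H0 / 4 * snd nu else rho0 / 4 * norm (fst nu) - dl / 2 * snd nu)"

lemma gap_pos: "nu ~= 0 ==> gap nu > 0"
proof -
 assume n: "nu ~= 0"
 have a: "rho0 / 4 * norm (fst nu) >= 0" using rho0 by simp
 consider "snd nu > 0" | "snd nu < 0" | "snd nu = 0" by linarith
 then show ?thesis
 proof cases
  case 1
  then have "th * H0 / 4 * snd nu > 0" using pos(1) H0 by simp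
  then show ?thesis using a 1 unfolding gap_def by simp
 next
  case 2
  then have "dl / 2 * snd nu < 0" using dl0 by (simp add: mult_pos_neg)
  then show ?thesis using a 2 unfolding gap_def by simp
 next
  case 3
  then have "fst nu ~= 0" using n by (auto simp: prod_eq_iff)
  then show ?thesis using rho0 3 unfolding gap_def by simp
 qed
qed

text \<open>For upper normals the bounds from the disc and from the top point are combined with
  weights 1 - th and th; th is so small that the horizontal offset xs costs at most a quarter of the
  disc. For lower normals the disc suffices. The radii of the cap use up only part of the
  bound.\<close>

lemma gap_le:
 assumes dl: "dl <= th * H0 / 4" and s1: "rho0 * norm (fst nu) <= s" and s2: "xs \<bullet> fst nu + H0 * snd nu <= s"
 shows "gap nu <= s - hE nu"
proof -
 define x where "x = norm (fst nu)"
 define z where "z = snd nu"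
 have x: "x >= 0" by (simp add: x_def)
 have "rho1 * norm (T nu) <= rho1 * (x + kp * \<bar>z\<bar>)"
  unfolding x_def z_def using pos(4) by (intro mult_left_mono norm_T_le) auto
 also have "... = rho0 / 4 * x + dl / 2 * \<bar>z\<bar>" using pos(4) by (simp add: kp_def rho1_def distrib_left)
 finally have 1: "rho1 * norm (T nu) <= rho0 / 4 * x + dl / 2 * \<bar>z\<bar>" .
 have 2: "rE * norm nu <= rE * x + rE * \<bar>z\<bar>"
  unfolding distrib_left[symmetric] x_def z_def using pos(3) by (intro mult_left_mono norm_le_parts) auto
 have 3: "rE * x <= rho0 / 4 * x" using x by (intro mult_right_mono) (auto simp: rE_def)
 have x0: "rho0 * x >= 0" using rho0 x by simp
 show ?thesis
 proof (cases "z >= 0")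
  case True
  have "th * (xs \<bullet> fst nu + H0 * z) + (1 - th) * (rho0 * x) <= th * s + (1 - th) * s"
   using s1 s2 pos(1,2) unfolding x_def z_def by (intro add_mono mult_left_mono) auto
  then have "th * (xs \<bullet> fst nu) + th * H0 * z + rho0 * x - th * rho0 * x <= s" by (simp add: algebra_simps)
  moreover have "th * (xs \<bullet> fst nu) >= - (th * (norm xs * x))"
  proof -
   have "\<bar>xs \<bullet> fst nu\<bar> <= norm xs * x" unfolding x_def by (rule Cauchy_Schwarz_ineq2)
   then have "th * (- (norm xs * x)) <= th * (xs \<bullet> fst nu)" using pos(1) by (intro mult_left_mono) auto
   then show ?thesis by simp
  qed
  moreover have "th * (norm xs * x) + th * rho0 * x <= rho0 / 4 * x"
  proof -
   have s: "rho0 + norm xs > 0" using rho0 by (simp add: add_pos_nonneg)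
   have "th * (4 * (rho0 + norm xs)) <= rho0 / (4 * (rho0 + norm xs)) * (4 * (rho0 + norm xs))"
    using s by (intro mult_right_mono) (auto simp: th_def)
   moreover have "rho0 / (4 * (rho0 + norm xs)) * (4 * (rho0 + norm xs)) = rho0" using s by simp
   moreover have "th * (4 * (rho0 + norm xs)) = 4 * (th * (rho0 + norm xs))" by (rule mult.left_commute)
   ultimately have "th * (rho0 + norm xs) <= rho0 / 4" by linarith
   from mult_right_mono[OF this x] show ?thesis by (simp add: algebra_simps)
  qed
  moreover have "dl * z <= th * H0 / 4 * z" "rE * z <= th * H0 / 8 * z"
   using mult_right_mono[OF dl True] mult_right_mono[of rE "th * H0 / 8" z] True by (simp_all add: rE_def)
  moreover have "th * H0 * z >= 0" using pos(1) H0 True by simp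
  ultimately have "rho0 / 4 * x + th * H0 / 4 * z <= s - (rho1 * norm (T nu) + rE * norm nu + (rE + dl) * z)"
   using 1 2 3 True x0 by (simp add: distrib_right)
  then show ?thesis using True by (simp add: gap_def hE_def x_def z_def)
 next
  case False
  then have "rho0 / 4 * x - dl / 2 * z <= s - (rho1 * norm (T nu) + rE * norm nu + (rE + dl) * z)"
   using 1 2 3 x0 s1 unfolding x_def[symmetric] by (simp add: distrib_right)
  then show ?thesis using False by (simp add: gap_def hE_def x_def z_def)
 qed
qed

text \<open>In the plane of f and g some direction is mapped by \<open>T\<close> orthogonally to T
  nu, and near the pole \<open>T\<close> keeps half of its squared length. So the ellipsoid
  contributes at least k / 2 to the two entries together, with k = rho1 / |T nu|: one of them is at
  least k / 4, the other at least rE.\<close>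

lemma south_pair:
 assumes nu: "norm nu = 1" "norm (fst nu) <= \<bar>snd nu\<bar>" and f: "norm f = 1" "norm g = 1" "f \<bullet> g = 0" "nu \<bullet> f = 0" "nu \<bullet> g = 0"
 shows "rE * rho1 / (4 * norm (T nu)) <= WE nu f f * WE nu g g"
proof -
 have "nu ~= 0" using nu by auto
 then have T0: "norm (T nu) > 0" by (rule T_nonzero)
 have n0: "\<bar>snd nu\<bar> > 0"
 proof (rule ccontr)
  assume "\<not> ?thesis"
  then have "snd nu = 0" "fst nu = 0" using nu(2) by auto
  then show False using \<open>nu ~= 0\<close> by (simp add: prod_eq_iff)
 qed
 have half: "(norm (T xi))\<^sup>2 >= (norm xi)\<^sup>2 / 2" if "nu \<bullet> xi = 0" for xi
 proof -
  have "snd nu * snd xi = - (fst nu \<bullet> fst xi)" using that by (simp add: inner_prod_def)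
  then have "\<bar>snd nu\<bar> * \<bar>snd xi\<bar> = \<bar>fst nu \<bullet> fst xi\<bar>" by (simp add: abs_mult[symmetric])
  also have "... <= norm (fst nu) * norm (fst xi)" by (rule Cauchy_Schwarz_ineq2)
  also have "... <= \<bar>snd nu\<bar> * norm (fst xi)" using nu(2) by (intro mult_right_mono) auto
  finally have "\<bar>snd xi\<bar> <= norm (fst xi)" using n0 by simp
  then have "(snd xi)\<^sup>2 <= (norm (fst xi))\<^sup>2" using power_mono[of "\<bar>snd xi\<bar>" "norm (fst xi)" 2] by simp
  moreover have "(norm xi)\<^sup>2 = (norm (fst xi))\<^sup>2 + (snd xi)\<^sup>2" by (simp add: norm_prod_def)
  moreover have "(norm (T xi))\<^sup>2 = (norm (fst xi))\<^sup>2 + (kp * snd xi)\<^sup>2" by (simp add: norm_prod_def T_def power_mult_distrib)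
  ultimately show ?thesis using zero_le_power2[of "kp * snd xi"] by linarith
 qed
 define e where "e = T nu /\<^sub>R norm (T nu)"
 have e: "norm e = 1" using T0 by (simp add: e_def)
 define P where "P = T f"
 define Q where "Q = T g"
 define A where "A = e \<bullet> P"
 define B where "B = e \<bullet> Q"
 have Aq: "(T nu \<bullet> T f)\<^sup>2 / (norm (T nu))\<^sup>2 = A\<^sup>2" "(T nu \<bullet> T g)\<^sup>2 / (norm (T nu))\<^sup>2 = B\<^sup>2"
 proof -
  have "A = T nu \<bullet> T f / norm (T nu)" "B = T nu \<bullet> T g / norm (T nu)"
   by (simp_all add: A_def B_def P_def Q_def e_def divide_inverse mult.commute)
  then show "(T nu \<bullet> T f)\<^sup>2 / (norm (T nu))\<^sup>2 = A\<^sup>2" "(T nu \<bullet> T g)\<^sup>2 / (norm (T nu))\<^sup>2 = B\<^sup>2"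
   by (simp_all add: power_divide)
 qed
 have sum: "1 / 2 <= ((norm P)\<^sup>2 - A\<^sup>2) + ((norm Q)\<^sup>2 - B\<^sup>2)"
 proof (cases "A = 0 & B = 0")
  case True
  then show ?thesis using half[OF f(4)] half[OF f(5)] f by (simp add: P_def Q_def)
 next
  case False
  define N where "N = A\<^sup>2 + B\<^sup>2"
  have N: "N > 0" using False by (auto simp: N_def sum_power2_gt_zero_iff)
  \<comment> \<open>The direction in question, up to scaling: the component of its image along
    \<open>e\<close> is B A - A B = 0. The parallelogram identity below relates it to the
    complementary combination.\<close>
  have "nu \<bullet> (B *\<^sub>R f - A *\<^sub>R g) = 0" using f by (simp add: inner_diff_right)
  from half[OF this] have "(norm (B *\<^sub>R f - A *\<^sub>R g))\<^sup>2 / 2 <= (norm (B *\<^sub>R P - A *\<^sub>R Q))\<^sup>2"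
   by (simp add: P_def Q_def linear_diff[OF linear_T] linear_scale[OF linear_T])
  moreover have "(norm (B *\<^sub>R f - A *\<^sub>R g))\<^sup>2 = N"
  proof -
   have ff: "f \<bullet> f = 1" "g \<bullet> g = 1" "g \<bullet> f = 0" using f by (simp_all add: dot_square_norm inner_commute)
   show ?thesis unfolding power2_norm_eq_inner N_def
    by (simp add: inner_diff_left inner_diff_right ff(3) f(3)) (simp add: ff f power2_eq_square)
  qed
  moreover have "(norm (B *\<^sub>R P - A *\<^sub>R Q))\<^sup>2 + (norm (A *\<^sub>R P + B *\<^sub>R Q))\<^sup>2 = N * ((norm P)\<^sup>2 + (norm Q)\<^sup>2)"
   unfolding power2_norm_eq_inner N_def
   by (simp add: inner_diff_left inner_diff_right inner_add_left inner_add_right inner_commute[of Q P] power2_eq_square algebra_simps)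
  moreover have "N\<^sup>2 <= (norm (A *\<^sub>R P + B *\<^sub>R Q))\<^sup>2"
  proof -
   have "e \<bullet> (A *\<^sub>R P + B *\<^sub>R Q) = N" by (simp add: inner_add_right A_def B_def N_def power2_eq_square)
   then have "\<bar>N\<bar> <= norm e * norm (A *\<^sub>R P + B *\<^sub>R Q)" by (metis Cauchy_Schwarz_ineq2)
   then show ?thesis using e N power_mono[of N "norm (A *\<^sub>R P + B *\<^sub>R Q)" 2] by simp
  qed
  ultimately have "N / 2 <= N * ((norm P)\<^sup>2 + (norm Q)\<^sup>2) - N\<^sup>2" by linarith
  also have "... = N * ((norm P)\<^sup>2 + (norm Q)\<^sup>2 - N)" by (simp add: power2_eq_square algebra_simps)
  finally have "N * (1 / 2) <= N * ((norm P)\<^sup>2 + (norm Q)\<^sup>2 - N)" by simp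
  then have "1 / 2 <= (norm P)\<^sup>2 + (norm Q)\<^sup>2 - N" using N by (simp only: mult_le_cancel_left_pos)
  then show ?thesis by (simp add: N_def)
 qed
 define k where "k = rho1 / norm (T nu)"
 have k: "k > 0" using pos(4) T0 by (simp add: k_def)
 have w: "WE nu f f = rE + k * ((norm P)\<^sup>2 - A\<^sup>2)" "WE nu g g = rE + k * ((norm Q)\<^sup>2 - B\<^sup>2)"
  unfolding WE_diag Aq k_def P_def Q_def using f by simp_all
 have ge: "WE nu f f >= rE" "WE nu g g >= rE" using WE_ge[of f nu] WE_ge[of g nu] f by simp_all
 have target: "rE * rho1 / (4 * norm (T nu)) = rE * (k / 4)" by (simp add: k_def)
 consider "1 / 4 <= (norm P)\<^sup>2 - A\<^sup>2" | "1 / 4 <= (norm Q)\<^sup>2 - B\<^sup>2" using sum by linarith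
 then show ?thesis
 proof cases
  case 1
  then have "k * (1 / 4) <= k * ((norm P)\<^sup>2 - A\<^sup>2)" using k by (intro mult_left_mono) auto
  then have "k / 4 <= WE nu f f" unfolding w using pos(3) by simp
  then have "k / 4 * rE <= WE nu f f * WE nu g g" using ge pos(3) k by (intro mult_mono) auto
  then show ?thesis unfolding target by (simp add: mult.commute)
 next
  case 2
  then have "k * (1 / 4) <= k * ((norm Q)\<^sup>2 - B\<^sup>2)" using k by (intro mult_left_mono) auto
  then have "k / 4 <= WE nu g g" unfolding w using pos(3) by simp
  then have "rE * (k / 4) <= WE nu f f * WE nu g g" using ge pos(3) k by (intro mult_mono) auto
  then show ?thesis unfolding target .
 qed
qed

text \<open>Away from the south pole the gap is at least c1 and products of radii are at least rE^2.
  Near it the gap is comparable to |T nu| and products are at least of order 1 / |T nu|. In both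
  cases 1 / Y is bounded by a constant times D, and \<open>pair_amgm\<close> applies.\<close>

lemma WE_pair_sum:
 fixes f :: "'n => (real^'n) \<times> real"
 assumes nu: "norm nu = 1" and f: "!!i. norm (f i) = 1" "!!i j. i ~= j ==> f i \<bullet> f j = 0" "!!i. nu \<bullet> f i = 0"
  and b: "!!i. b i > 0" and D: "gap nu <= D"
 shows "(\<Sum>i\<in>UNIV. pair_weight b i * WE nu (f i) (f i)) >= 8 * pair_sum b - CE * D"
proof -
 have w: "WE nu (f i) (f i) >= rE" for i using WE_ge[of "f i" nu] f by simp
 have n1: "norm (fst nu) + \<bar>snd nu\<bar> >= 1" using norm_le_parts[of nu] nu by simp
 have "nu ~= 0" using nu by auto
 then have D0: "D > 0" and T0: "norm (T nu) > 0" using gap_pos[OF \<open>nu ~= 0\<close>] D T_nonzero[OF \<open>nu ~= 0\<close>] by auto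
 have "\<exists>Y>0. 1 / Y <= (1 / (rE\<^sup>2 * c1) + 16 / (rho0 * rE * rho1)) * D & (\<forall>i j. i ~= j --> Y <= WE nu (f i) (f i) * WE nu (f j) (f j))"
 proof (cases "snd nu < 0 & norm (fst nu) <= \<bar>snd nu\<bar>")
  case True
  have "rho0 / 4 * norm (T nu) <= rho0 / 4 * (norm (fst nu) + kp * \<bar>snd nu\<bar>)" using rho0 by (intro mult_left_mono norm_T_le) auto
  also have "... = gap nu" using True rho0 by (simp add: gap_def kp_def rho1_def field_simps)
  finally have TD: "norm (T nu) <= 4 / rho0 * D" using D rho0 by (simp add: field_simps)
  show ?thesis
  proof (intro exI[of _ "rE * rho1 / (4 * norm (T nu))"] conjI allI impI)
   show "rE * rho1 / (4 * norm (T nu)) > 0" using pos T0 by simp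
   have "1 / (rE * rho1 / (4 * norm (T nu))) = 4 / (rE * rho1) * norm (T nu)" by simp
   also have "... <= 4 / (rE * rho1) * (4 / rho0 * D)" using TD pos by (intro mult_left_mono) auto
   also have "... = 16 / (rho0 * rE * rho1) * D" by (simp add: mult_ac)
   also have "... <= (1 / (rE\<^sup>2 * c1) + 16 / (rho0 * rE * rho1)) * D" using D0 pos by (intro mult_right_mono) auto
   finally show "1 / (rE * rho1 / (4 * norm (T nu))) <= (1 / (rE\<^sup>2 * c1) + 16 / (rho0 * rE * rho1)) * D" .
   fix i j :: 'n assume ij: "i ~= j"
   show "rE * rho1 / (4 * norm (T nu)) <= WE nu (f i) (f i) * WE nu (f j) (f j)"
    using True f(2)[OF ij] by (intro south_pair nu f(1,3)) auto
  qed
 next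
  case False
  have "c1 <= D"
  proof (cases "snd nu >= 0")
   case True
   have "c1 * 1 <= c1 * (norm (fst nu) + \<bar>snd nu\<bar>)" using n1 pos(6) by (intro mult_left_mono) auto
   also have "... <= rho0 / 4 * norm (fst nu) + th * H0 / 4 * \<bar>snd nu\<bar>"
    unfolding distrib_left using rho0 by (intro add_mono mult_right_mono) (auto simp: c1_def)
   also have "... = gap nu" using True by (simp add: gap_def)
   finally show ?thesis using D by simp
  next
   case F: False
   then have "norm (fst nu) >= 1 / 2" using False n1 by linarith
   then have "rho0 / 4 * (1 / 2) <= rho0 / 4 * norm (fst nu)" using rho0 by (intro mult_left_mono) auto
   moreover have "dl / 2 * snd nu <= 0" using F dl0 by (simp add: mult_nonneg_nonpos)
   moreover have "c1 <= rho0 / 8" by (simp add: c1_def)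
   ultimately show ?thesis using D F unfolding gap_def by simp
  qed
  show ?thesis
  proof (intro exI[of _ "rE\<^sup>2"] conjI allI impI)
   show "rE\<^sup>2 > 0" using pos(3) by simp
   have "1 / rE\<^sup>2 = 1 / (rE\<^sup>2 * c1) * c1" using pos(6) by simp
   also have "... <= 1 / (rE\<^sup>2 * c1) * D" using \<open>c1 <= D\<close> pos(3,6) by (intro mult_left_mono) auto
   also have "... <= (1 / (rE\<^sup>2 * c1) + 16 / (rho0 * rE * rho1)) * D" using D0 pos rho0 by (intro mult_right_mono) auto
   finally show "1 / rE\<^sup>2 <= (1 / (rE\<^sup>2 * c1) + 16 / (rho0 * rE * rho1)) * D" .
   show "rE\<^sup>2 <= WE nu (f i) (f i) * WE nu (f j) (f j)" for i j
    unfolding power2_eq_square using w[of i] w[of j] pos(3) by (intro mult_mono) auto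
  qed
 qed
 then obtain Y where Y: "Y > 0" "1 / Y <= (1 / (rE\<^sup>2 * c1) + 16 / (rho0 * rE * rho1)) * D"
  "!!i j. i ~= j ==> Y <= WE nu (f i) (f i) * WE nu (f j) (f j)" by blast
 have "(\<Sum>i\<in>UNIV. pair_weight b i * WE nu (f i) (f i)) >= 8 * pair_sum b - (real CARD('n))\<^sup>2 / 2 * (128 / Y)"
 proof (rule pair_weight_sum)
  fix i j :: 'n assume ij: "i ~= j"
  have "WE nu (f i) (f i) > 0" "WE nu (f j) (f j) > 0" using w[of i] w[of j] pos(3) by linarith+
  then show "8 * (b i * b j) - 128 / Y <= b i * b j * (b i * WE nu (f i) (f i) + b j * WE nu (f j) (f j))"
   by (intro pair_amgm b Y(1) Y(3)[OF ij])
 qed (use Y in simp)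
 moreover have "(real CARD('n))\<^sup>2 / 2 * (128 / Y) <= CE * D"
 proof -
  have "64 * (real CARD('n))\<^sup>2 * (1 / Y) <= 64 * (real CARD('n))\<^sup>2 * ((1 / (rE\<^sup>2 * c1) + 16 / (rho0 * rE * rho1)) * D)"
   using Y(2) by (intro mult_left_mono) auto
  then show ?thesis by (simp add: CE_def mult.assoc)
 qed
 ultimately show ?thesis by linarith
qed

end

section \<open>The barrier\<close>

lemma norm_upper:
 fixes a v :: "'a::real_inner"
 assumes "a ~= 0"
 shows "norm (a + v) <= norm a + a \<bullet> v / norm a + (norm v)\<^sup>2 / (2 * norm a)"
proof -
 have m: "norm a > 0" using assms by simp
 have "0 <= (norm a - norm (a + v))\<^sup>2" by simp
 also have "(norm a - norm (a + v))\<^sup>2 = (norm a)\<^sup>2 + (norm (a + v))\<^sup>2 - 2 * (norm a * norm (a + v))"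
  by (simp add: power2_eq_square algebra_simps)
 also have "(norm (a + v))\<^sup>2 = (norm a)\<^sup>2 + 2 * (a \<bullet> v) + (norm v)\<^sup>2"
  by (simp add: power2_norm_eq_inner inner_add_left inner_add_right inner_commute)
 finally have "2 * (norm a * norm (a + v)) <= 2 * (norm a)\<^sup>2 + 2 * (a \<bullet> v) + (norm v)\<^sup>2" by simp
 then have "norm (a + v) <= (2 * (norm a)\<^sup>2 + 2 * (a \<bullet> v) + (norm v)\<^sup>2) / (2 * norm a)"
  using m by (simp add: pos_le_divide_eq mult_ac)
 also have "... = norm a + a \<bullet> v / norm a + (norm v)\<^sup>2 / (2 * norm a)"
  using m by (simp add: add_divide_distrib power2_eq_square)
 finally show ?thesis .
qed

text \<open>In the frame of \<open>L\<close> the form is diagonal with the principal curvatures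
  \<beta> i, so sigma_2 is their second symmetric function.\<close>

lemma hyp_speed_diagonal:
 fixes L :: "(real^'n) \<times> real => (real^'n) \<times> real" and \<beta> :: "'n => real"
 assumes L: "orthogonal_transformation L"
 defines "Q \<equiv> %u v. \<Sum>i\<in>UNIV. \<beta> i * ((u \<bullet> L (axis i 1, 0)) * (v \<bullet> L (axis i 1, 0)))"
 shows "bilinear Q" "Q u v = Q v u" "hyp_speed (L (0, 1)) Q = pair_sum \<beta>"
  "Q (L (x, y)) (L (x, y)) = (\<Sum>i\<in>UNIV. \<beta> i * (x $ i)\<^sup>2)"
proof -
 have Li: "L u \<bullet> L v = u \<bullet> v" for u v using L unfolding orthogonal_transformation_def by blast
 show Qb: "bilinear Q"
  unfolding Q_def by (rule bilinearI2) (simp_all add: inner_add_left sum.distrib sum_distrib_left algebra_simps)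
 show "Q u v = Q v u" unfolding Q_def by (simp add: mult.commute)
 have fx: "L (x, y) \<bullet> L (axis i 1, 0) = x $ i" for x y i by (simp add: Li inner_axis)
 show "Q (L (x, y)) (L (x, y)) = (\<Sum>i\<in>UNIV. \<beta> i * (x $ i)\<^sup>2)"
  by (simp add: Q_def fx power2_eq_square)
 define Q0 where "Q0 u v = (\<Sum>i\<in>UNIV. \<beta> i * (fst u $ i * fst v $ i))" for u v :: "(real^'n) \<times> real"
 have "Q (L u) (L v) = Q0 u v" for u v by (cases u, cases v) (simp add: Q_def Q0_def fx)
 then have "hyp_speed (L (0, 1)) Q = hyp_speed (0, 1) Q0"
  using hyp_speed_orthogonal[OF Qb L, of "(0, 1)"] by simp
 also have "... = pair_sum \<beta>"
 proof -
  have ax: "Q0 (axis i 1, 0) v = \<beta> i * fst v $ i" "Q0 v (axis i 1, 0) = \<beta> i * fst v $ i" for i v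
   by (simp_all add: Q0_def axis_def if_distrib[of "%x. x * _"] if_distrib[of "%x. _ * x"] cong: if_cong)
  have z: "Q0 (0, c) v = 0" "Q0 v (0, c) = 0" for c v by (simp_all add: Q0_def)
  have 1: "tangent_trace (0, 1) Q0 = (\<Sum>i\<in>UNIV. \<beta> i)"
   by (simp add: tangent_trace_def sum_Basis_prod ax z)
  have 2: "tangent_trace (0, 1) (%u v. Q0 u w * Q0 v z) = (\<Sum>i\<in>UNIV. (\<beta> i)\<^sup>2 * (fst w $ i * fst z $ i))" for w z
   by (simp add: tangent_trace_def sum_Basis_prod ax z power2_eq_square mult_ac)
  have 3: "tangent_trace (0 :: real^'n, 1 :: real) (%w z. \<Sum>i\<in>UNIV. (\<beta> i)\<^sup>2 * (fst w $ i * fst z $ i)) = (\<Sum>i\<in>UNIV. (\<beta> i)\<^sup>2)"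
   by (simp add: tangent_trace_def sum_Basis_prod axis_def if_distrib[of "%x. x * _"] if_distrib[of "%x. _ * x"] cong: if_cong)
  have "(\<Sum>i\<in>UNIV. \<beta> i)\<^sup>2 = (\<Sum>i\<in>UNIV. \<Sum>j\<in>UNIV. \<beta> i * \<beta> j)" by (simp add: power2_eq_square sum_product)
  also have "... = (\<Sum>i\<in>UNIV. (\<beta> i)\<^sup>2 + (\<Sum>j\<in>UNIV - {i}. \<beta> i * \<beta> j))"
  proof (intro sum.cong refl)
   fix i :: 'n
   show "(\<Sum>j\<in>UNIV. \<beta> i * \<beta> j) = (\<beta> i)\<^sup>2 + (\<Sum>j\<in>UNIV - {i}. \<beta> i * \<beta> j)"
    using sum.remove[of UNIV i "%j. \<beta> i * \<beta> j"] by (simp add: power2_eq_square)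
  qed
  finally have "(\<Sum>i\<in>UNIV. \<beta> i)\<^sup>2 = (\<Sum>i\<in>UNIV. (\<beta> i)\<^sup>2) + 2 * pair_sum \<beta>"
   by (simp add: sum.distrib pair_sum_def)
  then show ?thesis unfolding hyp_speed_def 2 3 1 by (simp add: norm_Pair)
 qed
 finally show "hyp_speed (L (0, 1)) Q = pair_sum \<beta>" .
qed

context scalar_flow
begin

text \<open>A point c off the surface lies in a bounded component exactly if the Borsuk map x -> (x
  - c) / |x - c| on the surface is essential. While the flow avoids c it is itself a homotopy
  between the Borsuk maps at times 0 and s1.\<close>

lemma inside_persist:
 assumes s1: "0 <= s1" "s1 < Tc" and o: "!!s. 0 <= s ==> s <= s1 ==> c \<notin> M s" and in0: "c \<in> inside (M 0)"
 shows "c \<in> inside (M s1)"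
proof -
 define B where "B x = inverse (norm (x - c)) *\<^sub>R (x - c)" for x
 have s1': "s1 \<in> {0..<Tc}" "0 \<in> {0..<Tc}" using s1 by auto
 have nz: "X p s ~= c" if "p \<in> S" "0 <= s" "s <= s1" for p s using o[OF that(2,3)] X_in_M[OF that(1), of s] by auto
 have nB: "B x \<in> sphere 0 1" if "x ~= c" for x using that by (simp add: B_def)
 have "\<not> (\<exists>a. homotopic_with_canon (%x. True) (M s1) (sphere 0 1) B (%x. a))"
 proof
  assume "\<exists>a. homotopic_with_canon (%x. True) (M s1) (sphere 0 1) B (%x. a)"
  then obtain a where "homotopic_with_canon (%x. True) (M s1) (sphere 0 1) B (%x. a)" by blast
  then have h1: "homotopic_with_canon (%x. True) S (sphere 0 1) (B \<circ> (%p. X p s1)) ((%x. a) \<circ> (%p. X p s1))"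
   using continuous_X_at[OF s1'(1)] X_in_M by (intro homotopic_with_compose_continuous_right) auto
  have h2: "homotopic_with_canon (%x. True) S (sphere 0 1) B (B \<circ> (%p. X p s1))"
  proof (subst homotopic_with)
   let ?h = "%x. B (X (snd x) (fst x * s1))"
   have r: "0 <= u * s1" "u * s1 <= s1" if "u \<in> {0..1}" for u using that s1 mult_right_mono[of u 1 s1] by auto
   have c1: "continuous_on ({0..1} \<times> S) (%x. X (snd x) (fst x * s1))"
   proof -
    have "continuous_on ({0..1} \<times> S) ((%(p, t). X p t) \<circ> (%x. (snd x, fst x * s1)))"
    proof (intro continuous_on_compose continuous_on_subset[OF continuous_X] continuous_intros)
     show "(%x. (snd x, fst x * s1)) ` ({0..1} \<times> S) \<subseteq> S \<times> {0..<Tc}"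
     proof
      fix q assume "q \<in> (%x. (snd x, fst x * s1)) ` ({0..1} \<times> S)"
      then obtain u p where "u \<in> {0..1}" "p \<in> S" "q = (p, u * s1)" by force
      then show "q \<in> S \<times> {0..<Tc}" using r[of u] s1 by auto
     qed
    qed
    then show ?thesis by (simp add: o_def)
   qed
   have ne: "X (snd x) (fst x * s1) ~= c" if "x \<in> {0..1} \<times> S" for x
    using that r[of "fst x"] by (intro nz) auto
   have "continuous_on ({0..1} \<times> S) ?h" unfolding B_def using c1 ne by (intro continuous_intros) auto
   moreover have "?h \<in> ({0..1} \<times> S) \<rightarrow> sphere 0 1" using nB ne by auto
   ultimately have "continuous_map (top_of_set ({0..1} \<times> S)) (top_of_set (sphere 0 1)) ?h"
    by (simp add: continuous_map_subtopology_eu)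
   then have "continuous_map (prod_topology (top_of_set {0..1}) (top_of_set S)) (top_of_set (sphere 0 1)) ?h"
    by (simp add: prod_topology_subtopology_eu)
   then show "\<exists>h. continuous_map (prod_topology (top_of_set {0..1::real}) (top_of_set S)) (top_of_set (sphere 0 1)) h &
     (\<forall>x\<in>topspace (top_of_set S). h (0, x) = B x) & (\<forall>x\<in>topspace (top_of_set S). h (1, x) = (B \<circ> (%p. X p s1)) x) &
     (\<forall>t\<in>{0..1::real}. True)"
    using X_0 by (intro exI[of _ ?h]) simp
  qed simp
  from homotopic_with_trans[OF h2 h1] have "homotopic_with_canon (%x. True) (M 0) (sphere 0 1) B (%x. a)"
   unfolding M_0 by (simp add: o_def)
  then have "\<not> bounded (connected_component_set (- M 0) c)"
   using Borsuk_map_essential_bounded_component[OF compact_M[OF s1'(2)] o[OF order_refl s1(1)]] unfolding B_def by blast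
  then show False using in0 by (simp add: inside_def)
 qed
 then have "bounded (connected_component_set (- M s1) c)"
  using Borsuk_map_essential_bounded_component[OF compact_M[OF s1'(1)] o[of s1]] s1 unfolding B_def by auto
 then show ?thesis using o[of s1] s1 by (simp add: inside_def)
qed

end

text \<open>\<open>start\<close> puts the barrier strictly inside at time 0, \<open>etT\<close>
  keeps the weight of the cap at most 1 / 2 up to T1, and \<open>rep\<close> lets
  \<open>averaged_heat\<close> run with om = ep.\<close>

locale barrier = smoothed_flow S X Tc r + cap rho0 H0 xs dl
 for S :: "((real^'n) \<times> real) set" and X and Tc r rho0 H0 :: real and xs :: "real^'n" and dl :: real +
 fixes K :: "((real^'n) \<times> real) set" and T1 mu :: real
 assumes K: "compact K" "convex K" "S = frontier K"
  and T1: "0 < T1" "T1 < Tc" and dlle: "dl <= th * H0 / 4"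
  and s1: "!!nu. rho0 * norm (fst nu) <= supp nu T1" and s2: "!!nu. xs \<bullet> fst nu + H0 * snd nu <= supp nu T1"
  and mu: "mu > 1" and etT: "2 * (1 - 1 / mu) * exp ((CE + 1) * T1) <= 1 / 2" and rep: "r <= (1 - 1 / mu) / 16"
  and start: "!!nu. norm nu = 1 ==> (1 - 2 * (1 - 1 / mu)) * Phi nu 1 0 + 2 * (1 - 1 / mu) * hE nu < supp nu 0"
begin

definition "ep = 1 - 1 / mu"
definition "kk = CE + 1"
definition "et s = 2 * ep * exp (kk * s)"
text \<open>The mollification scale norm nu keeps this sublinear in nu, so that \<open>Lt s\<close>,
  cut out by the corresponding half-spaces, behaves like a Minkowski combination.\<close>

definition "hL nu s = (1 - et s) * Phi nu (norm nu) (s / mu) + et s * hE nu"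
definition "Lt s = {z. \<forall>nu. norm nu = 1 --> z \<bullet> nu <= hL nu s}"

lemma ep: "0 < ep" "ep <= 1/4" "1 / mu = 1 - ep" and kk: "kk > 1"
proof -
 show "0 < ep" "1 / mu = 1 - ep" using mu by (auto simp: ep_def)
 show "kk > 1" using pos(7) by (simp add: kk_def)
 then have "1 <= exp (kk * T1)" using T1 by simp
 then have "2 * ep * 1 <= 2 * ep * exp (kk * T1)" using \<open>0 < ep\<close> by (intro mult_left_mono) auto
 then show "ep <= 1/4" using etT by (simp add: ep_def kk_def)
qed

lemma et: "s \<in> {0..T1} ==> 2 * ep <= et s" "s \<in> {0..T1} ==> et s <= 1/2" "et s > 0" "et 0 = 2 * ep"
proof -
 show "et s > 0" "et 0 = 2 * ep" using ep by (simp_all add: et_def)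
 assume s: "s \<in> {0..T1}"
 have "1 <= exp (kk * s)" using s kk by simp
 then have "2 * ep * 1 <= 2 * ep * exp (kk * s)" using ep by (intro mult_left_mono) auto
 then show "2 * ep <= et s" by (simp add: et_def)
 have "kk * s <= kk * T1" using s kk by simp
 then have "2 * ep * exp (kk * s) <= 2 * ep * exp (kk * T1)" using ep by (intro mult_left_mono) auto
 then show "et s <= 1/2" using etT by (simp add: ep_def kk_def et_def)
qed

lemma time: "s \<in> {0..T1} ==> s / mu \<in> {0..T1}" "s \<in> {0..T1} ==> s / mu \<in> {0..<Tc}" "s \<in> {0..T1} ==> s \<in> {0..<Tc}"
proof -
 assume s: "s \<in> {0..T1}"
 have "s / mu = s * (1 - ep)" using ep(3) by (simp add: divide_inverse)
 also have "... <= s * 1" using s ep by (intro mult_left_mono) auto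
 finally have "s / mu <= s" by simp
 moreover have "0 <= s / mu" using s mu by simp
 ultimately show "s / mu \<in> {0..T1}" "s / mu \<in> {0..<Tc}" "s \<in> {0..<Tc}" using s T1 by auto
qed

lemma gap_supp: "s \<in> {0..T1} ==> gap nu <= supp nu s - hE nu"
proof -
 assume s: "s \<in> {0..T1}"
 then have a: "supp nu T1 <= supp nu s" using T1 by (intro supp_antimono) auto
 show ?thesis by (rule gap_le[OF dlle]) (use a s1[of nu] s2[of nu] in linarith)+
qed

lemma hE_le_supp: "s \<in> {0..T1} ==> hE nu <= supp nu s"
 using gap_supp[of s nu] gap_pos[of nu] supp_scale[OF time(3), of s 0 nu] by (cases "nu = 0") (simp_all add: hE_def T_def zero_prod_def)

lemma hL_scale: "s \<in> {0..T1} ==> c >= 0 ==> hL (c *\<^sub>R nu) s = c * hL nu s"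
 using Phi_scale[OF time(2), of s c nu "norm nu"] by (simp add: hL_def hE_scale algebra_simps)

lemma hL_strict:
 assumes s: "s \<in> {0..T1}"
 shows "hL (a + b) s + et s * (rE * (norm a + norm b - norm (a + b))) <= hL a s + hL b s"
proof -
 note t = time(2)[OF s]
 have "Phi (a + b) (norm (a + b)) (s / mu) <= Phi (a + b) (norm a + norm b) (s / mu)"
  by (rule Phi_mono[OF t norm_ge_zero norm_triangle_ineq])
 also have "... <= Phi a (norm a) (s / mu) + Phi b (norm b) (s / mu)" by (rule Phi_add[OF t])
 finally have "(1 - et s) * Phi (a + b) (norm (a + b)) (s / mu) <= (1 - et s) * (Phi a (norm a) (s / mu) + Phi b (norm b) (s / mu))"
  using et(2)[OF s] by (intro mult_left_mono) auto
 moreover have "et s * (hE (a + b) + rE * (norm a + norm b - norm (a + b))) <= et s * (hE a + hE b)"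
  using et(3)[of s] by (intro mult_left_mono hE_strict) auto
 ultimately show ?thesis by (simp add: hL_def distrib_left)
qed

lemma LtD: "z \<in> Lt s ==> norm nu = 1 ==> z \<bullet> nu <= hL nu s"
 unfolding Lt_def by blast

lemma Lt_all: "z \<in> Lt s ==> s \<in> {0..T1} ==> z \<bullet> nu <= hL nu s"
proof -
 assume z: "z \<in> Lt s" and s: "s \<in> {0..T1}"
 show ?thesis
 proof (cases "nu = 0")
  case True
  then show ?thesis using hL_scale[OF s, of 0 nu] by simp
 next
  case False
  have "z \<bullet> sgn nu <= hL (sgn nu) s" using LtD[OF z, of "sgn nu"] False by (simp add: norm_sgn)
  then have "norm nu * (z \<bullet> sgn nu) <= norm nu * hL (sgn nu) s" by (intro mult_left_mono) auto
  also have "norm nu * hL (sgn nu) s = hL (norm nu *\<^sub>R sgn nu) s" using hL_scale[OF s, of "norm nu" "sgn nu"] by simp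
  finally have "z \<bullet> (norm nu *\<^sub>R sgn nu) <= hL (norm nu *\<^sub>R sgn nu) s" by simp
  moreover have "norm nu *\<^sub>R sgn nu = nu" using False by (simp add: sgn_div_norm)
  ultimately show ?thesis by simp
 qed
qed

lemma continuous_hL: "continuous_on (UNIV \<times> {0..T1}) (%x. hL (fst x) (snd x))"
proof -
 have "continuous_on (UNIV \<times> {0..T1}) ((%(nu, N, t). Phi nu N t) \<circ> (%x. (fst x, norm (fst x), snd x / mu)))"
 proof (intro continuous_on_compose continuous_on_subset[OF continuous_Phi] continuous_intros)
  show "(%x. (fst x, norm (fst x), snd x / mu)) ` (UNIV \<times> {0..T1}) \<subseteq> UNIV \<times> UNIV \<times> {0..<Tc}"
  proof
   fix q assume "q \<in> (%x. (fst x, norm (fst x), snd x / mu)) ` (UNIV \<times> {0..T1})"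
   then obtain x where "snd x \<in> {0..T1}" "q = (fst x, norm (fst x), snd x / mu)" by force
   then show "q \<in> UNIV \<times> UNIV \<times> {0..<Tc}" using time(2)[of "snd x"] by simp
  qed
 qed (use mu in simp)
 then have "continuous_on (UNIV \<times> {0..T1}) (%x. Phi (fst x) (norm (fst x)) (snd x / mu))" by (simp add: o_def)
 then show ?thesis unfolding hL_def et_def by (intro continuous_intros continuous_hE)
qed

text \<open>Constraints that are strict on a compact set of normals survive small changes of point
  and time. This disposes of all normals away from the contact normal.\<close>

lemma far:
 assumes Kf: "compact Kf" and sc: "sc \<in> {0..T1}" and lt: "!!nu. nu \<in> Kf ==> norm nu = 1 & z \<bullet> nu < hL nu sc"
 obtains e where "e > 0" "!!(zt :: (real^'n) \<times> real) s nu. norm zt < e ==> \<bar>s - sc\<bar> < e ==> s \<in> {0..T1} ==> nu \<in> Kf ==> (z + zt) \<bullet> nu <= hL nu s"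
proof (cases "Kf = {}")
 case True
 then show thesis using that[of 1] by simp
next
 case False
 have c: "continuous_on (Kf \<times> {0..T1}) (%x. hL (fst x) (snd x))" by (rule continuous_on_subset[OF continuous_hL]) auto
 have "continuous_on Kf ((%x. hL (fst x) (snd x)) \<circ> (%nu. (nu, sc)))"
  using sc by (intro continuous_on_compose continuous_on_subset[OF c] continuous_intros) auto
 then have "continuous_on Kf (%nu. hL nu sc)" by (simp add: o_def)
 then have "continuous_on Kf (%nu. hL nu sc - z \<bullet> nu)" by (intro continuous_intros)
 from continuous_attains_inf[OF Kf False this] obtain nu1 where
  n1: "nu1 \<in> Kf" "\<forall>nu\<in>Kf. hL nu1 sc - z \<bullet> nu1 <= hL nu sc - z \<bullet> nu" by blast
 define m where "m = hL nu1 sc - z \<bullet> nu1"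
 have m: "m > 0" "!!nu. nu \<in> Kf ==> m <= hL nu sc - z \<bullet> nu" using n1 lt[of nu1] by (auto simp: m_def)
 have "uniformly_continuous_on (Kf \<times> {0..T1}) (%x. hL (fst x) (snd x))"
  by (rule compact_uniformly_continuous[OF c]) (intro compact_Times Kf compact_Icc)
 then obtain d where d: "d > 0" "!!x x'. x \<in> Kf \<times> {0..T1} ==> x' \<in> Kf \<times> {0..T1} ==> dist x' x < d ==>
   dist (hL (fst x') (snd x')) (hL (fst x) (snd x)) < m / 2"
  using m(1) unfolding uniformly_continuous_on_def by (metis half_gt_zero)
 show thesis
 proof (rule that[of "min d (m / 2)"])
  show "min d (m / 2) > 0" using d m by simp
  fix zt nu :: "(real^'n) \<times> real" and s assume a: "norm zt < min d (m / 2)" "\<bar>s - sc\<bar> < min d (m / 2)" "s \<in> {0..T1}" "nu \<in> Kf"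
  have "dist (nu, s) (nu, sc) < d" using a by (simp add: dist_Pair_Pair dist_real_def)
  then have "dist (hL nu s) (hL nu sc) < m / 2" using d(2)[of "(nu, sc)" "(nu, s)"] a sc by simp
  then have 1: "hL nu s > hL nu sc - m / 2" unfolding dist_real_def by linarith
  have "zt \<bullet> nu <= norm zt * norm nu" by (rule norm_cauchy_schwarz)
  then have "zt \<bullet> nu < m / 2" using a lt[OF a(4)] by simp
  then show "(z + zt) \<bullet> nu <= hL nu s" using 1 m(2)[OF a(4)] unfolding inner_add_left by linarith
 qed
qed

lemma far_ex:
 assumes "compact Kf" "sc \<in> {0..T1}" "!!nu. nu \<in> Kf ==> norm nu = 1 & z \<bullet> nu < hL nu sc"
 shows "\<exists>e>0. \<forall>(zt :: (real^'n) \<times> real) s nu. norm zt < e --> \<bar>s - sc\<bar> < e --> s \<in> {0..T1} --> nu \<in> Kf --> (z + zt) \<bullet> nu <= hL nu s"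
proof (rule far[OF assms], goal_cases)
 case (2 e)
 show ?case
 proof (intro exI[of _ e] conjI allI impI)
  show "0 < e" by (rule 2(1))
 qed (rule 2(2))
qed

lemma combination_in_Lt:
 assumes s: "s \<in> {0..T1}" and z1: "!!nu. z1 \<bullet> nu <= supp nu (s / mu)" and z2: "!!nu. z2 \<bullet> nu <= hE nu"
 shows "(1 - et s) *\<^sub>R z1 + et s *\<^sub>R z2 \<in> Lt s"
 unfolding Lt_def
proof (intro CollectI allI impI)
 fix nu :: "(real^'n) \<times> real"
 have "z1 \<bullet> nu <= Phi nu (norm nu) (s / mu)" using z1[of nu] Phi_ge[OF time(2)[OF s] norm_ge_zero, of nu nu] by linarith
 then have "(1 - et s) * (z1 \<bullet> nu) + et s * (z2 \<bullet> nu) <= hL nu s"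
  unfolding hL_def using et(2)[OF s] et(3)[of s] by (intro add_mono mult_left_mono z2) auto
 then show "((1 - et s) *\<^sub>R z1 + et s *\<^sub>R z2) \<bullet> nu <= hL nu s" by (simp add: inner_add_left)
qed

definition "cen = (0 :: real^'n, rE + dl)"

lemma cen_le: "cen \<bullet> nu <= hE nu"
proof -
 have "cen \<bullet> nu = (rE + dl) * snd nu" by (simp add: cen_def inner_prod_def)
 moreover have "rE * norm nu >= 0" using pos(3) by simp
 ultimately show ?thesis using hE_ge(1)[of nu] by linarith
qed

lemma cen_in_Lt: "s \<in> {0..T1} ==> cen \<in> Lt s"
proof -
 assume s: "s \<in> {0..T1}"
 have "(1 - et s) *\<^sub>R cen + et s *\<^sub>R cen \<in> Lt s"
  using order_trans[OF cen_le hE_le_supp[OF time(1)[OF s]]] cen_le by (intro combination_in_Lt[OF s])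
 then show ?thesis by (simp add: scaleR_add_left[symmetric])
qed

text \<open>By \<open>start\<close> and compactness the constraints at time 0 lie below the support
  function of K with a uniform margin m; by separation each point of \<open>Lt 0\<close> has a ball
  of radius m in K.\<close>

lemma Lt_0_interior: "Lt 0 \<subseteq> interior K"
proof
 fix z assume z: "z \<in> Lt 0"
 have z0: "0 \<in> {0..T1}" "0 \<in> {0..<Tc}" using T1 by auto
 have inK: "z \<in> K" if "!!nu. norm nu = 1 ==> z \<bullet> nu < supp nu 0" for z
 proof (rule ccontr)
  assume "z \<notin> K"
  with separating_hyperplane_closed_point[OF K(2) compact_imp_closed[OF K(1)]]
  obtain a b where ab: "a \<bullet> z < b" "\<forall>x\<in>K. a \<bullet> x > b" by blast
  obtain p where p: "p \<in> S" "supp (- sgn a) 0 = X p 0 \<bullet> (- sgn a)" using supp_attained[OF z0(2)] by blast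
  have "p \<in> K" using p(1) K by (simp add: frontier_def compact_imp_closed)
  then have lt: "a \<bullet> z < a \<bullet> p" using ab by force
  then have "a ~= 0" by auto
  then have "z \<bullet> (- sgn a) < p \<bullet> (- sgn a)" using that[of "- sgn a"] p X_0[OF p(1)] by (simp add: norm_sgn)
  then have "inverse (norm a) * (a \<bullet> p) < inverse (norm a) * (a \<bullet> z)" by (simp add: sgn_div_norm inner_commute)
  then show False using lt \<open>a ~= 0\<close> by (simp add: mult_less_cancel_left_pos)
 qed
 let ?Sp = "sphere (0 :: (real^'n) \<times> real) 1"
 have "continuous_on ?Sp ((%x. hL (fst x) (snd x)) \<circ> (%nu. (nu, 0)))"
  using z0 by (intro continuous_on_compose continuous_on_subset[OF continuous_hL] continuous_intros) auto
 then have "continuous_on ?Sp (%nu. supp nu 0 - hL nu 0)" unfolding o_def using z0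
  by (intro continuous_intros continuous_h) (auto simp: o_def)
 moreover have "compact ?Sp" "?Sp ~= {}" by auto
 ultimately obtain nu1 where n1: "nu1 \<in> ?Sp" "\<forall>nu\<in>?Sp. supp nu1 0 - hL nu1 0 <= supp nu 0 - hL nu 0"
  using continuous_attains_inf by blast
 define m where "m = supp nu1 0 - hL nu1 0"
 have m0: "m > 0" using start[of nu1] n1(1) et(4) by (simp add: m_def hL_def ep_def)
 have "ball z m \<subseteq> K"
 proof
  fix w assume w: "w \<in> ball z m"
  show "w \<in> K"
  proof (rule inK)
   fix nu :: "(real^'n) \<times> real" assume nu: "norm nu = 1"
   have "(w - z) \<bullet> nu <= norm (w - z) * norm nu" by (rule norm_cauchy_schwarz)
   then have "(w - z) \<bullet> nu < m" using w nu by (simp add: dist_norm norm_minus_commute)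
   moreover have "z \<bullet> nu <= hL nu 0" by (rule LtD[OF z nu])
   moreover have "m <= supp nu 0 - hL nu 0" using n1(2) nu by (simp add: m_def)
   ultimately show "w \<bullet> nu < supp nu 0" unfolding inner_diff_left by linarith
  qed
 qed
 then show "z \<in> interior K" using m0 by (intro interiorI[of "ball z m"]) auto
qed

lemma Lt_convex: "convex (Lt s)"
proof -
 have "Lt s = (\<Inter>nu\<in>{nu. norm nu = 1}. {z. nu \<bullet> z <= hL nu s})" by (auto simp: Lt_def inner_commute)
 then show ?thesis by (simp add: convex_INT convex_halfspace_le)
qed

text \<open>The centre \<open>cen\<close> of the cap is inside at time 0 and never crossed;
  \<open>Lt s\<close> is convex, contains it and misses \<open>M s\<close>, so it lies in the same
  component.\<close>

lemma Lt_inside: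
 assumes s: "s \<in> {0..T1}" and free: "!!s'. s' \<in> {0..s} ==> Lt s' \<inter> M s' = {}"
 shows "Lt s \<subseteq> inside (M s)"
proof -
 have z0: "0 \<in> {0..T1}" using T1 by auto
 have "interior K = inside (M 0)"
  using inside_frontier_eq_interior[OF compact_imp_bounded[OF K(1)] K(2)] M_0 K(3) by metis
 then have "cen \<in> inside (M 0)" using cen_in_Lt[OF z0] Lt_0_interior by auto
 then have c: "cen \<in> inside (M s)"
 proof (rule inside_persist[rotated 3])
  fix s' assume "0 <= s'" "s' <= s"
  then show "cen \<notin> M s'" using free[of s'] cen_in_Lt[of s'] s by auto
 qed (use s T1 in auto)
 have "Lt s \<subseteq> - M s" using free[of s] s by auto
 then have "Lt s \<subseteq> connected_component_set (- M s) cen"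
  using cen_in_Lt[OF s] convex_connected[OF Lt_convex] by (intro connected_component_maximal)
 moreover have "connected_component_set (- M s) cen \<subseteq> inside (M s)"
  using c by (metis inside_same_component mem_Collect_eq subsetI)
 ultimately show ?thesis by blast
qed

text \<open>Near the contact normal the barrier has a quadratic lower bound in p; its Legendre
  transform is a paraboloid whose positive side lies in the barrier, as \<open>flow_sub\<close>
  requires. That paraboloid retreats at speed \<Lambda> = P + e0 D0 / 4, while its sigma_2 exceeds P
  only by the smaller loss conceded through e3.\<close>

lemma contact:
 assumes sc: "0 < sc" "sc <= T1" and z0: "z0 \<in> M sc" "z0 \<in> Lt sc" and nu0: "norm nu0 = 1" "z0 \<bullet> nu0 = hL nu0 sc"
  and before: "!!s. 0 <= s ==> s < sc ==> Lt s \<subseteq> inside (M s)"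
 shows False
proof -
 have sT: "sc \<in> {0..T1}" using sc by simp
 define sg where "sg = sc / mu"
 define e0 where "e0 = et sc"
 have e0: "0 < e0" "e0 <= 1/2" "2 * ep <= e0" using et(1,2)[OF sT] et(3)[of sc] by (simp_all add: e0_def)
 have sg: "0 < sg" "sg < Tc" "sg \<in> {0..T1}" "sg \<in> {0..<Tc}"
  using time(1,2)[OF sT] sc mu by (auto simp: sg_def)
 have nz: "nu0 ~= 0" using nu0 by auto
 \<comment> \<open>Two contact normals would saturate the constraints at both summands, so the one
   at their sum would violate \<open>hL_strict\<close>.\<close>
 have uniq: "z0 \<bullet> nu < hL nu sc" if nu: "norm nu = 1" "nu ~= nu0" for nu
 proof (rule ccontr)
  assume "\<not> ?thesis"
  then have eq: "z0 \<bullet> nu = hL nu sc" using Lt_all[OF z0(2) sT, of nu] by simp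
  have "hL (nu0 + nu) sc + e0 * (rE * (norm nu0 + norm nu - norm (nu0 + nu))) <= z0 \<bullet> nu0 + z0 \<bullet> nu"
   using hL_strict[OF sT, of nu0 nu] unfolding eq nu0(2) e0_def .
  moreover have "z0 \<bullet> nu0 + z0 \<bullet> nu <= hL (nu0 + nu) sc" using Lt_all[OF z0(2) sT, of "nu0 + nu"] by (simp add: inner_add_right)
  ultimately have "e0 * (rE * (2 - norm (nu0 + nu))) <= 0" using nu0 nu by simp
  then have "rE * (2 - norm (nu0 + nu)) <= 0" using e0(1) by (simp add: mult_le_0_iff)
  then have "2 <= norm (nu0 + nu)" using pos(3) by (simp add: mult_le_0_iff)
  have one: "nu0 \<bullet> nu0 = 1" "nu \<bullet> nu = 1" using nu0 nu by (simp_all add: dot_square_norm)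
  from \<open>2 <= norm (nu0 + nu)\<close> have "2\<^sup>2 <= (norm (nu0 + nu))\<^sup>2" by (intro power_mono) auto
  also have "(norm (nu0 + nu))\<^sup>2 = 2 + 2 * (nu0 \<bullet> nu)"
   using one unfolding power2_norm_eq_inner by (simp add: inner_add_left inner_add_right inner_commute)
  finally have "1 <= nu0 \<bullet> nu" by simp
  moreover have "(norm (nu - nu0))\<^sup>2 = 2 - 2 * (nu0 \<bullet> nu)"
   using one unfolding power2_norm_eq_inner by (simp add: inner_diff_left inner_diff_right inner_commute)
  ultimately have "(norm (nu - nu0))\<^sup>2 <= 0" by simp
  then show False using nu by simp
 qed
 define W where "W xi eta = (1 - e0) * d2G nu0 sg xi eta + e0 * WE nu0 xi eta" for xi eta
 note bG = d2G_bilinear[OF sg(4), of nu0] and bE = WE_bilinear[of nu0]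
 have Wb: "bilinear W"
  unfolding W_def by (rule bilinearI2) (simp_all add: bilinear_simps[OF bG] bilinear_simps[OF bE] algebra_simps)
 have Ws: "W u v = W v u" for u v unfolding W_def d2G_sym[of nu0 sg u v] WE_sym[of nu0 u v] ..
 \<comment> \<open>The frame diagonalises the Hessian of the barrier, not that of the flow or of the
   cap separately. The \<open>b i\<close> below are the principal curvatures of the barrier, and the
   tangent-plane inequality for the flow is taken at this matrix.\<close>
 obtain L :: "(real^'n) \<times> real => (real^'n) \<times> real" where L: "orthogonal_transformation L" "L (0, -1) = nu0"
  "!!i j. i ~= j ==> W (L (axis i 1, 0)) (L (axis j 1, 0)) = 0"
  using diagonalizing_frame[OF Wb Ws nu0(1)] by blast
 interpret L: linear L using L by (simp add: orthogonal_transformation_def)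
 have Li: "L u \<bullet> L v = u \<bullet> v" for u v using L(1) unfolding orthogonal_transformation_def by blast
 have Ln: "norm (L u) = norm u" for u using L(1) by (rule orthogonal_transformation_norm)
 define f where "f i = L (axis i 1, 0)" for i :: 'n
 have f: "norm (f i) = 1" "i ~= j ==> f i \<bullet> f j = 0" "nu0 \<bullet> f i = 0" for i j
 proof -
  show "norm (f i) = 1" by (simp add: f_def Ln norm_Pair)
  show "i ~= j ==> f i \<bullet> f j = 0" by (simp add: f_def Li inner_axis_axis)
  show "nu0 \<bullet> f i = 0" unfolding L(2)[symmetric] f_def Li by simp
 qed
 define w where "w i = W (f i) (f i)" for i
 have nu32: "norm nu0 <= 3/2" using nu0 by simp
 have w: "w i >= e0 * rE" for i
 proof -
  have "(1 - e0) * d2G nu0 sg (f i) (f i) >= 0" using d2G_nonneg[OF sg(4) nu32] e0 by (intro mult_nonneg_nonneg) auto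
  moreover have "e0 * rE <= e0 * WE nu0 (f i) (f i)" using WE_ge[of "f i" nu0] f(1)[of i] e0 by (intro mult_left_mono) auto
  ultimately show ?thesis by (simp add: w_def W_def)
 qed
 have erpos: "e0 * rE > 0" using e0 pos(3) by simp
 have w0: "w i > 0" for i using w[of i] erpos by linarith
 define b where "b i = 1 / w i" for i
 have b: "b i > 0" for i using w0[of i] by (simp add: b_def)
 define P where "P = pair_sum b"
 have P: "P > 0" unfolding P_def by (rule pair_pos(2)[where b = b, OF b dim2])
 \<comment> \<open>Euler's relation for a function homogeneous of degree -2.\<close>
 have sumw: "(\<Sum>i\<in>UNIV. pair_weight b i * w i) = 2 * P"
 proof -
  have "pair_weight b i * w i = (\<Sum>j\<in>UNIV - {i}. b i * b j)" for i
  proof -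
   have "b i * w i = 1" using w0[of i] by (simp add: b_def)
   then have "pair_weight b i * w i = b i * (\<Sum>j\<in>UNIV - {i}. b j)" unfolding pair_weight_def power2_eq_square
    by (metis (no_types, opaque_lifting) mult.assoc mult.commute mult.right_neutral)
   then show ?thesis by (simp add: sum_distrib_left)
  qed
  then show ?thesis by (simp add: P_def pair_sum_def)
 qed
 define g2 where "g2 = (\<Sum>i\<in>UNIV. pair_weight b i * d2G nu0 sg (f i) (f i))"
 define wE where "wE = (\<Sum>i\<in>UNIV. pair_weight b i * WE nu0 (f i) (f i))"
 have comb: "(1 - e0) * g2 + e0 * wE = 2 * P"
  unfolding sumw[symmetric] g2_def wE_def sum_distrib_left sum.distrib[symmetric] w_def W_def
  by (intro sum.cong refl) (simp add: algebra_simps)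
 define D0 where "D0 = Phi nu0 1 sg - hE nu0"
 have gapD: "gap nu0 <= D0"
  using gap_supp[OF sg(3), of nu0] Phi_ge[OF sg(4), of 1 nu0] by (simp add: D0_def)
 have D0: "D0 > 0" using gap_pos[OF nz] gapD by linarith
 have wEge: "wE >= 8 * P - CE * D0"
  unfolding wE_def P_def by (rule WE_pair_sum[OF nu0(1) f b gapD])
 \<comment> \<open>The growth of \<open>et\<close> yields an excess e0 D0 / 2 over the error e0 CE
   D0: half is spent on the slack of \<open>averaged_heat\<close>, the other half stays in
   \<Lambda>.\<close>
 define dl2 where "dl2 = e0 * D0 / 4"
 have dl2: "dl2 > 0" using e0 D0 by (simp add: dl2_def)
 define \<Lambda> where "\<Lambda> = P + e0 * D0 / 4"
 have ep1: "ep < 1" using ep by simp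
 have rep': "r <= ep / 16" using rep by (simp add: ep_def)
 note ah = averaged_heat[where b = b, OF L(1) b ep(1) ep1 rep' sg(1,2) dl2, folded f_def, unfolded L(2), folded g2_def P_def]
 from ah obtain rhoa where rhoa: "rhoa > 0" "!!p tau. norm p < rhoa ==> 0 < tau ==> tau < rhoa ==>
   G (L (p, -1)) sg <= G (L (p, -1)) (sg - tau) + tau * ((1 - ep) * (g2 - 3 * P) + dl2)" by blast
 \<comment> \<open>From (1 - e0) g2 = 2 P - e0 wE and wE >= 8 P - CE D0 follows (1 - e0) (g2 - 3 P)
   <= - (1 + 5 e0) P + e0 CE D0. The two factors 1 - ep, from the slowed time and from
   \<open>averaged_heat\<close>, are absorbed by 5 e0 >= 10 ep.\<close>
 have rate: "(1 - e0) * ((1 - ep) * t * ((1 - ep) * (g2 - 3 * P) + dl2)) <= t * (- P + e0 * CE * D0 + dl2)" if t: "t >= 0" for t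
 proof -
  define A where "A = (1 - e0) * (g2 - 3 * P)"
  have "e0 * (8 * P - CE * D0) <= e0 * wE" using wEge e0 by (intro mult_left_mono) auto
  then have A: "A <= - ((1 + 5 * e0) * P) + e0 * CE * D0"
   using comb unfolding A_def by (simp add: algebra_simps)
  have q: "0 <= (1 - ep)\<^sup>2" "(1 - ep)\<^sup>2 <= 1" using ep by (auto simp: power_le_one)
  have "(1 - ep)\<^sup>2 * A <= (1 - ep)\<^sup>2 * (- ((1 + 5 * e0) * P) + e0 * CE * D0)" using A q by (intro mult_left_mono)
  moreover have "(1 - ep)\<^sup>2 * (e0 * CE * D0) <= 1 * (e0 * CE * D0)"
   using q e0 pos(7) D0 by (intro mult_right_mono) auto
  moreover have "1 * P <= (1 - ep)\<^sup>2 * (1 + 5 * e0) * P"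
  proof (intro mult_right_mono)
   have "ep * ep <= ep * (1/4)" using ep by (intro mult_left_mono) auto
   moreover have "ep * (ep * ep) >= 0" using ep by simp
   moreover have "(1 - ep)\<^sup>2 * (1 + 10 * ep) = 1 + 8 * ep - 19 * (ep * ep) + 10 * (ep * (ep * ep))"
    by (simp add: power2_eq_square algebra_simps)
   ultimately have "1 <= (1 - ep)\<^sup>2 * (1 + 10 * ep)" using ep by linarith
   also have "... <= (1 - ep)\<^sup>2 * (1 + 5 * e0)" using e0 by (intro mult_left_mono) auto
   finally show "1 <= (1 - ep)\<^sup>2 * (1 + 5 * e0)" .
  qed (use P in simp)
  moreover have "(1 - ep)\<^sup>2 * (- ((1 + 5 * e0) * P) + e0 * CE * D0) = - ((1 - ep)\<^sup>2 * (1 + 5 * e0) * P) + (1 - ep)\<^sup>2 * (e0 * CE * D0)"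
   by (simp add: algebra_simps)
  ultimately have 1: "(1 - ep)\<^sup>2 * A <= - P + e0 * CE * D0" by linarith
  have "(1 - e0) * (1 - ep) <= 1 * 1" using e0 ep by (intro mult_mono) auto
  then have 2: "(1 - e0) * (1 - ep) * dl2 <= 1 * dl2" using dl2 by (intro mult_right_mono) auto
  have "(1 - e0) * ((1 - ep) * t * ((1 - ep) * (g2 - 3 * P) + dl2)) = t * ((1 - ep)\<^sup>2 * A + (1 - e0) * (1 - ep) * dl2)"
   by (simp add: A_def power2_eq_square algebra_simps)
  also have "... <= t * (- P + e0 * CE * D0 + dl2)" using 1 2 t by (intro mult_left_mono) auto
  finally show ?thesis .
 qed
 \<comment> \<open>Curvatures raised by 1 + e3 give sigma_2 at most P + 3 e3 P, and 3 e3 P <= 3 e0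
   D0 / 16 is below the surplus in \<Lambda>. In return each \<open>w i\<close> may be lowered by 2
   e'.\<close>
 define e3 where "e3 = min 1 (e0 * D0 / (16 * P))"
 have e3: "0 < e3" "e3 <= 1" "16 * P * e3 <= e0 * D0" using e0 D0 P by (auto simp: e3_def min_def field_simps)
 define e' where "e' = e0 * rE * e3 / 4"
 have e': "e' > 0" using erpos e3 by (simp add: e'_def)
 define l where "l p = (1 - e0) * dG nu0 sg (L (p, 0)) + e0 * dE nu0 (L (p, 0))" for p
 have linL0: "linear (%p. L (p, 0))" by (rule linearI) (simp_all add: L.add[symmetric] L.scale[symmetric])
 have nup: "L (p, -1) = nu0 + L (p, 0)" for p unfolding L(2)[symmetric] by (simp add: L.add[symmetric])
 have np: "norm (L (p, 0)) = norm p" for p by (simp add: Ln norm_Pair)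
 have perp: "nu0 \<bullet> L (p, 0) = 0" for p unfolding L(2)[symmetric] Li by simp
 have nge1: "norm (L (p, -1)) >= 1" for p unfolding Ln using norm_snd_le[of "-1 :: real" p] by simp
 have WL: "W (L (p, 0)) (L (p, 0)) = (\<Sum>i\<in>UNIV. w i * (p $ i)\<^sup>2)" for p
 proof -
  have "(p, 0) = (\<Sum>i\<in>UNIV. p $ i *\<^sub>R (axis i 1, 0 :: real))"
   by (simp add: prod_eq_iff fst_sum snd_sum vec_eq_iff axis_def if_distrib[of "%x. _ * x"] cong: if_cong)
  then have "L (p, 0) = (\<Sum>i\<in>UNIV. p $ i *\<^sub>R f i)" by (simp only: L.sum L.scale f_def)
  then have "W (L (p, 0)) (L (p, 0)) = (\<Sum>i\<in>UNIV. \<Sum>j\<in>UNIV. p $ i * (p $ j * W (f j) (f i)))"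
   by (simp add: bilinear_sum_left[OF Wb] bilinear_sum_right[OF Wb] bilinear_simps[OF Wb] sum_distrib_left)
  also have "... = (\<Sum>i\<in>UNIV. \<Sum>j\<in>UNIV. if j = i then w i * (p $ i)\<^sup>2 else 0)"
  proof (intro sum.cong refl)
   fix i j :: 'n
   show "p $ i * (p $ j * W (f j) (f i)) = (if j = i then w i * (p $ i)\<^sup>2 else 0)"
    using L(3)[of j i] unfolding f_def[symmetric] by (simp add: w_def power2_eq_square)
  qed
  finally show ?thesis by simp
 qed
 obtain Kc where Kc: "Kc > 0" "!!xi. norm xi <= 1/2 ==>
   \<bar>G (nu0 + xi) sg - G nu0 sg - dG nu0 sg xi - d2G nu0 sg xi xi / 2\<bar> <= Kc * norm xi ^ 3"
 proof -
  have "compact {sg}" "{sg} \<subseteq> {0..<Tc}" using sg(4) by auto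
  from G_expansion[OF this] obtain Kc where "Kc > 0" "\<forall>nu t xi. norm nu <= 3 / 2 --> norm xi <= 1 / 2 --> t \<in> {sg} -->
    \<bar>G (nu + xi) t - G nu t - dG nu t xi - d2G nu t xi xi / 2\<bar> <= Kc * norm xi ^ 3" by blast
  then show thesis using nu32 by (intro that) blast+
 qed
 have hLc: "z0 \<bullet> nu0 = (1 - e0) * G nu0 sg + e0 * hE nu0"
  using nu0 by (simp add: hL_def G_def e0_def sg_def)
 \<comment> \<open>The point z0 obeys all constraints, with equality at nu0, and \<open>hL\<close>
   lies below its linear expansion plus Cu |p|^2. So the linear map z0 . L (p, 0) - l p is at most
   quadratic in p, hence zero.\<close>
 have grad: "z0 \<bullet> L (p, 0) = l p" for p
 proof -
  obtain B where B: "!!x y. \<bar>d2G nu0 sg x y\<bar> <= B * norm x * norm y" using bilinear_bounded[OF bG] by auto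
  define Cu where "Cu = \<bar>Phi 0 1 sg\<bar> + \<bar>B\<bar> + Kc + rho1 * (1 + kp)\<^sup>2 / norm (T nu0) + rE"
  have up: "z0 \<bullet> L (p, 0) - l p <= Cu * (norm p)\<^sup>2" if p: "norm p <= 1/2" for p
  proof -
   let ?x = "L (p, 0)" and ?n = "norm (L (p, -1))"
   have n1: "?n - 1 <= (norm p)\<^sup>2"
   proof -
    have "?n = sqrt ((norm p)\<^sup>2 + 1)" unfolding Ln by (simp add: norm_Pair)
    also have "... <= 1 + (norm p)\<^sup>2" by (intro real_le_lsqrt) (auto simp: power2_sum)
    finally show ?thesis by simp
   qed
   have "Phi (L (p, -1) + 0) (1 + (?n - 1)) sg <= Phi (L (p, -1)) 1 sg + Phi 0 (?n - 1) sg" by (rule Phi_add[OF sg(4)])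
   moreover have "Phi 0 (?n - 1) sg = (?n - 1) * Phi 0 1 sg"
    using Phi_scale[OF sg(4), of "?n - 1" 0 1] nge1[of p] by simp
   moreover have "(?n - 1) * Phi 0 1 sg <= (norm p)\<^sup>2 * \<bar>Phi 0 1 sg\<bar>"
    using n1 nge1[of p] by (intro order_trans[OF mult_left_mono[OF abs_ge_self] mult_right_mono]) auto
   ultimately have a1: "Phi (L (p, -1)) ?n sg <= G (L (p, -1)) sg + (norm p)\<^sup>2 * \<bar>Phi 0 1 sg\<bar>" by (simp add: G_def)
   have a2: "G (L (p, -1)) sg <= G nu0 sg + dG nu0 sg ?x + (norm p)\<^sup>2 * (\<bar>B\<bar> + Kc)"
   proof -
    have "G (L (p, -1)) sg <= G nu0 sg + dG nu0 sg ?x + d2G nu0 sg ?x ?x / 2 + Kc * norm p ^ 3"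
     using Kc(2)[of ?x] p unfolding np nup abs_le_iff by linarith
    moreover have "d2G nu0 sg ?x ?x <= \<bar>B\<bar> * (norm p)\<^sup>2"
    proof -
     have "\<bar>d2G nu0 sg ?x ?x\<bar> <= B * (norm p)\<^sup>2" using B[of ?x ?x] unfolding np by (simp add: power2_eq_square mult.assoc)
     also have "... <= \<bar>B\<bar> * (norm p)\<^sup>2" by (intro mult_right_mono) auto
     finally show ?thesis by linarith
    qed
    moreover have "Kc * norm p ^ 3 <= Kc * (1 * (norm p)\<^sup>2)"
     unfolding power3_eq_cube power2_eq_square mult.assoc using p Kc(1) by (intro mult_left_mono mult_right_mono) auto
    moreover have "\<bar>B\<bar> * (norm p)\<^sup>2 >= 0" by simp
    moreover have "(norm p)\<^sup>2 * (\<bar>B\<bar> + Kc) = \<bar>B\<bar> * (norm p)\<^sup>2 + Kc * (1 * (norm p)\<^sup>2)" by (simp add: algebra_simps)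
    ultimately show ?thesis by linarith
   qed
   have a3: "hE (L (p, -1)) <= hE nu0 + dE nu0 ?x + (norm p)\<^sup>2 * (rho1 * (1 + kp)\<^sup>2 / norm (T nu0) + rE)"
   proof -
    have T0: "norm (T nu0) > 0" by (rule T_nonzero[OF nz])
    have "norm (T ?x) <= norm (fst ?x) + kp * \<bar>snd ?x\<bar>" by (rule norm_T_le)
    also have "... <= norm ?x + kp * norm ?x"
     using norm_fst_le[of "fst ?x" "snd ?x"] norm_snd_le[of "snd ?x" "fst ?x"] pos(5) by (intro add_mono mult_left_mono) auto
    finally have "norm (T ?x) <= (1 + kp) * norm p" by (simp add: np distrib_right)
    then have "(norm (T ?x))\<^sup>2 <= ((1 + kp) * norm p)\<^sup>2" by (intro power_mono) auto
    then have "(norm (T ?x))\<^sup>2 / (2 * norm (T nu0)) <= (1 + kp)\<^sup>2 * (norm p)\<^sup>2 / (1 * norm (T nu0))"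
     using T0 by (intro frac_le) (auto simp: power_mult_distrib)
    then have "norm (T nu0 + T ?x) <= norm (T nu0) + T nu0 \<bullet> T ?x / norm (T nu0) + (1 + kp)\<^sup>2 * (norm p)\<^sup>2 / norm (T nu0)"
     using norm_upper[of "T nu0" "T ?x"] T0 by fastforce
    then have "rho1 * norm (T (L (p, -1))) <= rho1 * (norm (T nu0) + T nu0 \<bullet> T ?x / norm (T nu0) + (1 + kp)\<^sup>2 * (norm p)\<^sup>2 / norm (T nu0))"
     unfolding nup linear_add[OF linear_T] using pos(4) by (intro mult_left_mono) auto
    moreover have "rE * norm (L (p, -1)) <= rE * (1 + (norm p)\<^sup>2)" using n1 pos(3) by (intro mult_left_mono) auto
    moreover have "(rE + dl) * snd (L (p, -1)) = (rE + dl) * snd nu0 + (rE + dl) * snd ?x" unfolding nup by (simp add: distrib_left)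
    ultimately show ?thesis unfolding hE_def dE_def nu0(1) by (simp add: algebra_simps)
   qed
   have "z0 \<bullet> nu0 + z0 \<bullet> ?x <= hL (L (p, -1)) sc"
    using Lt_all[OF z0(2) sT, of "L (p, -1)"] unfolding nup inner_add_right .
   also have "... <= (1 - e0) * (G nu0 sg + dG nu0 sg ?x + (norm p)\<^sup>2 * (\<bar>B\<bar> + Kc + \<bar>Phi 0 1 sg\<bar>)) +
     e0 * (hE nu0 + dE nu0 ?x + (norm p)\<^sup>2 * (rho1 * (1 + kp)\<^sup>2 / norm (T nu0) + rE))"
    unfolding hL_def e0_def[symmetric] sg_def[symmetric] using a1 a2 a3 e0
    by (intro add_mono mult_left_mono) (auto simp: distrib_left)
   finally have *: "z0 \<bullet> ?x - l p <= (1 - e0) * ((norm p)\<^sup>2 * (\<bar>B\<bar> + Kc + \<bar>Phi 0 1 sg\<bar>)) + e0 * ((norm p)\<^sup>2 * (rho1 * (1 + kp)\<^sup>2 / norm (T nu0) + rE))"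
    unfolding hLc l_def distrib_left by linarith
   have "(1 - e0) * ((norm p)\<^sup>2 * (\<bar>B\<bar> + Kc + \<bar>Phi 0 1 sg\<bar>)) <= 1 * ((norm p)\<^sup>2 * (\<bar>B\<bar> + Kc + \<bar>Phi 0 1 sg\<bar>))"
    using e0 Kc(1) by (intro mult_right_mono mult_nonneg_nonneg) auto
   moreover have "e0 * ((norm p)\<^sup>2 * (rho1 * (1 + kp)\<^sup>2 / norm (T nu0) + rE)) <= 1 * ((norm p)\<^sup>2 * (rho1 * (1 + kp)\<^sup>2 / norm (T nu0) + rE))"
    using e0 pos(3,4) T_nonzero[OF nz] by (intro mult_right_mono mult_nonneg_nonneg add_nonneg_nonneg) auto
   ultimately show ?thesis using * unfolding Cu_def by (simp add: algebra_simps)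
  qed
  have le: "z0 \<bullet> L (p, 0) - l p <= 0" for p
  proof (rule ccontr)
   assume neg: "\<not> ?thesis"
   define m where "m = z0 \<bullet> L (p, 0) - l p"
   have m: "m > 0" using neg by (simp add: m_def)
   define C where "C = (\<bar>Cu\<bar> + 1) * ((norm p)\<^sup>2 + 1)"
   have C: "C > 0" by (simp add: C_def add_nonneg_pos)
   define t where "t = min (1 / (2 * (norm p + 1))) (m / (2 * C))"
   have n1: "2 * (norm p + 1) > 0" by (simp add: add_nonneg_pos)
   have t: "t > 0" "t <= 1 / (2 * (norm p + 1))" "t <= m / (2 * C)" using m C n1 by (auto simp: t_def)
   have "t * norm p <= 1 / (2 * (norm p + 1)) * norm p" using t by (intro mult_right_mono) auto
   also have "... <= 1 / 2" using n1 by (simp add: field_simps)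
   finally have "norm (t *\<^sub>R p) <= 1/2" using t(1) by simp
   from up[OF this] have "t * m <= Cu * (t * norm p)\<^sup>2"
   proof -
    have "z0 \<bullet> L (t *\<^sub>R p, 0) - l (t *\<^sub>R p) = t * m"
     unfolding l_def linear_scale[OF linL0] linear_scale[OF dG_linear[OF sg(4)]] linear_scale[OF dE_linear] m_def
     by (simp add: algebra_simps)
    then show ?thesis using up[OF \<open>norm (t *\<^sub>R p) <= 1/2\<close>] t(1) by simp
   qed
   then have "t * m <= t * (t * (Cu * (norm p)\<^sup>2))" by (simp add: power2_eq_square mult_ac)
   then have "m <= t * (Cu * (norm p)\<^sup>2)" using t(1) by simp
   also have "... <= t * C" using t(1) unfolding C_def by (intro mult_left_mono mult_mono) auto
   also have "... <= m / (2 * C) * C" using t(3) C by (intro mult_right_mono) auto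
   also have "... = m / 2" using C by simp
   finally show False using m by simp
  qed
  have "z0 \<bullet> L (- p, 0) - l (- p) = - (z0 \<bullet> L (p, 0) - l p)"
   unfolding l_def linear_neg[OF linL0] linear_neg[OF dG_linear[OF sg(4)]] linear_neg[OF dE_linear] by simp
  then show ?thesis using le[of p] le[of "- p"] by linarith
 qed
 \<comment> \<open>Lower bound for the barrier just before sc. It combines
   \<open>averaged_heat\<close> for the flow, the expansion of \<open>hE\<close>, and the smaller
   weight of the cap at earlier times, which adds e0 - et s times the gap.\<close>
 have "\<exists>rhob>0. \<forall>p s. norm p < rhob --> sc - rhob < s --> s < sc --> 0 <= s -->
   z0 \<bullet> L (p, -1) + (\<Sum>i\<in>UNIV. w i * (p $ i)\<^sup>2) / 2 - e' * (norm p)\<^sup>2 + \<Lambda> * (sc - s) <= hL (L (p, -1)) s"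
 proof -
  obtain rhoh where rhoh: "rhoh > 0" "!!xi. norm xi < rhoh ==> nu0 \<bullet> xi = 0 ==>
    hE nu0 + dE nu0 xi + WE nu0 xi xi / 2 - e' / 2 * (norm xi)\<^sup>2 <= hE (nu0 + xi)"
   using hE_lower[OF nu0(1), of "e' / 2"] e' by auto
  \<comment> \<open>Relative loss allowed both in the slope of \<open>et\<close> and in the gap near
    nu0: kk (1 - cc)^2 >= kk - 1 / 2 = CE + 1 / 2.\<close>
  define cc where "cc = 1 / (4 * kk)"
  have cc: "0 < cc" "cc <= 1/4" "kk * cc = 1/4" using kk by (auto simp: cc_def field_simps)
  obtain d where d: "d > 0" "!!p s. norm p < d ==> \<bar>s - sg\<bar> < d ==> s \<in> {0..<Tc} ==> G (L (p, -1)) s - hE (L (p, -1)) >= D0 * (1 - cc)"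
  proof -
   let ?U = "(UNIV :: (real^'n) set) \<times> {0..<Tc}"
   have cL: "continuous_on ?U (%x. L (fst x, -1))" unfolding nup
    by (intro continuous_intros bounded_linear.continuous_on[OF linL0[unfolded linear_conv_bounded_linear]])
   have "continuous_on ?U ((%(nu, N, t). Phi nu N t) \<circ> (%x. (L (fst x, -1), 1, snd x)))"
    by (intro continuous_on_compose continuous_on_subset[OF continuous_Phi] continuous_intros cL) auto
   then have "continuous_on ?U (%x. Phi (L (fst x, -1)) 1 (snd x))" by (simp add: o_def)
   then have c: "continuous_on ?U (%x. G (L (fst x, -1)) (snd x) - hE (L (fst x, -1)))"
    unfolding G_def by (intro continuous_intros continuous_hE cL)
   define F where "F x = G (L (fst x, -1)) (snd x) - hE (L (fst x, -1))" for x
   have cF: "\<forall>y\<in>?U. \<forall>e>0. \<exists>d>0. \<forall>x\<in>?U. dist x y < d --> dist (F x) (F y) < e"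
    using c unfolding continuous_on_iff F_def .
   have pD: "D0 * cc > 0" using D0 cc by simp
   have mU: "(0, sg) \<in> ?U" using sg by simp
   from cF[rule_format, OF mU pD] obtain d where d: "d > 0" "!!x. x \<in> ?U ==> dist x (0, sg) < d ==> dist (F x) (F (0, sg)) < D0 * cc"
    by blast
   show thesis
   proof (rule that[of "d / 2"])
    show "d / 2 > 0" using d by simp
    fix p :: "real^'n" and s assume a: "norm p < d / 2" "\<bar>s - sg\<bar> < d / 2" "s \<in> {0..<Tc}"
    have "dist (p, s) (0, sg) <= norm p + \<bar>s - sg\<bar>" using norm_Pair_le[of p "s - sg"] by (simp add: dist_norm)
    then have "dist (p, s) (0, sg) < d" using a by linarith
    then have "dist (G (L (p, -1)) s - hE (L (p, -1))) (G (L (0, -1)) sg - hE (L (0, -1))) < D0 * cc"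
     using d(2)[of "(p, s)"] a by (simp add: F_def)
    then have "G (L (p, -1)) s - hE (L (p, -1)) > D0 - D0 * cc" unfolding L(2) dist_real_def D0_def[folded G_def] by linarith
    then show "G (L (p, -1)) s - hE (L (p, -1)) >= D0 * (1 - cc)" by (simp add: right_diff_distrib)
   qed
  qed
  define rhob where "rhob = min (min (min rhoa rhoh) (min d (1/2))) (min (e' / (2 * Kc)) (cc / kk))"
  have rhob: "rhob > 0" using rhoa rhoh d e' Kc cc kk by (simp add: rhob_def)
  have "z0 \<bullet> L (p, -1) + (\<Sum>i\<in>UNIV. w i * (p $ i)\<^sup>2) / 2 - e' * (norm p)\<^sup>2 + \<Lambda> * (sc - s) <= hL (L (p, -1)) s"
   if p: "norm p < rhob" and s: "sc - rhob < s" "s < sc" "0 <= s" for p s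
  proof -
   let ?x = "L (p, 0)" and ?v = "L (p, -1)"
   have p': "norm p < rhoa" "norm p < rhoh" "norm p < d" "norm p <= 1/2" "norm p <= e' / (2 * Kc)" using p by (simp_all add: rhob_def)
   have sI: "s \<in> {0..T1}" using s sc by auto
   define t where "t = sc - s"
   have t: "0 < t" "t < rhoa" "t < d" "t <= cc / kk" using s by (simp_all add: t_def rhob_def)
   define tau where "tau = (1 - ep) * t"
   have taut: "0 < tau" "tau <= t" using t ep by (auto simp: tau_def)
   have st: "s / mu = sg - tau"
   proof -
    have "s / mu = s * (1 - ep)" "sg = sc * (1 - ep)" unfolding sg_def ep(3)[symmetric] by simp_all
    then show ?thesis by (simp add: tau_def t_def algebra_simps)
   qed
   define g where "g = G ?v (s / mu)"
   define hh where "hh = hE ?v"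
   have i1: "Phi ?v (norm ?v) (s / mu) >= g" unfolding g_def G_def by (rule Phi_mono[OF time(2)[OF sI] zero_le_one nge1])
   have i2: "G ?v sg - tau * ((1 - ep) * (g2 - 3 * P) + dl2) <= g"
    using rhoa(2)[OF p'(1) taut(1)] taut t unfolding g_def st by simp
   have i3: "G ?v sg >= G nu0 sg + dG nu0 sg ?x + d2G nu0 sg ?x ?x / 2 - e' / 2 * (norm p)\<^sup>2"
   proof -
    have "Kc * norm p <= e' / 2" using p'(5) Kc(1) by (simp add: pos_le_divide_eq mult_ac)
    then have "Kc * norm p * (norm p)\<^sup>2 <= e' / 2 * (norm p)\<^sup>2" by (intro mult_right_mono) auto
    then have "Kc * norm p ^ 3 <= e' / 2 * (norm p)\<^sup>2" by (simp add: power2_eq_square power3_eq_cube mult.assoc)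
    then show ?thesis using Kc(2)[of ?x] p'(4) unfolding np nup abs_le_iff by linarith
   qed
   have i4: "hh >= hE nu0 + dE nu0 ?x + WE nu0 ?x ?x / 2 - e' / 2 * (norm p)\<^sup>2"
    using rhoh(2)[of ?x] p'(2) perp unfolding hh_def np nup by simp
   have i5: "e0 - et s >= kk * e0 * t * (1 - cc)"
   proof -
    define x where "x = kk * t"
    have x: "0 < x" "x <= cc" using t kk by (auto simp: x_def pos_le_divide_eq mult.commute)
    have "et s = e0 * exp (- x)" by (simp add: et_def e0_def x_def t_def exp_add[symmetric] algebra_simps)
    moreover have "exp (- x) <= 1 - x * (1 - cc)"
    proof -
     have "exp (- x) <= 1 / (1 + x)" using exp_ge_add_one_self[of x] x by (simp add: exp_minus inverse_eq_divide frac_le)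
     also have "... <= 1 - x * (1 - x)"
     proof (rule mult_imp_div_pos_le)
      have "(1 - x * (1 - x)) * (1 + x) = 1 + x * x * x" by (simp add: algebra_simps)
      moreover have "x * x * x >= 0" using x by simp
      ultimately show "1 <= (1 - x * (1 - x)) * (1 + x)" by linarith
     qed (use x in simp)
     also have "... <= 1 - x * (1 - cc)" using x by (simp add: mult_left_mono)
     finally show ?thesis .
    qed
    then have "e0 * exp (- x) <= e0 * (1 - x * (1 - cc))" using e0 by (intro mult_left_mono) auto
    ultimately show ?thesis by (simp add: x_def algebra_simps)
   qed
   have i6: "D0 * (1 - cc) <= g - hh" unfolding g_def hh_def using p'(3) t taut time(2)[OF sI] by (intro d(2)) (auto simp: st)
   have i7: "(e0 - et s) * (g - hh) >= e0 * t * D0 * (CE + 1/2)"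
   proof -
    have "kk * e0 * t * (1 - cc) * (D0 * (1 - cc)) <= (e0 - et s) * (g - hh)"
    proof -
     have n1: "0 <= kk * e0 * t * (1 - cc)" using kk e0 t cc by (intro mult_nonneg_nonneg) auto
     have n2: "0 <= D0 * (1 - cc)" using D0 cc by (intro mult_nonneg_nonneg) auto
     show ?thesis by (rule mult_mono[OF i5 i6 order_trans[OF n1 i5] n2])
    qed
    moreover have "e0 * t * D0 * (CE + 1/2) <= e0 * t * D0 * (kk * (1 - cc)\<^sup>2)"
    proof (intro mult_left_mono)
     have "kk * (1 - cc)\<^sup>2 = kk - 2 * (kk * cc) + kk * cc\<^sup>2" by (simp add: power2_eq_square algebra_simps)
     moreover have "kk * cc\<^sup>2 >= 0" using kk by simp
     ultimately show "CE + 1/2 <= kk * (1 - cc)\<^sup>2" using cc(3) kk_def by linarith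
    qed (use e0 t D0 in simp)
    ultimately show ?thesis by (simp add: power2_eq_square mult_ac)
   qed
   have r1: "(1 - e0) * (tau * ((1 - ep) * (g2 - 3 * P) + dl2)) <= t * (- P + e0 * CE * D0 + dl2)"
    using rate[of t] t unfolding tau_def by simp
   have j1: "(1 - e0) * (G nu0 sg + dG nu0 sg ?x + d2G nu0 sg ?x ?x / 2 - e' / 2 * (norm p)\<^sup>2) - (1 - e0) * (tau * ((1 - ep) * (g2 - 3 * P) + dl2)) <= (1 - e0) * g"
   proof -
    let ?A = "G nu0 sg + dG nu0 sg ?x + d2G nu0 sg ?x ?x / 2 - e' / 2 * (norm p)\<^sup>2"
    let ?R = "tau * ((1 - ep) * (g2 - 3 * P) + dl2)"
    have "?A - ?R <= g" using i2 i3 by linarith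
    then have "(1 - e0) * (?A - ?R) <= (1 - e0) * g" using e0 by (intro mult_left_mono) auto
    then show ?thesis by (simp only: right_diff_distrib[of "1 - e0" ?A ?R])
   qed
   have j2: "e0 * (hE nu0 + dE nu0 ?x + WE nu0 ?x ?x / 2 - e' / 2 * (norm p)\<^sup>2) <= e0 * hh"
    using i4 e0 by (intro mult_left_mono) auto
   have j3: "(1 - et s) * g + et s * hh <= hL ?v s"
    unfolding hL_def hh_def using i1 et(2)[OF sI] et(3)[of s] by (intro add_mono mult_left_mono) auto
   have j4: "(1 - et s) * g + et s * hh = (1 - e0) * g + e0 * hh + (e0 - et s) * (g - hh)" by (simp add: algebra_simps)
   have j5: "(1 - e0) * (G nu0 sg + dG nu0 sg ?x + d2G nu0 sg ?x ?x / 2 - e' / 2 * (norm p)\<^sup>2) +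
     e0 * (hE nu0 + dE nu0 ?x + WE nu0 ?x ?x / 2 - e' / 2 * (norm p)\<^sup>2) =
     z0 \<bullet> nu0 + l p + W ?x ?x / 2 - e' / 2 * (norm p)\<^sup>2"
    unfolding hLc l_def W_def by (simp add: algebra_simps add_divide_distrib diff_divide_distrib)
   have j6: "t * (- P + e0 * CE * D0 + dl2) = e0 * t * D0 * (CE + 1/2) - \<Lambda> * t"
    unfolding dl2_def \<Lambda>_def by (simp add: algebra_simps)
   have j7: "z0 \<bullet> ?v = z0 \<bullet> nu0 + l p" unfolding nup inner_add_right grad ..
   have j8: "e' / 2 * (norm p)\<^sup>2 <= e' * (norm p)\<^sup>2" using e' by (intro mult_right_mono) auto
   show ?thesis
    using j1 j2 j3 j4 j5 j6 j8 r1 i7 unfolding j7 WL[symmetric] t_def[symmetric] by linarith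
  qed
  then show ?thesis using rhob by blast
 qed
 then obtain rhob where rhob: "rhob > 0" "!!p s. norm p < rhob ==> sc - rhob < s ==> s < sc ==> 0 <= s ==>
   z0 \<bullet> L (p, -1) + (\<Sum>i\<in>UNIV. w i * (p $ i)\<^sup>2) / 2 - e' * (norm p)\<^sup>2 + \<Lambda> * (sc - s) <= hL (L (p, -1)) s" by blast
 define \<beta> where "\<beta> i = (1 + e3) * b i" for i
 have \<beta>: "\<beta> i > 0" for i using b[of i] e3 by (simp add: \<beta>_def)
 define Q where "Q u v = (\<Sum>i\<in>UNIV. \<beta> i * ((u \<bullet> L (axis i 1, 0)) * (v \<bullet> L (axis i 1, 0))))" for u v
 note Qd = hyp_speed_diagonal[OF L(1), of \<beta>, folded Q_def]
 \<comment> \<open>Unit normals within rho2 of nu0 are multiples of some L (p, -1) with |p| < rhob;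
   the others form the compact set \<open>Kf\<close>.\<close>
 define rho2 where "rho2 = min (rhob / 4) (1/2)"
 have rho2: "0 < rho2" "rho2 <= rhob / 4" "rho2 <= 1/2" using rhob by (auto simp: rho2_def)
 define Kf where "Kf = sphere (0 :: (real^'n) \<times> real) 1 \<inter> {nu. rho2 <= dist nu nu0}"
 have cKf: "compact Kf" unfolding Kf_def
  by (intro compact_Int_closed compact_sphere closed_Collect_le continuous_intros)
 have ltKf: "norm nu = 1 & z0 \<bullet> nu < hL nu sc" if "nu \<in> Kf" for nu
 proof -
  have "norm nu = 1" "nu ~= nu0" using that rho2 unfolding Kf_def by (simp, force)
  then show ?thesis using uniq by simp
 qed
 obtain e1 where e1: "e1 > 0" "!!(zt :: (real^'n) \<times> real) s nu. norm zt < e1 ==> \<bar>s - sc\<bar> < e1 ==> s \<in> {0..T1} ==> nu \<in> Kf ==> (z0 + zt) \<bullet> nu <= hL nu s"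
  using far_ex[OF cKf sT ltKf] by blast
 define rhof where "rhof = min (min e1 rhob) sc"
 define c0 where "c0 = Min (range \<beta>)"
 have c0: "c0 > 0" "!!i. c0 <= \<beta> i" using \<beta> by (auto simp: c0_def)
 have N0: "L (0, 1) ~= 0" using Ln[of "(0, 1)"] by (auto simp: norm_Pair)
 \<comment> \<open>The inner normal is L (0, 1), opposite to nu0. Where the paraboloid function is
   positive, the point lies in \<open>Lt s\<close>, which is inside \<open>M s\<close> before
   contact.\<close>
 have "\<Lambda> <= hyp_speed (L (0, 1)) Q"
 proof (rule flow_sub[where ?t0.0 = sc and ?z0.0 = z0 and rho = rhof and ?c0.0 = c0])
  show "0 < sc" "sc < Tc" "z0 \<in> M sc" "bilinear Q" "L (0, 1) ~= 0" "c0 > 0" using sc T1 z0 Qd(1) N0 c0 by auto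
  show "Q u v = Q v u" for u v by (rule Qd(2))
  show "rhof > 0" using e1 rhob sc by (simp add: rhof_def)
  show "c0 * (norm zt)\<^sup>2 <= Q zt zt" if "L (0, 1) \<bullet> zt = 0" for zt
  proof -
   obtain x y where zt: "zt = L (x, y)" using orthogonal_transformation_surj[OF L(1)] by (metis surjD surj_pair)
   have "y = 0" using that unfolding zt Li by simp
   then have "(norm zt)\<^sup>2 = (norm x)\<^sup>2" unfolding zt Ln by (simp add: norm_Pair)
   then have "c0 * (norm zt)\<^sup>2 = (\<Sum>i\<in>UNIV. c0 * (x $ i)\<^sup>2)" unfolding norm2_cart[of x] by (simp add: sum_distrib_left)
   also have "... <= Q zt zt" unfolding zt Qd(4) using c0(2) by (intro sum_mono mult_right_mono) auto
   finally show ?thesis .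
  qed
  show "z \<in> inside (M s)" if s: "sc - rhof < s" "s < sc" and z: "dist z z0 < rhof" and F: "0 < hyp_fun (L (0, 1)) Q \<Lambda> (z - z0) (s - sc)" for z s
  proof -
   have s': "sc - rhob < s" "\<bar>s - sc\<bar> < e1" "s \<in> {0..T1}" "0 <= s" using s sc by (auto simp: rhof_def abs_if)
   define zt where "zt = z - z0"
   have nzt: "norm zt < e1" using z by (simp add: zt_def dist_norm rhof_def)
   obtain x y where zt: "zt = L (x, y)" using orthogonal_transformation_surj[OF L(1)] by (metis surjD surj_pair)
   have F': "(\<Sum>i\<in>UNIV. \<beta> i * (x $ i)\<^sup>2) / 2 - \<Lambda> * (sc - s) < y"
    using F unfolding hyp_fun_def zt_def[symmetric] unfolding zt Qd(4) Li by (simp add: algebra_simps)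
   have near: "(z0 + zt) \<bullet> L (p, -1) <= hL (L (p, -1)) s" if p: "norm p < rhob" for p
   proof -
    \<comment> \<open>Young's inequality in each coordinate, available because \<beta> i (w i - 2
      e') >= 1.\<close>
    have "x \<bullet> p <= (\<Sum>i\<in>UNIV. \<beta> i * (x $ i)\<^sup>2) / 2 + ((\<Sum>i\<in>UNIV. w i * (p $ i)\<^sup>2) / 2 - e' * (norm p)\<^sup>2)"
    proof -
     have "x $ i * p $ i <= \<beta> i * (x $ i)\<^sup>2 / 2 + (w i * (p $ i)\<^sup>2 / 2 - e' * (p $ i)\<^sup>2)" for i
     proof -
      have bw: "\<beta> i * (w i - 2 * e') >= 1"
      proof -
       have "2 * e' <= w i * e3 / 2" using w[of i] e3(1) mult_right_mono[OF w[of i], of e3] by (simp add: e'_def)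
       then have "w i * (1 - e3 / 2) <= w i - 2 * e'" by (simp add: algebra_simps)
       then have "\<beta> i * (w i * (1 - e3 / 2)) <= \<beta> i * (w i - 2 * e')" using \<beta>[of i] by (intro mult_left_mono) auto
       moreover have "\<beta> i * (w i * (1 - e3 / 2)) = (1 + e3) * (1 - e3 / 2)" using w0[of i] by (simp add: \<beta>_def b_def)
       moreover have "(1 + e3) * (1 - e3 / 2) >= 1"
        using mult_left_mono[OF e3(2), of e3] e3(1) by (simp add: algebra_simps)
       ultimately show ?thesis by linarith
      qed
      have "0 <= (\<beta> i * x $ i - p $ i)\<^sup>2" by simp
      also have "... = \<beta> i * (\<beta> i * (x $ i)\<^sup>2 - 2 * (x $ i * p $ i)) + 1 * (p $ i)\<^sup>2" by (simp add: power2_eq_square algebra_simps)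
      also have "... <= \<beta> i * (\<beta> i * (x $ i)\<^sup>2 - 2 * (x $ i * p $ i)) + \<beta> i * (w i - 2 * e') * (p $ i)\<^sup>2"
       using bw by (intro add_left_mono mult_right_mono) auto
      also have "... = \<beta> i * (\<beta> i * (x $ i)\<^sup>2 - 2 * (x $ i * p $ i) + (w i - 2 * e') * (p $ i)\<^sup>2)" by (simp add: algebra_simps)
      finally have "0 <= \<beta> i * (x $ i)\<^sup>2 - 2 * (x $ i * p $ i) + (w i - 2 * e') * (p $ i)\<^sup>2"
       using \<beta>[of i] by (simp add: zero_le_mult_iff)
      moreover have "(w i - 2 * e') * (p $ i)\<^sup>2 = w i * (p $ i)\<^sup>2 - 2 * (e' * (p $ i)\<^sup>2)" by (simp add: algebra_simps)
      ultimately show ?thesis by linarith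
     qed
     then have "(\<Sum>i\<in>UNIV. x $ i * p $ i) <= (\<Sum>i\<in>UNIV. \<beta> i * (x $ i)\<^sup>2 / 2 + (w i * (p $ i)\<^sup>2 / 2 - e' * (p $ i)\<^sup>2))" by (intro sum_mono)
     then show ?thesis unfolding inner_vec_def norm2_cart by (simp add: sum.distrib sum_subtractf sum_divide_distrib sum_distrib_left)
    qed
    moreover have "(z0 + zt) \<bullet> L (p, -1) = z0 \<bullet> L (p, -1) + (x \<bullet> p - y)" unfolding zt inner_add_left Li by simp
    ultimately show ?thesis using rhob(2)[OF p s'(1) s(2) s'(4)] F' by linarith
   qed
   have "z0 + zt \<in> Lt s" unfolding Lt_def
   proof (intro CollectI allI impI)
    fix nu :: "(real^'n) \<times> real" assume nu: "norm nu = 1"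
    show "(z0 + zt) \<bullet> nu <= hL nu s"
    proof (cases "nu \<in> Kf")
     case True
     then show ?thesis using e1(2)[OF nzt s'(2,3)] by blast
    next
     case False
     then have dn: "norm (nu - nu0) < rho2" using nu by (simp add: Kf_def dist_norm)
     obtain q c where qc: "nu = L (q, c)" using orthogonal_transformation_surj[OF L(1)] by (metis surjD surj_pair)
     have "norm (nu - nu0) = norm (q, c + 1)" unfolding qc L(2)[symmetric] by (simp add: L.diff[symmetric] Ln)
     then have qn: "norm q < rho2" "\<bar>c + 1\<bar> < rho2" using dn norm_fst_le[of q "c + 1"] norm_snd_le[of "c + 1" q] by auto
     define k where "k = - c"
     have k: "k >= 1/2" using qn(2) rho2(3) by (simp add: k_def abs_if split: if_splits)
     define p where "p = (1 / k) *\<^sub>R q"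
     have "norm p = norm q / k" using k by (simp add: p_def)
     also have "... <= norm q / (1/2)" using k by (intro divide_left_mono) auto
     also have "... < rhob" using qn(1) rho2(2) norm_ge_zero[of q] rhob(1) by simp
     finally have pn: "norm p < rhob" .
     have "nu = k *\<^sub>R L (p, -1)" unfolding qc L.scale[symmetric] using k by (simp add: p_def k_def)
     then have "(z0 + zt) \<bullet> nu = k * ((z0 + zt) \<bullet> L (p, -1))" "hL nu s = k * hL (L (p, -1)) s"
      using hL_scale[OF s'(3), of k "L (p, -1)"] k by simp_all
     then show ?thesis using mult_left_mono[OF near[OF pn], of k] k by simp
    qed
   qed
   then have "z \<in> Lt s" by (simp add: zt_def)
   then show ?thesis using before[OF s'(4) s(2)] by blast
  qed
 qed
 also have "hyp_speed (L (0, 1)) Q = (1 + e3)\<^sup>2 * P"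
  unfolding Qd(3) P_def pair_sum_def \<beta>_def by (simp add: sum_distrib_left power2_eq_square mult_ac)
 also have "... <= P + 3 * (P * e3)"
 proof -
  have "e3 * e3 <= e3 * 1" using e3 by (intro mult_left_mono) auto
  then have "(1 + e3)\<^sup>2 <= 1 + 3 * e3" by (simp add: power2_eq_square algebra_simps)
  from mult_right_mono[OF this, of P] P show ?thesis by (simp add: algebra_simps)
 qed
 finally have "\<Lambda> <= P + 3 * (P * e3)" .
 moreover have "16 * (P * e3) <= e0 * D0" using e3(3) by (simp only: mult.assoc)
 moreover have "e0 * D0 > 0" by (rule mult_pos_pos[OF e0(1) D0])
 ultimately show False unfolding \<Lambda>_def by linarith
qed

text \<open>The set \<open>C\<close> of pairs (p, s) at which the flow meets the barrier is compact,
  so there is a first contact time, and \<open>contact\<close> excludes it.\<close>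

lemma no_contact: "s \<in> {0..T1} ==> Lt s \<inter> M s = {}"
proof (rule ccontr)
 assume s: "s \<in> {0..T1}" and ne: "Lt s \<inter> M s ~= {}"
 define C where "C = (\<Inter>nu\<in>sphere 0 1. {x \<in> S \<times> {0..T1}. X (fst x) (snd x) \<bullet> nu <= hL nu (snd x)})"
 have memC: "(p, s) \<in> C \<longleftrightarrow> p \<in> S & s \<in> {0..T1} & X p s \<in> Lt s" for p s
 proof -
  have "(0 :: real^'n, 1 :: real) \<in> sphere 0 1" by (simp add: norm_Pair)
  then show ?thesis unfolding C_def Lt_def by fastforce
 qed
 have cS: "compact (S \<times> {0..T1})" by (intro compact_Times compact_S compact_Icc)
 have cX: "continuous_on (S \<times> {0..T1}) (%x. X (fst x) (snd x))"
  using continuous_on_subset[OF continuous_X, of "S \<times> {0..T1}"] T1 by (force simp: split_beta')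
 have cl: "closed {x \<in> S \<times> {0..T1}. X (fst x) (snd x) \<bullet> nu <= hL nu (snd x)}" for nu
 proof (rule continuous_on_closed_Collect_le)
 have "continuous_on (S \<times> {0..T1}) ((%x. hL (fst x) (snd x)) \<circ> (%x. (nu, snd x)))"
  by (intro continuous_on_compose continuous_on_subset[OF continuous_hL] continuous_intros) auto
 then show "continuous_on (S \<times> {0..T1}) (%x. hL nu (snd x))" by (simp add: o_def)
 qed (use cX cS in \<open>auto intro!: continuous_intros compact_imp_closed\<close>)
 have "closed C" unfolding C_def using cl by (intro closed_INT) auto
 moreover have "C \<subseteq> S \<times> {0..T1}" using memC by auto
 ultimately have "compact C" using compact_Int_closed[OF cS] by (metis inf.absorb_iff2)
 moreover have "C ~= {}"
 proof -
  obtain p where "p \<in> S" "X p s \<in> Lt s" using ne by (auto simp: evolving_surface_def)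
  then have "(p, s) \<in> C" using memC s by blast
  then show ?thesis by blast
 qed
 ultimately obtain x where x: "x \<in> C" "\<forall>y\<in>C. snd x <= snd y"
  using continuous_attains_inf[of C snd] continuous_on_snd[OF continuous_on_id] by blast
 obtain p0 sc where xp: "x = (p0, sc)" by (cases x)
 have p0: "p0 \<in> S" "sc \<in> {0..T1}" "X p0 sc \<in> Lt sc" using x(1) memC unfolding xp by blast+
 have first: "Lt s' \<inter> M s' = {}" if "0 <= s'" "s' < sc" for s'
 proof (rule ccontr)
  assume "Lt s' \<inter> M s' ~= {}"
  then obtain p where "p \<in> S" "X p s' \<in> Lt s'" by (auto simp: evolving_surface_def)
  then have "(p, s') \<in> C" using memC that p0 by auto
  then show False using x(2) that unfolding xp by force
 qed
 define z0 where "z0 = X p0 sc"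
 have z0: "z0 \<in> M sc" "z0 \<in> Lt sc" using X_in_M[OF p0(1)] p0 by (simp_all add: z0_def)
 have before: "Lt s' \<subseteq> inside (M s')" if "0 <= s'" "s' < sc" for s'
  using that p0 first by (intro Lt_inside) auto
 have sc0: "sc ~= 0"
 proof
  assume "sc = 0"
  then have "z0 \<in> interior K" "z0 \<in> frontier K" using z0 Lt_0_interior M_0 K(3) by auto
  then show False by (simp add: frontier_def)
 qed
 then have sc: "0 < sc" "sc <= T1" using p0 by auto
 \<comment> \<open>If all constraints were strict at z0, the same material point p0 would already
   lie in the barrier slightly earlier.\<close>
 have "\<exists>nu0. norm nu0 = 1 & z0 \<bullet> nu0 = hL nu0 sc"
 proof (rule ccontr)
  assume no: "\<not> ?thesis"
  have lt: "norm nu = 1 & z0 \<bullet> nu < hL nu sc" if "nu \<in> sphere 0 1" for nu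
  proof -
   have "norm nu = 1" using that by simp
   moreover from this have "z0 \<bullet> nu <= hL nu sc" by (rule LtD[OF z0(2)])
   moreover have "z0 \<bullet> nu ~= hL nu sc" using no \<open>norm nu = 1\<close> by blast
   ultimately show ?thesis by linarith
  qed
  obtain e where e: "e > 0" "!!(zt :: (real^'n) \<times> real) s nu. norm zt < e ==> \<bar>s - sc\<bar> < e ==> s \<in> {0..T1} ==> nu \<in> sphere 0 1 ==> (z0 + zt) \<bullet> nu <= hL nu s"
   using far_ex[OF compact_sphere p0(2) lt] by blast
  have "continuous_on {0..T1} ((%x. X (fst x) (snd x)) \<circ> (%s. (p0, s)))"
   using p0 by (intro continuous_on_compose continuous_on_subset[OF cX] continuous_intros) auto
  then have "continuous_on {0..T1} (%s. X p0 s)" by (simp add: o_def)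
  then obtain d where d: "d > 0" "!!s. s \<in> {0..T1} ==> dist s sc < d ==> dist (X p0 s) (X p0 sc) < e"
   using p0(2) e(1) unfolding continuous_on_iff by meson
  define s' where "s' = sc - min (min d e) sc / 2"
  have s': "0 <= s'" "s' < sc" "s' \<in> {0..T1}" "dist s' sc < d" "\<bar>s' - sc\<bar> < e"
   using d e sc by (auto simp: s'_def dist_real_def min_def)
  have "X p0 s' \<in> Lt s'"
   unfolding Lt_def
  proof (intro CollectI allI impI)
   fix nu :: "(real^'n) \<times> real" assume "norm nu = 1"
   then show "X p0 s' \<bullet> nu <= hL nu s'"
    using e(2)[of "X p0 s' - z0" s' nu] d(2)[OF s'(3,4)] s' by (simp add: dist_norm z0_def)
  qed
  then show False using first[OF s'(1,2)] X_in_M[OF p0(1)] by blast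
 qed
 then obtain nu0 where "norm nu0 = 1" "z0 \<bullet> nu0 = hL nu0 sc" by blast
 from contact[OF sc z0 this before] show False .
qed

lemma combination_inside:
 assumes s: "s \<in> {0..T1}" and z1: "z1 \<in> M (s / mu)"
 shows "(1 - et s) *\<^sub>R z1 + et s *\<^sub>R (0, dl) \<in> inside (M s)"
proof -
 have "(1 - et s) *\<^sub>R z1 + et s *\<^sub>R (0, dl) \<in> Lt s"
 proof (rule combination_in_Lt[OF s])
  show "z1 \<bullet> nu <= supp nu (s / mu)" for nu by (rule supp_ge[OF time(2)[OF s] z1])
  show "(0, dl) \<bullet> nu <= hE nu" for nu using hE_ge(2)[of nu] by (simp add: inner_prod_def)
 qed
 moreover have "Lt s \<subseteq> inside (M s)" using s no_contact by (intro Lt_inside) auto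
 ultimately show ?thesis by blast
qed

end

section \<open>Decay of the flat side\<close>

lemma outermost_radial_point:
 fixes A :: "'a::euclidean_space set"
 assumes A: "compact A" and c0: "c0 *\<^sub>R th \<in> A" and th: "norm th = 1"
 obtains c where "c >= c0" "c *\<^sub>R th \<in> frontier A"
proof -
 define I where "I = {c. c0 <= c & c *\<^sub>R th \<in> A}"
 obtain B where B: "\<forall>x\<in>A. norm x <= B" using compact_imp_bounded[OF A] unfolding bounded_iff by blast
 have le: "c <= B" if "c \<in> I" for c
  using bspec[OF B, of "c *\<^sub>R th"] that th abs_ge_self[of c] by (simp add: I_def)
 have ne: "I ~= {}" using c0 by (auto simp: I_def)
 have bd: "bdd_above I" using le by (intro bdd_aboveI)
 have "closed I"
 proof -
  have "closed ({c0..} \<inter> (%c. c *\<^sub>R th) -` A)"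
   by (intro closed_Int closed_atLeast continuous_closed_vimage compact_imp_closed A) (auto intro!: continuous_intros)
  moreover have "I = {c0..} \<inter> (%c. c *\<^sub>R th) -` A" by (auto simp: I_def)
  ultimately show ?thesis by simp
 qed
 define c where "c = Sup I"
 have cI: "c \<in> I" unfolding c_def by (rule closed_contains_Sup[OF ne bd \<open>closed I\<close>])
 have "c *\<^sub>R th \<notin> interior A"
 proof
  assume "c *\<^sub>R th \<in> interior A"
  then obtain e where e: "e > 0" "cball (c *\<^sub>R th) e \<subseteq> A" using mem_interior_cball by blast
  have "dist (c *\<^sub>R th) ((c + e) *\<^sub>R th) = e" using th e(1) by (simp add: dist_norm scaleR_diff_left[symmetric])
  then have "(c + e) *\<^sub>R th \<in> A" using e by auto
  then have "c + e \<in> I" using cI e(1) by (simp add: I_def)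
  then have "c + e <= c" unfolding c_def by (rule cSup_upper[OF _ bd])
  then show False using e(1) by simp
 qed
 moreover have "c *\<^sub>R th \<in> closure A" using cI closure_subset by (auto simp: I_def)
 ultimately show thesis using cI by (intro that[of c]) (auto simp: I_def frontier_def)
qed

text \<open>The outermost point of \<open>A\<close> on a ray is a frontier point, and a polar graph
  has only one point on each ray.\<close>

lemma polar_graph_le:
 assumes p: "polar_graph (frontier A) rho" and A: "compact A" and c: "c *\<^sub>R th \<in> A" and th: "th \<in> sphere (0 :: 'a::euclidean_space) 1"
 shows "c <= rho th"
proof (cases "c <= 0")
 case True
 moreover have "rho th > 0" using p th unfolding polar_graph_def by blast
 ultimately show ?thesis by linarith
next
 case False
 obtain c' where c': "c' >= c" "c' *\<^sub>R th \<in> frontier A" using outermost_radial_point[OF A c] th by auto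
 then obtain th' where th': "th' \<in> sphere 0 1" "c' *\<^sub>R th = rho th' *\<^sub>R th'" "rho th' > 0" using p by (auto simp: polar_graph_def)
 have "\<bar>c'\<bar> = \<bar>rho th'\<bar>" using arg_cong[OF th'(2), of norm] th th'(1) by simp
 then have "c' = rho th'" using th'(3) c'(1) False by linarith
 then have "th = th'" using th'(2,3) by simp
 then show ?thesis using \<open>c' = rho th'\<close> c' by simp
qed

locale flat_flow = scalar_flow S X Tc for S :: "((real^'n) \<times> real) set" and X and Tc :: real +
 fixes K :: "((real^'n) \<times> real) set" and T1 rho0 :: real
 assumes K: "compact K" "convex K" "S = frontier K" and up: "!!z. z \<in> S ==> snd z >= 0"
  and graph: "!!t. t \<in> {0..<Tc} ==> graph_contains_flat_side (M t)"
  and T1: "0 < T1" "T1 < Tc" and rho0: "rho0 > 0" "cball 0 rho0 \<subseteq> flat_side (M T1)"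
begin

text \<open>Monotonicity of \<open>supp\<close> in the direction (0, -1).\<close>

lemma M_up: "t \<in> {0..<Tc} ==> z \<in> M t \<union> inside (M t) ==> snd z >= 0"
proof -
 assume t: "t \<in> {0..<Tc}" and z: "z \<in> M t \<union> inside (M t)"
 have "z \<bullet> (0, -1) <= supp (0, -1) t" by (rule supp_ge'[OF t z])
 also have "... <= supp (0, -1) 0" using t by (intro supp_antimono) auto
 also have "... <= 0"
 proof (rule supp_le)
  show "0 \<in> {0..<Tc}" using t by simp
  fix z assume "z \<in> M 0"
  then show "z \<bullet> (0, -1) <= 0" using up[of z] unfolding M_0 by (simp add: inner_prod_def)
 qed
 finally show ?thesis by (simp add: inner_prod_def)
qed

text \<open>The infimum in \<open>lower_function\<close> is attained, as \<open>M t\<close> is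
  compact. Conversely, \<open>graph_contains_flat_side\<close> places all points at height 0 over
  the graph domain.\<close>

lemma flat_side_eq: "t \<in> {0..<Tc} ==> flat_side (M t) = {x. (x, 0) \<in> M t}"
proof (intro set_eqI iffI CollectI)
 fix x assume t: "t \<in> {0..<Tc}"
 have cl: "compact (M t)" by (rule compact_M[OF t])
 {
  assume "x \<in> flat_side (M t)"
  then have x: "x \<in> fst ` M t" "Inf {y. (x, y) \<in> M t} = 0"
   using interior_subset by (auto simp: flat_side_def graph_domain_def lower_function_def)
  have ne: "{y. (x, y) \<in> M t} ~= {}" using x(1) by force
  have "closed ((%y. (x, y)) -` M t)"
   by (intro continuous_closed_vimage compact_imp_closed cl) (auto intro!: continuous_intros)
  then have c: "closed {y. (x, y) \<in> M t}" by (simp add: vimage_def)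
  have "bdd_below {y. (x, y) \<in> M t}" using M_up[OF t] by (intro bdd_belowI[of _ 0]) force
  from closed_contains_Inf[OF ne this c] show "(x, 0) \<in> M t" using x(2) by simp
 }
 assume "x \<in> {x. (x, 0) \<in> M t}"
 then have x: "(x, 0) \<in> M t" by simp
 have "Inf {y. (x, y) \<in> M t} = 0"
  by (rule cInf_eq_minimum) (use x M_up[OF t] in force)+
 then show "x \<in> flat_side (M t)"
  using x graph[OF t] by (simp add: flat_side_def graph_contains_flat_side_def lower_function_def)
qed

lemma compact_flat_side: "t \<in> {0..<Tc} ==> compact (flat_side (M t))"
proof -
 assume t: "t \<in> {0..<Tc}"
 have "compact (fst ` (M t \<inter> {z. snd z = 0}))"
  by (intro compact_continuous_image compact_Int_closed compact_M[OF t] continuous_intros closed_Collect_eq)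
 moreover have "fst ` (M t \<inter> {z. snd z = 0}) = {x. (x, 0) \<in> M t}" by force
 ultimately show ?thesis using flat_side_eq[OF t] by simp
qed

text \<open>A local graph has inside points above it; a ball of them reaches a positive height, so
  the support function in the direction (0, 1) is positive.\<close>

lemma top_point: "\<exists>xs H0. H0 > 0 & (xs, H0) \<in> M T1"
proof -
 have T1': "T1 \<in> {0..<Tc}" using T1 by auto
 have "\<exists>z. z \<in> M T1" using ne_M by blast
 then obtain z where z: "z \<in> M T1" by blast
 have "\<exists>psi QQ a b u x C. local_graph M psi QQ a b u &
     QQ \<subseteq> UNIV \<times> {0<..<Tc} & (x, T1) \<in> QQ & z = psi (x, u x T1) &
     (\<forall>y y' s. (y, s) \<in> QQ & (y', s) \<in> QQ --> \<bar>u y s - u y' s\<bar> <= C * norm (y - y'))"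
  by (rule flow[unfolded scalar_curvature_flow_def, THEN conjunct2, THEN conjunct2, THEN conjunct2,
     THEN conjunct1, THEN bspec, THEN bspec]) (use T1 z in auto)
 then obtain psi :: "(real^'n) \<times> real => (real^'n) \<times> real" and QQ :: "((real^'n) \<times> real) set" and a b :: real and u x
  where lg: "local_graph M psi QQ a b u" and x: "(x, T1) \<in> QQ" by blast
 have "u x T1 < b" "!!y. u x T1 < y & y < b ==> psi (x, y) \<in> inside (M T1)"
  using lg x unfolding local_graph_def by blast+
 then have w: "psi (x, (u x T1 + b) / 2) \<in> inside (M T1)" by simp
 define v where "v = psi (x, (u x T1 + b) / 2)"
 have "open (inside (M T1))" by (intro open_inside compact_imp_closed compact_M[OF T1'])
 then obtain e where e: "e > 0" "cball v e \<subseteq> inside (M T1)" using w open_contains_cball unfolding v_def by blast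
 have "v + (0, e) \<in> cball v e" using e(1) by (simp add: dist_norm norm_Pair)
 then have ve: "v + (0, e) \<in> M T1 \<union> inside (M T1)" "v \<in> M T1 \<union> inside (M T1)" using e by (auto simp: v_def w)
 have "snd (v + (0, e)) > 0" using M_up[OF T1' ve(2)] e(1) by simp
 moreover have "(v + (0, e)) \<bullet> (0, 1) <= supp (0, 1) T1" by (rule supp_ge'[OF T1' ve(1)])
 moreover obtain z1 where z1: "z1 \<in> M T1" "supp (0, 1) T1 = z1 \<bullet> (0, 1)" using supp_attained_M[OF T1'] by blast
 ultimately have "snd z1 > 0" by (simp add: inner_prod_def)
 then show ?thesis using z1(1) by (intro exI[of _ "fst z1"] exI[of _ "snd z1"]) simp
qed

text \<open>The point is \<open>start\<close>. The margin m between \<open>supp\<close> and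
  \<open>hE\<close> is positive by \<open>gap_pos\<close>, and r R0 <= ep m makes mollification
  raise \<open>supp\<close> by at most half of the gain 2 ep m.\<close>

lemma barrier_exists:
 fixes xs :: "real^'n"
 assumes top: "H0 > 0" "(xs, H0) \<in> M T1"
  and dl: "0 < dl" "dl <= cap.th rho0 xs * H0 / 4" and mu: "mu > 1"
  and small: "2 * (1 - 1 / mu) * exp ((cap.CE rho0 H0 xs + 1) * T1) <= 1 / 2"
 shows "\<exists>r. barrier S X Tc r rho0 H0 xs dl K T1 mu"
proof -
 note disc = rho0(2)
 interpret cap rho0 H0 xs dl by unfold_locales (use rho0 top dl in auto)
 have T1': "T1 \<in> {0..<Tc}" "0 \<in> {0..<Tc}" using T1 by auto
 have s1: "rho0 * norm (fst nu) <= supp nu T1" for nu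
 proof -
  define x where "x = rho0 *\<^sub>R sgn (fst nu)"
  have "norm x <= rho0" using rho0 by (simp add: x_def norm_sgn)
  then have "(x, 0) \<in> M T1" using disc flat_side_eq[OF T1'(1)] by auto
  from supp_ge[OF T1'(1) this, of nu] have "x \<bullet> fst nu <= supp nu T1" by (simp add: inner_prod_def)
  moreover have "x \<bullet> fst nu = rho0 * norm (fst nu)"
   by (cases "fst nu = 0") (simp_all add: x_def sgn_div_norm dot_square_norm power2_eq_square)
  ultimately show ?thesis by simp
 qed
 have s2: "xs \<bullet> fst nu + H0 * snd nu <= supp nu T1" for nu
  using supp_ge[OF T1'(1) top(2), of nu] by (simp add: inner_prod_def)
 define ep where "ep = 1 - 1 / mu"
 have ep: "0 < ep" "ep < 1" using mu by (auto simp: ep_def)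
 have cE: "CE + 1 > 0" using pos(7) by simp
 have "1 <= exp ((CE + 1) * T1)" using cE T1 by simp
 then have "2 * ep * 1 <= 2 * ep * exp ((CE + 1) * T1)" using ep by (intro mult_left_mono) auto
 then have ep2: "2 * ep <= 1 / 2" using small by (simp add: ep_def)
 let ?Sp = "sphere (0 :: (real^'n) \<times> real) 1"
 have gapf: "gap nu <= supp nu 0 - hE nu" for nu
 proof (rule gap_le[OF dl(2)])
  have "supp nu T1 <= supp nu 0" using T1 by (intro supp_antimono) auto
  then show "rho0 * norm (fst nu) <= supp nu 0" "xs \<bullet> fst nu + H0 * snd nu <= supp nu 0" using s1[of nu] s2[of nu] by linarith+
 qed
 have cs: "continuous_on ?Sp (%nu. supp nu 0 - hE nu)"
 proof -
  have "continuous_on ?Sp ((%(nu, t). supp nu t) \<circ> (%nu. (nu, 0)))"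
   using T1' by (intro continuous_on_compose continuous_on_subset[OF continuous_supp] continuous_intros) auto
  then show ?thesis by (intro continuous_intros continuous_hE) (simp_all add: o_def)
 qed
 have "?Sp ~= {}" by simp
 then obtain nu1 where n1: "nu1 \<in> ?Sp" "\<forall>nu\<in>?Sp. supp nu1 0 - hE nu1 <= supp nu 0 - hE nu"
  using continuous_attains_inf[OF compact_sphere _ cs] by blast
 define m where "m = supp nu1 0 - hE nu1"
 have "nu1 ~= 0" using n1(1) by auto
 then have m: "m > 0" using gapf[of nu1] gap_pos[of nu1] by (simp add: m_def)
 obtain R0 where R0: "R0 > 0" "!!z t. 0 <= t ==> t <= T1 ==> z \<in> M t ==> norm z <= R0" using X_bounded[OF T1(2)] by blast
 define r where "r = min (ep / 16) (ep * m / R0)"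
 have rr: "0 < r" "r <= ep / 16" "r * R0 <= ep * m" using ep m R0 by (auto simp: r_def min_def field_simps)
 have r1: "r <= 1" using rr(2) ep by linarith
 interpret smoothed_flow S X Tc r by unfold_locales (use rr(1) r1 in auto)
 have start: "(1 - 2 * (1 - 1 / mu)) * Phi nu 1 0 + 2 * (1 - 1 / mu) * hE nu < supp nu 0" if nu: "norm nu = 1" for nu
 proof -
  have "Phi nu 1 0 <= supp nu 0 + 1 * (\<bar>R0\<bar> * r)"
  proof (rule Phi_le[OF T1'(2)])
   fix y
   have "\<bar>supp y 0\<bar> <= R0 * norm y" using R0(2)[of 0] T1 by (intro supp_le_norm[OF T1'(2)]) auto
   then show "supp y 0 <= R0 * norm y" by linarith
  qed simp
  then have "Phi nu 1 0 <= supp nu 0 + ep * m" using rr(3) R0(1) by (simp add: mult.commute)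
  then have 1: "(1 - 2 * ep) * Phi nu 1 0 <= (1 - 2 * ep) * (supp nu 0 + ep * m)" using ep2 by (intro mult_left_mono) auto
  have "(1 - 2 * ep) * (ep * m) <= 1 * (ep * m)" using ep m by (intro mult_right_mono) auto
  moreover have "2 * ep * m <= 2 * ep * (supp nu 0 - hE nu)" using n1(2) nu ep by (intro mult_left_mono) (auto simp: m_def)
  moreover have "ep * m > 0" using ep m by simp
  ultimately have "(1 - 2 * ep) * Phi nu 1 0 + 2 * ep * hE nu < supp nu 0" using 1 by (simp add: algebra_simps)
  then show ?thesis by (simp add: ep_def)
 qed
 have "barrier S X Tc r rho0 H0 xs dl K T1 mu"
  by unfold_locales (fact K T1 dl(2) s1 s2 mu small start rr(2)[unfolded ep_def])+
 then show ?thesis by blast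
qed

text \<open>With mu fixed, the height \<open>dl\<close> of the cap tends to 0: combinations of (x,
  0) with (0, dl) are inside, so their limit at height 0 is inside or on the surface. It is not
  inside, since no inside point has negative height.\<close>

lemma flat_side_step:
 "\<exists>A>0. \<exists>ez>0. \<forall>mu t0 x. 1 < mu --> 1 - 1 / mu <= ez --> 0 < t0 --> mu * t0 <= T1 --> x \<in> flat_side (M t0) -->
   (\<exists>e. 0 <= e & e <= A * (1 - 1 / mu) & e <= 1 & (1 - e) *\<^sub>R x \<in> flat_side (M (mu * t0)))"
proof -
 obtain xs H0 where top: "H0 > 0" "(xs, H0) \<in> M T1" using top_point by blast
 define E where "E = exp ((cap.CE rho0 H0 xs + 1) * T1)"
 have E: "E > 0" by (simp add: E_def)
 have step: "\<exists>e. 0 <= e & e <= 2 * E * (1 - 1 / mu) & e <= 1 & (1 - e) *\<^sub>R x \<in> flat_side (M (mu * t0))"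
  if mu: "1 < mu" "1 - 1 / mu <= 1 / (4 * E)" and t0: "0 < t0" "mu * t0 <= T1" and x: "x \<in> flat_side (M t0)" for mu t0 x
 proof -
  have small: "2 * (1 - 1 / mu) * E <= 1 / 2" using mu(2) E by (simp add: pos_le_divide_eq mult_ac)
  have tT: "mu * t0 \<in> {0..T1}" "mu * t0 \<in> {0..<Tc}" using t0 mu T1 by auto
  have "1 * t0 <= mu * t0" using mu t0 by (intro mult_right_mono) auto
  then have "t0 <= T1" using t0(2) by linarith
  then have t0T: "t0 \<in> {0..<Tc}" using t0(1) T1 by auto
  have xM: "(x, 0) \<in> M t0" using x flat_side_eq[OF t0T] by simp
  \<comment> \<open>The weight of the cap at time mu * t0, the same for all \<open>dl\<close>
    because \<open>CE\<close> does not involve \<open>dl\<close>.\<close>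
  define e where "e = 2 * (1 - 1 / mu) * exp ((cap.CE rho0 H0 xs + 1) * (mu * t0))"
  interpret c0: cap rho0 H0 xs 1 by unfold_locales (use rho0 top in auto)
  define dl0 where "dl0 = c0.th * H0 / 4"
  have dl0: "dl0 > 0" using c0.pos(1) top by (simp add: dl0_def)
  have m0: "0 < 1 - 1 / mu" using mu by simp
  have ein: "0 <= e" "e <= 2 * E * (1 - 1 / mu)" "e <= 1"
  proof -
   show "0 <= e" using m0 by (simp add: e_def)
   have "exp ((c0.CE + 1) * (mu * t0)) <= E" unfolding E_def using t0 c0.pos(7) by (simp add: mult_left_mono)
   then have le: "e <= 2 * (1 - 1 / mu) * E" unfolding e_def using m0 by (intro mult_left_mono) auto
   then show "e <= 2 * E * (1 - 1 / mu)" by (simp only: mult.commute mult.left_commute)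
   show "e <= 1" using le small by linarith
  qed
  have ins: "(1 - e) *\<^sub>R (x, 0) + e *\<^sub>R (0, dl) \<in> inside (M (mu * t0))" if dl: "0 < dl" "dl <= dl0" for dl
  proof -
   obtain r where "barrier S X Tc r rho0 H0 xs dl K T1 mu"
    using barrier_exists[OF top dl(1) _ mu(1)] dl(2) small unfolding dl0_def E_def by blast
   then interpret B: barrier S X Tc r rho0 H0 xs dl K T1 mu .
   have "B.et (mu * t0) = e" by (simp add: B.et_def B.ep_def B.kk_def e_def)
   moreover have "mu * t0 / mu = t0" using mu by simp
   ultimately show ?thesis using B.combination_inside[OF tT(1), of "(x, 0)"] xM by simp
  qed
  let ?Z = "M (mu * t0) \<union> inside (M (mu * t0))"
  have cZ: "closed (M (mu * t0))" by (rule compact_imp_closed[OF compact_M[OF tT(2)]])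
  have closedZ: "closed ?Z"
   unfolding union_with_inside by (intro closed_Compl open_outside cZ)
  have limZ: "(%k. (1 - e) *\<^sub>R (x, 0) + e *\<^sub>R (0, dl0 * inverse (real (Suc k)))) \<longlonglongrightarrow> (1 - e) *\<^sub>R (x, 0) + e *\<^sub>R (0, dl0 * 0)"
   by (intro tendsto_intros LIMSEQ_inverse_real_of_nat)
  have memZ: "(1 - e) *\<^sub>R (x, 0) + e *\<^sub>R (0, dl0 * inverse (real (Suc k))) \<in> ?Z" for k
  proof -
   have "inverse (real (Suc k)) <= 1" by (simp add: inverse_le_1_iff)
   then have "dl0 * inverse (real (Suc k)) <= dl0 * 1" using dl0 by (intro mult_left_mono) auto
   then show ?thesis using dl0 by (intro UnI2 ins) auto
  qed
  have "(1 - e) *\<^sub>R (x, 0) + e *\<^sub>R (0, dl0 * 0) \<in> ?Z"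
   by (rule Lim_in_closed_set[OF closedZ always_eventually[OF allI[OF memZ]] trivial_limit_sequentially limZ])
  then have lim: "((1 - e) *\<^sub>R x, 0) \<in> ?Z" by simp
  have "((1 - e) *\<^sub>R x, 0) \<notin> inside (M (mu * t0))"
  proof
   assume i: "((1 - e) *\<^sub>R x, 0) \<in> inside (M (mu * t0))"
   have "open (inside (M (mu * t0)))" by (rule open_inside[OF cZ])
   then obtain d where d: "d > 0" "cball ((1 - e) *\<^sub>R x, 0) d \<subseteq> inside (M (mu * t0))" using i open_contains_cball by blast
   have "((1 - e) *\<^sub>R x, - d) \<in> cball ((1 - e) *\<^sub>R x, 0) d" using d(1) by (simp add: dist_Pair_Pair dist_real_def)
   then have "((1 - e) *\<^sub>R x, - d) \<in> ?Z" using d(2) by blast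
   from M_up[OF tT(2) this] show False using d(1) by simp
  qed
  then have "(1 - e) *\<^sub>R x \<in> flat_side (M (mu * t0))" using lim flat_side_eq[OF tT(2)] by simp
  then show ?thesis using ein by blast
 qed
 show ?thesis
 proof (rule exI[of _ "2 * E"], intro conjI)
  show "\<exists>ez>0. \<forall>mu t0 x. 1 < mu --> 1 - 1 / mu <= ez --> 0 < t0 --> mu * t0 <= T1 --> x \<in> flat_side (M t0) -->
   (\<exists>e. 0 <= e & e <= 2 * E * (1 - 1 / mu) & e <= 1 & (1 - e) *\<^sub>R x \<in> flat_side (M (mu * t0)))"
   using step E by (intro exI[of _ "1 / (4 * E)"]) simp
 qed (use E in simp)
qed

text \<open>One step costs the factor 1 - A (1 - 1 / mu). With m steps of equal ratio mu = exp (l /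
  m) the product is at least (1 - A l / m)^m, which tends to exp (- A l) = (t0 / t)^A.\<close>

lemma radial_decay:
 assumes polar: "!!t. t \<in> {0..T1} ==> polar_graph (frontier (flat_side (M t))) (%th. \<gamma> th t)"
 shows "\<exists>A>0. \<forall>t0 t th. 0 < t0 --> t0 <= t --> t <= T1 --> th \<in> sphere 0 1 --> exp (- A * ln (t / t0)) * \<gamma> th t0 <= \<gamma> th t"
proof -
 obtain A ez where A: "A > 0" "ez > 0" and step: "!!mu t0 x. 1 < mu ==> 1 - 1 / mu <= ez ==> 0 < t0 ==> mu * t0 <= T1 ==> x \<in> flat_side (M t0) ==>
   \<exists>e. 0 <= e & e <= A * (1 - 1 / mu) & e <= 1 & (1 - e) *\<^sub>R x \<in> flat_side (M (mu * t0))"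
  using flat_side_step by blast
 have \<gamma>0: "\<gamma> th t > 0" if "t \<in> {0..T1}" "th \<in> sphere 0 1" for th t using polar[OF that(1)] that(2) unfolding polar_graph_def by blast
 have one: "(1 - A * (1 - 1 / mu)) * \<gamma> th t0 <= \<gamma> th (mu * t0)"
  if mu: "1 < mu" "1 - 1 / mu <= ez" and t0: "0 < t0" "mu * t0 <= T1" and th: "th \<in> sphere 0 1" for mu t0 th
 proof -
  have "1 * t0 <= mu * t0" using mu t0 by (intro mult_right_mono) auto
  then have "t0 <= T1" "0 < mu * t0" using t0 by linarith+
  then have tI: "t0 \<in> {0..T1}" "t0 \<in> {0..<Tc}" "mu * t0 \<in> {0..T1}" "mu * t0 \<in> {0..<Tc}" using t0 T1 by auto
  have "\<gamma> th t0 *\<^sub>R th \<in> frontier (flat_side (M t0))" using polar[OF tI(1)] th unfolding polar_graph_def by blast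
  then have "\<gamma> th t0 *\<^sub>R th \<in> flat_side (M t0)"
   using frontier_subset_closed[OF compact_imp_closed[OF compact_flat_side[OF tI(2)]]] by blast
  from step[OF mu t0 this] obtain e where e: "0 <= e" "e <= A * (1 - 1 / mu)" "(1 - e) *\<^sub>R (\<gamma> th t0 *\<^sub>R th) \<in> flat_side (M (mu * t0))" by blast
  have "(1 - e) * \<gamma> th t0 <= \<gamma> th (mu * t0)"
   using e(3) by (intro polar_graph_le[OF polar[OF tI(3)] compact_flat_side[OF tI(4)] _ th]) simp
  moreover have "(1 - A * (1 - 1 / mu)) * \<gamma> th t0 <= (1 - e) * \<gamma> th t0"
   using e(2) \<gamma>0[OF tI(1) th] by (intro mult_right_mono) auto
  ultimately show ?thesis by linarith
 qed
 have "exp (- A * ln (t / t0)) * \<gamma> th t0 <= \<gamma> th t" if t: "0 < t0" "t0 <= t" "t <= T1" and th: "th \<in> sphere 0 1" for t0 t th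
 proof (cases "t0 = t")
  case False
  define l where "l = ln (t / t0)"
  have "t / t0 > 1" using t False by simp
  then have l: "l > 0" by (simp add: l_def)
  have el: "exp l * t0 = t" using t by (simp add: l_def)
  \<comment> \<open>From m0 on, each step is short enough for \<open>one\<close> and its factor is
    positive, so the inequalities can be chained.\<close>
  obtain m0 :: nat where m0: "l / ez < real m0" "A * l < real m0" using reals_Archimedean2[of "max (l / ez) (A * l)"] by auto
  have chain: "(1 + - A * l / real m) ^ m * \<gamma> th t0 <= \<gamma> th t" if m: "m0 <= m" for m
  proof -
   have mp: "real m > 0" "l / ez < real m" "A * l < real m"
   proof -
    show "l / ez < real m" "A * l < real m" using m m0 by linarith+
    then show "real m > 0" using l A(1) mult_pos_pos[of A l] by linarith
   qed
   define mu where "mu = exp (l / real m)"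
   have mu: "mu > 1" using l mp by (simp add: mu_def)
   have il: "1 - 1 / mu <= l / real m"
    using exp_ge_add_one_self[of "- (l / real m)"] by (simp add: mu_def exp_minus inverse_eq_divide)
   also have "l / real m <= ez" using mp A(2) by (simp add: pos_divide_less_eq pos_divide_le_eq mult.commute less_imp_le)
   finally have muez: "1 - 1 / mu <= ez" .
   have fac: "0 <= 1 + - A * l / real m" "1 + - A * l / real m <= 1 - A * (1 - 1 / mu)"
   proof -
    show "0 <= 1 + - A * l / real m" using mp by simp
    show "1 + - A * l / real m <= 1 - A * (1 - 1 / mu)" using mult_left_mono[OF il, of A] A(1) by simp
   qed
   have "(1 + - A * l / real m) ^ j * \<gamma> th t0 <= \<gamma> th (mu ^ j * t0)" if "j <= m" for j
    using that
   proof (induction j)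
    case (Suc j)
    have p1: "mu ^ j * t0 > 0" using mu t by simp
    have "mu ^ Suc j <= mu ^ m" using mu Suc.prems by (intro power_increasing) auto
    then have "mu ^ Suc j * t0 <= mu ^ m * t0" using t by (intro mult_right_mono) auto
    also have "mu ^ m = exp l" using mp(1) by (simp add: mu_def exp_of_nat_mult[symmetric])
    finally have p2: "mu * (mu ^ j * t0) <= T1" using el t by (simp add: mult.assoc)
    have "1 * (mu ^ j * t0) <= mu * (mu ^ j * t0)" using mu p1 by (intro mult_right_mono) auto
    then have "mu ^ j * t0 <= T1" using p2 by linarith
    then have pI: "mu ^ j * t0 \<in> {0..T1}" using p1 by simp
    have "(1 + - A * l / real m) * ((1 + - A * l / real m) ^ j * \<gamma> th t0) <= (1 + - A * l / real m) * \<gamma> th (mu ^ j * t0)"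
     using Suc fac(1) by (intro mult_left_mono) auto
    also have "... <= (1 - A * (1 - 1 / mu)) * \<gamma> th (mu ^ j * t0)"
     using fac(2) \<gamma>0[OF pI th] by (intro mult_right_mono) auto
    also have "... <= \<gamma> th (mu * (mu ^ j * t0))" by (rule one[OF mu muez p1 p2 th])
    finally show ?case by (simp add: mult.assoc)
   qed simp
   from this[of m] have "(1 + - A * l / real m) ^ m * \<gamma> th t0 <= \<gamma> th (mu ^ m * t0)" by simp
   moreover have "mu ^ m = exp l" using mp(1) by (simp add: mu_def exp_of_nat_mult[symmetric])
   ultimately show ?thesis using el by simp
  qed
  have "(%m. (1 + - A * l / real m) ^ m * \<gamma> th t0) \<longlonglongrightarrow> exp (- A * l) * \<gamma> th t0"
   by (intro tendsto_intros tendsto_exp_limit_sequentially)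
  then show ?thesis unfolding l_def[symmetric] using chain by (intro LIMSEQ_le_const2) auto
 qed (use t in simp)
 then show ?thesis using A(1) by blast
qed

end

theorem theorem2p3:
  fixes S :: "((real ^ 'n) \<times> real) set"
    and X :: "(real ^ 'n) \<times> real \<Rightarrow> real \<Rightarrow> (real ^ 'n) \<times> real"
    and M :: "real \<Rightarrow> ((real ^ 'n) \<times> real) set"
    and \<gamma> :: "real ^ 'n \<Rightarrow> real \<Rightarrow> real"
    and l R \<rho>0 T Tc :: real
  assumes dim: "CARD('n) \<ge> 3"
    and initial: "convex_with_flat_side S"
    and l_pos: "l > 0"
    and nondegenerate: "nondegenerate_interface l S"
    and flow: "scalar_curvature_flow S X Tc"
    and M_def: "M = evolving_surface X S"
    and graph: "\<forall>t\<in>{0..<Tc}. graph_contains_flat_side (M t)"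
    and Tc: "flat_side_vanishing_time M Tc"
    and T: "0 < T" "T < Tc"
    and \<rho>0: "\<rho>0 > 0" "cball 0 \<rho>0 \<subseteq> flat_side (M T)"
    and domain: "\<forall>t\<in>{0..T}. graph_domain (M t) \<subseteq> ball 0 R"
    and polar: "\<forall>t\<in>{0..T}. polar_graph (interface (M t)) (\<lambda>\<theta>. \<gamma> \<theta> t)"
  shows "\<exists>B>0. \<forall>t0 t \<theta>. 0 < t0 \<and> t0 \<le> t \<and> t \<le> T \<and> \<theta> \<in> sphere 0 1 \<longrightarrow>
           \<gamma> \<theta> t \<ge> exp (- ((t - t0) / (B * t0))) * \<gamma> \<theta> t0"
proof -
  obtain K where K: "compact K" "convex K" "S = frontier K"
    using initial unfolding convex_with_flat_side_def convex_hypersurface_def by blast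
  have flat: "interior (fst ` {z \<in> S. snd z = 0}) \<noteq> {}" "\<forall>z\<in>S - {z \<in> S. snd z = 0}. snd z > 0"
    using initial unfolding convex_with_flat_side_def Let_def by blast+
  have up: "snd z \<ge> 0" if "z \<in> S" for z
    using flat(2) that by (cases "snd z = 0") (auto intro: less_imp_le)
  have "S \<noteq> {}" using flat(1) by auto
  moreover have "compact S" using K by (simp add: compact_frontier)
  ultimately interpret flat_flow S X Tc K T \<rho>0
    by unfold_locales (use flow dim K T \<rho>0 graph up in \<open>simp_all add: M_def\<close>)
  obtain A where A: "A > 0" "\<And>t0 t (\<theta> :: real ^ 'n). 0 < t0 \<Longrightarrow> t0 \<le> t \<Longrightarrow> t \<le> T \<Longrightarrow> \<theta> \<in> sphere 0 1 \<Longrightarrow> exp (- A * ln (t / t0)) * \<gamma> \<theta> t0 \<le> \<gamma> \<theta> t"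
    using radial_decay[of \<gamma>] polar unfolding M_def by blast
  show ?thesis
  proof (rule exI[of _ "1 / A"], intro conjI allI impI)
    show "1 / A > 0" using A by simp
    fix t0 t :: real and \<theta> :: "real ^ 'n" assume a: "0 < t0 \<and> t0 \<le> t \<and> t \<le> T \<and> \<theta> \<in> sphere 0 1"
    \<comment> \<open>This weakens the power of t0 / t to the exponential bound, with B = 1 /
      A.\<close>
    have "ln (t / t0) \<le> t / t0 - 1" using a by (intro ln_le_minus_one) auto
    also have "\<dots> = (t - t0) / t0" using a by (simp add: diff_divide_distrib)
    finally have "A * ln (t / t0) \<le> A * ((t - t0) / t0)" using A(1) by (intro mult_left_mono) auto
    also have "\<dots> = (t - t0) / (1 / A * t0)" by simp
    finally have "exp (- ((t - t0) / (1 / A * t0))) \<le> exp (- A * ln (t / t0))" by simp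
    moreover have "\<gamma> \<theta> t0 > 0"
    proof -
      have "t0 \<in> {0..T}" using a by auto
      then show ?thesis using polar a unfolding polar_graph_def by blast
    qed
    ultimately have "exp (- ((t - t0) / (1 / A * t0))) * \<gamma> \<theta> t0 \<le> exp (- A * ln (t / t0)) * \<gamma> \<theta> t0"
      by (intro mult_right_mono) auto
    then show "exp (- ((t - t0) / (1 / A * t0))) * \<gamma> \<theta> t0 \<le> \<gamma> \<theta> t" using A(2)[of t0 t \<theta>] a by linarith
  qed
qed

end
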